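(* Let $\Omega\subset\mathbb R^N$ be a bounded Lipschitz domain, $s\in(0,1)$, $t>0$, and $A_s=I+(-\Delta)^s$ with eigenvalues $1\le\lambda_1\le\lambda_2\le\cdots\to\infty$ (repeated according to multiplicity). The singular values $\sigma_j=\lambda_j^{-1/2}e^{-t\lambda_j}$ of $B=e^{-tA_s}A_s^{-1/2}$ satisfy $$\log\frac1{\sigma_j}=t\lambda_j+\tfrac12\log\lambda_j\sim t\,\kappa_{N,s}\,|\Omega|^{-2s/N}\,j^{2s/N}\qquad(j\to\infty),$$ where $\kappa_{N,s}:=(2\pi)^{2s}\omega_N^{-2s/N}$ and $\omega_N=|\{\xi\in\mathbb R^N:|\xi|<1\}|$. In particular $\sigma_j\to0$ faster than any negative power of $j$, so $B$ is compact and belongs to every Schatten class $\mathcal S_p(L^2(\Omega))$, $p>0$ (in this sense the inverse problem is exponentially, rather than polynomially, ill posed).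
   Context: $a_j\sim b_j$ means $a_j/b_j\to1$. $H_0^s(\Omega)$ is the space of functions $u\in H^s(\mathbb R^N)$ with $u=0$ a.e. in $\mathbb R^N\setminus\Omega$ (also regarded as functions on $\Omega$). On it consider the closed, symmetric, coercive bilinear form $$a_s(u,v)=\int_\Omega uv\,dx+\frac{C_{N,s}}{2}\iint_{\mathbb R^{2N}}\frac{(u(x)-u(y))(v(x)-v(y))}{|x-y|^{N+2s}}\,dx\,dy,$$ where $C_{N,s}=\frac{4^s s\,\Gamma(N/2+s)}{\pi^{N/2}\Gamma(1-s)}$ is the standard normalization constant of the integral fractional Laplacian (so that the second term with $u=v$ equals $\int_{\mathbb R^N}|\xi|^{2s}|\hat u(\xi)|^2d\xi$ for the unitary Fourier transform). $A_s=I+(-\Delta)^s$ is the unique positive self-adjoint operator on $L^2(\Omega)$ associated with $a_s$; it has compact resolvent. Powers and $e^{-tA_s}$ are defined by the spectral theorem. A compact operator belongs to $\mathcal S_p$ if its singular values satisfy $\sum_j\sigma_j^p<\infty$. *)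

theory Defs
  imports
    "HOL-Analysis.Analysis"
    "HOL-Library.Equipollence"
    "HOL-Library.Landau_Symbols"
begin

section \<open>The real Hilbert space $L^2(\mathbb R^N)$\<close>

definition square_integrable :: "('a::euclidean_space \<Rightarrow> real) \<Rightarrow> bool" where
  "square_integrable f \<longleftrightarrow>
     f \<in> borel_measurable lborel \<and> integrable lborel (\<lambda>x. (f x)\<^sup>2)"

lemma square_integrable_mult:
  assumes "square_integrable f" "square_integrable g"
  shows "integrable lborel (\<lambda>x. f x * g x)"
proof (rule Bochner_Integration.integrable_bound)
  show "integrable lborel (\<lambda>x. (f x)\<^sup>2 + (g x)\<^sup>2)"
    using assms by (auto simp: square_integrable_def)
  show "(\<lambda>x. f x * g x) \<in> borel_measurable lborel"
    using assms by (auto simp: square_integrable_def)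
  have "\<bar>a * b\<bar> \<le> a\<^sup>2 + b\<^sup>2" for a b :: real
  proof -
    have "2 * (\<bar>a\<bar> * \<bar>b\<bar>) \<le> a\<^sup>2 + b\<^sup>2"
      using sum_squares_bound[of "\<bar>a\<bar>" "\<bar>b\<bar>"] by simp
    moreover have "0 \<le> \<bar>a\<bar> * \<bar>b\<bar>" by simp
    ultimately show ?thesis unfolding abs_mult by linarith
  qed
  then show "AE x in lborel. norm (f x * g x) \<le> norm ((f x)\<^sup>2 + (g x)\<^sup>2)"
    by simp
qed

lemma square_integrable_add:
  assumes "square_integrable f" "square_integrable g"
  shows "square_integrable (\<lambda>x. f x + g x)"
proof -
  have "integrable lborel (\<lambda>x. (f x)\<^sup>2 + (g x)\<^sup>2 + 2 * (f x * g x))"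
    using assms square_integrable_mult[OF assms] by (auto simp: square_integrable_def)
  then show ?thesis
    using assms by (auto simp: square_integrable_def power2_sum algebra_simps)
qed

lemma square_integrable_scale:
  "square_integrable f \<Longrightarrow> square_integrable (\<lambda>x. c * f x)"
  by (auto simp: square_integrable_def power_mult_distrib)

lemma square_integrable_zero: "square_integrable (\<lambda>_. 0)"
  by (simp add: square_integrable_def)

lemma square_integrable_uminus: "square_integrable f \<Longrightarrow> square_integrable (\<lambda>x. - f x)"
  by (auto simp: square_integrable_def)

lemma square_integrable_diff:
  "square_integrable f \<Longrightarrow> square_integrable g \<Longrightarrow> square_integrable (\<lambda>x. f x - g x)"
  using square_integrable_add[OF _ square_integrable_uminus] by simp

lemmas square_integrable_intros =
  square_integrable_zero square_integrable_add square_integrable_uminus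
  square_integrable_diff square_integrable_scale

quotient_type (overloaded) 'a l2 = "'a::euclidean_space \<Rightarrow> real" / partial:
  "\<lambda>f g. square_integrable f \<and> square_integrable g \<and> (AE x in lborel. f x = g x)"
proof (rule part_equivpI)
  show "\<exists>f::'a \<Rightarrow> real. square_integrable f \<and> square_integrable f \<and> (AE x in lborel. f x = f x)"
    using square_integrable_zero by auto
  show "symp (\<lambda>f g::'a \<Rightarrow> real. square_integrable f \<and> square_integrable g \<and> (AE x in lborel. f x = g x))"
    by (auto intro!: sympI elim: eventually_mono)
  show "transp (\<lambda>f g::'a \<Rightarrow> real. square_integrable f \<and> square_integrable g \<and> (AE x in lborel. f x = g x))"
    by (rule transpI) (auto elim: eventually_elim2)
qed

instantiation l2 :: (euclidean_space) real_vector
begin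

lift_definition zero_l2 :: "'a l2" is "\<lambda>_. 0"
  by (simp add: square_integrable_zero)

lift_definition plus_l2 :: "'a l2 \<Rightarrow> 'a l2 \<Rightarrow> 'a l2" is "\<lambda>f g x. f x + g x"
  by (auto intro: square_integrable_intros elim: eventually_elim2)

lift_definition uminus_l2 :: "'a l2 \<Rightarrow> 'a l2" is "\<lambda>f x. - f x"
  by (auto intro: square_integrable_intros)

lift_definition minus_l2 :: "'a l2 \<Rightarrow> 'a l2 \<Rightarrow> 'a l2" is "\<lambda>f g x. f x - g x"
  by (auto intro: square_integrable_intros elim: eventually_elim2)

lift_definition scaleR_l2 :: "real \<Rightarrow> 'a l2 \<Rightarrow> 'a l2" is "\<lambda>c f x. c * f x"
  by (auto intro: square_integrable_intros elim: eventually_mono)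

instance
  by standard
     (transfer; auto simp: square_integrable_intros algebra_simps
        intro!: square_integrable_intros)+

end

instantiation l2 :: (euclidean_space) real_inner
begin

lift_definition inner_l2 :: "'a l2 \<Rightarrow> 'a l2 \<Rightarrow> real" is "\<lambda>f g. LINT x|lborel. f x * g x"
  by (rule integral_cong_AE) (auto simp: square_integrable_def elim: eventually_elim2)

definition norm_l2 :: "'a l2 \<Rightarrow> real" where "norm_l2 u = sqrt (inner u u)"
definition dist_l2 :: "'a l2 \<Rightarrow> 'a l2 \<Rightarrow> real" where "dist_l2 u v = norm (u - v)"
definition sgn_l2 :: "'a l2 \<Rightarrow> 'a l2" where "sgn_l2 u = u /\<^sub>R norm u"
definition uniformity_l2 :: "('a l2 \<times> 'a l2) filter" where
  "uniformity_l2 = (INF e\<in>{0 <..}. principal {(u, v). dist u v < e})"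
definition open_l2 :: "'a l2 set \<Rightarrow> bool" where
  "open_l2 U \<longleftrightarrow> (\<forall>u\<in>U. \<forall>\<^sub>F (u', v) in uniformity. u' = u \<longrightarrow> v \<in> U)"

instance
proof
  fix u v w :: "'a l2" and c :: real
  show "dist u v = norm (u - v)" by (rule dist_l2_def)
  show "sgn u = u /\<^sub>R norm u" by (rule sgn_l2_def)
  show "uniformity = (INF e\<in>{0 <..}. principal {(u, v::'a l2). dist u v < e})"
    by (rule uniformity_l2_def)
  show "open U \<longleftrightarrow> (\<forall>u\<in>U. \<forall>\<^sub>F (u', v) in uniformity. u' = u \<longrightarrow> v \<in> U)" for U :: "'a l2 set"
    by (rule open_l2_def)
  show "inner u v = inner v u"
    by transfer (simp add: mult.commute)
  show "inner (u + v) w = inner u w + inner v w"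
    by transfer (simp add: distrib_right square_integrable_mult)
  show "inner (c *\<^sub>R u) v = c * inner u v"
    by transfer (simp add: mult.assoc)
  show "0 \<le> inner u u"
    by transfer simp
  show "inner u u = 0 \<longleftrightarrow> u = 0"
  proof transfer
    fix f :: "'a \<Rightarrow> real"
    assume "square_integrable f \<and> square_integrable f \<and> (AE x in lborel. f x = f x)"
    then have f: "square_integrable f" by simp
    then have "integrable lborel (\<lambda>x. f x * f x)" by (simp add: square_integrable_mult)
    then have "(LINT x|lborel. f x * f x) = 0 \<longleftrightarrow> (AE x in lborel. f x * f x = 0)"
      by (intro integral_nonneg_eq_0_iff_AE) auto
    then show "(LINT x|lborel. f x * f x) = 0 \<longleftrightarrow>
        (square_integrable f \<and> square_integrable (\<lambda>_::'a. 0) \<and> (AE x in lborel. f x = 0))"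
      using f by (simp add: square_integrable_def)
  qed
  show "norm u = sqrt (inner u u)" by (rule norm_l2_def)
qed

end


section \<open>Operators on a closed subspace \<open>H\<close> of a real inner product space\<close>

text \<open>Operators, bounded or not, are represented by their graphs, so that the product
  \<open>S T\<close> of operators is the relational composition \<^term>\<open>T O S\<close>.\<close>

definition form_operator ::
  "'h::real_inner set \<Rightarrow> 'h set \<Rightarrow> ('h \<Rightarrow> 'h \<Rightarrow> real) \<Rightarrow> ('h \<times> 'h) set" where
  "form_operator H D a = {(u, f). u \<in> D \<and> f \<in> H \<and> (\<forall>v\<in>D. a u v = inner f v)}"

definition adjoint_on :: "'h::real_inner set \<Rightarrow> ('h \<times> 'h) set \<Rightarrow> ('h \<times> 'h) set" where
  "adjoint_on H T = {(v, w). v \<in> H \<and> w \<in> H \<and> (\<forall>(u, z)\<in>T. inner z v = inner u w)}"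

definition eigenspace :: "('h::real_vector \<times> 'h) set \<Rightarrow> real \<Rightarrow> 'h set" where
  "eigenspace T \<mu> = {u. (u, \<mu> *\<^sub>R u) \<in> T}"

text \<open>\<open>J\<close> has as many elements as \<open>V\<close> has dimensions. The constant \<^const>\<open>dim\<close> is not used
  because it is 0 on infinite-dimensional spaces.\<close>

definition dimension_matches :: "'h::real_vector set \<Rightarrow> 'i set \<Rightarrow> bool" where
  "dimension_matches V J \<longleftrightarrow> (\<exists>b. independent b \<and> span b = V \<and> b \<approx> J)"

text \<open>Sequences are indexed from 1; their value at 0 is irrelevant.\<close>

definition eigenvalue_sequence :: "('h::real_vector \<times> 'h) set \<Rightarrow> (nat \<Rightarrow> real) \<Rightarrow> bool" where
  "eigenvalue_sequence T \<Lambda> \<longleftrightarrow> mono_on {1..} \<Lambda> \<and>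
     (\<forall>\<mu>. dimension_matches (eigenspace T \<mu>) {j. 1 \<le> j \<and> \<Lambda> j = \<mu>})"

text \<open>Square roots of the eigenvalues of $T^*T$ in nonincreasing order with multiplicities.
  Only positive values are counted, so that a finite-rank operator has trailing zeros.\<close>

definition singular_values ::
  "'h::real_inner set \<Rightarrow> ('h \<times> 'h) set \<Rightarrow> (nat \<Rightarrow> real) \<Rightarrow> bool" where
  "singular_values H T \<sigma> \<longleftrightarrow>
     antimono_on {1..} \<sigma> \<and> (\<forall>j\<ge>1. 0 \<le> \<sigma> j) \<and>
     (\<forall>\<mu>>0. dimension_matches (eigenspace (T O adjoint_on H T) (\<mu>\<^sup>2)) {j. 1 \<le> j \<and> \<sigma> j = \<mu>})"

definition compact_operator :: "'h::real_inner set \<Rightarrow> ('h \<times> 'h) set \<Rightarrow> bool" where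
  "compact_operator H T \<longleftrightarrow>
     T \<subseteq> H \<times> H \<and> subspace T \<and> single_valued T \<and> Domain T = H \<and>
     compact (closure (T `` {u \<in> H. norm u \<le> 1}))"

definition schatten_class :: "'h::real_inner set \<Rightarrow> real \<Rightarrow> ('h \<times> 'h) set \<Rightarrow> bool" where
  "schatten_class H p T \<longleftrightarrow> compact_operator H T \<and>
     (\<exists>\<sigma>. singular_values H T \<sigma> \<and> summable (\<lambda>j. \<sigma> (Suc j) powr p))"


section \<open>Functional calculus of a self-adjoint operator\<close>

definition orthogonal_projection_on :: "'h::real_inner set \<Rightarrow> ('h \<Rightarrow> 'h) \<Rightarrow> bool" where
  "orthogonal_projection_on H P \<longleftrightarrow>
     (\<forall>u\<in>H. P u \<in> H \<and> P (P u) = P u) \<and>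
     (\<forall>u\<in>H. \<forall>v\<in>H. \<forall>c. P (u + c *\<^sub>R v) = P u + c *\<^sub>R P v) \<and>
     (\<forall>u\<in>H. \<forall>v\<in>H. inner (P u) v = inner u (P v))"

definition projection_valued_measure ::
  "'h::real_inner set \<Rightarrow> (real set \<Rightarrow> 'h \<Rightarrow> 'h) \<Rightarrow> bool" where
  "projection_valued_measure H E \<longleftrightarrow>
     (\<forall>S\<in>sets borel. orthogonal_projection_on H (E S)) \<and>
     (\<forall>u\<in>H. E UNIV u = u) \<and>
     (\<forall>S::nat \<Rightarrow> real set. range S \<subseteq> sets borel \<longrightarrow> disjoint_family S \<longrightarrow>
        (\<forall>u\<in>H. (\<lambda>i. E (S i) u) sums E (\<Union>i. S i) u))"

definition scalar_measure ::
  "(real set \<Rightarrow> 'h::real_inner \<Rightarrow> 'h) \<Rightarrow> 'h \<Rightarrow> real measure" where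
  "scalar_measure E u = measure_of UNIV (sets borel) (\<lambda>S. ennreal (inner (E S u) u))"

text \<open>The operator $\int f\,dE$: its domain consists of the \<open>u\<close> with
  $\int |f|^2\,d\langle E u,u\rangle<\infty$, and its value \<open>v\<close> at \<open>u\<close> satisfies
  $\langle v,w\rangle=\int f\,d\langle E u,w\rangle$ for all \<open>w\<close> in the (dense) domain, where
  the signed measure $\langle E u,w\rangle$ is expressed by polarization.\<close>

definition spectral_domain ::
  "'h::real_inner set \<Rightarrow> (real set \<Rightarrow> 'h \<Rightarrow> 'h) \<Rightarrow> (real \<Rightarrow> real) \<Rightarrow> 'h set" where
  "spectral_domain H E f = {u \<in> H. integrable (scalar_measure E u) (\<lambda>x. (f x)\<^sup>2)}"

definition spectral_integral ::
  "'h::real_inner set \<Rightarrow> (real set \<Rightarrow> 'h \<Rightarrow> 'h) \<Rightarrow> (real \<Rightarrow> real) \<Rightarrow> ('h \<times> 'h) set" where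
  "spectral_integral H E f =
     {(u, v). f \<in> borel_measurable borel \<and> u \<in> spectral_domain H E f \<and> v \<in> H \<and>
        (\<forall>w\<in>spectral_domain H E f. inner v w =
           ((LINT x|scalar_measure E (u + w). f x) - (LINT x|scalar_measure E (u - w). f x)) / 4)}"

text \<open>The operator $f(A)$. The projection-valued measure \<open>E\<close> with $A=\int x\,dE(x)$ exists if
  \<open>A\<close> is self-adjoint, and it is unique.\<close>

definition functional_calculus ::
  "'h::real_inner set \<Rightarrow> ('h \<times> 'h) set \<Rightarrow> (real \<Rightarrow> real) \<Rightarrow> ('h \<times> 'h) set" where
  "functional_calculus H A f =
     {(u, v). \<exists>E. projection_valued_measure H E \<and> spectral_integral H E (\<lambda>x. x) = A \<and>
        (u, v) \<in> spectral_integral H E f}"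


section \<open>The fractional Laplacian on a bounded Lipschitz domain\<close>

definition lipschitz_domain :: "'a::euclidean_space set \<Rightarrow> bool" where
  "lipschitz_domain \<Omega> \<longleftrightarrow> open \<Omega> \<and> connected \<Omega> \<and> \<Omega> \<noteq> {} \<and>
     (\<forall>p\<in>frontier \<Omega>. \<exists>r>0. \<exists>e L \<gamma>. norm e = 1 \<and> L-lipschitz_on {y. inner y e = 0} \<gamma> \<and>
        \<Omega> \<inter> ball p r = {x \<in> ball p r. \<gamma> (x - inner x e *\<^sub>R e) < inner x e})"

text \<open>$L^2(\Omega)$ is identified, through extension by zero, with the subspace of $L^2(\mathbb R^N)$
  of functions vanishing a.e. outside \<open>\<Omega>\<close>. The value \<^term>\<open>rep_l2 u\<close> is a representative of the
  class \<open>u\<close>.\<close>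

definition L2_on :: "'a::euclidean_space set \<Rightarrow> 'a l2 set" where
  "L2_on \<Omega> = {u. AE x in lborel. x \<notin> \<Omega> \<longrightarrow> rep_l2 u x = 0}"

text \<open>$H^s(\mathbb R^N)$ for $0<s<1$, by finiteness of the Gagliardo seminorm. On the diagonal,
  a null set, the integrand is 0 by the convention on division.\<close>

definition sobolev_space :: "real \<Rightarrow> 'a::euclidean_space l2 set" where
  "sobolev_space s = {u. integrable (lborel \<Otimes>\<^sub>M lborel)
     (\<lambda>(x, y). (rep_l2 u x - rep_l2 u y)\<^sup>2 / norm (x - y) powr (real DIM('a) + 2 * s))}"

definition H0 :: "real \<Rightarrow> 'a::euclidean_space set \<Rightarrow> 'a l2 set" where
  "H0 s \<Omega> = {u \<in> sobolev_space s. AE x in lborel. x \<notin> \<Omega> \<longrightarrow> rep_l2 u x = 0}"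

definition frac_const :: "nat \<Rightarrow> real \<Rightarrow> real" where
  "frac_const N s =
     4 powr s * s * Gamma (real N / 2 + s) / (pi powr (real N / 2) * Gamma (1 - s))"

definition frac_form ::
  "real \<Rightarrow> 'a::euclidean_space set \<Rightarrow> 'a l2 \<Rightarrow> 'a l2 \<Rightarrow> real" where
  "frac_form s \<Omega> u v =
     (LINT x:\<Omega>|lborel. rep_l2 u x * rep_l2 v x) +
     frac_const DIM('a) s / 2 *
       (LINT (x, y)|(lborel \<Otimes>\<^sub>M lborel).
          (rep_l2 u x - rep_l2 u y) * (rep_l2 v x - rep_l2 v y) /
          norm (x - y) powr (real DIM('a) + 2 * s))"

text \<open>The operator $A_s=I+(-\Delta)^s$ on $L^2(\Omega)$.\<close>

definition frac_operator :: "real \<Rightarrow> 'a::euclidean_space set \<Rightarrow> ('a l2 \<times> 'a l2) set" where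
  "frac_operator s \<Omega> = form_operator (L2_on \<Omega>) (H0 s \<Omega>) (frac_form s \<Omega>)"

text \<open>The operator $e^{-tA_s}A_s^{-1/2}$. The spectrum of $A_s$ lies in $[1,\infty)$, so the values of
  the two functions on the rest of the line are irrelevant.\<close>

definition forward_operator ::
  "real \<Rightarrow> real \<Rightarrow> 'a::euclidean_space set \<Rightarrow> ('a l2 \<times> 'a l2) set" where
  "forward_operator s t \<Omega> =
     functional_calculus (L2_on \<Omega>) (frac_operator s \<Omega>) (\<lambda>x. x powr (- 1 / 2)) O
     functional_calculus (L2_on \<Omega>) (frac_operator s \<Omega>) (\<lambda>x. exp (- t * x))"

end

theory Submission
  imports Defs "HOL-Probability.Probability" "HOL-Complex_Analysis.Great_Picard" "HOL-Real_Asymp.Real_Asymp"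
begin

text \<open>The operator is diagonalised by minimising the form successively; the sublevel sets of the form are
  compact in $L^2$ because low frequencies are handled by Arzela--Ascoli and high frequencies by the
  form itself. Testing with spectral projections shows that the projection-valued measure of a
  diagonal operator is unique, so functions of it are diagonal as well and everything reduces to
  Weyl's law for the eigenvalues.

  For Weyl's law one compares the Riesz mean $\sum_j(x-\lambda_j)_+$ with its phase-space volume
  $(2\pi)^{-N}|\Omega|\int(x-|\xi|^{2s})_+\,d\xi$. The upper bound is Berezin's inequality (Plancherel and
  Bessel); the lower bound uses the modulated cut-offs $\phi(x)e^{i\xi x}$ as trial functions.
  The counting function, being the derivative of the Riesz mean, inherits the asymptotics by
  monotonicity.\<close>

section \<open>Orthonormal bases\<close>

text \<open>The Hilbert space is real, so a plane wave enters through its real and imaginary parts,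
  and the only Fourier quantity needed is the sum of squares of the cosine and sine transforms. For
  an integrable function this is defined pointwise, and functions on a bounded set are integrable,
  so no Fourier transform on \<open>L^2\<close> has to be constructed. Gaussian damping yields
  Plancherel as an inequality, and as an equality once the Gagliardo seminorm is finite. For the
  form itself one direction of the spectral formula suffices: the upper bound needs the weighted
  spectrum below the seminorm, and the lower bound computes seminorms of the trial functions in
  position space. Riesz means are estimated instead of the counting function because
  \<open>x * inner u u - a u u\<close> can be summed and integrated over a whole family of trial
  functions. The lower bound loses a multiple of \<open>x powr \<theta>\<close>, from the identity
  in the operator and the seminorm of the cut-off, against a main term of order
  \<open>x powr (\<theta> + 1)\<close>. The conclusion concerns every eigenvalue sequence, so a
  given sequence has to be matched with an eigenbasis by multiplicities.\<close>

lemma orthogonal_summable: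
  fixes x :: "nat \<Rightarrow> 'h::{real_inner,banach}"
  assumes orth: "\<And>i j. i \<noteq> j \<Longrightarrow> inner (x i) (x j) = 0"
    and bd: "\<And>n. (\<Sum>i<n. (norm (x i))\<^sup>2) \<le> B"
  shows "summable x"
proof -
  have "summable (\<lambda>i. (norm (x i))\<^sup>2)"
    using bd by (intro summableI_nonneg_bounded) auto
  note C = this[unfolded summable_Cauchy]
  show ?thesis
    unfolding summable_Cauchy
  proof (intro allI impI)
    fix \<epsilon> :: real assume "\<epsilon> > 0"
    then have "\<epsilon>\<^sup>2 > 0" by simp
    then obtain N where N: "\<And>m n. m \<ge> N \<Longrightarrow> norm (\<Sum>i=m..<n. (norm (x i))\<^sup>2) < \<epsilon>\<^sup>2"
      using C by blast
    have "norm (sum x {m..<n}) < \<epsilon>" if "m \<ge> N" for m n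
    proof -
      \<comment> \<open>Pythagoras turns a block of the vector series into a block of the scalar
        series, so the Cauchy criterion transfers.\<close>
      have "(norm (sum x {m..<n}))\<^sup>2 = (\<Sum>i=m..<n. (norm (x i))\<^sup>2)"
        using orth by (intro norm_sum_Pythagorean) (auto simp: pairwise_def orthogonal_def)
      also have "\<dots> < \<epsilon>\<^sup>2"
        using N[OF that, of n] by simp
      finally show ?thesis
        using \<open>\<epsilon> > 0\<close> by (simp add: power2_less_imp_less)
    qed
    then show "\<exists>N. \<forall>m\<ge>N. \<forall>n. norm (sum x {m..<n}) < \<epsilon>" by blast
  qed
qed

text \<open>The squared distance from \<open>u\<close> to its projection \<open>p\<close> is
  nonnegative. An arbitrary finite index set is allowed because the bound is later applied to the
  indices of all eigenvalues below a level.\<close>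

lemma bessel_inequality:
  fixes e :: "'i \<Rightarrow> 'h::real_inner"
  assumes "finite I" and on: "\<And>i j. i \<in> I \<Longrightarrow> j \<in> I \<Longrightarrow> inner (e i) (e j) = (if i = j then 1 else 0)"
  shows "(\<Sum>j\<in>I. (inner u (e j))\<^sup>2) \<le> inner u u"
proof -
  define p where "p = (\<Sum>j\<in>I. inner u (e j) *\<^sub>R e j)"
  have "inner p (e j) = inner u (e j)" if "j \<in> I" for j
    using that \<open>finite I\<close> by (simp add: p_def inner_sum_left on sum.delta' if_distrib cong: if_cong)
  then have pp: "inner p p = (\<Sum>j\<in>I. (inner u (e j))\<^sup>2)"
    by (subst (2) p_def) (simp add: inner_sum_right power2_eq_square)
  have up: "inner u p = (\<Sum>j\<in>I. (inner u (e j))\<^sup>2)"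
    by (simp add: p_def inner_sum_right power2_eq_square)
  have "0 \<le> inner (u - p) (u - p)" by simp
  also have "\<dots> = inner u u - (\<Sum>j\<in>I. (inner u (e j))\<^sup>2)"
    using pp up by (simp add: inner_diff_left inner_diff_right inner_commute[of p u])
  finally show ?thesis by simp
qed

text \<open>\<open>H\<close> is a closed subspace of an ambient complete space, just as
  \<open>L2_on \<Omega>\<close> sits inside the functions on the whole space; its completeness is
  inherited.\<close>

locale hilbert_basis =
  fixes H :: "'h::{real_inner,banach} set" and e :: "nat \<Rightarrow> 'h"
  assumes subspace_H: "subspace H" and closed_H: "closed H" and e_H: "e j \<in> H"
    and orthonormal: "inner (e i) (e j) = (if i = j then 1 else 0)"
    and total: "f \<in> H \<Longrightarrow> (\<And>j. inner f (e j) = 0) \<Longrightarrow> f = 0"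
begin

lemma coeff_eqI:
  assumes "u \<in> H" "v \<in> H" "\<And>j. inner u (e j) = inner v (e j)"
  shows "u = v"
  using total[of "u - v"] assms subspace_diff[OF subspace_H] by (auto simp: inner_diff_left)

lemma bessel: "(\<Sum>j<n. (inner u (e j))\<^sup>2) \<le> inner u u"
  by (rule bessel_inequality) (auto simp: orthonormal)

text \<open>Riesz-Fischer: the partial sums remain in the closed set \<open>H\<close>, and
  continuity of the inner product reads off the coefficients of the limit.\<close>

lemma synthesis:
  assumes "\<And>n. (\<Sum>j<n. (c j)\<^sup>2) \<le> B"
  obtains v where "v \<in> H" "(\<lambda>j. c j *\<^sub>R e j) sums v" "\<And>j. inner v (e j) = c j"
proof -
  have n1: "norm (e j) = 1" for j by (simp add: norm_eq_sqrt_inner orthonormal)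
  have "summable (\<lambda>j. c j *\<^sub>R e j)"
    using assms by (intro orthogonal_summable[where B = B]) (auto simp: orthonormal n1)
  then obtain v where v: "(\<lambda>j. c j *\<^sub>R e j) sums v" by (auto simp: summable_def)
  have "v \<in> H"
    using closed_H
  proof (rule closed_sequentially)
    show "(\<Sum>j<n. c j *\<^sub>R e j) \<in> H" for n
      by (intro subspace_sum subspace_H subspace_scale e_H)
    show "(\<lambda>n. \<Sum>j<n. c j *\<^sub>R e j) \<longlonglongrightarrow> v" using v by (simp add: sums_def)
  qed
  moreover have "inner v (e j) = c j" for j
  proof -
    have "(\<lambda>i. inner (c i *\<^sub>R e i) (e j)) sums inner v (e j)"
      by (rule bounded_linear.sums[OF bounded_linear_inner_left v])
    moreover have "(\<lambda>i. inner (c i *\<^sub>R e i) (e j)) = (\<lambda>i. if i = j then c i else 0)"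
      by (auto simp: orthonormal)
    ultimately have "(\<lambda>i. if i = j then c i else 0) sums inner v (e j)" by simp
    moreover have "(\<lambda>i. if i = j then c i else 0) sums c j"
      using sums_single[of j c] by simp
    ultimately show ?thesis by (rule sums_unique2)
  qed
  ultimately show ?thesis using v that by blast
qed

lemma expansion:
  assumes "u \<in> H"
  shows "(\<lambda>j. inner u (e j) *\<^sub>R e j) sums u"
proof -
  obtain v where "v \<in> H" and v: "(\<lambda>j. inner u (e j) *\<^sub>R e j) sums v" "\<And>j. inner v (e j) = inner u (e j)"
    using synthesis[OF bessel] by blast
  then have "v = u" by (intro coeff_eqI assms) auto
  then show ?thesis using v by simp
qed

lemma parseval:
  assumes "u \<in> H"
  shows "(\<lambda>j. inner u (e j) * inner w (e j)) sums inner u w"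
  using bounded_linear.sums[OF bounded_linear_inner_left expansion[OF assms], of w]
  by (simp add: inner_commute)

text \<open>Multiplication of coefficients on the maximal domain: \<open>u\<close> belongs to it
  exactly when the products \<open>c j * inner u (e j)\<close> are the coefficients of some vector
  of \<open>H\<close>. This is the model to which the unbounded operator and all its functions are
  reduced.\<close>

definition diag :: "(nat \<Rightarrow> real) \<Rightarrow> ('h \<times> 'h) set" where
  "diag c = {(u, v). u \<in> H \<and> v \<in> H \<and> (\<forall>j. inner v (e j) = c j * inner u (e j))}"

lemma diag_total:
  assumes "u \<in> H" and c: "\<And>j. \<bar>c j\<bar> \<le> B"
  obtains v where "(u, v) \<in> diag c"
proof -
  have "(\<Sum>j<n. (c j * inner u (e j))\<^sup>2) \<le> B\<^sup>2 * inner u u" for n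
  proof -
    have "(\<Sum>j<n. (c j * inner u (e j))\<^sup>2) \<le> (\<Sum>j<n. B\<^sup>2 * (inner u (e j))\<^sup>2)"
    proof (intro sum_mono)
      fix j
      have "(c j)\<^sup>2 \<le> B\<^sup>2" using power_mono[OF c[of j], of 2] by simp
      then show "(c j * inner u (e j))\<^sup>2 \<le> B\<^sup>2 * (inner u (e j))\<^sup>2"
        by (simp add: power_mult_distrib mult_right_mono)
    qed
    also have "\<dots> \<le> B\<^sup>2 * inner u u"
      unfolding sum_distrib_left[symmetric] by (intro mult_left_mono bessel) auto
    finally show ?thesis .
  qed
  from synthesis[OF this] obtain v where "v \<in> H" "\<And>j. inner v (e j) = c j * inner u (e j)"
    by blast
  then show ?thesis using assms that by (auto simp: diag_def)
qed

lemma diag_unique: "(u, v) \<in> diag c \<Longrightarrow> (u, v') \<in> diag c \<Longrightarrow> v = v'"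
  by (auto simp: diag_def intro!: coeff_eqI)

text \<open>\<open>diag c\<close> acts first, and boundedness of \<open>c\<close> makes the
  intermediate vector exist for every \<open>u\<close>; the second factor may be unbounded.\<close>

lemma diag_compose:
  assumes "\<And>j. \<bar>c j\<bar> \<le> B"
  shows "diag c O diag d = diag (\<lambda>j. d j * c j)"
proof (intro equalityI subrelI)
  fix u v assume "(u, v) \<in> diag (\<lambda>j. d j * c j)"
  then have uv: "u \<in> H" "v \<in> H" "\<And>j. inner v (e j) = d j * c j * inner u (e j)"
    by (auto simp: diag_def)
  obtain w where "(u, w) \<in> diag c"
    using diag_total[OF uv(1)] assms by blast
  moreover from this uv have "(w, v) \<in> diag d" by (auto simp: diag_def)
  ultimately show "(u, v) \<in> diag c O diag d" by blast
qed (auto simp: diag_def)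

text \<open>Testing against the pairs \<open>(e j, c j *\<^sub>R e j)\<close> determines every
  coefficient of an adjoint value. The converse is Parseval on both sides, since the real factor
  \<open>c j\<close> can be moved from one entry to the other.\<close>

lemma diag_adjoint:
  assumes "\<And>j. \<bar>c j\<bar> \<le> B"
  shows "adjoint_on H (diag c) = diag c"
proof (intro equalityI subrelI)
  fix v w assume vw: "(v, w) \<in> adjoint_on H (diag c)"
  have "inner w (e j) = c j * inner v (e j)" for j
  proof -
    have "(e j, c j *\<^sub>R e j) \<in> diag c"
      using e_H subspace_scale[OF subspace_H] by (auto simp: diag_def orthonormal)
    then have "inner (c j *\<^sub>R e j) v = inner (e j) w" using vw by (auto simp: adjoint_on_def)
    then show ?thesis by (simp add: inner_commute)
  qed
  then show "(v, w) \<in> diag c" using vw by (auto simp: diag_def adjoint_on_def)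
next
  fix v w assume vw: "(v, w) \<in> diag c"
  have "inner z v = inner u w" if uz: "(u, z) \<in> diag c" for u z
  proof -
    have "(\<lambda>j. inner z (e j) * inner v (e j)) sums inner z v"
      using uz by (intro parseval) (auto simp: diag_def)
    moreover have "(\<lambda>j. inner u (e j) * inner w (e j)) sums inner u w"
      using uz by (intro parseval) (auto simp: diag_def)
    moreover have "inner z (e j) * inner v (e j) = inner u (e j) * inner w (e j)" for j
      using uz vw by (auto simp: diag_def)
    ultimately show ?thesis by (simp add: sums_unique2)
  qed
  then show "(v, w) \<in> adjoint_on H (diag c)" using vw by (auto simp: diag_def adjoint_on_def)
qed

lemma eigenspace_diag:
  assumes fin: "finite {j. c j = \<mu>}"
  shows "eigenspace (diag c) \<mu> = span (e ` {j. c j = \<mu>})"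
proof (intro equalityI subsetI)
  fix u assume "u \<in> eigenspace (diag c) \<mu>"
  then have u: "u \<in> H" "\<And>j. (\<mu> - c j) * inner u (e j) = 0"
    by (auto simp: eigenspace_def diag_def algebra_simps)
  then have z: "inner u (e j) = 0" if "c j \<noteq> \<mu>" for j using that by (metis eq_iff_diff_eq_0 mult_eq_0_iff)
  have "(\<lambda>j. inner u (e j) *\<^sub>R e j) sums (\<Sum>j\<in>{j. c j = \<mu>}. inner u (e j) *\<^sub>R e j)"
    using fin z by (intro sums_finite) auto
  with expansion[OF u(1)] have "u = (\<Sum>j\<in>{j. c j = \<mu>}. inner u (e j) *\<^sub>R e j)"
    by (rule sums_unique2)
  also have "\<dots> \<in> span (e ` {j. c j = \<mu>})"
    by (intro span_sum span_scale span_base) auto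
  finally show "u \<in> span (e ` {j. c j = \<mu>})" .
next
  fix u assume u: "u \<in> span (e ` {j. c j = \<mu>})"
  have "subspace (eigenspace (diag c) \<mu>)"
  proof -
    have "eigenspace (diag c) \<mu> = {u \<in> H. \<forall>j. c j \<noteq> \<mu> \<longrightarrow> inner u (e j) = 0}"
      using subspace_scale[OF subspace_H] by (auto simp: eigenspace_def diag_def)
    then show ?thesis using subspace_H by (auto simp: subspace_def inner_add_left)
  qed
  moreover have "e ` {j. c j = \<mu>} \<subseteq> eigenspace (diag c) \<mu>"
    using e_H subspace_scale[OF subspace_H] by (auto simp: eigenspace_def diag_def orthonormal)
  ultimately show "u \<in> eigenspace (diag c) \<mu>" using u span_minimal by blast
qed

lemma inj_e: "inj e"
  by (rule injI) (metis orthonormal zero_neq_one)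

lemma independent_e: "independent (e ` J)"
  by (rule pairwise_orthogonal_independent)
     (use orthonormal in \<open>auto simp: pairwise_def orthogonal_def orthonormal\<close>, metis inner_zero_left orthonormal zero_neq_one)

lemma dimension_matches_diag:
  assumes "finite {j. c j = \<mu>}"
  shows "dimension_matches (eigenspace (diag c) \<mu>) {j. c j = \<mu>}"
  unfolding dimension_matches_def
  using eigenspace_diag[OF assms] independent_e inj_e
  by (metis inj_on_image_eqpoll_self inj_on_subset subset_UNIV)

end

text \<open>\<open>dimension_matches\<close> only asserts that some basis has the right size, so two
  witnesses have to be compared: the finite basis bounds the other one, which is then finite and
  bounds it in turn.\<close>

lemma dimension_matches_finite:
  assumes "dimension_matches V I" "dimension_matches V J" "finite I"
  shows "finite J" "card J = card I"
proof -
  obtain b b' where b: "independent b" "span b = V" "b \<approx> I" and b': "independent b'" "span b' = V" "b' \<approx> J"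
    using assms by (auto simp: dimension_matches_def)
  have fb: "finite b" using b(3) assms(3) eqpoll_finite_iff by blast
  have "finite b' \<and> card b' \<le> card b"
    using b b' fb span_superset by (intro independent_span_bound) auto
  moreover from this have "card b \<le> card b'"
    using b b' span_superset independent_span_bound[of b' b] by auto
  ultimately have "finite b'" "card b = card b'" by auto
  then show "finite J" "card J = card I"
    using b(3) b'(3) fb assms(3) eqpoll_finite_iff[OF b'(3)] by (auto simp: eqpoll_iff_card)
qed

section \<open>Projection-valued measures\<close>

locale pvm =
  fixes H :: "'h::real_inner set" and E :: "real set \<Rightarrow> 'h \<Rightarrow> 'h"
  assumes H: "subspace H" and E: "projection_valued_measure H E"
begin

lemma E_H: "S \<in> sets borel \<Longrightarrow> u \<in> H \<Longrightarrow> E S u \<in> H"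
  and E_idem: "S \<in> sets borel \<Longrightarrow> u \<in> H \<Longrightarrow> E S (E S u) = E S u"
  and E_affine: "S \<in> sets borel \<Longrightarrow> u \<in> H \<Longrightarrow> v \<in> H \<Longrightarrow> E S (u + c *\<^sub>R v) = E S u + c *\<^sub>R E S v"
  and E_sym: "S \<in> sets borel \<Longrightarrow> u \<in> H \<Longrightarrow> v \<in> H \<Longrightarrow> inner (E S u) v = inner u (E S v)"
  and E_UNIV: "u \<in> H \<Longrightarrow> E UNIV u = u"
  using E by (auto simp: projection_valued_measure_def orthogonal_projection_on_def)

lemma E_sums:
  "range S \<subseteq> sets borel \<Longrightarrow> disjoint_family S \<Longrightarrow> u \<in> H \<Longrightarrow> (\<lambda>i. E (S i) u) sums E (\<Union>i. S i) u"
  for S :: "nat \<Rightarrow> real set"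
  using E by (auto simp: projection_valued_measure_def)

lemma E_add: "S \<in> sets borel \<Longrightarrow> u \<in> H \<Longrightarrow> v \<in> H \<Longrightarrow> E S (u + v) = E S u + E S v"
  using E_affine[of S u v 1] by simp

lemma E_0: "S \<in> sets borel \<Longrightarrow> E S 0 = 0"
  using E_add[of S 0 0] subspace_0[OF H] by simp

lemma E_minus: "S \<in> sets borel \<Longrightarrow> u \<in> H \<Longrightarrow> E S (- u) = - E S u"
  using E_affine[of S 0 u "-1"] subspace_0[OF H] E_0 by simp

text \<open>Countable additivity for the constantly empty family makes a constant series converge,
  so its term is 0.\<close>

lemma E_empty: "u \<in> H \<Longrightarrow> E {} u = 0"
proof -
  assume "u \<in> H"
  then have "(\<lambda>i::nat. E {} u) sums E {} u"
    using E_sums[of "\<lambda>_. {}" u] by (auto simp: disjoint_family_on_def)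
  then have "(\<lambda>i::nat. E {} u) \<longlonglongrightarrow> 0" by (intro summable_LIMSEQ_zero) (auto simp: summable_def)
  then show ?thesis by (simp add: LIMSEQ_const_iff)
qed

lemma E_Un:
  assumes "S \<in> sets borel" "T \<in> sets borel" "S \<inter> T = {}" "u \<in> H"
  shows "E (S \<union> T) u = E S u + E T u"
proof -
  have "(\<lambda>n. E (binaryset S T n) u) sums E (\<Union>n. binaryset S T n) u"
    using assms by (intro E_sums)
      (auto simp: range_binaryset_eq disjoint_family_on_def binaryset_def)
  moreover have "(\<lambda>n. E (binaryset S T n) u) sums (E S u + E T u)"
    by (rule binaryset_sums[of "\<lambda>S. E S u"]) (simp add: E_empty assms)
  ultimately show ?thesis by (simp add: sums_unique2 UN_binaryset_eq)
qed

text \<open>The axioms do not state that disjoint sets give orthogonal ranges. It follows from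
  idempotence of \<open>E (S \<union> T)\<close>: the anticommutator of the two projections
  vanishes, and applying \<open>E S\<close> once more shows that they also commute, so their product
  is 0.\<close>

lemma E_disjoint:
  assumes S: "S \<in> sets borel" and T: "T \<in> sets borel" and "S \<inter> T = {}" and u: "u \<in> H"
  shows "E S (E T u) = 0"
proof -
  have ac: "E S (E T w) + E T (E S w) = 0" if w: "w \<in> H" for w
  proof -
    have "E (S \<union> T) (E (S \<union> T) w) = E (S \<union> T) w" using S T w by (intro E_idem) auto
    then have "E S (E S w + E T w) + E T (E S w + E T w) = E S w + E T w"
      using assms w by (simp add: E_Un E_H subspace_add[OF H])
    then show ?thesis using S T w by (simp add: E_add E_H E_idem)
  qed
  have 1: "E S (E T w) = - E T (E S w)" if "w \<in> H" for w
    using ac[OF that] by (simp add: eq_neg_iff_add_eq_0)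
  have "E S (E T u) = - E S (E T (E S u))"
    using S T u 1[of u] E_idem[of S "E T u"] by (simp add: E_H E_minus)
  moreover have "E S (E T (E S u)) = - E T (E S u)" using 1[of "E S u"] S T u by (simp add: E_H E_idem)
  ultimately have "E S (E T u) = E T (E S u)" by simp
  with ac[OF u] have "2 *\<^sub>R E S (E T u) = 0" by (simp add: scaleR_2)
  then show ?thesis by simp
qed

lemma E_mult:
  assumes S: "S \<in> sets borel" and T: "T \<in> sets borel" and u: "u \<in> H"
  shows "E S (E T u) = E (S \<inter> T) u"
proof -
  have "E T u = E (S \<inter> T) u + E (T - S) u"
  proof -
    have "T = (S \<inter> T) \<union> (T - S)" "(S \<inter> T) \<inter> (T - S) = {}" by auto
    then show ?thesis using E_Un[of "S \<inter> T" "T - S" u] assms by auto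
  qed
  then have "E S (E T u) = E S (E (S \<inter> T) u) + E S (E (T - S) u)"
    using assms by (simp add: E_add E_H)
  also have "E S (E (T - S) u) = 0" using assms by (intro E_disjoint) auto
  also have "E S (E (S \<inter> T) u) = E (S \<inter> T) u"
  proof -
    have "E (S \<inter> T) u = E (S \<inter> T) (E (S \<inter> T) u)" using assms by (simp add: E_idem)
    moreover have "E S v = E (S \<inter> T) v + E (S - T) v" if "v \<in> H" for v
    proof -
      have "S = (S \<inter> T) \<union> (S - T)" "(S \<inter> T) \<inter> (S - T) = {}" by auto
      then show ?thesis using E_Un[of "S \<inter> T" "S - T" v] assms that by auto
    qed
    moreover have "E (S - T) (E (S \<inter> T) u) = 0" using assms by (intro E_disjoint) auto
    ultimately show ?thesis using assms by (metis E_H add.right_neutral sets.Int)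
  qed
  finally show ?thesis by simp
qed

lemma inner_E_self: "S \<in> sets borel \<Longrightarrow> u \<in> H \<Longrightarrow> inner (E S u) u = inner (E S u) (E S u)"
  by (metis E_H E_idem E_sym)

lemma sets_scalar_measure [measurable_cong, simp]: "sets (scalar_measure E u) = sets borel"
  using sets.sigma_sets_eq[of "borel :: real measure"] by (simp add: scalar_measure_def)

lemma space_scalar_measure [simp]: "space (scalar_measure E u) = UNIV"
  by (simp add: scalar_measure_def)

lemma emeasure_scalar_measure:
  assumes u: "u \<in> H" and S: "S \<in> sets borel"
  shows "emeasure (scalar_measure E u) S = ennreal (inner (E S u) u)"
proof (rule emeasure_measure_of[OF scalar_measure_def])
  show "sets borel \<subseteq> Pow (UNIV :: real set)" by simp
  show "positive (sets (scalar_measure E u)) (\<lambda>S. ennreal (inner (E S u) u))"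
    by (simp add: positive_def E_empty u)
  show "S \<in> sets (scalar_measure E u)" using S by simp
  show "countably_additive (sets (scalar_measure E u)) (\<lambda>S. ennreal (inner (E S u) u))"
  proof (rule countably_additiveI)
    fix A :: "nat \<Rightarrow> real set" assume A: "range A \<subseteq> sets (scalar_measure E u)" "disjoint_family A"
    then have A': "range A \<subseteq> sets borel" by simp
    have "(\<lambda>i. inner (E (A i) u) u) sums inner (E (\<Union>i. A i) u) u"
      by (rule bounded_linear.sums[OF bounded_linear_inner_left E_sums[OF A' A(2) u]])
    then show "(\<Sum>i. ennreal (inner (E (A i) u) u)) = ennreal (inner (E (\<Union> (range A)) u) u)"
      using A' u by (intro suminf_ennreal_eq) (auto simp: inner_E_self)
  qed
qed

lemma finite_scalar_measure: "u \<in> H \<Longrightarrow> finite_measure (scalar_measure E u)"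
  by (intro finite_measureI) (simp add: emeasure_scalar_measure)

lemma inner_E_split:
  assumes "u \<in> H" "S \<in> sets borel" "T \<in> sets borel"
  shows "inner (E T u) u = inner (E (T \<inter> S) u) u + inner (E (T - S) u) u"
proof -
  have "E (T \<inter> S \<union> (T - S)) u = E (T \<inter> S) u + E (T - S) u"
    using assms by (intro E_Un) auto
  then show ?thesis by (simp add: Int_Diff_Un inner_add_left)
qed

text \<open>In the spectral sense the vector is \<open>(a + c) *\<^sub>R u\<close> on
  \<open>S\<close> and \<open>a *\<^sub>R u\<close> off it, so the measure of \<open>u\<close> is
  rescaled by the square of the local factor. This evaluates the polarized integrals of
  \<open>spectral_integral\<close> when the test vector is \<open>E S u\<close>.\<close>

lemma scalar_measure_affine:
  assumes u: "u \<in> H" and S: "S \<in> sets borel"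
  shows "scalar_measure E (a *\<^sub>R u + c *\<^sub>R E S u) =
    density (scalar_measure E u) (\<lambda>x. ennreal (if x \<in> S then (a + c)\<^sup>2 else a\<^sup>2))"
proof (rule measure_eqI)
  fix T assume "T \<in> sets (scalar_measure E (a *\<^sub>R u + c *\<^sub>R E S u))"
  then have T: "T \<in> sets borel" by simp
  let ?w = "E S u" and ?m = "\<lambda>S. inner (E S u) u"
  have w: "?w \<in> H" using E_H u S by simp
  have au: "a *\<^sub>R u \<in> H" using u H by (simp add: subspace_scale)
  have auw: "a *\<^sub>R u + c *\<^sub>R E S u \<in> H" using au w H by (simp add: subspace_scale subspace_add)
  have "E T (a *\<^sub>R u) = a *\<^sub>R E T u" using E_affine[of T 0 u a] E_0[OF T] T u subspace_0[OF H] by simp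
  then have e: "E T (a *\<^sub>R u + c *\<^sub>R ?w) = a *\<^sub>R E T u + c *\<^sub>R E (T \<inter> S) u"
    using T S u w au by (simp add: E_affine E_mult)
  have 1: "inner (E T u) ?w = ?m (T \<inter> S)"
    using E_sym[of S "E T u" u] E_mult[of S T u] T S u by (simp add: E_H Int_commute)
  have 2: "inner (E (T \<inter> S) u) ?w = ?m (T \<inter> S)"
    using E_sym[of S "E (T \<inter> S) u" u] E_mult[of S "T \<inter> S" u] T S u by (simp add: E_H Int_commute Int_left_commute)
  have "inner (E T (a *\<^sub>R u + c *\<^sub>R ?w)) (a *\<^sub>R u + c *\<^sub>R ?w) = (a + c)\<^sup>2 * ?m (T \<inter> S) + a\<^sup>2 * ?m (T - S)"
    using inner_E_split[OF u S T]
    by (simp add: e inner_add_left inner_add_right 1 2 power2_eq_square algebra_simps)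
  moreover have "emeasure (density (scalar_measure E u) (\<lambda>x. ennreal (if x \<in> S then (a + c)\<^sup>2 else a\<^sup>2))) T
      = ennreal ((a + c)\<^sup>2) * ennreal (?m (T \<inter> S)) + ennreal (a\<^sup>2) * ennreal (?m (T - S))"
  proof -
    have "emeasure (density (scalar_measure E u) (\<lambda>x. ennreal (if x \<in> S then (a + c)\<^sup>2 else a\<^sup>2))) T =
       (\<integral>\<^sup>+x. ennreal (if x \<in> S then (a + c)\<^sup>2 else a\<^sup>2) * indicator T x \<partial>scalar_measure E u)"
      using T S by (intro emeasure_density) auto
    also have "\<dots> = (\<integral>\<^sup>+x. ennreal ((a + c)\<^sup>2) * indicator (T \<inter> S) x + ennreal (a\<^sup>2) * indicator (T - S) x \<partial>scalar_measure E u)"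
      by (intro nn_integral_cong) (auto simp: indicator_def)
    also have "\<dots> = ennreal ((a + c)\<^sup>2) * ennreal (?m (T \<inter> S)) + ennreal (a\<^sup>2) * ennreal (?m (T - S))"
      using T S u by (subst nn_integral_add) (auto simp: nn_integral_cmult_indicator emeasure_scalar_measure)
    finally show ?thesis .
  qed
  ultimately show "emeasure (scalar_measure E (a *\<^sub>R u + c *\<^sub>R ?w)) T =
     emeasure (density (scalar_measure E u) (\<lambda>x. ennreal (if x \<in> S then (a + c)\<^sup>2 else a\<^sup>2))) T"
    using T S u by (simp add: emeasure_scalar_measure[OF auw T] ennreal_mult inner_E_self ennreal_plus)
qed simp

text \<open>Testing the eigenvalue equation against \<open>E S e\<close> gives $\int_S (x-\lambda)\,d\mu_e(x)=0$ for all
  Borel sets \<open>S\<close>, so the scalar measure of an eigenvector is concentrated at its eigenvalue.\<close>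

lemma eigenvector_E:
  assumes e: "(e, l *\<^sub>R e) \<in> spectral_integral H E (\<lambda>x. x)" and S: "S \<in> sets borel"
  shows "E S e = (if l \<in> S then e else 0)"
proof -
  define \<mu> where "\<mu> = scalar_measure E e"
  have eH: "e \<in> H" and int2: "integrable \<mu> (\<lambda>x. x\<^sup>2)"
    using e by (auto simp: spectral_integral_def spectral_domain_def \<mu>_def)
  interpret \<mu>: finite_measure \<mu> unfolding \<mu>_def by (rule finite_scalar_measure[OF eH])
  have [measurable_cong, simp]: "sets \<mu> = sets borel" by (simp add: \<mu>_def)
  have [simp]: "space \<mu> = UNIV" by (simp add: \<mu>_def)
  have int1: "integrable \<mu> (\<lambda>x. x)"
  proof (rule Bochner_Integration.integrable_bound)
    show "integrable \<mu> (\<lambda>x. 1 + x\<^sup>2)" using int2 by simp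
    have "\<bar>x\<bar> \<le> 1 + x\<^sup>2" for x :: real
      using sum_squares_bound[of 1 "\<bar>x\<bar>"] by (simp add: abs_if split: if_splits)
    then show "AE x in \<mu>. norm x \<le> norm (1 + x\<^sup>2)" by simp
  qed simp
  have meas: "(\<integral>x. indicator T x * (x - l) \<partial>\<mu>) = 0" if T: "T \<in> sets borel" for T
  proof -
    define w where "w = E T e"
    have w: "w \<in> H" using E_H T eH by (simp add: w_def)
    have D: "scalar_measure E (a *\<^sub>R e + c *\<^sub>R w) = density \<mu> (\<lambda>x. ennreal (if x \<in> T then (a + c)\<^sup>2 else a\<^sup>2))" for a c
      unfolding w_def \<mu>_def by (rule scalar_measure_affine[OF eH T])
    have I: "integrable \<mu> (\<lambda>x. (if x \<in> T then a else c) * g x)" if "integrable \<mu> g" for g :: "real \<Rightarrow> real" and a c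
      using T that by (intro Bochner_Integration.integrable_bound[OF integrable_mult_right[OF that, of "\<bar>a\<bar> + \<bar>c\<bar>"]])
        (auto simp: abs_mult intro!: mult_right_mono)
    have "integrable (scalar_measure E w) (\<lambda>x. x\<^sup>2)"
      using D[of 0 1] I[OF int2, of "(0 + 1)\<^sup>2" "0\<^sup>2"] T by (simp add: integrable_real_density)
    then have "w \<in> spectral_domain H E (\<lambda>x. x)" using w by (simp add: spectral_domain_def)
    then have "inner (l *\<^sub>R e) w =
        ((LINT x|scalar_measure E (e + w). x) - (LINT x|scalar_measure E (e - w). x)) / 4"
      using e by (auto simp: spectral_integral_def)
    \<comment> \<open>With \<open>w = E T e\<close>, the vectors \<open>e + w\<close> and
      \<open>e - w\<close> are \<open>2 *\<^sub>R e\<close> and 0 on \<open>T\<close> and equal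
      \<open>e\<close> off it. The densities are therefore 4, 1 and 0, 1, and their difference lives
      on \<open>T\<close> alone.\<close>
    also have "(LINT x|scalar_measure E (e + w). x) = (LINT x|\<mu>. (if x \<in> T then 4 else 1) * x)"
      using D[of 1 1] T by (simp add: integral_real_density cong: if_cong)
    also have "(LINT x|scalar_measure E (e - w). x) = (LINT x|\<mu>. (if x \<in> T then 0 else 1) * x)"
      using D[of 1 "-1"] T by (simp add: integral_real_density cong: if_cong)
    also have "((LINT x|\<mu>. (if x \<in> T then 4 else 1) * x) - (LINT x|\<mu>. (if x \<in> T then 0 else 1) * x)) / 4
       = (LINT x|\<mu>. indicator T x * x)"
    proof -
      have "(LINT x|\<mu>. (if x \<in> T then 4 else 1) * x) - (LINT x|\<mu>. (if x \<in> T then 0 else 1) * x)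
        = (LINT x|\<mu>. (if x \<in> T then 4 else 1) * x - (if x \<in> T then 0 else 1) * x)"
        using I[OF int1, of 4 1] I[OF int1, of 0 1] by simp
      also have "\<dots> = (LINT x|\<mu>. 4 * (indicator T x * x))"
        by (intro Bochner_Integration.integral_cong) (auto simp: indicator_def)
      finally show ?thesis by simp
    qed
    finally have 1: "l * inner e w = (LINT x|\<mu>. indicator T x * x)" by simp
    have "inner e w = measure \<mu> T"
      using T eH by (simp add: \<mu>_def w_def measure_def emeasure_scalar_measure inner_E_self inner_commute[of e])
    moreover have "(LINT x|\<mu>. indicator T x * (x - l)) = (LINT x|\<mu>. indicator T x * x) - (LINT x|\<mu>. indicator T x * l)"
    proof -
      have "integrable \<mu> (\<lambda>x. indicator T x * x)"
        using I[OF int1, of 1 0] by (rule Bochner_Integration.integrable_cong[THEN iffD1, rotated 2]) (auto simp: indicator_def)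
      moreover have "integrable \<mu> (\<lambda>x. indicator T x * l)"
        using T by (intro integrable_mult_left integrable_real_indicator) (auto simp: \<mu>.emeasure_finite less_top[symmetric])
      ultimately show ?thesis by (simp add: right_diff_distrib)
    qed
    ultimately show ?thesis using 1 T by (simp add: mult.commute)
  qed
  have int: "integrable \<mu> (\<lambda>x. indicator T x * (x - l))" if "T \<in> sets borel" for T
  proof (rule Bochner_Integration.integrable_bound)
    show "integrable \<mu> (\<lambda>x. x - l)" using int1 by simp
    show "(\<lambda>x. indicator T x * (x - l)) \<in> borel_measurable \<mu>" using that by measurable
    show "AE x in \<mu>. norm (indicator T x * (x - l)) \<le> norm (x - l)" by (simp add: indicator_def)
  qed
  \<comment> \<open>On either side of \<open>l\<close> the factor \<open>x - l\<close> has one sign,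
    so the vanishing integral leaves no mass there.\<close>
  have "AE x in \<mu>. indicator {l<..} x * (x - l) = 0"
    using meas[of "{l<..}"] int[of "{l<..}"] by (subst integral_nonneg_eq_0_iff_AE[symmetric]) (auto simp: indicator_def)
  moreover have "AE x in \<mu>. - (indicator {..<l} x * (x - l)) = 0"
    using meas[of "{..<l}"] int[of "{..<l}"] by (subst integral_nonneg_eq_0_iff_AE[symmetric]) (auto simp: indicator_def)
  ultimately have "AE x in \<mu>. x = l"
    by eventually_elim (auto simp: indicator_def split: if_splits)
  then have "emeasure \<mu> (- {l}) = 0"
    by (subst (asm) AE_iff_measurable[of "- {l}"]) auto
  then have "inner (E (- {l}) e) (E (- {l}) e) = 0"
    using eH by (simp add: \<mu>_def emeasure_scalar_measure inner_E_self)
  then have "E (- {l}) e = 0" by simp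
  moreover have "E ({l} \<union> - {l}) e = E {l} e + E (- {l}) e" using eH by (intro E_Un) auto
  ultimately have el: "E {l} e = e" using eH by (simp add: E_UNIV)
  have "E S e = E S (E {l} e)" by (simp add: el)
  also have "\<dots> = E (S \<inter> {l}) e" using S eH by (intro E_mult) auto
  finally show ?thesis using el E_empty[OF eH] by auto
qed

end

section \<open>Functional calculus of diagonal operators\<close>

context hilbert_basis
begin

lemma diag_function:
  assumes "u \<in> H" and c: "\<And>j. \<bar>c j\<bar> \<le> B"
  shows "(u, THE v. (u, v) \<in> diag c) \<in> diag c"
proof -
  obtain v where v: "(u, v) \<in> diag c" using diag_total[OF assms] .
  then show ?thesis by (rule theI) (rule diag_unique[OF _ v])
qed

definition spectral_proj :: "(nat \<Rightarrow> real) \<Rightarrow> real set \<Rightarrow> 'h \<Rightarrow> 'h" where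
  "spectral_proj l S u = (THE v. (u, v) \<in> diag (\<lambda>j. indicator S (l j)))"

lemma
  assumes "u \<in> H"
  shows spectral_proj_H: "spectral_proj l S u \<in> H"
    and spectral_proj_coeff: "inner (spectral_proj l S u) (e j) = indicator S (l j) * inner u (e j)"
proof -
  have "(u, spectral_proj l S u) \<in> diag (\<lambda>j. indicator S (l j))"
    unfolding spectral_proj_def by (rule diag_function[OF assms, where B = 1]) (simp add: indicator_def)
  then show "spectral_proj l S u \<in> H"
    and "inner (spectral_proj l S u) (e j) = indicator S (l j) * inner u (e j)"
    unfolding diag_def by blast+
qed

lemma spectral_proj_inner:
  assumes "u \<in> H"
  shows "(\<lambda>j. indicator S (l j) * (inner u (e j) * inner v (e j))) sums inner (spectral_proj l S u) v"
  using parseval[OF spectral_proj_H[OF assms], of l S v] by (simp add: spectral_proj_coeff[OF assms] mult.assoc)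

text \<open>For countable additivity, the projections of \<open>u\<close> onto disjoint sets are
  pairwise orthogonal with squared norms summing to at most \<open>inner u u\<close>, so their
  series converges; its limit is then identified by coefficients, where additivity is that of an
  indicator.\<close>

lemma projection_valued_measure_spectral_proj: "projection_valued_measure H (spectral_proj l)"
  unfolding projection_valued_measure_def orthogonal_projection_on_def
proof (intro conjI ballI allI impI)
  fix u v S c assume uv: "u \<in> H" "v \<in> H"
  show "spectral_proj l S u \<in> H" by (rule spectral_proj_H[OF uv(1)])
  show "spectral_proj l S (spectral_proj l S u) = spectral_proj l S u"
    by (rule coeff_eqI) (auto simp: spectral_proj_H spectral_proj_coeff uv indicator_def)
  have uv': "u + c *\<^sub>R v \<in> H" using uv subspace_H by (simp add: subspace_add subspace_scale)
  show "spectral_proj l S (u + c *\<^sub>R v) = spectral_proj l S u + c *\<^sub>R spectral_proj l S v"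
    by (rule coeff_eqI)
       (auto simp: spectral_proj_H spectral_proj_coeff uv uv' inner_add_left algebra_simps
         intro!: subspace_add[OF subspace_H] subspace_scale[OF subspace_H])
  show "inner (spectral_proj l S u) v = inner u (spectral_proj l S v)"
    using spectral_proj_inner[OF uv(1), of S l v] spectral_proj_inner[OF uv(2), of S l u]
    by (simp add: inner_commute mult.commute sums_unique2)
next
  fix u assume u: "u \<in> H"
  show "spectral_proj l UNIV u = u"
    by (rule coeff_eqI) (auto simp: spectral_proj_H spectral_proj_coeff u)
next
  fix S :: "nat \<Rightarrow> real set" and u
  assume disj: "disjoint_family S" and u: "u \<in> H"
  let ?P = "spectral_proj l"
  have orth: "inner (?P (S i) u) (?P (S k) u) = 0" if "i \<noteq> k" for i k
  proof -
    have "S i \<inter> S k = {}" using disj that by (auto simp: disjoint_family_on_def)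
    then have "indicator (S i) (l j) * (inner u (e j) * (indicator (S k) (l j) * inner u (e j))) = 0" for j
      by (auto simp: indicator_def)
    then have "(\<lambda>j. 0) sums inner (?P (S i) u) (?P (S k) u)"
      using spectral_proj_inner[OF u, of "S i" l "?P (S k) u"] by (simp only: spectral_proj_coeff[OF u])
    then show ?thesis by (rule sums_unique2) simp
  qed
  have n2: "(norm (?P T u))\<^sup>2 = inner (?P T u) u" for T
  proof -
    have "indicator T x * (a * (indicator T x * a)) = indicator T x * (a * a)" for a x :: real
      by (simp add: indicator_def)
    then have "(\<lambda>j. indicator T (l j) * (inner u (e j) * inner u (e j))) sums inner (?P T u) (?P T u)"
      using spectral_proj_inner[OF u, of T l "?P T u"] by (simp only: spectral_proj_coeff[OF u])
    then show ?thesis using spectral_proj_inner[OF u, of T l u] by (simp add: dot_square_norm[symmetric] sums_unique2)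
  qed
  have bd: "(\<Sum>i<n. (norm (?P (S i) u))\<^sup>2) \<le> inner u u" for n
  proof -
    have 1: "(\<lambda>j. \<Sum>i<n. indicator (S i) (l j) * (inner u (e j) * inner u (e j))) sums (\<Sum>i<n. inner (?P (S i) u) u)"
      by (intro sums_sum spectral_proj_inner u)
    have 2: "(\<lambda>j. inner u (e j) * inner u (e j)) sums inner u u" by (rule parseval[OF u])
    have 3: "(\<Sum>i<n. indicator (S i) (l j) * (inner u (e j) * inner u (e j))) \<le> inner u (e j) * inner u (e j)" for j
    proof -
      have "(\<Sum>i<n. indicator (S i) (l j)) = (indicator (\<Union>i<n. S i) (l j) :: real)"
        using disj by (intro indicator_UN_disjoint[symmetric]) (auto simp: disjoint_family_on_def)
      also have "\<dots> \<le> 1" by (rule indicator_le_1)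
      finally have "(\<Sum>i<n. indicator (S i) (l j)) * (inner u (e j) * inner u (e j)) \<le> 1 * (inner u (e j) * inner u (e j))"
        by (rule mult_right_mono) simp
      then show ?thesis by (simp only: sum_distrib_right mult_1)
    qed
    show ?thesis unfolding n2 by (rule sums_le[OF 3 1 2])
  qed
  obtain v where v: "(\<lambda>i. ?P (S i) u) sums v"
    using orthogonal_summable[OF orth bd] by (auto simp: summable_def)
  have "v \<in> H"
    using closed_H
  proof (rule closed_sequentially)
    show "(\<Sum>i<n. ?P (S i) u) \<in> H" for n
      by (intro subspace_sum subspace_H spectral_proj_H u)
    show "(\<lambda>n. \<Sum>i<n. ?P (S i) u) \<longlonglongrightarrow> v" using v by (simp add: sums_def)
  qed
  moreover have "inner v (e j) = inner (?P (\<Union>i. S i) u) (e j)" for j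
  proof -
    have "(\<lambda>i. inner (?P (S i) u) (e j)) sums inner v (e j)"
      by (rule bounded_linear.sums[OF bounded_linear_inner_left v])
    then have 1: "(\<lambda>i. indicator (S i) (l j) * inner u (e j)) sums inner v (e j)"
      by (simp add: spectral_proj_coeff u)
    have 2: "(\<lambda>i. indicator (S i) (l j) * inner u (e j)) sums (indicator (\<Union>i. S i) (l j) * inner u (e j))"
    proof (cases "\<exists>i. l j \<in> S i")
      case True
      then obtain i where i: "l j \<in> S i" by blast
      then have "l j \<notin> S k" if "k \<noteq> i" for k using disj that by (auto simp: disjoint_family_on_def)
      then have "(\<lambda>k. indicator (S k) (l j) * inner u (e j)) = (\<lambda>k. if k = i then inner u (e j) else 0)"
        using i by (auto simp: indicator_def)
      then show ?thesis using sums_single[of i "\<lambda>_. inner u (e j)"] i by (auto simp: indicator_def)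
    qed (auto simp: indicator_def)
    show ?thesis using sums_unique2[OF 1 2] by (simp add: spectral_proj_coeff u)
  qed
  ultimately have "v = ?P (\<Union>i. S i) u" by (intro coeff_eqI spectral_proj_H u)
  then show "(\<lambda>i. ?P (S i) u) sums ?P (\<Union>i. S i) u" using v by simp
qed

text \<open>The sum of point masses \<open>(inner u (e j))\<^sup>2\<close> at the points
  \<open>l j\<close>, encoded as the image of a weighted counting measure so that integrals against
  it become series.\<close>

definition coeff_measure :: "(nat \<Rightarrow> real) \<Rightarrow> 'h \<Rightarrow> real measure" where
  "coeff_measure l u = distr (density (count_space UNIV) (\<lambda>j. ennreal ((inner u (e j))\<^sup>2))) borel l"

lemma scalar_measure_spectral_proj:
  assumes u: "u \<in> H"
  shows "scalar_measure (spectral_proj l) u = coeff_measure l u"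
proof (rule measure_eqI)
  interpret P: pvm H "spectral_proj l"
    using subspace_H projection_valued_measure_spectral_proj by unfold_locales
  show "sets (scalar_measure (spectral_proj l) u) = sets (coeff_measure l u)"
    by (simp add: coeff_measure_def)
  fix S assume "S \<in> sets (scalar_measure (spectral_proj l) u)"
  then have S: "S \<in> sets borel" by simp
  have "emeasure (coeff_measure l u) S = (\<integral>\<^sup>+j. ennreal ((inner u (e j))\<^sup>2) * indicator (l -` S) j \<partial>count_space UNIV)"
    using S by (simp add: coeff_measure_def emeasure_distr emeasure_density)
  also have "\<dots> = (\<integral>\<^sup>+j. ennreal (indicator S (l j) * (inner u (e j) * inner u (e j))) \<partial>count_space UNIV)"
    by (intro nn_integral_cong) (auto simp: indicator_def power2_eq_square)
  also have "\<dots> = ennreal (inner (spectral_proj l S u) u)"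
    using spectral_proj_inner[OF u, of S l u]
    by (subst nn_integral_count_space_nat) (intro suminf_ennreal_eq; auto simp: indicator_def)
  finally show "emeasure (scalar_measure (spectral_proj l) u) S = emeasure (coeff_measure l u) S"
    using P.emeasure_scalar_measure[OF u S] by simp
qed

lemma integrable_coeff_measure:
  assumes [measurable]: "f \<in> borel_measurable borel"
  shows "integrable (coeff_measure l u) f \<longleftrightarrow> summable (\<lambda>j. \<bar>f (l j)\<bar> * (inner u (e j))\<^sup>2)"
  unfolding coeff_measure_def
  by (subst integrable_distr_eq, simp, simp, subst integrable_real_density, simp, simp, simp,
      subst integrable_count_space_nat_iff, simp add: abs_mult mult.commute)

lemma integral_coeff_measure:
  assumes [measurable]: "f \<in> borel_measurable borel" and "integrable (coeff_measure l u) f"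
  shows "(LINT x|coeff_measure l u. f x) = (\<Sum>j. f (l j) * (inner u (e j))\<^sup>2)"
proof -
  have "(LINT x|coeff_measure l u. f x) = (LINT j|count_space UNIV. (inner u (e j))\<^sup>2 * f (l j))"
    unfolding coeff_measure_def by (subst integral_distr, simp, simp, subst integral_real_density, simp_all)
  also have "\<dots> = (\<Sum>j. (inner u (e j))\<^sup>2 * f (l j))"
    using integrable_coeff_measure[OF assms(1)] assms(2)
    by (intro integral_count_space_nat) (simp add: integrable_count_space_nat_iff abs_mult mult.commute)
  finally show ?thesis by (simp add: mult.commute)
qed

lemma spectral_domain_spectral_proj:
  assumes [measurable]: "f \<in> borel_measurable borel"
  shows "spectral_domain H (spectral_proj l) f = {u \<in> H. summable (\<lambda>j. (f (l j) * inner u (e j))\<^sup>2)}"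
  by (auto simp: spectral_domain_def scalar_measure_spectral_proj integrable_coeff_measure power_mult_distrib)

text \<open>Polarizing the coefficient series gives the sum of
  \<open>f (l j) * (inner u (e j) * inner w (e j))\<close>. Testing with \<open>w = e j\<close>
  isolates one coefficient of the value, and Parseval gives the reverse inclusion.\<close>

lemma spectral_integral_spectral_proj:
  assumes [measurable]: "f \<in> borel_measurable borel"
  shows "spectral_integral H (spectral_proj l) f = diag (\<lambda>j. f (l j))"
proof -
  let ?D = "spectral_domain H (spectral_proj l) f"
  let ?q = "\<lambda>u w. ((LINT x|scalar_measure (spectral_proj l) (u + w). f x) - (LINT x|scalar_measure (spectral_proj l) (u - w). f x)) / 4"
  \<comment> \<open>The domain controls only the square of \<open>f\<close>. Since the coefficients
    of \<open>u\<close> are square summable, \<open>\<bar>a\<bar> \<le> a\<^sup>2 + 1\<close> makes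
    \<open>f\<close> itself integrable, which the polarized integrals require.\<close>
  have intD: "summable (\<lambda>j. \<bar>f (l j)\<bar> * (inner u (e j))\<^sup>2)" if "u \<in> ?D" for u
  proof (rule summable_comparison_test')
    have u: "u \<in> H" "summable (\<lambda>j. (f (l j) * inner u (e j))\<^sup>2)"
      using that by (auto simp: spectral_domain_spectral_proj)
    then show "summable (\<lambda>j. (f (l j) * inner u (e j))\<^sup>2 + inner u (e j) * inner u (e j))"
      using parseval[OF u(1), of u] by (intro summable_add) (auto simp: summable_def)
    have "\<bar>a\<bar> * b\<^sup>2 \<le> (a * b)\<^sup>2 + b * b" for a b :: real
    proof -
      have "\<bar>a\<bar> \<le> a\<^sup>2 + 1" using sum_squares_bound[of 1 "\<bar>a\<bar>"] by (simp add: abs_if split: if_splits)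
      then have "\<bar>a\<bar> * b\<^sup>2 \<le> (a\<^sup>2 + 1) * b\<^sup>2" by (intro mult_right_mono) auto
      then show ?thesis by (simp add: algebra_simps power2_eq_square)
    qed
    then show "norm (\<bar>f (l j)\<bar> * (inner u (e j))\<^sup>2) \<le> (f (l j) * inner u (e j))\<^sup>2 + inner u (e j) * inner u (e j)"
      if "j \<ge> 0" for j by simp
  qed
  have Dadd: "u + c *\<^sub>R w \<in> ?D" if uw: "u \<in> ?D" "w \<in> ?D" for u w c
  proof -
    have "summable (\<lambda>j. 2 * (f (l j) * inner u (e j))\<^sup>2 + 2 * c\<^sup>2 * (f (l j) * inner w (e j))\<^sup>2)"
      using uw by (intro summable_add summable_mult) (auto simp: spectral_domain_spectral_proj)
    then have "summable (\<lambda>j. (f (l j) * inner (u + c *\<^sub>R w) (e j))\<^sup>2)"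
    proof (rule summable_comparison_test'[where N = 0])
      have "(a * (x + c * y))\<^sup>2 \<le> 2 * (a * x)\<^sup>2 + 2 * c\<^sup>2 * (a * y)\<^sup>2" for a x y :: real
        using zero_le_power2[of "a * x - a * c * y"] by (simp add: power2_eq_square algebra_simps)
      then show "norm ((f (l j) * inner (u + c *\<^sub>R w) (e j))\<^sup>2) \<le> 2 * (f (l j) * inner u (e j))\<^sup>2 + 2 * c\<^sup>2 * (f (l j) * inner w (e j))\<^sup>2" for j
        by (simp add: inner_add_left)
    qed
    then show ?thesis using uw subspace_H by (auto simp: spectral_domain_spectral_proj subspace_add subspace_scale)
  qed
  have q: "(\<lambda>j. f (l j) * (inner u (e j) * inner w (e j))) sums ?q u w" if uw: "u \<in> ?D" "w \<in> ?D" for u w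
  proof -
    have *: "(\<lambda>j. f (l j) * (inner z (e j))\<^sup>2) sums (LINT x|scalar_measure (spectral_proj l) z. f x)" if z: "z \<in> ?D" for z
    proof -
      have "z \<in> H" using z by (simp add: spectral_domain_def)
      then have "(LINT x|scalar_measure (spectral_proj l) z. f x) = (\<Sum>j. f (l j) * (inner z (e j))\<^sup>2)"
        using intD[OF z] by (simp add: scalar_measure_spectral_proj integral_coeff_measure integrable_coeff_measure)
      moreover have "summable (\<lambda>j. f (l j) * (inner z (e j))\<^sup>2)"
        by (rule summable_rabs_cancel) (use intD[OF z] in \<open>simp add: abs_mult\<close>)
      ultimately show ?thesis by (simp add: summable_sums)
    qed
    have "u + w \<in> ?D" "u - w \<in> ?D" using Dadd[OF uw, of 1] Dadd[OF uw, of "-1"] by auto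
    note S = sums_divide[OF sums_diff[OF *[OF this(1)] *[OF this(2)]], of 4]
    have "(f (l j) * (inner (u + w) (e j))\<^sup>2 - f (l j) * (inner (u - w) (e j))\<^sup>2) / 4 =
        f (l j) * (inner u (e j) * inner w (e j))" for j
      by (simp add: inner_add_left inner_diff_left power2_eq_square algebra_simps)
    then show ?thesis using S by simp
  qed
  have eD: "e j \<in> ?D" for j
  proof -
    have "(\<lambda>i. (f (l i) * inner (e j) (e i))\<^sup>2) = (\<lambda>i. if i = j then (f (l i))\<^sup>2 else 0)"
      by (auto simp: orthonormal)
    then show ?thesis
      using e_H summable_single[of j] by (auto simp: spectral_domain_spectral_proj)
  qed
  show ?thesis
  proof (intro equalityI subrelI)
    fix u v assume "(u, v) \<in> spectral_integral H (spectral_proj l) f"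
    then have uv: "u \<in> ?D" "v \<in> H" "\<And>w. w \<in> ?D \<Longrightarrow> inner v w = ?q u w"
      by (auto simp: spectral_integral_def)
    have "inner v (e j) = f (l j) * inner u (e j)" for j
    proof -
      have "(\<lambda>i. f (l i) * (inner u (e i) * inner (e j) (e i))) = (\<lambda>i. if i = j then f (l i) * inner u (e i) else 0)"
        by (auto simp: orthonormal)
      then have "(\<lambda>i. if i = j then f (l i) * inner u (e i) else 0) sums inner v (e j)"
        using q[OF uv(1) eD[of j]] unfolding uv(3)[OF eD[of j]] by simp
      then show ?thesis by (rule sums_unique2) (rule sums_single)
    qed
    then show "(u, v) \<in> diag (\<lambda>j. f (l j))" using uv by (auto simp: diag_def spectral_domain_def)
  next
    fix u v assume "(u, v) \<in> diag (\<lambda>j. f (l j))"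
    then have uv: "u \<in> H" "v \<in> H" "\<And>j. inner v (e j) = f (l j) * inner u (e j)" by (auto simp: diag_def)
    have "u \<in> ?D"
      using uv parseval[OF uv(2), of v] by (auto simp: spectral_domain_spectral_proj power2_eq_square summable_def)
    moreover have "inner v w = ?q u w" if "w \<in> ?D" for w
    proof (rule sums_unique2)
      show "(\<lambda>j. f (l j) * (inner u (e j) * inner w (e j))) sums inner v w"
        using parseval[OF uv(2), of w] uv(3) by (simp add: mult.assoc)
      show "(\<lambda>j. f (l j) * (inner u (e j) * inner w (e j))) sums ?q u w" by (rule q[OF \<open>u \<in> ?D\<close> that])
    qed
    ultimately show "(u, v) \<in> spectral_integral H (spectral_proj l) f"
      using uv by (auto simp: spectral_integral_def)
  qed
qed

text \<open>The eigenvectors fix \<open>E S (e j)\<close>, and by symmetry of \<open>E S\<close>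
  these values are all the coefficients of \<open>E S u\<close>. Uniqueness matters because
  \<open>functional_calculus\<close> accepts every measure that represents the operator.\<close>

lemma pvm_eq_spectral_proj:
  assumes E: "projection_valued_measure H E" and A: "spectral_integral H E (\<lambda>x. x) = diag l"
    and u: "u \<in> H" and S: "S \<in> sets borel"
  shows "E S u = spectral_proj l S u"
proof -
  interpret pvm H E using subspace_H E by unfold_locales
  show ?thesis
  proof (rule coeff_eqI)
    fix j
    have "(e j, l j *\<^sub>R e j) \<in> diag l"
      using e_H subspace_scale[OF subspace_H] by (auto simp: diag_def orthonormal)
    then have "E S (e j) = (if l j \<in> S then e j else 0)"
      using A S by (intro eigenvector_E) auto
    then show "inner (E S u) (e j) = inner (spectral_proj l S u) (e j)"
      using E_sym[OF S u e_H[of j]] by (simp add: spectral_proj_coeff u)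
  qed (auto simp: E_H S u spectral_proj_H)
qed

text \<open>The measure \<open>spectral_proj l\<close> supplies one inclusion; for the other, any
  representing measure agrees with it on \<open>H\<close>, hence so do its domains and
  integrals.\<close>

lemma functional_calculus_diag:
  assumes f: "f \<in> borel_measurable borel"
  shows "functional_calculus H (diag l) f = diag (\<lambda>j. f (l j))"
proof -
  have "spectral_integral H E f = diag (\<lambda>j. f (l j))"
    if E: "projection_valued_measure H E" and A: "spectral_integral H E (\<lambda>x. x) = diag l" for E
  proof -
    have sm: "scalar_measure E u = scalar_measure (spectral_proj l) u" if "u \<in> H" for u
      unfolding scalar_measure_def by (rule measure_of_eq) (auto simp: pvm_eq_spectral_proj[OF E A that] sets.sigma_sets_eq[of "borel :: real measure", simplified])
    then have dom: "spectral_domain H E f = spectral_domain H (spectral_proj l) f"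
      by (auto simp: spectral_domain_def)
    have pm: "u + w \<in> H" "u - w \<in> H" if "u \<in> spectral_domain H (spectral_proj l) f" "w \<in> spectral_domain H (spectral_proj l) f" for u w
      using that subspace_H by (auto simp: spectral_domain_def subspace_add subspace_diff)
    have "spectral_integral H E f = spectral_integral H (spectral_proj l) f"
      unfolding spectral_integral_def dom using pm sm by auto
    then show ?thesis by (simp add: spectral_integral_spectral_proj f)
  qed
  moreover have "spectral_integral H (spectral_proj l) (\<lambda>x. x) = diag l"
    by (simp add: spectral_integral_spectral_proj)
  ultimately show ?thesis
    using projection_valued_measure_spectral_proj unfolding functional_calculus_def by fastforce
qed

end

section \<open>Coercive forms with compact sublevel sets\<close>

text \<open>\<open>compact_sublevel\<close> carries two facts: closedness of the form, because
  compact sets are closed, and compactness of the resolvent. \<open>D_total\<close> says that the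
  form domain is dense in \<open>H\<close>, and \<open>D_infinite\<close> that the construction of
  eigenvectors never stops.\<close>

locale compact_form =
  fixes H D :: "'h::{real_inner,banach} set" and a :: "'h \<Rightarrow> 'h \<Rightarrow> real"
  assumes subspace_H: "subspace H" and closed_H: "closed H"
    and subspace_D: "subspace D" and D_H: "D \<subseteq> H"
    and a_add: "u \<in> D \<Longrightarrow> v \<in> D \<Longrightarrow> w \<in> D \<Longrightarrow> a (u + v) w = a u w + a v w"
    and a_scale: "u \<in> D \<Longrightarrow> w \<in> D \<Longrightarrow> a (c *\<^sub>R u) w = c * a u w"
    and a_sym: "u \<in> D \<Longrightarrow> v \<in> D \<Longrightarrow> a u v = a v u"
    and coercive: "u \<in> D \<Longrightarrow> inner u u \<le> a u u"
    and compact_sublevel: "compact {u \<in> D. a u u \<le> C}"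
    and D_total: "f \<in> H \<Longrightarrow> (\<And>d. d \<in> D \<Longrightarrow> inner f d = 0) \<Longrightarrow> f = 0"
    and D_infinite: "finite F \<Longrightarrow> \<not> D \<subseteq> span F"
begin

lemmas D_closure = subspace_0[OF subspace_D] subspace_add[OF subspace_D] subspace_diff[OF subspace_D]
  subspace_scale[OF subspace_D]

lemma a_add2: "u \<in> D \<Longrightarrow> v \<in> D \<Longrightarrow> w \<in> D \<Longrightarrow> a w (u + v) = a w u + a w v"
  by (simp add: a_sym[of w] a_add D_closure)

lemma a_scale2: "u \<in> D \<Longrightarrow> w \<in> D \<Longrightarrow> a w (c *\<^sub>R u) = c * a w u"
  by (simp add: a_sym[of w] a_scale D_closure)

lemma a_diff: "u \<in> D \<Longrightarrow> v \<in> D \<Longrightarrow> w \<in> D \<Longrightarrow> a (u - v) w = a u w - a v w"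
  using a_add[of u "- 1 *\<^sub>R v" w] a_scale[of v w "-1"] D_closure(4)[of v "-1"] by simp

lemma a_diff2: "u \<in> D \<Longrightarrow> v \<in> D \<Longrightarrow> w \<in> D \<Longrightarrow> a w (u - v) = a w u - a w v"
  by (simp add: a_sym[of w] a_diff D_closure)

lemma a_0: "w \<in> D \<Longrightarrow> a 0 w = 0"
  using a_scale[of 0 w 0] D_closure(1) by simp

lemma a_nonneg: "u \<in> D \<Longrightarrow> 0 \<le> a u u"
  using coercive[of u] inner_ge_zero[of u] by linarith

lemma D_sum: "(\<And>j. j \<in> I \<Longrightarrow> f j \<in> D) \<Longrightarrow> sum f I \<in> D"
  by (rule subspace_sum[OF subspace_D])

lemma a_sum: "finite I \<Longrightarrow> (\<And>j. j \<in> I \<Longrightarrow> f j \<in> D) \<Longrightarrow> w \<in> D \<Longrightarrow> a (sum f I) w = (\<Sum>j\<in>I. a (f j) w)"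
proof (induction I rule: finite_induct)
  case (insert i I)
  then show ?case using a_add[of "f i" "sum f I" w] D_sum[of I f] by simp
qed (simp add: a_0)

lemma a_square:
  assumes "u \<in> D" "v \<in> D"
  shows "a (u + t *\<^sub>R v) (u + t *\<^sub>R v) = a u u + 2 * t * a u v + t\<^sup>2 * a v v"
  using assms by (simp add: a_add a_add2 a_scale a_scale2 a_sym[of v u] D_closure power2_eq_square algebra_simps)

lemma a_Cauchy_Schwarz:
  assumes uv: "u \<in> D" "v \<in> D"
  shows "(a u v)\<^sup>2 \<le> a u u * a v v"
proof (cases "a v v = 0")
  case True
  then have "inner v v = 0" using coercive[OF uv(2)] inner_ge_zero[of v] by linarith
  then have "v = 0" by simp
  then show ?thesis using a_0[OF uv(1)] a_sym[OF uv] a_0[OF uv(2)] by simp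
next
  case False
  then have p: "a v v > 0" using a_nonneg[OF uv(2)] by simp
  have "0 \<le> a (u + (- a u v / a v v) *\<^sub>R v) (u + (- a u v / a v v) *\<^sub>R v)"
    using uv by (intro a_nonneg D_closure)
  also have "\<dots> = a u u - (a u v)\<^sup>2 / a v v"
    unfolding a_square[OF uv] using p by (simp add: power2_eq_square field_simps)
  finally show ?thesis using p by (simp add: field_simps)
qed

lemma closed_sublevel: "closed {u \<in> D. a u u \<le> C}"
  by (rule compact_imp_closed[OF compact_sublevel])

lemma sublevel_limit:
  assumes "X \<longlonglongrightarrow> u" and "\<And>n. n \<ge> M \<Longrightarrow> X n \<in> D" "\<And>n. n \<ge> M \<Longrightarrow> a (X n) (X n) \<le> C"
  shows "u \<in> D" "a u u \<le> C"
proof -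
  have "u \<in> {u \<in> D. a u u \<le> C}"
    using closed_sublevel
  proof (rule closed_sequentially)
    show "(\<lambda>n. X (n + M)) \<longlonglongrightarrow> u" using assms(1) by (rule LIMSEQ_ignore_initial_segment)
  qed (use assms in auto)
  then show "u \<in> D" "a u u \<le> C" by auto
qed

text \<open>Minimisation of the Rayleigh quotient on the orthogonal complement of
  \<open>e 0, ..., e (n - 1)\<close>. A minimising sequence lies in one compact sublevel set;
  normalisation and orthogonality survive in the limit by continuity of the inner product, and the
  value of the form by closedness of all sublevel sets.\<close>

lemma minimizer_exists:
  fixes n :: nat
  assumes e: "\<And>i. i < n \<Longrightarrow> e i \<in> D"
    and on: "\<And>i j. i < n \<Longrightarrow> j < n \<Longrightarrow> inner (e i) (e j) = (if i = j then 1 else 0)"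
  obtains u where "u \<in> D" "inner u u = 1" "\<And>i. i < n \<Longrightarrow> inner u (e i) = 0"
    "\<And>w. w \<in> D \<Longrightarrow> (\<And>i. i < n \<Longrightarrow> inner w (e i) = 0) \<Longrightarrow> a u u * inner w w \<le> a w w"
proof -
  define V where "V = {w \<in> D. (\<forall>i<n. inner w (e i) = 0) \<and> inner w w = 1}"
  have unit: "(1 / norm w) *\<^sub>R w \<in> V" if "w \<in> D" "w \<noteq> 0" "\<And>i. i < n \<Longrightarrow> inner w (e i) = 0" for w
    using that by (auto simp: V_def D_closure dot_square_norm power2_eq_square)
  have "V \<noteq> {}"
  proof -
    have "\<not> D \<subseteq> span (e ` {..<n})" by (intro D_infinite finite_imageI finite_lessThan)
    then obtain d where d: "d \<in> D" "d \<notin> span (e ` {..<n})" by blast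
    define w where "w = d - (\<Sum>i<n. inner d (e i) *\<^sub>R e i)"
    have "(\<Sum>i<n. inner d (e i) *\<^sub>R e i) \<in> span (e ` {..<n})"
      by (intro span_sum span_scale span_base) auto
    then have "w \<noteq> 0" using d by (auto simp: w_def)
    moreover have "w \<in> D" using d e by (auto simp: w_def intro!: D_closure D_sum)
    moreover have "inner w (e k) = 0" if "k < n" for k
    proof -
      have "(\<Sum>i<n. inner d (e i) * inner (e i) (e k)) = (\<Sum>i<n. if i = k then inner d (e i) else 0)"
        using that by (intro sum.cong) (auto simp: on)
      then show ?thesis using that by (simp add: w_def inner_diff_left inner_sum_left)
    qed
    ultimately show ?thesis using unit by blast
  qed
  define m where "m = (INF w\<in>V. a w w)"
  have bdd: "bdd_below ((\<lambda>w. a w w) ` V)"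
    using a_nonneg by (intro bdd_belowI[of _ 0]) (auto simp: V_def)
  have "\<exists>w\<in>V. a w w < m + 1 / real (Suc k)" for k
    using cInf_lessD[of "(\<lambda>w. a w w) ` V" "m + 1 / real (Suc k)"] \<open>V \<noteq> {}\<close> by (auto simp: m_def)
  then obtain x where x: "\<And>k. x k \<in> V" "\<And>k. a (x k) (x k) < m + 1 / real (Suc k)" by metis
  have "x k \<in> {u \<in> D. a u u \<le> m + 1}" for k
  proof -
    have "1 / real (Suc k) \<le> 1" by simp
    then show ?thesis using x[of k] unfolding V_def by (simp, linarith)
  qed
  then obtain u r where u: "strict_mono r" "(x \<circ> r) \<longlonglongrightarrow> u" and uD: "u \<in> D"
    using compact_sublevel[of "m + 1"] unfolding compact_eq_seq_compact_metric seq_compact_def by blast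
  have "a u u \<le> m + 1 / real (Suc k)" for k
  proof (rule sublevel_limit(2)[OF u(2)])
    fix i assume "k \<le> i"
    then have "k \<le> r i" using seq_suble[OF u(1), of i] by linarith
    then have "1 / real (Suc (r i)) \<le> 1 / real (Suc k)" by (intro frac_le) auto
    then show "a ((x \<circ> r) i) ((x \<circ> r) i) \<le> m + 1 / real (Suc k)"
      using x(2)[of "r i"] by simp
    show "(x \<circ> r) i \<in> D" using x(1) by (simp add: V_def)
  qed
  then have "a u u \<le> m + \<epsilon>" if "\<epsilon> > 0" for \<epsilon>
    using that nat_approx_posE by (metis add_left_mono le_less_trans less_eq_real_def)
  then have le: "a u u \<le> m" by (rule field_le_epsilon)
  have o: "inner u (e i) = 0" if "i < n" for i
  proof -
    have "(\<lambda>k. inner ((x \<circ> r) k) (e i)) \<longlonglongrightarrow> inner u (e i)"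
      by (intro tendsto_inner u tendsto_const)
    moreover have "(\<lambda>k. inner ((x \<circ> r) k) (e i)) = (\<lambda>k. 0)" using x(1) that by (auto simp: V_def)
    ultimately show ?thesis by (simp add: LIMSEQ_const_iff)
  qed
  have "(\<lambda>k. inner ((x \<circ> r) k) ((x \<circ> r) k)) \<longlonglongrightarrow> inner u u"
    by (intro tendsto_inner u)
  moreover have "(\<lambda>k. inner ((x \<circ> r) k) ((x \<circ> r) k)) = (\<lambda>k. 1)" using x(1) by (auto simp: V_def)
  ultimately have one: "inner u u = 1" by (simp add: LIMSEQ_const_iff)
  show ?thesis
  proof (rule that[OF uD one o])
    fix w assume w: "w \<in> D" "\<And>i. i < n \<Longrightarrow> inner w (e i) = 0"
    show "a u u * inner w w \<le> a w w"
    proof (cases "w = 0")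
      case True
      then show ?thesis using a_0[of 0] D_closure by simp
    next
      case False
      have "a u u \<le> a ((1 / norm w) *\<^sub>R w) ((1 / norm w) *\<^sub>R w)"
        using le cINF_lower[OF bdd unit[OF w(1) False w(2)]] by (simp add: m_def)
      also have "\<dots> = a w w / inner w w"
        using w(1) by (simp add: a_scale a_scale2 D_closure dot_square_norm power2_eq_square)
      finally show ?thesis using False by (simp add: field_simps)
    qed
  qed
qed

lemma minimizer_eigenvector:
  assumes u: "u \<in> D" "inner u u = 1" and w: "w \<in> D"
    and min: "\<And>t. a u u * inner (u + t *\<^sub>R w) (u + t *\<^sub>R w) \<le> a (u + t *\<^sub>R w) (u + t *\<^sub>R w)"
  shows "a u w = a u u * inner u w"
proof (rule ccontr)
  define b where "b = a u w - a u u * inner u w"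
  define c where "c = a w w - a u u * inner w w"
  assume "a u w \<noteq> a u u * inner u w"
  then have b: "b \<noteq> 0" by (simp add: b_def)
  have q: "0 \<le> 2 * t * b + t\<^sup>2 * c" for t
    using min[of t] u(2) unfolding a_square[OF u(1) w]
    by (simp add: b_def c_def inner_add_left inner_add_right inner_commute[of w u] power2_eq_square algebra_simps)
  \<comment> \<open>With \<open>\<bar>c\<bar> + 1\<close> in the denominator the linear term
    outweighs the quadratic one whatever the sign of \<open>c\<close>, even for
    \<open>c = 0\<close>.\<close>
  define t where "t = - b / (\<bar>c\<bar> + 1)"
  have "t\<^sup>2 * c \<le> t\<^sup>2 * (\<bar>c\<bar> + 1)" by (intro mult_left_mono) auto
  also have "\<dots> = b\<^sup>2 / (\<bar>c\<bar> + 1)" by (simp add: t_def power2_eq_square)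
  finally have "0 \<le> 2 * t * b + b\<^sup>2 / (\<bar>c\<bar> + 1)" using q[of t] by linarith
  moreover have "2 * t * b = - 2 * (b\<^sup>2 / (\<bar>c\<bar> + 1))" by (simp add: t_def power2_eq_square)
  ultimately have "b\<^sup>2 / (\<bar>c\<bar> + 1) \<le> 0" by linarith
  moreover have "b\<^sup>2 / (\<bar>c\<bar> + 1) > 0" using b by (intro divide_pos_pos) (auto simp: abs_add_one_gt_zero add.commute)
  ultimately show False by simp
qed

end

text \<open>The eigenvalue equation is stated weakly, so that it makes sense before the operator is
  known to be \<open>diag l\<close>. No order of \<open>l\<close> is prescribed, so permuting a
  basis stays within the locale.\<close>

locale compact_form_basis = compact_form H D a
  for H D :: "'h::{real_inner,banach} set" and a +
  fixes e :: "nat \<Rightarrow> 'h" and l :: "nat \<Rightarrow> real"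
  assumes e_D: "e j \<in> D"
    and e_orthonormal: "inner (e i) (e j) = (if i = j then 1 else 0)"
    and eigen: "v \<in> D \<Longrightarrow> a (e j) v = l j * inner (e j) v"
    and e_total: "f \<in> H \<Longrightarrow> (\<And>j. inner f (e j) = 0) \<Longrightarrow> f = 0"
    and l_finite: "finite {j. l j \<le> C}"
begin

sublocale hilbert_basis H e
  using subspace_H closed_H e_D D_H e_orthonormal e_total by unfold_locales auto

lemma l_ge_1: "1 \<le> l j"
  using coercive[OF e_D[of j]] eigen[OF e_D[of j], of j] by (simp add: e_orthonormal)

lemma a_combination:
  assumes "finite I" "v \<in> D"
  shows "a (\<Sum>j\<in>I. c j *\<^sub>R e j) v = (\<Sum>j\<in>I. l j * c j * inner (e j) v)"
  using assms by (simp add: a_sum D_closure e_D a_scale eigen mult_ac)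

lemma a_combination_self:
  assumes "finite I"
  shows "a (\<Sum>j\<in>I. c j *\<^sub>R e j) (\<Sum>j\<in>I. c j *\<^sub>R e j) = (\<Sum>j\<in>I. l j * (c j)\<^sup>2)"
proof -
  have "inner (e j) (\<Sum>i\<in>I. c i *\<^sub>R e i) = c j" if "j \<in> I" for j
  proof -
    have "(\<Sum>i\<in>I. c i * inner (e j) (e i)) = (\<Sum>i\<in>I. if i = j then c i else 0)"
      by (intro sum.cong) (auto simp: e_orthonormal)
    then show ?thesis using that assms by (simp add: inner_sum_right)
  qed
  then show ?thesis
    using assms by (subst a_combination) (auto intro!: D_sum D_closure e_D sum.cong simp: power2_eq_square)
qed

text \<open>The \<open>e j\<close> are orthogonal for the form as well, so the \<open>L^2\<close>
  projection \<open>p\<close> of \<open>f\<close> is also its projection with respect to the form,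
  and the form of the remainder \<open>f - p\<close> is nonnegative.\<close>

lemma a_bessel:
  assumes f: "f \<in> D"
  shows "(\<Sum>j<n. l j * (inner f (e j))\<^sup>2) \<le> a f f"
proof -
  define p where "p = (\<Sum>j<n. inner f (e j) *\<^sub>R e j)"
  have p: "p \<in> D" by (auto simp: p_def intro!: D_sum D_closure e_D)
  have "a p f = (\<Sum>j<n. l j * (inner f (e j))\<^sup>2)"
    unfolding p_def by (subst a_combination) (auto simp: f inner_commute power2_eq_square mult_ac)
  moreover have "a p p = (\<Sum>j<n. l j * (inner f (e j))\<^sup>2)"
    unfolding p_def by (simp add: a_combination_self)
  moreover have "0 \<le> a (f - p) (f - p)" using f p by (intro a_nonneg D_closure)
  ultimately show ?thesis using f p by (simp add: a_diff a_diff2 a_sym[of f p] D_closure)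
qed

lemma variational_bound:
  assumes f: "f \<in> D" and "0 \<le> x"
  shows "x * inner f f - a f f \<le> (\<Sum>j\<in>{j. l j \<le> x}. (x - l j) * (inner f (e j))\<^sup>2)" (is "_ \<le> ?S")
proof -
  have "x * inner f f - a f f \<le> ?S + x * (inner f f - (\<Sum>j<n. inner f (e j) * inner f (e j)))" for n
  proof -
    have "(\<Sum>j<n. (x - l j) * (inner f (e j))\<^sup>2) \<le> (\<Sum>j\<in>{..<n} \<inter> {j. l j \<le> x}. (x - l j) * (inner f (e j))\<^sup>2)"
      by (subst sum.inter_restrict) (auto intro!: sum_mono mult_nonpos_nonneg)
    also have "\<dots> \<le> ?S" by (intro sum_mono2 l_finite) auto
    finally have "(\<Sum>j<n. (x - l j) * (inner f (e j))\<^sup>2) \<le> ?S" .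
    moreover have "(\<Sum>j<n. (x - l j) * (inner f (e j))\<^sup>2) =
        x * (\<Sum>j<n. inner f (e j) * inner f (e j)) - (\<Sum>j<n. l j * (inner f (e j))\<^sup>2)"
      by (simp add: left_diff_distrib sum_subtractf sum_distrib_left power2_eq_square)
    ultimately show ?thesis using a_bessel[OF f, of n] by (simp add: right_diff_distrib)
  qed
  moreover have "(\<lambda>n. ?S + x * (inner f f - (\<Sum>j<n. inner f (e j) * inner f (e j)))) \<longlonglongrightarrow> ?S + x * (inner f f - inner f f)"
    using parseval[of f f] f D_H by (intro tendsto_intros) (auto simp: sums_def)
  ultimately have "x * inner f f - a f f \<le> ?S + x * (inner f f - inner f f)"
    by (intro LIMSEQ_le_const) auto
  then show ?thesis by simp
qed

text \<open>The substantial inclusion has to show that \<open>u\<close> lies in the form domain,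
  knowing only that the \<open>l j * inner u (e j)\<close> are coefficients of a vector. Then the
  series of \<open>l j * (inner u (e j))\<^sup>2\<close> converges, so the partial sums of the
  expansion are Cauchy for the form.\<close>

lemma form_operator_eq_diag: "form_operator H D a = diag l"
proof (intro equalityI subrelI)
  fix u f assume uf: "(u, f) \<in> form_operator H D a"
  then have "inner f (e j) = l j * inner u (e j)" for j
    using e_D[of j] a_sym[of u "e j"] eigen[of u j] by (auto simp: form_operator_def inner_commute)
  then show "(u, f) \<in> diag l" using uf D_H by (auto simp: form_operator_def diag_def)
next
  fix u f assume "(u, f) \<in> diag l"
  then have u: "u \<in> H" and f: "f \<in> H" and uf: "\<And>j. inner f (e j) = l j * inner u (e j)" by (auto simp: diag_def)
  define p where "p n = (\<Sum>j<n. inner u (e j) *\<^sub>R e j)" for n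
  have pD: "p n \<in> D" for n by (auto simp: p_def intro!: D_sum D_closure e_D)
  have pu: "p \<longlonglongrightarrow> u" using expansion[OF u] by (simp add: sums_def p_def[abs_def])
  have app: "a (p n - p m) (p n - p m) = (\<Sum>j=m..<n. l j * (inner u (e j))\<^sup>2)" if "m \<le> n" for m n
  proof -
    have "p n - p m = (\<Sum>j=m..<n. inner u (e j) *\<^sub>R e j)"
      using that sum_diff_nat_ivl[of 0 m n "\<lambda>j. inner u (e j) *\<^sub>R e j"] by (simp add: p_def atLeast0LessThan)
    then show ?thesis by (simp add: a_combination_self)
  qed
  have sm: "summable (\<lambda>j. l j * (inner u (e j))\<^sup>2)"
    using parseval[OF f, of u] by (auto simp: uf summable_def power2_eq_square mult.assoc)
  \<comment> \<open>Closed sublevel sets take the place of completeness of \<open>D\<close> in the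
    form norm: with \<open>m\<close> fixed, the bound on \<open>p n - p m\<close> persists in the
    limit in \<open>n\<close>.\<close>
  have tail: "\<exists>M. \<forall>m\<ge>M. u \<in> D \<and> a (u - p m) (u - p m) \<le> \<epsilon>" if eps: "\<epsilon> > 0" for \<epsilon>
  proof -
    obtain M where M: "\<forall>m\<ge>M. \<forall>n. norm (\<Sum>j=m..<n. l j * (inner u (e j))\<^sup>2) < \<epsilon>"
      using sm[unfolded summable_Cauchy, rule_format, OF eps] ..
    have "u - p m \<in> D \<and> a (u - p m) (u - p m) \<le> \<epsilon>" if m: "m \<ge> M" for m
    proof -
      have lim: "(\<lambda>n. p n - p m) \<longlonglongrightarrow> u - p m" by (intro tendsto_intros pu)
      have le: "a (p n - p m) (p n - p m) \<le> \<epsilon>" if "n \<ge> m" for n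
        using M[rule_format, OF m, of n] by (simp add: app that)
      show ?thesis using sublevel_limit[OF lim _ le] pD by (auto intro: D_closure)
    qed
    moreover have "u \<in> D" if "u - p m \<in> D" for m
      using D_closure(2)[OF that pD[of m]] by simp
    ultimately show ?thesis by blast
  qed
  have uD: "u \<in> D" using tail[of 1] by auto
  have "a u v = inner f v" if v: "v \<in> D" for v
  proof -
    have "(\<lambda>n. a (p n) v) \<longlonglongrightarrow> inner f v"
    proof -
      have "a (p n) v = (\<Sum>j<n. inner f (e j) * inner v (e j))" for n
        unfolding p_def by (subst a_combination) (auto simp: v uf inner_commute)
      then show ?thesis using parseval[OF f, of v] by (simp add: sums_def)
    qed
    moreover have "(\<lambda>n. a (p n) v) \<longlonglongrightarrow> a u v"
    proof (rule LIMSEQ_I)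
      fix r :: real assume r: "r > 0"
      define \<epsilon> where "\<epsilon> = r\<^sup>2 / (a v v + 1)"
      have avv: "0 \<le> a v v" by (rule a_nonneg[OF v])
      have "\<epsilon> > 0" using r avv by (simp add: \<epsilon>_def)
      then obtain M where M: "\<And>m. m \<ge> M \<Longrightarrow> a (u - p m) (u - p m) \<le> \<epsilon>" using tail by blast
      have "norm (a (p n) v - a u v) < r" if "n \<ge> M" for n
      proof -
        have "(a (p n) v - a u v)\<^sup>2 = (a (u - p n) v)\<^sup>2"
          using uD pD v by (simp add: a_diff power2_commute)
        also have "\<dots> \<le> a (u - p n) (u - p n) * a v v"
          by (intro a_Cauchy_Schwarz D_closure uD pD v)
        also have "\<dots> \<le> \<epsilon> * a v v" using M[OF that] avv by (intro mult_right_mono)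
        also have "\<dots> < \<epsilon> * (a v v + 1)" using \<open>\<epsilon> > 0\<close> by simp
        also have "\<dots> = r\<^sup>2" using avv by (simp add: \<epsilon>_def)
        finally have "\<bar>a (p n) v - a u v\<bar>\<^sup>2 < r\<^sup>2" by simp
        then show ?thesis using r by (simp only: real_norm_def) (rule power2_less_imp_less, simp_all)
      qed
      then show "\<exists>M. \<forall>n\<ge>M. norm (a (p n) v - a u v) < r" by blast
    qed
    ultimately show ?thesis by (rule LIMSEQ_unique[symmetric])
  qed
  then show "(u, f) \<in> form_operator H D a" using uD f by (auto simp: form_operator_def)
qed

end

section \<open>Construction of an eigenbasis\<close>

context compact_form
begin

text \<open>Each choice refers to all earlier vectors, so it is made by well-founded recursion. The
  eigenvalue equation is part of the invariant because a new minimiser must also be orthogonal to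
  the old vectors with respect to the form.\<close>

lemma eigenbasis_exists:
  obtains e l where "compact_form_basis H D a e l" "mono l"
proof -
  let ?Q = "\<lambda>e (n::nat) r. r \<in> D \<and> inner r r = 1 \<and> (\<forall>i<n. inner r (e i) = 0) \<and>
     (\<forall>w\<in>D. a r w = a r r * inner r w) \<and>
     (\<forall>w\<in>D. (\<forall>i<n. inner w (e i) = 0) \<longrightarrow> a r r * inner w w \<le> a w w)"
  have ex: "\<exists>e. \<forall>n::nat. ?Q e n (e n)"
  proof (rule dependent_wellorder_choice)
    fix n :: nat and e assume IH: "\<And>i. i < n \<Longrightarrow> ?Q e i (e i)"
    have IH1: "e i \<in> D" and IH2: "inner (e i) (e i) = 1" and IH3: "k < i \<Longrightarrow> inner (e i) (e k) = 0"
      and IH4: "w \<in> D \<Longrightarrow> a (e i) w = a (e i) (e i) * inner (e i) w" if "i < n" for i k w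
      using IH[OF that] by blast+
    have on: "inner (e i) (e j) = (if i = j then 1 else 0)" if "i < n" "j < n" for i j
      using IH2[OF that(1)] IH3[OF that(1), of j] IH3[OF that(2), of i]
      by (cases i j rule: linorder_cases) (auto simp: inner_commute)
    obtain u where u: "u \<in> D" "inner u u = 1" "\<And>i. i < n \<Longrightarrow> inner u (e i) = 0"
        "\<And>w. w \<in> D \<Longrightarrow> (\<And>i. i < n \<Longrightarrow> inner w (e i) = 0) \<Longrightarrow> a u u * inner w w \<le> a w w"
      using minimizer_exists[of n e] IH1 on by blast
    \<comment> \<open>Minimality tests only directions orthogonal to the earlier vectors. Along
      their span both sides vanish: \<open>u\<close> is orthogonal to them, and they are
      eigenvectors.\<close>
    have eig: "a u v = a u u * inner u v" if v: "v \<in> D" for v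
    proof -
      define q where "q = (\<Sum>i<n. inner v (e i) *\<^sub>R e i)"
      have q: "q \<in> D" unfolding q_def by (intro D_sum D_closure IH1) auto
      have "inner (v - q) (e k) = 0" if "k < n" for k
      proof -
        have "(\<Sum>i<n. inner v (e i) * inner (e i) (e k)) = (\<Sum>i<n. if i = k then inner v (e i) else 0)"
          using that by (intro sum.cong) (auto simp: on)
        then show ?thesis using that by (simp add: q_def inner_diff_left inner_sum_left)
      qed
      then have "a u (v - q) = a u u * inner u (v - q)"
        using u v q by (intro minimizer_eigenvector u(4)) (auto simp: inner_add_left D_closure)
      moreover have "a q u = 0"
      proof -
        have "a (e i) u = 0" if "i < n" for i
          using IH4[OF that u(1)] u(3)[OF that] by (simp add: inner_commute)
        then show ?thesis
          unfolding q_def using IH1 u(1) by (subst a_sum) (auto simp: D_closure a_scale)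
      qed
      moreover have "inner u q = 0" by (simp add: q_def inner_sum_right u)
      ultimately show ?thesis using u(1) v q by (simp add: a_diff2 inner_diff_right a_sym[of u q])
    qed
    show "\<exists>r. ?Q e n r"
    proof (rule exI[of _ u], intro conjI ballI allI impI)
      show "a u w = a u u * inner u w" if "w \<in> D" for w by (rule eig[OF that])
      show "a u u * inner w w \<le> a w w" if w: "w \<in> D" "\<forall>i<n. inner w (e i) = 0" for w
        by (rule u(4)[OF w(1) w(2)[rule_format]])
    qed (fact u(1), fact u(2), rule u(3))
  qed simp
  from ex obtain e where e: "\<forall>n. ?Q e n (e n)" ..
  note e1 = spec[OF e, THEN conjunct1]
    and e2 = spec[OF e, THEN conjunct2, THEN conjunct1]
    and e3 = spec[OF e, THEN conjunct2, THEN conjunct2, THEN conjunct1, rule_format]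
    and e4 = spec[OF e, THEN conjunct2, THEN conjunct2, THEN conjunct2, THEN conjunct1, THEN bspec]
    and e5 = spec[OF e, THEN conjunct2, THEN conjunct2, THEN conjunct2, THEN conjunct2, THEN bspec, THEN mp]
  define l where "l j = a (e j) (e j)" for j
  have eD: "e j \<in> D" for j by (rule e1)
  have on: "inner (e i) (e j) = (if i = j then 1 else 0)" for i j
  proof -
    show ?thesis
      using e2[of i] e3[of i j] e3[of j i] by (cases i j rule: linorder_cases) (auto simp: inner_commute)
  qed
  have eig: "a (e j) v = l j * inner (e j) v" if "v \<in> D" for j v
    unfolding l_def by (rule e4[OF that])
  have low: "l n * inner w w \<le> a w w" if "w \<in> D" "\<And>i. i < n \<Longrightarrow> inner w (e i) = 0" for n w
    unfolding l_def by (rule e5[OF that(1)]) (simp add: that(2))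
  have mono: "mono l"
  proof (rule monoI)
    fix m n :: nat assume "m \<le> n"
    then have "l m * inner (e n) (e n) \<le> a (e n) (e n)" by (intro low) (auto simp: eD on)
    then show "l m \<le> l n" by (simp add: on l_def[of n])
  qed
  \<comment> \<open>Otherwise the whole orthonormal sequence lies in one compact sublevel set,
    although its members are at mutual distance \<open>sqrt 2\<close>.\<close>
  have unb: "\<exists>n. C < l n" for C
  proof (rule ccontr)
    assume "\<not> (\<exists>n. C < l n)"
    then have "e k \<in> {u \<in> D. a u u \<le> C}" for k
      using eD by (auto simp: l_def not_less)
    then obtain u r where u: "strict_mono r" "(e \<circ> r) \<longlonglongrightarrow> u"
      using compact_sublevel[of C] unfolding compact_eq_seq_compact_metric seq_compact_def by blast
    then have "Cauchy (e \<circ> r)" by (intro LIMSEQ_imp_Cauchy)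
    then obtain M where M: "\<And>m n. m \<ge> M \<Longrightarrow> n \<ge> M \<Longrightarrow> norm ((e \<circ> r) m - (e \<circ> r) n) < 1"
      unfolding Cauchy_iff using zero_less_one by blast
    have "r M \<noteq> r (Suc M)" using u(1) by (simp add: strict_mono_eq)
    then have "(norm (e (r M) - e (r (Suc M))))\<^sup>2 = 2"
      by (simp add: power2_norm_eq_inner inner_diff_left inner_diff_right on)
    moreover have "(norm (e (r M) - e (r (Suc M))))\<^sup>2 < 1"
      using M[of M "Suc M"] by (simp add: power_less_one_iff)
    ultimately show False by simp
  qed
  have fin: "finite {j. l j \<le> C}" for C
  proof -
    obtain n where "C < l n" using unb by blast
    then have "{j. l j \<le> C} \<subseteq> {..<n}" using monoD[OF mono] by (force simp: not_less[symmetric])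
    then show ?thesis by (rule finite_subset) simp
  qed
  have tot: "f = 0" if f: "f \<in> H" and z: "\<And>j. inner f (e j) = 0" for f
  proof (rule D_total[OF f])
    fix d assume d: "d \<in> D"
    define B where "B = inner f f * a d d"
    \<comment> \<open>The remainder \<open>d - q\<close> is orthogonal to the first \<open>n\<close>
      vectors, so its squared norm times \<open>l n\<close> is at most \<open>a d d\<close>. As
      \<open>f\<close> is orthogonal to \<open>q\<close>, it sees only this remainder, and
      unboundedness of \<open>l\<close> then forces \<open>inner f d = 0\<close>.\<close>
    have B: "(inner f d)\<^sup>2 * l n \<le> B" for n
    proof -
      define q where "q = (\<Sum>i<n. inner d (e i) *\<^sub>R e i)"
      have q: "q \<in> D" unfolding q_def by (intro D_sum D_closure eD)
      have c: "inner (d - q) (e k) = 0" if "k < n" for k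
      proof -
        have "(\<Sum>i<n. inner d (e i) * inner (e i) (e k)) = (\<Sum>i<n. if i = k then inner d (e i) else 0)"
          using that by (intro sum.cong) (auto simp: on)
        then show ?thesis using that by (simp add: q_def inner_diff_left inner_sum_left)
      qed
      have "a q (d - q) = 0"
      proof -
        have "a (e i) (d - q) = 0" if "i < n" for i
          using eig[of "d - q" i] c[OF that] d q by (simp add: D_closure inner_commute)
        moreover have "a q (d - q) = (\<Sum>i<n. a (inner d (e i) *\<^sub>R e i) (d - q))"
          using d q by (subst (1) q_def, subst a_sum) (auto simp: D_closure eD)
        ultimately show ?thesis using d q by (simp add: a_scale D_closure eD)
      qed
      then have "a d d = a (d - q) (d - q) + a q q"
        using d q by (simp add: a_diff a_diff2 D_closure a_sym[of q d])
      then have le: "l n * inner (d - q) (d - q) \<le> a d d"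
        using low[of "d - q" n] c d q a_nonneg[OF q] by (auto simp: D_closure)
      have "inner f d = inner f (d - q)" by (simp add: q_def inner_diff_right inner_sum_right z)
      then have "(inner f d)\<^sup>2 \<le> inner f f * inner (d - q) (d - q)"
        using Cauchy_Schwarz_ineq[of f "d - q"] by simp
      then have "(inner f d)\<^sup>2 * l n \<le> inner f f * inner (d - q) (d - q) * l n"
        using a_nonneg[OF eD] by (intro mult_right_mono) (auto simp: l_def)
      also have "\<dots> \<le> B" using mult_left_mono[OF le inner_ge_zero[of f]] by (simp add: B_def mult_ac)
      finally show ?thesis .
    qed
    show "inner f d = 0"
    proof (rule ccontr)
      assume "inner f d \<noteq> 0"
      then have p: "(inner f d)\<^sup>2 > 0" by simp
      obtain n where "B / (inner f d)\<^sup>2 < l n" using unb by blast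
      then show False using B[of n] p by (simp add: field_simps)
    qed
  qed
  have "compact_form_basis H D a e l"
    using eD on eig tot fin by unfold_locales auto
  then show ?thesis using mono that by blast
qed

lemma eigenvalue_sequence_exists: "\<exists>\<Lambda>. eigenvalue_sequence (form_operator H D a) \<Lambda>"
proof -
  obtain e l where "compact_form_basis H D a e l" and mono: "mono l" by (rule eigenbasis_exists)
  then interpret compact_form_basis H D a e l by simp
  have "dimension_matches (eigenspace (form_operator H D a) \<mu>) {j. 1 \<le> j \<and> l (j - 1) = \<mu>}" for \<mu>
  proof -
    have "finite {j. l j = \<mu>}" by (rule finite_subset[OF _ l_finite[of \<mu>]]) auto
    then have "dimension_matches (eigenspace (diag l) \<mu>) {j. l j = \<mu>}" by (rule dimension_matches_diag)
    moreover have "{j. l j = \<mu>} \<approx> {j. 1 \<le> j \<and> l (j - 1) = \<mu>}"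
    proof -
      have "bij_betw Suc {j. l j = \<mu>} {j. 1 \<le> j \<and> l (j - 1) = \<mu>}"
        by (rule bij_betwI[where g = "\<lambda>j. j - 1"]) auto
      then show ?thesis unfolding eqpoll_def by blast
    qed
    ultimately show ?thesis
      unfolding dimension_matches_def form_operator_eq_diag by (meson eqpoll_trans)
  qed
  moreover have "mono_on {1..} (\<lambda>j. l (j - 1))"
    by (intro mono_onI monoD[OF mono] diff_le_mono)
  ultimately show ?thesis unfolding eigenvalue_sequence_def by blast
qed

text \<open>The level sets of \<open>\<Lambda>\<close> and of \<open>l\<close> have equal finite
  size, both being the dimension of the same eigenspace. Bijections between them glue to a
  permutation \<open>\<pi>\<close> of the basis, so the sequences are matched without comparing them
  term by term.\<close>

lemma eigenvalue_sequence_basis: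
  assumes \<Lambda>: "eigenvalue_sequence (form_operator H D a) \<Lambda>"
  obtains e where "compact_form_basis H D a e (\<lambda>j. \<Lambda> (Suc j))"
proof -
  obtain e l where "compact_form_basis H D a e l" and mono: "mono l" by (rule eigenbasis_exists)
  then interpret compact_form_basis H D a e l by simp
  define I J where "I \<mu> = {j. l j = \<mu>}" and "J \<mu> = {j. \<Lambda> (Suc j) = \<mu>}" for \<mu>
  have finI: "finite (I \<mu>)" for \<mu> unfolding I_def by (rule finite_subset[OF _ l_finite[of \<mu>]]) auto
  have "\<exists>h. bij_betw h (J \<mu>) (I \<mu>)" for \<mu>
  proof -
    have 1: "dimension_matches (eigenspace (diag l) \<mu>) (I \<mu>)"
      using finI[of \<mu>] unfolding I_def by (rule dimension_matches_diag)
    have 2: "dimension_matches (eigenspace (diag l) \<mu>) {j. 1 \<le> j \<and> \<Lambda> j = \<mu>}"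
      using \<Lambda> by (simp add: eigenvalue_sequence_def form_operator_eq_diag)
    have "bij_betw Suc (J \<mu>) {j. 1 \<le> j \<and> \<Lambda> j = \<mu>}"
      unfolding J_def by (rule bij_betwI[where g = "\<lambda>j. j - 1"]) auto
    moreover obtain g where "bij_betw g {j. 1 \<le> j \<and> \<Lambda> j = \<mu>} (I \<mu>)"
      using dimension_matches_finite[OF 1 2 finI] finI by (meson finite_same_card_bij)
    ultimately show ?thesis using bij_betw_trans by blast
  qed
  then obtain h where h: "\<And>\<mu>. bij_betw (h \<mu>) (J \<mu>) (I \<mu>)" by metis
  define \<pi> where "\<pi> j = h (\<Lambda> (Suc j)) j" for j
  have \<pi>I: "\<pi> j \<in> I (\<Lambda> (Suc j))" for j
    using bij_betwE[OF h[of "\<Lambda> (Suc j)"]] by (auto simp: \<pi>_def J_def)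
  then have l\<pi>: "l (\<pi> j) = \<Lambda> (Suc j)" for j by (auto simp: I_def)
  have inj: "inj \<pi>"
  proof (rule injI)
    fix i j assume ij: "\<pi> i = \<pi> j"
    then have "\<Lambda> (Suc i) = \<Lambda> (Suc j)" by (metis l\<pi>)
    then show "i = j"
      using ij bij_betw_imp_inj_on[OF h[of "\<Lambda> (Suc j)"]] by (auto simp: \<pi>_def J_def dest: inj_onD)
  qed
  have surj: "\<exists>j. \<pi> j = i" for i
  proof -
    have "i \<in> I (l i)" by (simp add: I_def)
    then obtain j where "j \<in> J (l i)" "h (l i) j = i"
      using bij_betw_imp_surj_on[OF h[of "l i"]] by (metis imageE)
    then show ?thesis by (auto simp: \<pi>_def J_def intro!: exI[of _ j])
  qed
  have "compact_form_basis H D a (e \<circ> \<pi>) (\<lambda>j. \<Lambda> (Suc j))"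
  proof (unfold_locales)
    show "inner ((e \<circ> \<pi>) i) ((e \<circ> \<pi>) j) = (if i = j then 1 else 0)" for i j
      using inj by (auto simp: e_orthonormal inj_eq)
    show "f = 0" if "f \<in> H" "\<And>j. inner f ((e \<circ> \<pi>) j) = 0" for f
      using that(2) surj by (intro e_total[OF that(1)]) (metis comp_apply)
    have "{j. \<Lambda> (Suc j) \<le> C} = \<pi> -` {j. l j \<le> C}" for C by (auto simp: l\<pi>)
    then show "finite {j. \<Lambda> (Suc j) \<le> C}" for C using finite_vimageI[OF l_finite inj] by simp
  qed (auto simp: e_D eigen l\<pi>)
  then show ?thesis by (rule that)
qed

end

section \<open>Gaussian integrals and the constant of the fractional Laplacian\<close>

text \<open>The characteristic function of the standard normal law, with the variable rescaled by
  \<open>c = sqrt (2 * r)\<close> so that the density becomes a multiple of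
  \<open>exp (- r * x\<^sup>2)\<close>.\<close>

lemma gaussian_fourier_real:
  fixes r t :: real
  assumes r: "r > 0"
  shows "integrable lborel (\<lambda>x. exp (- r * x\<^sup>2) *\<^sub>R iexp (t * x))"
    and "(\<integral>x. exp (- r * x\<^sup>2) *\<^sub>R iexp (t * x) \<partial>lborel) = complex_of_real (sqrt (pi / r) * exp (- t\<^sup>2 / (4 * r)))"
proof -
  define c where "c = sqrt (2 * r)"
  have c: "c > 0" "c\<^sup>2 = 2 * r" using r by (auto simp: c_def)
  have sn: "std_normal_density (0 + c * x) = exp (- r * x\<^sup>2) / sqrt (2 * pi)" for x
    using c by (simp add: std_normal_density_def power_mult_distrib)
  have "has_bochner_integral lborel (\<lambda>x. std_normal_density x *\<^sub>R iexp (t / c * x)) (complex_of_real (exp (- (t / c)\<^sup>2 / 2)))"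
  proof -
    have "integrable std_normal_distribution (\<lambda>x. iexp (t / c * x))"
    proof -
      interpret prob_space std_normal_distribution by (rule prob_space_normal_density) simp
      show ?thesis by (rule integrable_iexp) auto
    qed
    then have "integrable lborel (\<lambda>x. std_normal_density x *\<^sub>R iexp (t / c * x))"
      by (subst (asm) integrable_density) (auto simp: normal_density_nonneg)
    moreover have "(\<integral>x. std_normal_density x *\<^sub>R iexp (t / c * x) \<partial>lborel) = complex_of_real (exp (- (t / c)\<^sup>2 / 2))"
      using fun_cong[OF char_std_normal_distribution, of "t / c"] unfolding char_def
      by (subst (asm) integral_density) (auto simp: normal_density_nonneg)
    ultimately show ?thesis by (simp add: has_bochner_integral_iff)
  qed
  then have "has_bochner_integral lborel (\<lambda>x. std_normal_density (0 + c * x) *\<^sub>R iexp (t / c * (0 + c * x)))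
      (complex_of_real (exp (- (t / c)\<^sup>2 / 2)) /\<^sub>R \<bar>c\<bar>)"
    using c(1) by (subst (asm) lborel_has_bochner_integral_real_affine_iff[of c _ _ 0]) auto
  then have "has_bochner_integral lborel (\<lambda>x. sqrt (2 * pi) *\<^sub>R (std_normal_density (0 + c * x) *\<^sub>R iexp (t / c * (0 + c * x))))
      (sqrt (2 * pi) *\<^sub>R (complex_of_real (exp (- (t / c)\<^sup>2 / 2)) /\<^sub>R \<bar>c\<bar>))"
    by (intro has_bochner_integral_scaleR_right) auto
  moreover have "(\<lambda>x. sqrt (2 * pi) *\<^sub>R (std_normal_density (0 + c * x) *\<^sub>R iexp (t / c * (0 + c * x)))) =
      (\<lambda>x. exp (- r * x\<^sup>2) *\<^sub>R iexp (t * x))"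
  proof
    fix x
    have "t / c * (0 + c * x) = t * x" using c(1) by simp
    then show "sqrt (2 * pi) *\<^sub>R (std_normal_density (0 + c * x) *\<^sub>R iexp (t / c * (0 + c * x))) = exp (- r * x\<^sup>2) *\<^sub>R iexp (t * x)"
      unfolding sn by (simp del: add_0)
  qed
  moreover have "sqrt (2 * pi) *\<^sub>R (complex_of_real (exp (- (t / c)\<^sup>2 / 2)) /\<^sub>R \<bar>c\<bar>) =
      complex_of_real (sqrt (pi / r) * exp (- t\<^sup>2 / (4 * r)))"
  proof -
    have "sqrt (2 * pi) / c = sqrt (pi / r)" using r by (simp add: c_def real_sqrt_divide[symmetric])
    moreover have "(t / c)\<^sup>2 / 2 = t\<^sup>2 / (4 * r)" using c(2) by (simp add: power_divide)
    moreover have "sqrt (2 * pi) *\<^sub>R (complex_of_real x /\<^sub>R \<bar>c\<bar>) = complex_of_real (sqrt (2 * pi) / c * x)" for x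
      using c(1) by (simp add: scaleR_conv_of_real divide_inverse mult_ac)
    ultimately show ?thesis by simp
  qed
  ultimately have "has_bochner_integral lborel (\<lambda>x. exp (- r * x\<^sup>2) *\<^sub>R iexp (t * x))
      (complex_of_real (sqrt (pi / r) * exp (- t\<^sup>2 / (4 * r))))"
    by simp
  then show "integrable lborel (\<lambda>x. exp (- r * x\<^sup>2) *\<^sub>R iexp (t * x))"
    and "(\<integral>x. exp (- r * x\<^sup>2) *\<^sub>R iexp (t * x) \<partial>lborel) = complex_of_real (sqrt (pi / r) * exp (- t\<^sup>2 / (4 * r)))"
    by (auto simp: has_bochner_integral_iff)
qed

text \<open>Lebesgue measure is the image of a product measure, and both the Gaussian and the
  complex exponential factor over the coordinates. A cosine does not factor, so the real part is
  taken only at the end.\<close>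

lemma gaussian_fourier:
  fixes z :: "'a::euclidean_space" and r :: real
  assumes r: "r > 0"
  shows "integrable lborel (\<lambda>\<xi>::'a. exp (- r * (norm \<xi>)\<^sup>2))"
    and "integrable lborel (\<lambda>\<xi>::'a. exp (- r * (norm \<xi>)\<^sup>2) * cos (\<xi> \<bullet> z))"
    and "(\<integral>\<xi>. exp (- r * (norm \<xi>)\<^sup>2) * cos (\<xi> \<bullet> z) \<partial>lborel) = (pi / r) powr (real DIM('a) / 2) * exp (- (norm z)\<^sup>2 / (4 * r))"
proof -
  interpret P: product_sigma_finite "\<lambda>_::'a. lborel :: real measure" by standard
  define F where "F z \<xi> = (exp (- r * (norm \<xi>)\<^sup>2) *\<^sub>R iexp (\<xi> \<bullet> z))" for z \<xi> :: 'a
  have n2: "(norm x)\<^sup>2 = (\<Sum>b\<in>Basis. (x \<bullet> b)\<^sup>2)" for x :: 'a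
    unfolding power2_norm_eq_inner by (subst euclidean_inner) (simp add: power2_eq_square)
  have F: "F z (\<Sum>b\<in>Basis. f b *\<^sub>R b) = (\<Prod>b\<in>Basis. exp (- r * (f b)\<^sup>2) *\<^sub>R iexp ((z \<bullet> b) * f b))" for z :: 'a and f
  proof -
    let ?x = "\<Sum>b\<in>Basis. f b *\<^sub>R b"
    have "exp (- r * (norm ?x)\<^sup>2) = (\<Prod>b\<in>Basis. exp (- r * (f b)\<^sup>2))"
      unfolding n2 by (simp add: sum_distrib_left exp_sum sum_negf[symmetric] inner_sum_left_Basis)
    moreover have "iexp (?x \<bullet> z) = (\<Prod>b\<in>Basis. iexp ((z \<bullet> b) * f b))"
    proof -
      have "?x \<bullet> z = (\<Sum>b\<in>Basis. (z \<bullet> b) * f b)"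
        by (simp only: inner_sum_left inner_scaleR_left inner_commute[of z] mult.commute)
      then show ?thesis by (simp only: of_real_sum sum_distrib_left exp_sum finite_Basis)
    qed
    ultimately show ?thesis by (simp add: F_def scaleR_conv_of_real prod.distrib)
  qed
  have [measurable]: "F z \<in> borel_measurable borel" for z
    unfolding F_def by (intro borel_measurable_continuous_onI continuous_intros)
  have meas: "(\<lambda>f. \<Sum>b\<in>Basis. f b *\<^sub>R b) \<in> measurable (\<Pi>\<^sub>M b\<in>Basis. lborel) (borel :: 'a measure)"
    by measurable
  have int: "integrable lborel (F z)" for z
    unfolding lborel_eq[where 'a = 'a]
    by (subst integrable_distr_eq[OF meas], simp, simp only: F)
       (intro P.product_integrable_prod finite_Basis gaussian_fourier_real(1) r)
  have "integral\<^sup>L lborel (F z) = (\<Prod>b\<in>Basis. complex_of_real (sqrt (pi / r) * exp (- (z \<bullet> b)\<^sup>2 / (4 * r))))"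
    unfolding lborel_eq[where 'a = 'a]
    by (subst integral_distr[OF meas], simp, simp only: F, subst P.product_integral_prod)
       (simp_all only: finite_Basis gaussian_fourier_real[OF r])
  also have "\<dots> = complex_of_real (sqrt (pi / r) ^ DIM('a) * exp (- (norm z)\<^sup>2 / (4 * r)))"
    unfolding n2 by (simp add: prod.distrib exp_sum[symmetric] sum_negf sum_divide_distrib flip: of_real_prod of_real_mult)
  also have "sqrt (pi / r) ^ DIM('a) = (pi / r) powr (real DIM('a) / 2)"
    using r by (simp add: powr_half_sqrt[symmetric] powr_realpow[symmetric] powr_powr)
  finally have I: "integral\<^sup>L lborel (F z) = complex_of_real ((pi / r) powr (real DIM('a) / 2) * exp (- (norm z)\<^sup>2 / (4 * r)))" .
  have ReF: "Re (F z \<xi>) = exp (- r * (norm \<xi>)\<^sup>2) * cos (\<xi> \<bullet> z)" for z \<xi>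
    by (simp add: F_def Re_exp)
  show "integrable lborel (\<lambda>\<xi>::'a. exp (- r * (norm \<xi>)\<^sup>2) * cos (\<xi> \<bullet> z))"
    using integrable_Re[OF int[of z]] unfolding ReF .
  show "integrable lborel (\<lambda>\<xi>::'a. exp (- r * (norm \<xi>)\<^sup>2))"
    using integrable_Re[OF int[of 0]] unfolding ReF by simp
  show "(\<integral>\<xi>. exp (- r * (norm \<xi>)\<^sup>2) * cos (\<xi> \<bullet> z) \<partial>lborel) = (pi / r) powr (real DIM('a) / 2) * exp (- (norm z)\<^sup>2 / (4 * r))"
    using integral_Re[OF int[of z]] unfolding ReF I by simp
qed

lemma nn_integral_gaussian:
  fixes \<xi> :: "'a::euclidean_space"
  assumes r: "r > 0"
  shows "(\<integral>\<^sup>+(z::'a). ennreal (exp (- r * (norm z)\<^sup>2)) \<partial>lborel) = ennreal ((pi / r) powr (real DIM('a) / 2))"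
    and "(\<integral>\<^sup>+z. ennreal ((1 - cos (\<xi> \<bullet> z)) * exp (- r * (norm z)\<^sup>2)) \<partial>lborel) =
      ennreal ((pi / r) powr (real DIM('a) / 2) * (1 - exp (- (norm \<xi>)\<^sup>2 / (4 * r))))"
proof -
  have 0: "(\<integral>(z::'a). exp (- r * (norm z)\<^sup>2) \<partial>lborel) = (pi / r) powr (real DIM('a) / 2)"
    using gaussian_fourier(3)[OF r, of "0::'a"] by simp
  show "(\<integral>\<^sup>+(z::'a). ennreal (exp (- r * (norm z)\<^sup>2)) \<partial>lborel) = ennreal ((pi / r) powr (real DIM('a) / 2))"
    using gaussian_fourier(1)[OF r, where 'a = 'a] 0 by (subst nn_integral_eq_integral) simp_all
  have eq: "(1 - cos (\<xi> \<bullet> z)) * exp (- r * (norm z)\<^sup>2) = exp (- r * (norm z)\<^sup>2) - exp (- r * (norm z)\<^sup>2) * cos (z \<bullet> \<xi>)" for z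
    by (simp add: algebra_simps inner_commute)
  have "(\<integral>\<^sup>+z. ennreal ((1 - cos (\<xi> \<bullet> z)) * exp (- r * (norm z)\<^sup>2)) \<partial>lborel) =
      ennreal (\<integral>z. (1 - cos (\<xi> \<bullet> z)) * exp (- r * (norm z)\<^sup>2) \<partial>lborel)"
    unfolding eq by (intro nn_integral_eq_integral Bochner_Integration.integrable_diff gaussian_fourier r)
       (auto intro!: AE_I2 mult_left_le)
  also have "(\<integral>z. (1 - cos (\<xi> \<bullet> z)) * exp (- r * (norm z)\<^sup>2) \<partial>lborel) =
      (pi / r) powr (real DIM('a) / 2) - (pi / r) powr (real DIM('a) / 2) * exp (- (norm \<xi>)\<^sup>2 / (4 * r))"
    unfolding eq using gaussian_fourier(2,3)[OF r, of \<xi>] gaussian_fourier(1)[OF r, where 'a = 'a] 0 by simp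
  finally show "(\<integral>\<^sup>+z. ennreal ((1 - cos (\<xi> \<bullet> z)) * exp (- r * (norm z)\<^sup>2)) \<partial>lborel) =
      ennreal ((pi / r) powr (real DIM('a) / 2) * (1 - exp (- (norm \<xi>)\<^sup>2 / (4 * r))))"
    by (simp add: right_diff_distrib)
qed

lemma nn_integral_incseq_indicator:
  assumes A: "incseq A" and [measurable]: "\<And>n. A n \<in> sets M" "f \<in> borel_measurable M"
  shows "(\<lambda>n. \<integral>\<^sup>+x. f x * indicator (A n) x \<partial>M) \<longlonglongrightarrow> (\<integral>\<^sup>+x. f x * indicator (\<Union>n. A n) x \<partial>M)"
proof (rule nn_integral_LIMSEQ)
  show "incseq (\<lambda>n x. f x * indicator (A n) x)"
    using A by (auto simp: incseq_def le_fun_def indicator_def)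
  fix x
  show "(\<lambda>n. f x * indicator (A n) x) \<longlonglongrightarrow> f x * indicator (\<Union>n. A n) x"
  proof (cases "x \<in> (\<Union>n. A n)")
    case True
    then obtain k where "x \<in> A k" by blast
    then have "x \<in> A n" if "n \<ge> k" for n using incseqD[OF A that] by blast
    then have "eventually (\<lambda>n. f x * indicator (A n) x = f x * indicator (\<Union>n. A n) x) sequentially"
      using True by (auto simp: eventually_sequentially indicator_def)
    then show ?thesis by (rule tendsto_eventually)
  next
    case False
    then show ?thesis by (auto simp: indicator_def)
  qed
qed measurable

text \<open>The substitution uses \<open>- (1 / x)\<close> in place of \<open>1 / x\<close> because
  it is increasing. The half line is exhausted by the compact intervals \<open>A n\<close>, and a
  reflection finally undoes the sign.\<close>

lemma nn_integral_inverse_substitution: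
  fixes f :: "real \<Rightarrow> ennreal"
  assumes [measurable]: "f \<in> borel_measurable borel"
  shows "(\<integral>\<^sup>+x. f x * indicator {0<..} x \<partial>lborel) = (\<integral>\<^sup>+x. f (1 / x) * ennreal (1 / x\<^sup>2) * indicator {0<..} x \<partial>lborel)"
proof -
  define A where "A n = {1 / real (n + 2) .. real (n + 2)}" for n :: nat
  define B where "B n = {- real (n + 2) .. - (1 / real (n + 2))}" for n :: nat
  have inc: "1 / real (n + 2) \<le> 1 / real (m + 2)" if "m \<le> n" for m n
    using that by (intro divide_left_mono) auto
  have A: "incseq A" "(\<Union>n. A n) = {0<..}"
  proof -
    show "incseq A" using inc by (force simp: incseq_def A_def)
    show "(\<Union>n. A n) = {0<..}"
    proof (intro equalityI subsetI)
      fix x :: real assume "x \<in> (\<Union>n. A n)"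
      then obtain n where "1 / real (n + 2) \<le> x" by (auto simp: A_def)
      moreover have "0 < 1 / real (n + 2)" by simp
      ultimately have "0 < x" by (rule less_le_trans[rotated])
      then show "x \<in> {0<..}" by simp
    next
      fix x :: real assume "x \<in> {0<..}"
      then have x: "x > 0" by simp
      obtain n where n: "max x (1 / x) \<le> real n" using real_arch_simple by blast
      then have "1 / x \<le> real (n + 2)" "x \<le> real (n + 2)" by auto
      then have "1 / real (n + 2) \<le> x" using x by (simp add: field_simps)
      with \<open>x \<le> real (n + 2)\<close> show "x \<in> (\<Union>n. A n)" unfolding A_def by (intro UN_I[of n]) auto
    qed
  qed
  have BA: "x \<in> B n \<longleftrightarrow> - x \<in> A n" for x n by (auto simp: A_def B_def)
  have B: "incseq B" "(\<Union>n. B n) = {..<0}"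
    using A BA by (auto simp: incseq_def subset_iff set_eq_iff)
  have [measurable]: "A n \<in> sets borel" "B n \<in> sets borel" for n by (auto simp: A_def B_def)
  have "(\<integral>\<^sup>+x. f (- x) * indicator (B n) x \<partial>lborel) = (\<integral>\<^sup>+x. f (1 / x) * ennreal (1 / x\<^sup>2) * indicator (A n) x \<partial>lborel)" for n
  proof -
    have B_eq: "B n = {- (1 / (1 / real (n + 2))) .. - (1 / real (n + 2))}" by (simp add: B_def)
    have lt: "1 / real (n + 2) < real (n + 2)"
      by (rule less_le_trans[of _ 1]) auto
    have pos: "x > 0" if "x \<in> {1 / real (n + 2)..real (n + 2)}" for x
      using that by (auto intro: less_le_trans[of 0 "1 / real (n + 2)"])
    have "(\<integral>\<^sup>+x. f (- x) * indicator {- (1 / (1 / real (n + 2))) .. - (1 / real (n + 2))} x \<partial>lborel) =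
       (\<integral>\<^sup>+x. f (- (- (1 / x))) * ennreal (1 / x\<^sup>2) * indicator {1 / real (n + 2) .. real (n + 2)} x \<partial>lborel)"
      by (rule nn_integral_substitution_aux[where f = "\<lambda>x. f (- x)" and g = "\<lambda>x. - (1 / x)" and g' = "\<lambda>x. 1 / x\<^sup>2"])
         (use pos lt in \<open>auto intro!: derivative_eq_intros continuous_intros simp: power2_eq_square dest: pos\<close>)
    then show ?thesis unfolding B_eq A_def by simp
  qed
  moreover have "(\<lambda>n. \<integral>\<^sup>+x. f (1 / x) * ennreal (1 / x\<^sup>2) * indicator (A n) x \<partial>lborel) \<longlonglongrightarrow>
      (\<integral>\<^sup>+x. f (1 / x) * ennreal (1 / x\<^sup>2) * indicator {0<..} x \<partial>lborel)"
    using nn_integral_incseq_indicator[OF A(1), of lborel "\<lambda>x. f (1 / x) * ennreal (1 / x\<^sup>2)"] by (simp add: A)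
  moreover have "(\<lambda>n. \<integral>\<^sup>+x. f (- x) * indicator (B n) x \<partial>lborel) \<longlonglongrightarrow> (\<integral>\<^sup>+x. f (- x) * indicator {..<0} x \<partial>lborel)"
    using nn_integral_incseq_indicator[OF B(1), of lborel "\<lambda>x. f (- x)"] by (simp add: B)
  ultimately have "(\<integral>\<^sup>+x. f (- x) * indicator {..<0} x \<partial>lborel) = (\<integral>\<^sup>+x. f (1 / x) * ennreal (1 / x\<^sup>2) * indicator {0<..} x \<partial>lborel)"
    by (simp add: LIMSEQ_unique)
  moreover have "(\<integral>\<^sup>+x. f (- x) * indicator {..<0} x \<partial>lborel) = (\<integral>\<^sup>+x. f x * indicator {0<..} x \<partial>lborel)"
  proof -
    have "(\<integral>\<^sup>+x. f x * indicator {0<..} x \<partial>lborel) = (\<integral>\<^sup>+x. f (0 + - 1 * x) * indicator {0<..} (0 + - 1 * x) \<partial>lborel)"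
      by (subst nn_integral_real_affine[of _ "-1" 0]) auto
    also have "\<dots> = (\<integral>\<^sup>+x. f (- x) * indicator {..<0} x \<partial>lborel)"
      by (intro nn_integral_cong) (auto simp: indicator_def)
    finally show ?thesis by simp
  qed
  ultimately show ?thesis by simp
qed

lemma nn_integral_Gamma:
  fixes \<alpha> c :: real
  assumes \<alpha>: "\<alpha> > 0" and c: "c > 0"
  shows "(\<integral>\<^sup>+t. ennreal (t powr (\<alpha> - 1) * exp (- c * t)) * indicator {0<..} t \<partial>lborel) = ennreal (Gamma \<alpha> / c powr \<alpha>)"
proof -
  define I where "I = (\<integral>\<^sup>+t. ennreal (t powr (\<alpha> - 1) * exp (- c * t)) * indicator {0<..} t \<partial>lborel)"
  have "ennreal (Gamma \<alpha>) = (\<integral>\<^sup>+t. ennreal (indicator {0..} t * t powr (\<alpha> - 1) / exp t) \<partial>lborel)"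
    using Gamma_conv_nn_integral_real[OF \<alpha>] by simp
  also have "\<dots> = ennreal \<bar>c\<bar> * (\<integral>\<^sup>+t. ennreal (indicator {0..} (0 + c * t) * (0 + c * t) powr (\<alpha> - 1) / exp (0 + c * t)) \<partial>lborel)"
    using c by (intro nn_integral_real_affine) auto
  also have "(\<integral>\<^sup>+t. ennreal (indicator {0..} (0 + c * t) * (0 + c * t) powr (\<alpha> - 1) / exp (0 + c * t)) \<partial>lborel) =
      (\<integral>\<^sup>+t. ennreal (c powr (\<alpha> - 1)) * (ennreal (t powr (\<alpha> - 1) * exp (- c * t)) * indicator {0<..} t) \<partial>lborel)"
    using c by (intro nn_integral_cong)
      (auto simp: indicator_def zero_le_mult_iff powr_mult exp_minus field_simps ennreal_mult'[symmetric] not_less)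
  also have "\<dots> = ennreal (c powr (\<alpha> - 1)) * I" unfolding I_def by (intro nn_integral_cmult) auto
  finally have "ennreal (Gamma \<alpha>) = ennreal (c powr \<alpha>) * I"
    using c by (simp add: mult.assoc[symmetric] ennreal_mult'[symmetric] powr_diff)
  then have "ennreal (1 / c powr \<alpha>) * ennreal (Gamma \<alpha>) = ennreal (1 / c powr \<alpha>) * (ennreal (c powr \<alpha>) * I)" by simp
  then have "ennreal (Gamma \<alpha> / c powr \<alpha>) = I"
    using c by (simp add: mult.assoc[symmetric] ennreal_mult'[symmetric])
  then show ?thesis by (simp add: I_def)
qed

text \<open>Inverting \<open>r\<close> turns this into a Gamma integral with exponent
  \<open>1 - s\<close>.\<close>

lemma nn_integral_powr_exp_inverse:
  fixes p s :: real
  assumes p: "p > 0" and s: "s < 1"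
  shows "(\<integral>\<^sup>+r. ennreal (r powr (s - 2) * exp (- p / r)) * indicator {0<..} r \<partial>lborel) = ennreal (Gamma (1 - s) * p powr (s - 1))"
proof -
  have "(\<integral>\<^sup>+t. ennreal (t powr (1 - s - 1) * exp (- p * t)) * indicator {0<..} t \<partial>lborel) =
    (\<integral>\<^sup>+t. ennreal ((1 / t) powr (1 - s - 1) * exp (- p * (1 / t))) * ennreal (1 / t\<^sup>2) * indicator {0<..} t \<partial>lborel)"
    by (rule nn_integral_inverse_substitution) measurable
  also have "\<dots> = (\<integral>\<^sup>+r. ennreal (r powr (s - 2) * exp (- p / r)) * indicator {0<..} r \<partial>lborel)"
  proof (intro nn_integral_cong)
    fix t :: real
    have "(1 / t) powr (1 - s - 1) * exp (- p * (1 / t)) * (1 / t\<^sup>2) = t powr (s - 2) * exp (- p / t)" if "t > 0"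
    proof -
      have 1: "(1 / t) powr (1 - s - 1) = t powr s" using that by (simp add: powr_divide powr_minus_divide)
      have 2: "t powr (s - 2) = t powr s * (1 / t\<^sup>2)" using that by (simp add: powr_diff)
      show ?thesis unfolding 1 2 by simp
    qed
    then show "ennreal ((1 / t) powr (1 - s - 1) * exp (- p * (1 / t))) * ennreal (1 / t\<^sup>2) * indicator {0<..} t =
        ennreal (t powr (s - 2) * exp (- p / t)) * indicator {0<..} t"
      by (cases "t > 0") (simp_all add: ennreal_mult'[symmetric])
  qed
  finally show ?thesis
    using nn_integral_Gamma[of "1 - s" p] s p by (simp add: powr_diff powr_minus divide_simps)
qed

text \<open>\<open>1 - exp (- q / r)\<close> is the integral over \<open>p \<in> {0..q}\<close> of
  \<open>exp (- p / r) / r\<close>; after exchanging the integrals the inner one is a Gamma integral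
  and the outer one a power. This is the origin of the factor \<open>Gamma (1 - s) / s\<close> in
  the normalising constant.\<close>

lemma nn_integral_one_minus_exp:
  fixes q s :: real
  assumes q: "q \<ge> 0" and s: "0 < s" "s < 1"
  shows "(\<integral>\<^sup>+r. ennreal (r powr (s - 1) * (1 - exp (- q / r))) * indicator {0<..} r \<partial>lborel) = ennreal (Gamma (1 - s) * q powr s / s)"
proof -
  have inner: "ennreal (1 - exp (- q / r)) = (\<integral>\<^sup>+p. ennreal (exp (- p / r) / r) * indicator {0..q} p \<partial>lborel)" if r: "r > 0" for r
  proof -
    have "((\<lambda>p. exp (- p / r) / r) has_integral ((- exp (- q / r)) - (- exp (- 0 / r)))) {0..q}"
      using q r by (intro fundamental_theorem_of_calculus)
        (auto intro!: derivative_eq_intros simp: has_real_derivative_iff_has_vector_derivative[symmetric])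
    from nn_integral_has_integral_lebesgue'[OF _ this] show ?thesis using r by simp
  qed
  have "(\<integral>\<^sup>+r. ennreal (r powr (s - 1) * (1 - exp (- q / r))) * indicator {0<..} r \<partial>lborel) =
     (\<integral>\<^sup>+r. (\<integral>\<^sup>+p. (ennreal (r powr (s - 2) * exp (- p / r)) * indicator {0<..} r) * indicator {0..q} p \<partial>lborel) \<partial>lborel)"
  proof (intro nn_integral_cong)
    fix r :: real
    show "ennreal (r powr (s - 1) * (1 - exp (- q / r))) * indicator {0<..} r =
      (\<integral>\<^sup>+p. (ennreal (r powr (s - 2) * exp (- p / r)) * indicator {0<..} r) * indicator {0..q} p \<partial>lborel)"
    proof (cases "r > 0")
      case True
      have "ennreal (r powr (s - 1) * (1 - exp (- q / r))) = ennreal (r powr (s - 1)) * ennreal (1 - exp (- q / r))"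
        using True q by (intro ennreal_mult) auto
      also have "\<dots> = (\<integral>\<^sup>+p. ennreal (r powr (s - 1)) * (ennreal (exp (- p / r) / r) * indicator {0..q} p) \<partial>lborel)"
        unfolding inner[OF True] by (intro nn_integral_cmult[symmetric]) auto
      also have "\<dots> = (\<integral>\<^sup>+p. (ennreal (r powr (s - 2) * exp (- p / r)) * indicator {0<..} r) * indicator {0..q} p \<partial>lborel)"
      proof (intro nn_integral_cong)
        fix p
        have "r powr (s - 1) * (exp (- p / r) / r) = r powr (s - 2) * exp (- p / r)"
          using True by (simp add: powr_diff power2_eq_square)
        then show "ennreal (r powr (s - 1)) * (ennreal (exp (- p / r) / r) * indicator {0..q} p) =
            (ennreal (r powr (s - 2) * exp (- p / r)) * indicator {0<..} r) * indicator {0..q} p"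
          using True by (simp add: mult.assoc[symmetric] ennreal_mult'[symmetric])
      qed
      finally show ?thesis using True by simp
    qed simp
  qed
  also have "\<dots> = (\<integral>\<^sup>+p. (\<integral>\<^sup>+r. (ennreal (r powr (s - 2) * exp (- p / r)) * indicator {0<..} r) * indicator {0..q} p \<partial>lborel) \<partial>lborel)"
    by (rule lborel_pair.Fubini'[symmetric]) measurable
  also have "\<dots> = (\<integral>\<^sup>+p. ennreal (Gamma (1 - s)) * (ennreal (p powr (s - 1)) * indicator {0..q} p) \<partial>lborel)"
  proof (rule nn_integral_cong_AE)
    \<comment> \<open>At \<open>p = 0\<close> the inner integral diverges, whereas
      \<open>0 powr (s - 1)\<close> is 0, so the identity holds only off a null set.\<close>
    have "AE p in lborel. p \<noteq> (0::real)" by (rule AE_lborel_singleton)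
    then show "AE p in lborel. (\<integral>\<^sup>+r. (ennreal (r powr (s - 2) * exp (- p / r)) * indicator {0<..} r) * indicator {0..q} p \<partial>lborel) =
        ennreal (Gamma (1 - s)) * (ennreal (p powr (s - 1)) * indicator {0..q} p)"
    proof eventually_elim
      fix p :: real assume "p \<noteq> 0"
      show "(\<integral>\<^sup>+r. (ennreal (r powr (s - 2) * exp (- p / r)) * indicator {0<..} r) * indicator {0..q} p \<partial>lborel) =
        ennreal (Gamma (1 - s)) * (ennreal (p powr (s - 1)) * indicator {0..q} p)"
      proof (cases "p \<in> {0..q}")
        case True
        then have "p > 0" using \<open>p \<noteq> 0\<close> by auto
        then show ?thesis using True nn_integral_powr_exp_inverse[of p s] s by (simp add: ennreal_mult'')
      qed simp
    qed
  qed
  also have "\<dots> = ennreal (Gamma (1 - s)) * (\<integral>\<^sup>+p. ennreal (p powr (s - 1)) * indicator {0..q} p \<partial>lborel)"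
    by (intro nn_integral_cmult) auto
  also have "(\<integral>\<^sup>+p. ennreal (p powr (s - 1)) * indicator {0..q} p \<partial>lborel) = ennreal (q powr s / s)"
    using nn_integral_has_integral_lebesgue'[OF _ has_integral_powr_from_0[of "s - 1" q]] s q by simp
  finally show ?thesis using s by (simp add: ennreal_mult''[symmetric] Gamma_real_nonneg)
qed

lemma frac_const_pos: "0 < s \<Longrightarrow> s < 1 \<Longrightarrow> N > 0 \<Longrightarrow> 0 < frac_const N s"
  by (simp add: frac_const_def Gamma_real_pos)

text \<open>At the origin the power of 0 is 0, and so is the quotient by it; the diagonal thus gets
  the same value as in \<open>sobolev_space\<close>.\<close>

definition riesz_kernel :: "real \<Rightarrow> 'a::euclidean_space \<Rightarrow> real" where
  "riesz_kernel s z = 1 / norm z powr (real DIM('a) + 2 * s)"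

lemma riesz_kernel_nonneg [simp]: "0 \<le> riesz_kernel s z"
  by (simp add: riesz_kernel_def)

lemma riesz_kernel_minus [simp]: "riesz_kernel s (- z) = riesz_kernel s z"
  by (simp add: riesz_kernel_def)

lemma borel_measurable_riesz_kernel [measurable]: "riesz_kernel s \<in> borel_measurable borel"
  unfolding riesz_kernel_def[abs_def] by measurable

text \<open>Writing the kernel as a superposition of Gaussians by means of the Gamma integral reduces the
  integral to the Fourier transform of Gaussians.\<close>

lemma nn_integral_riesz_kernel:
  fixes \<xi> :: "'a::euclidean_space"
  assumes s: "0 < s" "s < 1"
  shows "(\<integral>\<^sup>+z. ennreal ((1 - cos (\<xi> \<bullet> z)) * riesz_kernel s z) \<partial>lborel) = ennreal (norm \<xi> powr (2 * s) / frac_const DIM('a) s)"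
proof -
  let ?N = "real DIM('a)"
  \<comment> \<open>Half the exponent of the kernel, because the Gaussians depend on the squared
    norm. The factor \<open>r powr (- ?N / 2)\<close> from their integrals then reduces
    \<open>r powr (\<alpha> - 1)\<close> to \<open>r powr (s - 1)\<close>.\<close>
  define \<alpha> where "\<alpha> = ?N / 2 + s"
  have \<alpha>: "\<alpha> > 0" using s by (simp add: \<alpha>_def add_nonneg_pos)
  have G: "Gamma \<alpha> > 0" "Gamma (1 - s) > 0" using \<alpha> s by (auto intro: Gamma_real_pos)
  have c1: "0 \<le> 1 - cos x" for x :: real by simp
  have k: "ennreal (Gamma \<alpha>) * ennreal ((1 - cos (\<xi> \<bullet> z)) * riesz_kernel s z) =
      (\<integral>\<^sup>+r. ennreal (r powr (\<alpha> - 1)) * indicator {0<..} r * ennreal ((1 - cos (\<xi> \<bullet> z)) * exp (- r * (norm z)\<^sup>2)) \<partial>lborel)" for z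
  proof (cases "z = 0")
    case False
    then have p: "(norm z)\<^sup>2 > 0" by simp
    have "(norm z)\<^sup>2 powr \<alpha> = norm z powr (?N + 2 * s)"
    proof -
      have "(norm z)\<^sup>2 = norm z powr 2" using False by simp
      moreover have "2 * \<alpha> = ?N + 2 * s" by (simp add: \<alpha>_def)
      ultimately show ?thesis by (simp only: powr_powr)
    qed
    then have "ennreal (Gamma \<alpha>) * ennreal ((1 - cos (\<xi> \<bullet> z)) * riesz_kernel s z) =
        ennreal (1 - cos (\<xi> \<bullet> z)) * ennreal (Gamma \<alpha> / (norm z)\<^sup>2 powr \<alpha>)"
      using G c1[of "\<xi> \<bullet> z"] by (simp add: riesz_kernel_def ennreal_mult'[symmetric] mult_ac del: ennreal_1)
    also have "\<dots> = (\<integral>\<^sup>+r. ennreal (1 - cos (\<xi> \<bullet> z)) * (ennreal (r powr (\<alpha> - 1) * exp (- (norm z)\<^sup>2 * r)) * indicator {0<..} r) \<partial>lborel)"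
      unfolding nn_integral_Gamma[OF \<alpha> p, symmetric] by (intro nn_integral_cmult[symmetric]) auto
    also have "\<dots> = (\<integral>\<^sup>+r. ennreal (r powr (\<alpha> - 1)) * indicator {0<..} r * ennreal ((1 - cos (\<xi> \<bullet> z)) * exp (- r * (norm z)\<^sup>2)) \<partial>lborel)"
      using c1[of "\<xi> \<bullet> z"] by (intro nn_integral_cong) (auto simp: indicator_def ennreal_mult'[symmetric] mult_ac)
    finally show ?thesis .
  qed simp
  define q where "q = (norm \<xi>)\<^sup>2 / 4"
  have "ennreal (Gamma \<alpha>) * (\<integral>\<^sup>+z. ennreal ((1 - cos (\<xi> \<bullet> z)) * riesz_kernel s z) \<partial>lborel) =
    (\<integral>\<^sup>+z. (\<integral>\<^sup>+r. ennreal (r powr (\<alpha> - 1)) * indicator {0<..} r * ennreal ((1 - cos (\<xi> \<bullet> z)) * exp (- r * (norm z)\<^sup>2)) \<partial>lborel) \<partial>lborel)"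
    unfolding k[symmetric] by (intro nn_integral_cmult[symmetric]) measurable
  also have "\<dots> = (\<integral>\<^sup>+r. (\<integral>\<^sup>+z. ennreal (r powr (\<alpha> - 1)) * indicator {0<..} r * ennreal ((1 - cos (\<xi> \<bullet> z)) * exp (- r * (norm z)\<^sup>2)) \<partial>lborel) \<partial>lborel)"
    by (rule lborel_pair.Fubini'[symmetric]) measurable
  also have "\<dots> = (\<integral>\<^sup>+r. ennreal (pi powr (?N / 2)) * (ennreal (r powr (s - 1) * (1 - exp (- q / r))) * indicator {0<..} r) \<partial>lborel)"
  proof (intro nn_integral_cong)
    fix r :: real
    show "(\<integral>\<^sup>+z. ennreal (r powr (\<alpha> - 1)) * indicator {0<..} r * ennreal ((1 - cos (\<xi> \<bullet> z)) * exp (- r * (norm z)\<^sup>2)) \<partial>lborel) =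
        ennreal (pi powr (?N / 2)) * (ennreal (r powr (s - 1) * (1 - exp (- q / r))) * indicator {0<..} r)"
    proof (cases "r > 0")
      case True
      have "(\<integral>\<^sup>+z. ennreal (r powr (\<alpha> - 1)) * indicator {0<..} r * ennreal ((1 - cos (\<xi> \<bullet> z)) * exp (- r * (norm z)\<^sup>2)) \<partial>lborel) =
          ennreal (r powr (\<alpha> - 1)) * ennreal ((pi / r) powr (?N / 2) * (1 - exp (- (norm \<xi>)\<^sup>2 / (4 * r))))"
        unfolding nn_integral_gaussian(2)[OF True, symmetric] using True by (subst nn_integral_cmult) simp_all
      also have "\<dots> = ennreal (r powr (\<alpha> - 1) * ((pi / r) powr (?N / 2) * (1 - exp (- q / r))))"
        by (simp add: ennreal_mult'[symmetric] q_def)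
      also have "r powr (\<alpha> - 1) * ((pi / r) powr (?N / 2) * (1 - exp (- q / r))) = pi powr (?N / 2) * (r powr (s - 1) * (1 - exp (- q / r)))"
        using True by (simp add: powr_divide \<alpha>_def powr_add powr_diff)
      finally show ?thesis using True by (simp add: ennreal_mult')
    qed simp
  qed
  also have "\<dots> = ennreal (pi powr (?N / 2)) * ennreal (Gamma (1 - s) * q powr s / s)"
    using s by (subst nn_integral_cmult, measurable, subst nn_integral_one_minus_exp) (auto simp: q_def)
  finally have "ennreal (1 / Gamma \<alpha>) * (ennreal (Gamma \<alpha>) * (\<integral>\<^sup>+z. ennreal ((1 - cos (\<xi> \<bullet> z)) * riesz_kernel s z) \<partial>lborel)) =
      ennreal (1 / Gamma \<alpha>) * (ennreal (pi powr (?N / 2)) * ennreal (Gamma (1 - s) * q powr s / s))"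
    by simp
  moreover have "1 / Gamma \<alpha> * (pi powr (?N / 2) * (Gamma (1 - s) * q powr s / s)) = norm \<xi> powr (2 * s) / frac_const DIM('a) s"
  proof -
    have "q powr s = norm \<xi> powr (2 * s) / 4 powr s"
    proof (cases "\<xi> = 0")
      case False
      then have "(norm \<xi>)\<^sup>2 = norm \<xi> powr 2" by simp
      then have "(norm \<xi>)\<^sup>2 powr s = norm \<xi> powr (2 * s)" by (simp only: powr_powr)
      then show ?thesis by (simp add: q_def powr_divide)
    qed (simp add: q_def)
    then show ?thesis using G s by (simp add: frac_const_def \<alpha>_def divide_simps)
  qed
  ultimately show ?thesis
    using G s by (simp add: mult.assoc[symmetric] ennreal_mult'[symmetric])
qed

section \<open>The Fourier power spectrum\<close>

lemma integrable_bounded_kernel: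
  fixes f :: "'a::euclidean_space \<Rightarrow> real" and g :: "'b::euclidean_space \<Rightarrow> real"
  assumes f: "integrable lborel f" and g: "integrable lborel g"
    and k[measurable]: "case_prod k \<in> borel_measurable (lborel \<Otimes>\<^sub>M lborel)" and b: "\<And>x y. \<bar>k x y\<bar> \<le> B"
  shows "integrable (lborel \<Otimes>\<^sub>M lborel) (\<lambda>(x, y). f x * g y * k x y)"
proof (rule lborel_pair.Fubini_integrable)
  have [measurable]: "f \<in> borel_measurable borel" "g \<in> borel_measurable borel"
    using f g by (auto dest: borel_measurable_integrable)
  have B: "0 \<le> B" using b[of undefined undefined] by linarith
  have int: "integrable lborel (\<lambda>y. f x * g y * k x y)" for x
  proof (rule Bochner_Integration.integrable_bound[OF integrable_mult_right[OF g, of "f x * B"]])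
    have "norm (f x * g y * k x y) \<le> norm (f x * B * g y)" for y
    proof -
      have "\<bar>f x\<bar> * \<bar>g y\<bar> * \<bar>k x y\<bar> \<le> \<bar>f x\<bar> * \<bar>g y\<bar> * B" by (intro mult_left_mono b) simp
      then show ?thesis using B by (simp add: abs_mult mult_ac)
    qed
    then show "AE y in lborel. norm (f x * g y * k x y) \<le> norm (f x * B * g y)" by simp
  qed measurable
  show "(\<lambda>(x, y). f x * g y * k x y) \<in> borel_measurable (lborel \<Otimes>\<^sub>M lborel)" by measurable
  show "AE x in lborel. integrable lborel (\<lambda>y. (case (x, y) of (x, y) \<Rightarrow> f x * g y * k x y))"
    using int by simp
  have "norm (\<integral>y. norm (f x * g y * k x y) \<partial>lborel) \<le> norm (\<bar>f x\<bar> * (B * (\<integral>y. \<bar>g y\<bar> \<partial>lborel)))" for x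
  proof -
    have "(\<integral>y. norm (f x * g y * k x y) \<partial>lborel) \<le> (\<integral>y. \<bar>f x\<bar> * B * \<bar>g y\<bar> \<partial>lborel)"
    proof (intro integral_mono integrable_norm int integrable_mult_right integrable_abs g)
      fix y
      have "\<bar>f x\<bar> * \<bar>g y\<bar> * \<bar>k x y\<bar> \<le> \<bar>f x\<bar> * \<bar>g y\<bar> * B" by (intro mult_left_mono b) simp
      then show "norm (f x * g y * k x y) \<le> \<bar>f x\<bar> * B * \<bar>g y\<bar>" by (simp add: abs_mult mult_ac)
    qed
    then show ?thesis using B by simp
  qed
  then show "integrable lborel (\<lambda>x. \<integral>y. norm (case (x, y) of (x, y) \<Rightarrow> f x * g y * k x y) \<partial>lborel)"
    by (intro Bochner_Integration.integrable_bound[OF integrable_mult_left[OF integrable_abs[OF f]]]) auto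
qed

lemma Fubini_bounded_kernel:
  fixes f :: "'a::euclidean_space \<Rightarrow> real" and g :: "'b::euclidean_space \<Rightarrow> real"
  assumes f: "integrable lborel f" and g: "integrable lborel g"
    and k: "case_prod k \<in> borel_measurable (lborel \<Otimes>\<^sub>M lborel)" and b: "\<And>x y. \<bar>k x y\<bar> \<le> B"
  shows "(\<integral>x. f x * (\<integral>y. g y * k x y \<partial>lborel) \<partial>lborel) = (\<integral>y. g y * (\<integral>x. f x * k x y \<partial>lborel) \<partial>lborel)"
proof -
  have "(\<integral>y. (\<integral>x. f x * g y * k x y \<partial>lborel) \<partial>lborel) = (\<integral>x. (\<integral>y. f x * g y * k x y \<partial>lborel) \<partial>lborel)"
    using integrable_bounded_kernel[OF assms] by (intro lborel_pair.Fubini_integral) (simp add: case_prod_beta)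
  moreover have "(\<integral>x. f x * g y * k x y \<partial>lborel) = g y * (\<integral>x. f x * k x y \<partial>lborel)" for y
    by (subst integral_mult_right_zero[symmetric]) (simp add: mult_ac)
  moreover have "(\<integral>y. f x * g y * k x y \<partial>lborel) = f x * (\<integral>y. g y * k x y \<partial>lborel)" for x
    by (subst integral_mult_right_zero[symmetric]) (simp add: mult_ac)
  ultimately show ?thesis by simp
qed

section \<open>Invariance of Lebesgue integrals under reflections and translations\<close>

lemma lborel_distr_reflect: "distr lborel borel (\<lambda>y. x - y) = (lborel :: 'a::euclidean_space measure)"
  using lborel_affine[of "-1" x] by (simp add: density_1)

lemma integral_reflect:
  fixes g :: "'a::euclidean_space \<Rightarrow> real"
  assumes [measurable]: "g \<in> borel_measurable borel"
  shows "(\<integral>y. g (x - y) \<partial>lborel) = (\<integral>y. g y \<partial>lborel)"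
    and "integrable lborel (\<lambda>y. g (x - y)) \<longleftrightarrow> integrable lborel g"
proof -
  show "(\<integral>y. g (x - y) \<partial>lborel) = (\<integral>y. g y \<partial>lborel)"
    by (subst (2) lborel_distr_reflect[of x, symmetric]) (simp add: integral_distr)
  show "integrable lborel (\<lambda>y. g (x - y)) \<longleftrightarrow> integrable lborel g"
    by (subst (2) lborel_distr_reflect[of x, symmetric]) (simp add: integrable_distr_eq)
qed

lemma integral_translate:
  fixes g :: "'a::euclidean_space \<Rightarrow> real"
  assumes [measurable]: "g \<in> borel_measurable borel"
  shows "(\<integral>y. g (y + x) \<partial>lborel) = (\<integral>y. g y \<partial>lborel)"
    and "integrable lborel (\<lambda>y. g (y + x)) \<longleftrightarrow> integrable lborel g"
proof -
  show "(\<integral>y. g (y + x) \<partial>lborel) = (\<integral>y. g y \<partial>lborel)"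
    by (subst (2) lborel_distr_plus[of x, symmetric]) (simp add: integral_distr add.commute)
  show "integrable lborel (\<lambda>y. g (y + x)) \<longleftrightarrow> integrable lborel g"
    by (subst (2) lborel_distr_plus[of x, symmetric]) (simp add: integrable_distr_eq add.commute)
qed

lemma nn_integral_translate:
  fixes g :: "'a::euclidean_space \<Rightarrow> ennreal"
  assumes [measurable]: "g \<in> borel_measurable borel"
  shows "(\<integral>\<^sup>+y. g (x + y) \<partial>lborel) = (\<integral>\<^sup>+y. g y \<partial>lborel)"
  by (subst (2) lborel_distr_plus[of x, symmetric]) (simp add: nn_integral_distr)

section \<open>Cosine and sine transforms and Plancherel's estimate\<close>

definition cos_transform :: "('a::euclidean_space \<Rightarrow> real) \<Rightarrow> 'a \<Rightarrow> real" where
  "cos_transform f \<xi> = (\<integral>x. f x * cos (\<xi> \<bullet> x) \<partial>lborel)"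

definition sin_transform :: "('a::euclidean_space \<Rightarrow> real) \<Rightarrow> 'a \<Rightarrow> real" where
  "sin_transform f \<xi> = (\<integral>x. f x * sin (\<xi> \<bullet> x) \<partial>lborel)"

text \<open>The squared modulus of the unnormalised Fourier integral of a real function, hence the
  factor \<open>(2 * pi) ^ DIM('a)\<close> in Plancherel's formula.\<close>

definition power_spectrum :: "('a::euclidean_space \<Rightarrow> real) \<Rightarrow> 'a \<Rightarrow> real" where
  "power_spectrum f \<xi> = (cos_transform f \<xi>)\<^sup>2 + (sin_transform f \<xi>)\<^sup>2"

lemma power_spectrum_nonneg [simp]: "0 \<le> power_spectrum f \<xi>"
  by (simp add: power_spectrum_def)

lemma borel_measurable_transforms [measurable]:
  fixes f :: "'a::euclidean_space \<Rightarrow> real"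
  assumes [measurable]: "f \<in> borel_measurable borel"
  shows "cos_transform f \<in> borel_measurable borel" "sin_transform f \<in> borel_measurable borel"
    "power_spectrum f \<in> borel_measurable borel"
  unfolding cos_transform_def[abs_def] sin_transform_def[abs_def] power_spectrum_def[abs_def] by measurable

lemma integrable_trig:
  fixes f :: "'a::euclidean_space \<Rightarrow> real"
  assumes f: "integrable lborel f"
  shows "integrable lborel (\<lambda>x. f x * cos (\<xi> \<bullet> x))" "integrable lborel (\<lambda>x. f x * sin (\<xi> \<bullet> x))"
proof -
  have [measurable]: "f \<in> borel_measurable borel" using f by (auto dest: borel_measurable_integrable)
  have le: "\<bar>a\<bar> * \<bar>cos t\<bar> \<le> \<bar>a\<bar>" "\<bar>a\<bar> * \<bar>sin t\<bar> \<le> \<bar>a\<bar>" for a t :: real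
    by (auto intro!: mult_left_le)
  show "integrable lborel (\<lambda>x. f x * cos (\<xi> \<bullet> x))" "integrable lborel (\<lambda>x. f x * sin (\<xi> \<bullet> x))"
    by (rule Bochner_Integration.integrable_bound[OF f]; simp add: abs_mult le)+
qed

lemma abs_transform_le:
  fixes f :: "'a::euclidean_space \<Rightarrow> real"
  assumes f: "integrable lborel f"
  shows "\<bar>cos_transform f \<xi>\<bar> \<le> (\<integral>x. \<bar>f x\<bar> \<partial>lborel)" "\<bar>sin_transform f \<xi>\<bar> \<le> (\<integral>x. \<bar>f x\<bar> \<partial>lborel)"
proof -
  have le: "\<bar>a\<bar> * \<bar>cos t\<bar> \<le> \<bar>a\<bar>" "\<bar>a\<bar> * \<bar>sin t\<bar> \<le> \<bar>a\<bar>" for a t :: real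
    by (auto intro!: mult_left_le)
  have "norm (cos_transform f \<xi>) \<le> (\<integral>x. norm (f x * cos (\<xi> \<bullet> x)) \<partial>lborel)"
    unfolding cos_transform_def by (rule integral_norm_bound)
  also have "\<dots> \<le> (\<integral>x. \<bar>f x\<bar> \<partial>lborel)"
    using f by (intro integral_mono integrable_norm integrable_trig) (auto simp: abs_mult le)
  finally show "\<bar>cos_transform f \<xi>\<bar> \<le> (\<integral>x. \<bar>f x\<bar> \<partial>lborel)" by simp
  have "norm (sin_transform f \<xi>) \<le> (\<integral>x. norm (f x * sin (\<xi> \<bullet> x)) \<partial>lborel)"
    unfolding sin_transform_def by (rule integral_norm_bound)
  also have "\<dots> \<le> (\<integral>x. \<bar>f x\<bar> \<partial>lborel)"
    using f by (intro integral_mono integrable_norm integrable_trig) (auto simp: abs_mult le)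
  finally show "\<bar>sin_transform f \<xi>\<bar> \<le> (\<integral>x. \<bar>f x\<bar> \<partial>lborel)" by simp
qed

text \<open>The Fourier integral of \<open>exp (- r * (norm \<xi>)\<^sup>2)\<close>, left
  unnormalised: its total mass is \<open>(2 * pi) ^ DIM('a)\<close> for every
  \<open>r\<close>.\<close>

definition heat_kernel :: "real \<Rightarrow> 'a::euclidean_space \<Rightarrow> real" where
  "heat_kernel r z = (pi / r) powr (real DIM('a) / 2) * exp (- (norm z)\<^sup>2 / (4 * r))"

lemma heat_kernel_nonneg [simp]: "0 \<le> heat_kernel r z"
  by (simp add: heat_kernel_def)

lemma borel_measurable_heat_kernel [measurable]: "heat_kernel r \<in> borel_measurable borel"
  unfolding heat_kernel_def[abs_def] by measurable

lemma
  assumes r: "r > 0"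
  shows heat_kernel_integrable: "integrable lborel (heat_kernel r :: 'a::euclidean_space \<Rightarrow> real)"
    and heat_kernel_integral: "(\<integral>z. heat_kernel r (z::'a) \<partial>lborel) = (2 * pi) ^ DIM('a)"
proof -
  have e: "exp (- (norm z)\<^sup>2 / (4 * r)) = exp (- (1 / (4 * r)) * (norm z)\<^sup>2)" for z :: 'a by simp
  have r': "1 / (4 * r) > 0" using r by simp
  show "integrable lborel (heat_kernel r :: 'a \<Rightarrow> real)"
    unfolding heat_kernel_def[abs_def] e by (intro integrable_mult_right gaussian_fourier(1) r')
  have "(\<integral>z. heat_kernel r (z::'a) \<partial>lborel) = (pi / r) powr (real DIM('a) / 2) * (pi / (1 / (4 * r))) powr (real DIM('a) / 2)"
    unfolding heat_kernel_def e using gaussian_fourier(3)[OF r', of "0::'a"] by simp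
  also have "\<dots> = ((2 * pi)\<^sup>2) powr (real DIM('a) / 2)"
    using r by (subst powr_mult[symmetric]) (auto simp: power2_eq_square field_simps)
  also have "\<dots> = ((2 * pi) powr 2) powr (real DIM('a) / 2)" by simp
  also have "\<dots> = (2 * pi) ^ DIM('a)" by (subst powr_powr) (simp add: powr_realpow)
  finally show "(\<integral>z. heat_kernel r (z::'a) \<partial>lborel) = (2 * pi) ^ DIM('a)" .
qed

text \<open>Squaring the transforms produces a double integral of
  \<open>f x * f y * cos (\<xi> \<bullet> (x - y))\<close>. The Gaussian makes it absolutely
  convergent in all variables, and integrating over \<open>\<xi>\<close> leaves the heat
  kernel.\<close>

lemma integral_gaussian_power_spectrum:
  fixes f :: "'a::euclidean_space \<Rightarrow> real"
  assumes f: "integrable lborel f" and r: "r > 0"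
  shows "(\<integral>\<xi>. exp (- r * (norm \<xi>)\<^sup>2) * power_spectrum f \<xi> \<partial>lborel) =
    (\<integral>x. f x * (\<integral>y. f y * heat_kernel r (x - y) \<partial>lborel) \<partial>lborel)"
proof -
  have [measurable]: "f \<in> borel_measurable borel" using f by (auto dest: borel_measurable_integrable)
  define g where "g \<xi> = exp (- r * (norm \<xi>)\<^sup>2)" for \<xi> :: 'a
  have g: "integrable lborel g" unfolding g_def[abs_def] by (rule gaussian_fourier(1)[OF r])
  define k where "k x \<xi> = cos_transform f \<xi> * cos (\<xi> \<bullet> x) + sin_transform f \<xi> * sin (\<xi> \<bullet> x)" for x \<xi>
  define M where "M = (\<integral>x. \<bar>f x\<bar> \<partial>lborel)"
  have "\<bar>k x \<xi>\<bar> \<le> M + M" for x \<xi>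
  proof -
    have "\<bar>cos_transform f \<xi> * cos (\<xi> \<bullet> x)\<bar> \<le> M * 1" "\<bar>sin_transform f \<xi> * sin (\<xi> \<bullet> x)\<bar> \<le> M * 1"
      unfolding abs_mult M_def by (intro mult_mono abs_transform_le f; simp)+
    then show ?thesis unfolding k_def by linarith
  qed
  moreover have [measurable]: "case_prod k \<in> borel_measurable (lborel \<Otimes>\<^sub>M lborel)"
    unfolding k_def[abs_def] by measurable
  ultimately have 1: "(\<integral>x. f x * (\<integral>\<xi>. g \<xi> * k x \<xi> \<partial>lborel) \<partial>lborel) = (\<integral>\<xi>. g \<xi> * (\<integral>x. f x * k x \<xi> \<partial>lborel) \<partial>lborel)"
    by (intro Fubini_bounded_kernel[OF f g]) auto
  have 2: "(\<integral>x. f x * k x \<xi> \<partial>lborel) = power_spectrum f \<xi>" for \<xi>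
  proof -
    have "(\<integral>x. f x * k x \<xi> \<partial>lborel) = (\<integral>x. cos_transform f \<xi> * (f x * cos (\<xi> \<bullet> x)) + sin_transform f \<xi> * (f x * sin (\<xi> \<bullet> x)) \<partial>lborel)"
      by (simp add: k_def algebra_simps)
    also have "\<dots> = cos_transform f \<xi> * cos_transform f \<xi> + sin_transform f \<xi> * sin_transform f \<xi>"
      by (subst Bochner_Integration.integral_add)
         (simp_all add: integrable_trig[OF f] cos_transform_def[symmetric] sin_transform_def[symmetric])
    finally show ?thesis by (simp add: power_spectrum_def power2_eq_square)
  qed
  have 3: "(\<integral>\<xi>. g \<xi> * k x \<xi> \<partial>lborel) = (\<integral>y. f y * heat_kernel r (x - y) \<partial>lborel)" for x
  proof -
    have "k x \<xi> = (\<integral>y. f y * cos (\<xi> \<bullet> (x - y)) \<partial>lborel)" for \<xi>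
    proof -
      have "(\<integral>y. f y * cos (\<xi> \<bullet> (x - y)) \<partial>lborel) =
          (\<integral>y. cos (\<xi> \<bullet> x) * (f y * cos (\<xi> \<bullet> y)) + sin (\<xi> \<bullet> x) * (f y * sin (\<xi> \<bullet> y)) \<partial>lborel)"
        by (simp add: inner_diff_right cos_diff algebra_simps)
      also have "\<dots> = k x \<xi>"
        by (subst Bochner_Integration.integral_add)
           (simp_all add: integrable_trig[OF f] cos_transform_def[symmetric] sin_transform_def[symmetric] k_def)
      finally show ?thesis by simp
    qed
    then have "(\<integral>\<xi>. g \<xi> * k x \<xi> \<partial>lborel) = (\<integral>\<xi>. g \<xi> * (\<integral>y. f y * cos (\<xi> \<bullet> (x - y)) \<partial>lborel) \<partial>lborel)" by simp
    also have "\<dots> = (\<integral>y. f y * (\<integral>\<xi>. g \<xi> * cos (\<xi> \<bullet> (x - y)) \<partial>lborel) \<partial>lborel)"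
      by (rule Fubini_bounded_kernel[OF g f, where B = 1]) auto
    also have "\<dots> = (\<integral>y. f y * heat_kernel r (x - y) \<partial>lborel)"
      unfolding g_def gaussian_fourier(3)[OF r] heat_kernel_def ..
    finally show ?thesis .
  qed
  show ?thesis using 1[unfolded 2 3] by (simp add: g_def)
qed

text \<open>Write \<open>2 * (f x * f y)\<close> as
  \<open>(f x)\<^sup>2 + (f y)\<^sup>2 - (f x - f y)\<^sup>2\<close>. The squares give the
  \<open>L^2\<close> norm because the heat kernel has constant mass; the remaining defect has a sign
  and resembles a Gagliardo seminorm, which yields the two halves of Plancherel below.\<close>

lemma gaussian_power_spectrum_identity:
  fixes f :: "'a::euclidean_space \<Rightarrow> real"
  assumes f: "integrable lborel f" and f2: "integrable lborel (\<lambda>x. (f x)\<^sup>2)" and r: "r > 0"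
  shows "integrable (lborel \<Otimes>\<^sub>M lborel) (\<lambda>(x, y). (f x - f y)\<^sup>2 * heat_kernel r (x - y))"
    and "(\<integral>\<xi>. exp (- r * (norm \<xi>)\<^sup>2) * power_spectrum f \<xi> \<partial>lborel) =
      (2 * pi) ^ DIM('a) * (\<integral>x. (f x)\<^sup>2 \<partial>lborel) -
      (\<integral>(x, y). (f x - f y)\<^sup>2 * heat_kernel r (x - y) \<partial>(lborel \<Otimes>\<^sub>M lborel)) / 2"
proof -
  have [measurable]: "f \<in> borel_measurable borel" using f by (auto dest: borel_measurable_integrable)
  let ?h = "heat_kernel r :: 'a \<Rightarrow> real" and ?P = "lborel \<Otimes>\<^sub>M lborel :: ('a \<times> 'a) measure"
  define K where "K = (2 * pi) ^ DIM('a)"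
  have K: "(\<integral>y. ?h (x - y) \<partial>lborel) = K" "integrable lborel (\<lambda>y. ?h (x - y))" for x
    using heat_kernel_integral[OF r] heat_kernel_integrable[OF r]
    by (simp_all add: integral_reflect[of ?h x] K_def)
  have I1: "integrable ?P (\<lambda>(x, y). (f x)\<^sup>2 * ?h (x - y))"
  proof (rule lborel_pair.Fubini_integrable)
    show "integrable lborel (\<lambda>x. \<integral>y. norm (case (x, y) of (x, y) \<Rightarrow> (f x)\<^sup>2 * ?h (x - y)) \<partial>lborel)"
      using f2 by (simp add: K)
  qed (auto simp: K)
  have V1: "(\<integral>(x, y). (f x)\<^sup>2 * ?h (x - y) \<partial>?P) = K * (\<integral>x. (f x)\<^sup>2 \<partial>lborel)"
    using lborel_pair.integral_fst'[OF I1] by (simp add: K mult.commute[of K])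
  have sw: "?h (y - x) = ?h (x - y)" for x y by (simp add: heat_kernel_def norm_minus_commute)
  have I2: "integrable ?P (\<lambda>(x, y). (f y)\<^sup>2 * ?h (x - y))"
    using lborel_pair.integrable_product_swap[OF I1] by (simp add: sw)
  have V2: "(\<integral>(x, y). (f y)\<^sup>2 * ?h (x - y) \<partial>?P) = K * (\<integral>x. (f x)\<^sup>2 \<partial>lborel)"
    using lborel_pair.integral_product_swap[of "\<lambda>(x, y). (f x)\<^sup>2 * ?h (x - y)"] I1 V1
    by (simp add: sw case_prod_beta)
  have I3: "integrable ?P (\<lambda>(x, y). f x * f y * ?h (x - y))"
  proof (rule integrable_bounded_kernel[OF f f])
    show "\<bar>?h (x - y)\<bar> \<le> (pi / r) powr (real DIM('a) / 2)" for x y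
      using r by (auto simp: heat_kernel_def abs_mult intro!: mult_left_le)
  qed measurable
  have V3: "(\<integral>(x, y). f x * f y * ?h (x - y) \<partial>?P) = (\<integral>\<xi>. exp (- r * (norm \<xi>)\<^sup>2) * power_spectrum f \<xi> \<partial>lborel)"
    using lborel_pair.integral_fst'[OF I3] integral_gaussian_power_spectrum[OF f r] by (simp add: mult.assoc)
  have eq: "(\<lambda>(x, y). (f x - f y)\<^sup>2 * ?h (x - y)) =
      (\<lambda>p. ((case p of (x, y) \<Rightarrow> (f x)\<^sup>2 * ?h (x - y)) + (case p of (x, y) \<Rightarrow> (f y)\<^sup>2 * ?h (x - y))) -
        2 * (case p of (x, y) \<Rightarrow> f x * f y * ?h (x - y)))"
    by (auto simp: fun_eq_iff power2_eq_square algebra_simps)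
  show "integrable ?P (\<lambda>(x, y). (f x - f y)\<^sup>2 * ?h (x - y))"
    unfolding eq by (intro Bochner_Integration.integrable_diff Bochner_Integration.integrable_add integrable_mult_right I1 I2 I3)
  have "(\<integral>(x, y). (f x - f y)\<^sup>2 * ?h (x - y) \<partial>?P) =
      K * (\<integral>x. (f x)\<^sup>2 \<partial>lborel) + K * (\<integral>x. (f x)\<^sup>2 \<partial>lborel) - 2 * (\<integral>\<xi>. exp (- r * (norm \<xi>)\<^sup>2) * power_spectrum f \<xi> \<partial>lborel)"
    unfolding eq
    by (subst Bochner_Integration.integral_diff, intro Bochner_Integration.integrable_add I1 I2, intro integrable_mult_right I3,
        subst Bochner_Integration.integral_add[OF I1 I2], subst integral_mult_right_zero) (simp only: V1 V2 V3)
  then show "(\<integral>\<xi>. exp (- r * (norm \<xi>)\<^sup>2) * power_spectrum f \<xi> \<partial>lborel) =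
      (2 * pi) ^ DIM('a) * (\<integral>x. (f x)\<^sup>2 \<partial>lborel) -
      (\<integral>(x, y). (f x - f y)\<^sup>2 * ?h (x - y) \<partial>?P) / 2"
    unfolding K_def[symmetric] by (simp only:) (simp add: field_simps)
qed

lemma gaussian_power_spectrum_limit:
  fixes f :: "'a::euclidean_space \<Rightarrow> real"
  assumes f: "integrable lborel f"
  shows "(\<lambda>n. \<integral>\<^sup>+\<xi>. ennreal (exp (- (1 / real (Suc n)) * (norm \<xi>)\<^sup>2) * power_spectrum f \<xi>) \<partial>lborel) \<longlonglongrightarrow>
    (\<integral>\<^sup>+\<xi>. ennreal (power_spectrum f \<xi>) \<partial>lborel)"
    and "(\<integral>\<^sup>+\<xi>. ennreal (exp (- (1 / real (Suc n)) * (norm \<xi>)\<^sup>2) * power_spectrum f \<xi>) \<partial>lborel) =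
      ennreal (\<integral>\<xi>. exp (- (1 / real (Suc n)) * (norm \<xi>)\<^sup>2) * power_spectrum f \<xi> \<partial>lborel)"
proof -
  have [measurable]: "f \<in> borel_measurable borel" using f by (auto dest: borel_measurable_integrable)
  show "(\<lambda>n. \<integral>\<^sup>+\<xi>. ennreal (exp (- (1 / real (Suc n)) * (norm \<xi>)\<^sup>2) * power_spectrum f \<xi>) \<partial>lborel) \<longlonglongrightarrow>
    (\<integral>\<^sup>+\<xi>. ennreal (power_spectrum f \<xi>) \<partial>lborel)"
  proof (rule nn_integral_LIMSEQ)
    have "1 / real (Suc n) * (norm \<xi>)\<^sup>2 \<le> 1 / real (Suc m) * (norm \<xi>)\<^sup>2" if "m \<le> n" for m n and \<xi> :: 'a
      using that by (intro mult_right_mono divide_left_mono) auto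
    then show "incseq (\<lambda>n \<xi>. ennreal (exp (- (1 / real (Suc n)) * (norm \<xi>)\<^sup>2) * power_spectrum f \<xi>))"
      by (auto simp: incseq_def le_fun_def intro!: ennreal_leI mult_right_mono)
    show "(\<lambda>n. ennreal (exp (- (1 / real (Suc n)) * (norm \<xi>)\<^sup>2) * power_spectrum f \<xi>)) \<longlonglongrightarrow> ennreal (power_spectrum f \<xi>)" for \<xi>
    proof -
      have "(\<lambda>n. 1 / real (Suc n)) \<longlonglongrightarrow> 0" using LIMSEQ_inverse_real_of_nat by (simp add: inverse_eq_divide)
      then have "(\<lambda>n. exp (- (1 / real (Suc n)) * (norm \<xi>)\<^sup>2) * power_spectrum f \<xi>) \<longlonglongrightarrow> exp (- 0 * (norm \<xi>)\<^sup>2) * power_spectrum f \<xi>"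
        by (intro tendsto_intros)
      then show ?thesis by (intro tendsto_ennrealI) simp
    qed
  qed measurable
  define M where "M = (\<integral>x. \<bar>f x\<bar> \<partial>lborel)"
  have P: "\<bar>power_spectrum f \<xi>\<bar> \<le> M\<^sup>2 + M\<^sup>2" for \<xi>
    using power_mono[OF abs_transform_le(1)[OF f, of \<xi>], of 2] power_mono[OF abs_transform_le(2)[OF f, of \<xi>], of 2]
    by (simp add: power_spectrum_def M_def)
  have "integrable lborel (\<lambda>\<xi>. exp (- (1 / real (Suc n)) * (norm \<xi>)\<^sup>2) * power_spectrum f \<xi>)"
  proof (rule Bochner_Integration.integrable_bound)
    show "integrable lborel (\<lambda>\<xi>::'a. exp (- (1 / real (Suc n)) * (norm \<xi>)\<^sup>2) * (M\<^sup>2 + M\<^sup>2))"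
      by (intro integrable_mult_left gaussian_fourier(1)) simp
    show "AE \<xi>::'a in lborel. norm (exp (- (1 / real (Suc n)) * (norm \<xi>)\<^sup>2) * power_spectrum f \<xi>)
        \<le> norm (exp (- (1 / real (Suc n)) * (norm \<xi>)\<^sup>2) * (M\<^sup>2 + M\<^sup>2))"
      using P by (intro AE_I2) (auto simp: abs_mult intro!: mult_left_mono)
  qed measurable
  then show "(\<integral>\<^sup>+\<xi>. ennreal (exp (- (1 / real (Suc n)) * (norm \<xi>)\<^sup>2) * power_spectrum f \<xi>) \<partial>lborel) =
      ennreal (\<integral>\<xi>. exp (- (1 / real (Suc n)) * (norm \<xi>)\<^sup>2) * power_spectrum f \<xi> \<partial>lborel)"
    by (intro nn_integral_eq_integral) auto
qed

text \<open>The defect in the Gaussian identity is nonnegative, and monotone convergence removes the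
  damping. No seminorm enters, so the bound also applies to a cut-off times an
  eigenfunction.\<close>

lemma power_spectrum_integral_le:
  fixes f :: "'a::euclidean_space \<Rightarrow> real"
  assumes f: "integrable lborel f" and f2: "integrable lborel (\<lambda>x. (f x)\<^sup>2)"
  shows "(\<integral>\<^sup>+\<xi>. ennreal (power_spectrum f \<xi>) \<partial>lborel) \<le> ennreal ((2 * pi) ^ DIM('a) * (\<integral>x. (f x)\<^sup>2 \<partial>lborel))"
proof (rule LIMSEQ_le_const2[OF gaussian_power_spectrum_limit(1)[OF f]])
  have "(\<integral>\<xi>. exp (- (1 / real (Suc n)) * (norm \<xi>)\<^sup>2) * power_spectrum f \<xi> \<partial>lborel) \<le> (2 * pi) ^ DIM('a) * (\<integral>x. (f x)\<^sup>2 \<partial>lborel)" for n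
  proof -
    have "0 \<le> (\<integral>(x, y). (f x - f y)\<^sup>2 * heat_kernel (1 / real (Suc n)) (x - y) \<partial>(lborel \<Otimes>\<^sub>M lborel))"
      by (intro Bochner_Integration.integral_nonneg) auto
    then show ?thesis using gaussian_power_spectrum_identity(2)[OF f f2, of "1 / real (Suc n)"] by simp
  qed
  then show "\<exists>N. \<forall>n\<ge>N. (\<integral>\<^sup>+\<xi>. ennreal (exp (- (1 / real (Suc n)) * (norm \<xi>)\<^sup>2) * power_spectrum f \<xi>) \<partial>lborel) \<le>
      ennreal ((2 * pi) ^ DIM('a) * (\<integral>x. (f x)\<^sup>2 \<partial>lborel))"
    unfolding gaussian_power_spectrum_limit(2)[OF f] by (intro exI allI impI ennreal_leI)
qed

text \<open>With \<open>w = (norm z)\<^sup>2 / (4 * r)\<close> the quotient of the two kernels is a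
  multiple of \<open>r powr s\<close> times \<open>w powr \<alpha> * exp (- w)\<close>, and the
  latter is at most \<open>\<alpha> powr \<alpha>\<close>. The remaining \<open>r powr s\<close>
  makes the Plancherel defect vanish as \<open>r\<close> tends to 0.\<close>

lemma heat_kernel_le_riesz_kernel:
  fixes z :: "'a::euclidean_space"
  assumes s: "0 < s" and r: "r > 0" and z: "z \<noteq> 0"
  defines "\<alpha> \<equiv> real DIM('a) / 2 + s"
  shows "heat_kernel r z \<le> pi powr (real DIM('a) / 2) * (4 * \<alpha>) powr \<alpha> * r powr s * riesz_kernel s z"
proof -
  let ?N = "real DIM('a)"
  have \<alpha>: "\<alpha> > 0" using s by (simp add: \<alpha>_def add_nonneg_pos)
  define w where "w = (norm z)\<^sup>2 / (4 * r)"
  have w: "w > 0" using z r by (simp add: w_def)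
  have n2: "norm z powr (?N + 2 * s) = (4 * r * w) powr \<alpha>"
  proof -
    have "4 * r * w = norm z powr 2" using z r by (simp add: w_def)
    moreover have "2 * \<alpha> = ?N + 2 * s" by (simp add: \<alpha>_def)
    ultimately show ?thesis by (simp only: powr_powr)
  qed
  have "w powr \<alpha> * exp (- w) \<le> \<alpha> powr \<alpha>"
  proof -
    have "w / \<alpha> \<le> exp (w / \<alpha>)" using exp_ge_add_one_self[of "w / \<alpha>"] by linarith
    then have "w \<le> \<alpha> * exp (w / \<alpha>)" using \<alpha> by (simp add: field_simps)
    then have "w powr \<alpha> \<le> (\<alpha> * exp (w / \<alpha>)) powr \<alpha>" using w \<alpha> by (intro powr_mono2) auto
    also have "\<dots> = \<alpha> powr \<alpha> * exp w" using \<alpha> by (simp add: powr_mult powr_def[of "exp (w / \<alpha>)"])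
    finally show ?thesis by (simp add: exp_minus divide_simps)
  qed
  then have "(pi / r) powr (?N / 2) * (4 * r) powr \<alpha> * (w powr \<alpha> * exp (- w)) \<le> (pi / r) powr (?N / 2) * (4 * r) powr \<alpha> * \<alpha> powr \<alpha>"
    by (intro mult_left_mono) auto
  moreover have "(pi / r) powr (?N / 2) * (4 * r) powr \<alpha> * (w powr \<alpha> * exp (- w)) = heat_kernel r z * norm z powr (?N + 2 * s)"
  proof -
    have "exp (- (norm z)\<^sup>2 / (4 * r)) = exp (- w)" by (simp add: w_def)
    moreover have "(4 * r * w) powr \<alpha> = (4 * r) powr \<alpha> * w powr \<alpha>" using r w by (simp add: powr_mult)
    ultimately show ?thesis unfolding n2 heat_kernel_def by simp
  qed
  moreover have "(pi / r) powr (?N / 2) * (4 * r) powr \<alpha> * \<alpha> powr \<alpha> = pi powr (?N / 2) * (4 * \<alpha>) powr \<alpha> * r powr s"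
  proof -
    have "r powr \<alpha> = r powr (?N / 2) * r powr s" by (simp add: \<alpha>_def powr_add)
    then show ?thesis using r \<alpha> by (simp add: powr_divide powr_mult)
  qed
  ultimately have "heat_kernel r z * norm z powr (?N + 2 * s) \<le> pi powr (?N / 2) * (4 * \<alpha>) powr \<alpha> * r powr s" by simp
  moreover have "norm z powr (?N + 2 * s) > 0" using z by simp
  ultimately show ?thesis by (simp add: riesz_kernel_def pos_le_divide_eq)
qed

text \<open>A finite seminorm gives the defect the explicit rate \<open>r powr s\<close>; this
  replaces the usual argument by continuity of translations in \<open>L^2\<close>.\<close>

lemma power_spectrum_integral_ge:
  fixes f :: "'a::euclidean_space \<Rightarrow> real"
  assumes f: "integrable lborel f" and f2: "integrable lborel (\<lambda>x. (f x)\<^sup>2)" and s: "0 < s"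
    and G: "integrable (lborel \<Otimes>\<^sub>M lborel) (\<lambda>(x, y). (f x - f y)\<^sup>2 * riesz_kernel s (x - y))"
  shows "ennreal ((2 * pi) ^ DIM('a) * (\<integral>x. (f x)\<^sup>2 \<partial>lborel)) \<le> (\<integral>\<^sup>+\<xi>. ennreal (power_spectrum f \<xi>) \<partial>lborel)"
proof (rule LIMSEQ_le[OF _ gaussian_power_spectrum_limit(1)[OF f]])
  define c where "c = pi powr (real DIM('a) / 2) * (4 * (real DIM('a) / 2 + s)) powr (real DIM('a) / 2 + s)"
  define I where "I = (\<integral>(x, y). (f x - f y)\<^sup>2 * riesz_kernel s (x - y) \<partial>(lborel \<Otimes>\<^sub>M lborel))"
  let ?V = "(2 * pi) ^ DIM('a) * (\<integral>x. (f x)\<^sup>2 \<partial>lborel)"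
  let ?r = "\<lambda>n. 1 / real (Suc n)"
  have le: "(\<integral>(x, y). (f x - f y)\<^sup>2 * heat_kernel r (x - y) \<partial>(lborel \<Otimes>\<^sub>M lborel)) \<le> c * r powr s * I" if r: "r > 0" for r
  proof -
    have "(\<integral>(x, y). (f x - f y)\<^sup>2 * heat_kernel r (x - y) \<partial>(lborel \<Otimes>\<^sub>M lborel)) \<le>
        (\<integral>p. c * r powr s * (case p of (x, y) \<Rightarrow> (f x - f y)\<^sup>2 * riesz_kernel s (x - y)) \<partial>(lborel \<Otimes>\<^sub>M lborel))"
    proof (intro integral_mono gaussian_power_spectrum_identity(1)[OF f f2 r] integrable_mult_right G)
      fix p :: "'a \<times> 'a"
      obtain x y where p: "p = (x, y)" by (cases p)
      show "(case p of (x, y) \<Rightarrow> (f x - f y)\<^sup>2 * heat_kernel r (x - y)) \<le> c * r powr s * (case p of (x, y) \<Rightarrow> (f x - f y)\<^sup>2 * riesz_kernel s (x - y))"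
      proof (cases "x = y")
        case False
        then have "(f x - f y)\<^sup>2 * heat_kernel r (x - y) \<le> (f x - f y)\<^sup>2 * (c * r powr s * riesz_kernel s (x - y))"
          using heat_kernel_le_riesz_kernel[OF s r, of "x - y"] by (intro mult_left_mono) (auto simp: c_def)
        then show ?thesis by (simp add: p mult_ac)
      qed (simp add: p)
    qed
    then show ?thesis by (simp add: I_def)
  qed
  have "(\<lambda>n. ?r n powr s) \<longlonglongrightarrow> 0"
  proof -
    have "(\<lambda>n. ?r n) \<longlonglongrightarrow> 0" using LIMSEQ_inverse_real_of_nat by (simp add: inverse_eq_divide)
    from tendsto_powr'[OF this tendsto_const, of s] s show ?thesis by simp
  qed
  then have "(\<lambda>n. ?V - c * ?r n powr s * I / 2) \<longlonglongrightarrow> ?V - c * 0 * I / 2"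
    by (intro tendsto_intros) simp_all
  then show "(\<lambda>n. ennreal (?V - c * ?r n powr s * I / 2)) \<longlonglongrightarrow> ennreal ?V"
    by (intro tendsto_ennrealI) simp
  have "?V - c * ?r n powr s * I / 2 \<le> (\<integral>\<xi>. exp (- ?r n * (norm \<xi>)\<^sup>2) * power_spectrum f \<xi> \<partial>lborel)" for n
    using gaussian_power_spectrum_identity(2)[OF f f2, of "?r n"] le[of "?r n"] by simp
  then show "\<exists>N. \<forall>n\<ge>N. ennreal (?V - c * ?r n powr s * I / 2) \<le> (\<integral>\<^sup>+\<xi>. ennreal (exp (- ?r n * (norm \<xi>)\<^sup>2) * power_spectrum f \<xi>) \<partial>lborel)"
    unfolding gaussian_power_spectrum_limit(2)[OF f] by (intro exI allI impI ennreal_leI)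
qed

lemma power_spectrum_translate_diff:
  fixes f :: "'a::euclidean_space \<Rightarrow> real"
  assumes f: "integrable lborel f"
  shows "power_spectrum (\<lambda>x. f (x + z) - f x) \<xi> = 2 * (1 - cos (\<xi> \<bullet> z)) * power_spectrum f \<xi>"
proof -
  have [measurable]: "f \<in> borel_measurable borel" using f by (auto dest: borel_measurable_integrable)
  let ?A = "cos_transform f \<xi>" and ?B = "sin_transform f \<xi>" and ?c = "cos (\<xi> \<bullet> z)" and ?s = "sin (\<xi> \<bullet> z)"
  have fz: "integrable lborel (\<lambda>x. f (x + z))" using f by (simp add: integral_translate(2)[of f z])
  have c: "(\<integral>x. f (x + z) * cos (\<xi> \<bullet> x) \<partial>lborel) = ?c * ?A + ?s * ?B"
  proof -
    have "(\<integral>x. f (x + z) * cos (\<xi> \<bullet> x) \<partial>lborel) = (\<integral>x. f x * cos (\<xi> \<bullet> (x - z)) \<partial>lborel)"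
      using integral_translate(1)[of "\<lambda>x. f x * cos (\<xi> \<bullet> (x - z))" z] by simp
    also have "\<dots> = (\<integral>x. ?c * (f x * cos (\<xi> \<bullet> x)) + ?s * (f x * sin (\<xi> \<bullet> x)) \<partial>lborel)"
      by (simp add: inner_diff_right cos_diff algebra_simps)
    also have "\<dots> = ?c * ?A + ?s * ?B"
      by (subst Bochner_Integration.integral_add) (simp_all add: integrable_trig[OF f] cos_transform_def sin_transform_def)
    finally show ?thesis .
  qed
  have s: "(\<integral>x. f (x + z) * sin (\<xi> \<bullet> x) \<partial>lborel) = ?c * ?B - ?s * ?A"
  proof -
    have "(\<integral>x. f (x + z) * sin (\<xi> \<bullet> x) \<partial>lborel) = (\<integral>x. f x * sin (\<xi> \<bullet> (x - z)) \<partial>lborel)"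
      using integral_translate(1)[of "\<lambda>x. f x * sin (\<xi> \<bullet> (x - z))" z] by simp
    also have "\<dots> = (\<integral>x. ?c * (f x * sin (\<xi> \<bullet> x)) - ?s * (f x * cos (\<xi> \<bullet> x)) \<partial>lborel)"
      by (simp add: inner_diff_right sin_diff algebra_simps)
    also have "\<dots> = ?c * ?B - ?s * ?A"
      by (subst Bochner_Integration.integral_diff) (simp_all add: integrable_trig[OF f] cos_transform_def sin_transform_def)
    finally show ?thesis .
  qed
  have "cos_transform (\<lambda>x. f (x + z) - f x) \<xi> = ?c * ?A + ?s * ?B - ?A"
    unfolding cos_transform_def[of "\<lambda>x. f (x + z) - f x"] left_diff_distrib
    by (subst Bochner_Integration.integral_diff) (simp_all add: integrable_trig[OF f] integrable_trig[OF fz] c cos_transform_def)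
  moreover have "sin_transform (\<lambda>x. f (x + z) - f x) \<xi> = ?c * ?B - ?s * ?A - ?B"
    unfolding sin_transform_def[of "\<lambda>x. f (x + z) - f x"] left_diff_distrib
    by (subst Bochner_Integration.integral_diff) (simp_all add: integrable_trig[OF f] integrable_trig[OF fz] s sin_transform_def)
  moreover have "(c * A + s * B - A)\<^sup>2 + (c * B - s * A - B)\<^sup>2 = ((c\<^sup>2 + s\<^sup>2) + 1 - 2 * c) * (A\<^sup>2 + B\<^sup>2)" for c s A B :: real
    by (simp add: power2_eq_square algebra_simps)
  moreover have "?c\<^sup>2 + ?s\<^sup>2 = 1" by simp
  ultimately show ?thesis by (simp add: power_spectrum_def)
qed

definition gagliardo :: "real \<Rightarrow> ('a::euclidean_space \<Rightarrow> real) \<Rightarrow> ennreal" where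
  "gagliardo s f = (\<integral>\<^sup>+(x, y). ennreal ((f x - f y)\<^sup>2 * riesz_kernel s (x - y)) \<partial>(lborel \<Otimes>\<^sub>M lborel))"

text \<open>The difference \<open>f(x+z) - f(x)\<close> multiplies the power spectrum by $2(1-\cos\xi z)$; integrating
  Plancherel's inequality for it against the kernel produces $|\xi|^{2s}$.\<close>

lemma power_spectrum_gagliardo:
  fixes f :: "'a::euclidean_space \<Rightarrow> real"
  assumes f: "integrable lborel f" and f2: "integrable lborel (\<lambda>x. (f x)\<^sup>2)" and s: "0 < s" "s < 1"
  shows "(\<integral>\<^sup>+\<xi>. ennreal (norm \<xi> powr (2 * s) * power_spectrum f \<xi>) \<partial>lborel) \<le>
    ennreal ((2 * pi) ^ DIM('a) * (frac_const DIM('a) s / 2)) * gagliardo s f"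
proof -
  have [measurable]: "f \<in> borel_measurable borel" using f by (auto dest: borel_measurable_integrable)
  let ?K = "(2 * pi) ^ DIM('a)" and ?C = "frac_const DIM('a) s" and ?k = "riesz_kernel s :: 'a \<Rightarrow> real"
  have C: "?C > 0" using s by (intro frac_const_pos) auto
  have c1: "0 \<le> 1 - cos x" for x :: real by simp
  have diff: "(\<integral>\<^sup>+\<xi>. ennreal (2 * (1 - cos (\<xi> \<bullet> z)) * power_spectrum f \<xi>) \<partial>lborel) \<le> ennreal ?K * (\<integral>\<^sup>+x. ennreal ((f (x + z) - f x)\<^sup>2) \<partial>lborel)" for z
  proof -
    have fz: "integrable lborel (\<lambda>x. f (x + z))" using f by (simp add: integral_translate(2)[of f z])
    have fz2: "integrable lborel (\<lambda>x. (f (x + z))\<^sup>2)" using f2 by (simp add: integral_translate(2)[of "\<lambda>x. (f x)\<^sup>2" z])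
    have i2: "integrable lborel (\<lambda>x. (f (x + z) - f x)\<^sup>2)"
      using square_integrable_diff[of "\<lambda>x. f (x + z)" f] fz2 f2 by (auto simp: square_integrable_def)
    have "(\<integral>\<^sup>+\<xi>. ennreal (power_spectrum (\<lambda>x. f (x + z) - f x) \<xi>) \<partial>lborel) \<le> ennreal (?K * (\<integral>x. (f (x + z) - f x)\<^sup>2 \<partial>lborel))"
      using f fz i2 by (intro power_spectrum_integral_le) auto
    also have "\<dots> = ennreal ?K * (\<integral>\<^sup>+x. ennreal ((f (x + z) - f x)\<^sup>2) \<partial>lborel)"
      using i2 by (simp add: nn_integral_eq_integral ennreal_mult)
    finally show ?thesis by (simp add: power_spectrum_translate_diff[OF f])
  qed
  have "(\<integral>\<^sup>+\<xi>. (\<integral>\<^sup>+z. ennreal (2 * (1 - cos (\<xi> \<bullet> z)) * power_spectrum f \<xi>) * ennreal (?k z) \<partial>lborel) \<partial>lborel) =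
      (\<integral>\<^sup>+z. (\<integral>\<^sup>+\<xi>. ennreal (2 * (1 - cos (\<xi> \<bullet> z)) * power_spectrum f \<xi>) * ennreal (?k z) \<partial>lborel) \<partial>lborel)"
    by (rule lborel_pair.Fubini'[symmetric]) measurable
  also have "\<dots> \<le> (\<integral>\<^sup>+z. ennreal ?K * (\<integral>\<^sup>+x. ennreal ((f (x + z) - f x)\<^sup>2 * ?k z) \<partial>lborel) \<partial>lborel)"
  proof (intro nn_integral_mono)
    fix z :: 'a
    have "(\<integral>\<^sup>+\<xi>. ennreal (2 * (1 - cos (\<xi> \<bullet> z)) * power_spectrum f \<xi>) * ennreal (?k z) \<partial>lborel) =
        (\<integral>\<^sup>+\<xi>. ennreal (2 * (1 - cos (\<xi> \<bullet> z)) * power_spectrum f \<xi>) \<partial>lborel) * ennreal (?k z)"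
      by (intro nn_integral_multc) measurable
    also have "\<dots> \<le> ennreal ?K * (\<integral>\<^sup>+x. ennreal ((f (x + z) - f x)\<^sup>2) \<partial>lborel) * ennreal (?k z)"
      by (intro mult_right_mono diff) simp
    also have "\<dots> = ennreal ?K * (\<integral>\<^sup>+x. ennreal ((f (x + z) - f x)\<^sup>2) * ennreal (?k z) \<partial>lborel)"
      unfolding mult.assoc by (subst nn_integral_multc) auto
    also have "(\<integral>\<^sup>+x. ennreal ((f (x + z) - f x)\<^sup>2) * ennreal (?k z) \<partial>lborel) = (\<integral>\<^sup>+x. ennreal ((f (x + z) - f x)\<^sup>2 * ?k z) \<partial>lborel)"
      by (simp add: ennreal_mult')
    finally show "(\<integral>\<^sup>+\<xi>. ennreal (2 * (1 - cos (\<xi> \<bullet> z)) * power_spectrum f \<xi>) * ennreal (?k z) \<partial>lborel) \<le>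
        ennreal ?K * (\<integral>\<^sup>+x. ennreal ((f (x + z) - f x)\<^sup>2 * ?k z) \<partial>lborel)" .
  qed
  also have "\<dots> = ennreal ?K * (\<integral>\<^sup>+z. (\<integral>\<^sup>+x. ennreal ((f (x + z) - f x)\<^sup>2 * ?k z) \<partial>lborel) \<partial>lborel)"
    by (intro nn_integral_cmult) measurable
  also have "(\<integral>\<^sup>+z. (\<integral>\<^sup>+x. ennreal ((f (x + z) - f x)\<^sup>2 * ?k z) \<partial>lborel) \<partial>lborel) =
      (\<integral>\<^sup>+x. (\<integral>\<^sup>+z. ennreal ((f (x + z) - f x)\<^sup>2 * ?k z) \<partial>lborel) \<partial>lborel)"
    by (rule lborel_pair.Fubini') measurable
  also have "\<dots> = (\<integral>\<^sup>+x. (\<integral>\<^sup>+y. ennreal ((f x - f y)\<^sup>2 * ?k (x - y)) \<partial>lborel) \<partial>lborel)"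
  proof (rule nn_integral_cong)
    fix x :: 'a
    have "(\<integral>\<^sup>+z. ennreal ((f (x + z) - f x)\<^sup>2 * ?k (x + z - x)) \<partial>lborel) = (\<integral>\<^sup>+y. ennreal ((f y - f x)\<^sup>2 * ?k (y - x)) \<partial>lborel)"
      by (rule nn_integral_translate) measurable
    moreover have "(f y - f x)\<^sup>2 * ?k (y - x) = (f x - f y)\<^sup>2 * ?k (x - y)" for y
      using riesz_kernel_minus[of s "x - y"] by (simp add: power2_commute)
    ultimately show "(\<integral>\<^sup>+z. ennreal ((f (x + z) - f x)\<^sup>2 * ?k z) \<partial>lborel) = (\<integral>\<^sup>+y. ennreal ((f x - f y)\<^sup>2 * ?k (x - y)) \<partial>lborel)"
      by simp
  qed
  also have "\<dots> = gagliardo s f"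
    unfolding gagliardo_def by (subst lborel.nn_integral_fst[symmetric]) auto
  finally have le: "(\<integral>\<^sup>+\<xi>. (\<integral>\<^sup>+z. ennreal (2 * (1 - cos (\<xi> \<bullet> z)) * power_spectrum f \<xi>) * ennreal (?k z) \<partial>lborel) \<partial>lborel)
     \<le> ennreal ?K * gagliardo s f" .
  \<comment> \<open>The translated difference contributes the factor 2 and the kernel integral the
    factor \<open>1 / ?C\<close>, which together explain the normalisation
    \<open>?C / 2\<close>.\<close>
  have "(\<integral>\<^sup>+\<xi>. ennreal (norm \<xi> powr (2 * s) * power_spectrum f \<xi>) \<partial>lborel) =
      (\<integral>\<^sup>+\<xi>. ennreal (?C / 2) * (\<integral>\<^sup>+z. ennreal (2 * (1 - cos (\<xi> \<bullet> z)) * power_spectrum f \<xi>) * ennreal (?k z) \<partial>lborel) \<partial>lborel)"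
  proof (intro nn_integral_cong)
    fix \<xi> :: 'a
    have "(\<integral>\<^sup>+z. ennreal (2 * (1 - cos (\<xi> \<bullet> z)) * power_spectrum f \<xi>) * ennreal (?k z) \<partial>lborel) =
       (\<integral>\<^sup>+z. ennreal (2 * power_spectrum f \<xi>) * ennreal ((1 - cos (\<xi> \<bullet> z)) * ?k z) \<partial>lborel)"
      by (intro nn_integral_cong) (simp add: ennreal_mult'[symmetric] mult_ac)
    also have "\<dots> = ennreal (2 * power_spectrum f \<xi>) * ennreal (norm \<xi> powr (2 * s) / ?C)"
      by (subst nn_integral_cmult) (simp_all add: nn_integral_riesz_kernel[OF s])
    finally show "ennreal (norm \<xi> powr (2 * s) * power_spectrum f \<xi>) =
        ennreal (?C / 2) * (\<integral>\<^sup>+z. ennreal (2 * (1 - cos (\<xi> \<bullet> z)) * power_spectrum f \<xi>) * ennreal (?k z) \<partial>lborel)"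
      using C by (simp add: ennreal_mult'[symmetric] mult_ac)
  qed
  also have "\<dots> = ennreal (?C / 2) * (\<integral>\<^sup>+\<xi>. (\<integral>\<^sup>+z. ennreal (2 * (1 - cos (\<xi> \<bullet> z)) * power_spectrum f \<xi>) * ennreal (?k z) \<partial>lborel) \<partial>lborel)"
    by (intro nn_integral_cmult) measurable
  also have "\<dots> \<le> ennreal (?C / 2) * (ennreal ?K * gagliardo s f)"
    by (intro mult_left_mono le) simp
  also have "\<dots> = ennreal (?K * (?C / 2)) * gagliardo s f"
  proof -
    have "ennreal (?K * (?C / 2)) = ennreal (?C / 2) * ennreal ?K"
      using C by (subst mult.commute, intro ennreal_mult) simp_all
    then show ?thesis by (simp only: mult.assoc)
  qed
  finally show ?thesis .
qed

section \<open>The space of square-integrable functions\<close>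

lemma square_integrable_rep: "square_integrable (rep_l2 u)"
  using Quotient3_rep_reflp[OF Quotient3_l2, of u] by simp

lemma abs_rep_l2 [simp]: "abs_l2 (rep_l2 u) = u"
  by (rule Quotient3_abs_rep[OF Quotient3_l2])

lemma rep_abs_l2: "square_integrable f \<Longrightarrow> AE x in lborel. rep_l2 (abs_l2 f) x = f x"
  using rep_abs_rsp_left[OF Quotient3_l2, of f f] by simp

lemma borel_measurable_rep_l2 [measurable]: "rep_l2 u \<in> borel_measurable borel"
  using square_integrable_rep[of u] by (simp add: square_integrable_def)

lemma integrable_rep_square: "integrable lborel (\<lambda>x. (rep_l2 u x)\<^sup>2)"
  using square_integrable_rep[of u] by (simp add: square_integrable_def)

lemma rep_add: "AE x in lborel. rep_l2 (u + v) x = rep_l2 u x + rep_l2 v x"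
  using rep_abs_l2[OF square_integrable_add[OF square_integrable_rep[of u] square_integrable_rep[of v]]]
    plus_l2.abs_eq[of "rep_l2 u" "rep_l2 v"] by (simp add: square_integrable_rep eq_onp_def)

lemma rep_diff: "AE x in lborel. rep_l2 (u - v) x = rep_l2 u x - rep_l2 v x"
  using rep_abs_l2[OF square_integrable_diff[OF square_integrable_rep[of u] square_integrable_rep[of v]]]
    minus_l2.abs_eq[of "rep_l2 u" "rep_l2 v"] by (simp add: square_integrable_rep eq_onp_def)

lemma rep_scaleR: "AE x in lborel. rep_l2 (c *\<^sub>R u) x = c * rep_l2 u x"
  using rep_abs_l2[OF square_integrable_scale[OF square_integrable_rep[of u], of c]]
    scaleR_l2.abs_eq[of "rep_l2 u" c] by (simp add: square_integrable_rep eq_onp_def)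

lemma rep_zero: "AE x in lborel. rep_l2 0 x = 0"
  using rep_abs_l2[OF square_integrable_zero] by (simp add: zero_l2.abs_eq)

lemma inner_rep: "inner u v = (\<integral>x. rep_l2 u x * rep_l2 v x \<partial>lborel)"
  using inner_l2.abs_eq[of "rep_l2 u" "rep_l2 v"] by (simp add: square_integrable_rep eq_onp_def)

lemma inner_abs_left:
  assumes f: "square_integrable f"
  shows "inner (abs_l2 f) u = (\<integral>x. f x * rep_l2 u x \<partial>lborel)"
  using inner_l2.abs_eq[of f "rep_l2 u"] f by (simp add: square_integrable_rep eq_onp_def)

lemma inner_abs_right: "square_integrable f \<Longrightarrow> inner u (abs_l2 f) = (\<integral>x. rep_l2 u x * f x \<partial>lborel)"
  using inner_abs_left[of f u] by (simp add: inner_commute mult.commute)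

lemma inner_abs:
  assumes "square_integrable f" "square_integrable g"
  shows "inner (abs_l2 f) (abs_l2 g) = (\<integral>x. f x * g x \<partial>lborel)"
  using inner_l2.abs_eq[of f g] assms by (simp add: eq_onp_def)

lemma norm_square_rep: "(norm u)\<^sup>2 = (\<integral>x. (rep_l2 u x)\<^sup>2 \<partial>lborel)"
  by (simp only: power2_norm_eq_inner inner_rep) (simp add: power2_eq_square)

lemma norm_square_diff: "(norm (u - v))\<^sup>2 = (\<integral>x. (rep_l2 u x - rep_l2 v x)\<^sup>2 \<partial>lborel)"
  unfolding norm_square_rep
  by (rule integral_cong_AE) (use rep_diff[of u v] in \<open>auto elim: eventually_mono\<close>)

lemma integrable_square_diff: "integrable lborel (\<lambda>x. (rep_l2 u x - rep_l2 v x)\<^sup>2)"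
  using square_integrable_diff[OF square_integrable_rep[of u] square_integrable_rep[of v]]
  by (simp add: square_integrable_def)

lemma nn_integral_square_diff:
  "(\<integral>\<^sup>+x. ennreal ((rep_l2 u x - rep_l2 v x)\<^sup>2) \<partial>lborel) = ennreal ((norm (u - v))\<^sup>2)"
  unfolding norm_square_diff by (rule nn_integral_eq_integral[OF integrable_square_diff]) simp

lemma l2_eqI:
  fixes u v :: "'a::euclidean_space l2"
  shows "AE x in lborel. rep_l2 u x = rep_l2 v x \<Longrightarrow> u = v"
proof -
  assume eq: "AE x in lborel. rep_l2 u x = rep_l2 v x"
  have "(norm (u - v))\<^sup>2 = (\<integral>(x::'a). 0 \<partial>lborel)"
    unfolding norm_square_diff by (rule integral_cong_AE) (use eq in \<open>auto elim: eventually_mono\<close>)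
  then show "u = v" by simp
qed

lemma l2_limit_AE_subseq:
  fixes X :: "nat \<Rightarrow> 'a::euclidean_space l2"
  assumes "X \<longlonglongrightarrow> u"
  obtains r where "strict_mono r" "AE x in lborel. (\<lambda>n. rep_l2 (X (r n)) x) \<longlonglongrightarrow> rep_l2 u x"
proof -
  have "(\<lambda>n. (norm (X n - u))\<^sup>2) \<longlonglongrightarrow> 0\<^sup>2"
    using assms by (intro tendsto_power) (simp add: LIM_zero tendsto_norm_zero)
  then have "(\<lambda>n. \<integral>x. norm ((rep_l2 (X n) x - rep_l2 u x)\<^sup>2) \<partial>lborel) \<longlonglongrightarrow> 0"
    by (simp add: norm_square_diff)
  from tendsto_L1_AE_subseq[OF integrable_square_diff this]
  obtain r where r: "strict_mono r" "AE x in lborel. (\<lambda>n. (rep_l2 (X (r n)) x - rep_l2 u x)\<^sup>2) \<longlonglongrightarrow> 0"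
    by blast
  from r(2) have "AE x in lborel. (\<lambda>n. rep_l2 (X (r n)) x) \<longlonglongrightarrow> rep_l2 u x"
  proof eventually_elim
    fix x assume "(\<lambda>n. (rep_l2 (X (r n)) x - rep_l2 u x)\<^sup>2) \<longlonglongrightarrow> 0"
    then have "(\<lambda>n. sqrt ((rep_l2 (X (r n)) x - rep_l2 u x)\<^sup>2)) \<longlonglongrightarrow> sqrt 0" by (rule tendsto_real_sqrt)
    then show "(\<lambda>n. rep_l2 (X (r n)) x) \<longlonglongrightarrow> rep_l2 u x" by (simp add: tendsto_rabs_zero_iff LIM_zero_iff)
  qed
  with r(1) show ?thesis by (rule that)
qed

text \<open>The rate \<open>1 / 8\<close> leaves room for the weight \<open>4 ^ n\<close>: the
  weighted squares still have integrals at most \<open>(1 / 2) ^ n\<close>, so almost everywhere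
  they tend to 0, and the increments are eventually below \<open>(1 / 2) ^ n\<close>.\<close>

lemma fast_Cauchy_AE_convergent:
  fixes X :: "nat \<Rightarrow> 'a::euclidean_space l2"
  assumes X: "\<And>n. (norm (X (Suc n) - X n))\<^sup>2 \<le> (1 / 8) ^ n"
  shows "AE x in lborel. convergent (\<lambda>n. rep_l2 (X n) x)"
proof -
  let ?f = "\<lambda>n. rep_l2 (X n)"
  have "(\<integral>\<^sup>+x. (\<Sum>n. ennreal (4 ^ n * (?f (Suc n) x - ?f n x)\<^sup>2)) \<partial>lborel) =
      (\<Sum>n. \<integral>\<^sup>+x. ennreal (4 ^ n * (?f (Suc n) x - ?f n x)\<^sup>2) \<partial>lborel)"
    by (rule nn_integral_suminf) measurable
  also have "\<dots> \<le> (\<Sum>n. ennreal ((1 / 2) ^ n))"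
  proof (rule suminf_le)
    fix n
    have "(\<integral>\<^sup>+x. ennreal (4 ^ n * (?f (Suc n) x - ?f n x)\<^sup>2) \<partial>lborel) = ennreal (4 ^ n) * ennreal ((norm (X (Suc n) - X n))\<^sup>2)"
      unfolding nn_integral_square_diff[symmetric]
      by (subst nn_integral_cmult[symmetric]) (simp_all add: ennreal_mult)
    also have "\<dots> \<le> ennreal (4 ^ n * (1 / 8) ^ n)"
      using X[of n] by (subst ennreal_mult[symmetric]) (auto intro!: ennreal_leI)
    also have "(4::real) ^ n * (1 / 8) ^ n = (1 / 2) ^ n"
      by (subst power_mult_distrib[symmetric]) simp
    finally show "(\<integral>\<^sup>+x. ennreal (4 ^ n * (?f (Suc n) x - ?f n x)\<^sup>2) \<partial>lborel) \<le> ennreal ((1 / 2) ^ n)" .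
  qed auto
  also have "\<dots> = ennreal 2"
    using geometric_sums[of "1 / 2 :: real"] by (intro suminf_ennreal_eq) auto
  finally have "(\<integral>\<^sup>+x. (\<Sum>n. ennreal (4 ^ n * (?f (Suc n) x - ?f n x)\<^sup>2)) \<partial>lborel) \<noteq> \<infinity>"
    by (auto simp: top_unique)
  then have "AE x in lborel. (\<Sum>n. ennreal (4 ^ n * (?f (Suc n) x - ?f n x)\<^sup>2)) \<noteq> \<infinity>"
    by (intro nn_integral_PInf_AE) auto
  then show ?thesis
  proof eventually_elim
    fix x assume "(\<Sum>n. ennreal (4 ^ n * (?f (Suc n) x - ?f n x)\<^sup>2)) \<noteq> \<infinity>"
    then have "summable (\<lambda>n. 4 ^ n * (?f (Suc n) x - ?f n x)\<^sup>2)"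
      by (intro summable_suminf_not_top) auto
    then have "(\<lambda>n. 4 ^ n * (?f (Suc n) x - ?f n x)\<^sup>2) \<longlonglongrightarrow> 0" by (rule summable_LIMSEQ_zero)
    then have "eventually (\<lambda>n. 4 ^ n * (?f (Suc n) x - ?f n x)\<^sup>2 < 1) sequentially"
      by (rule order_tendstoD) simp
    then obtain N where N: "\<And>n. n \<ge> N \<Longrightarrow> 4 ^ n * (?f (Suc n) x - ?f n x)\<^sup>2 < 1"
      by (auto simp: eventually_sequentially)
    have "summable (\<lambda>n. ?f (Suc n) x - ?f n x)"
    proof (rule summable_comparison_test')
      show "summable (\<lambda>n. (1 / 2 :: real) ^ n)" by (rule summable_geometric) simp
      fix n assume n: "N \<le> n"
      have "(2 ^ n * \<bar>?f (Suc n) x - ?f n x\<bar>)\<^sup>2 = 4 ^ n * (?f (Suc n) x - ?f n x)\<^sup>2"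
      proof -
        have "(2 ^ n)\<^sup>2 = (4::real) ^ n" unfolding power2_eq_square power_mult_distrib[symmetric] by simp
        then show ?thesis by (simp only: power_mult_distrib power2_abs)
      qed
      with N[OF n] have "(2 ^ n * \<bar>?f (Suc n) x - ?f n x\<bar>)\<^sup>2 < 1\<^sup>2" by simp
      then have "2 ^ n * \<bar>?f (Suc n) x - ?f n x\<bar> < 1" by (rule power2_less_imp_less) simp
      then show "norm (?f (Suc n) x - ?f n x) \<le> (1 / 2) ^ n"
        by (simp add: power_divide field_simps)
    qed
    then have "convergent (\<lambda>n. ?f 0 x + (\<Sum>k<n. ?f (Suc k) x - ?f k x))"
      by (intro convergent_add convergent_const) (simp add: summable_iff_convergent)
    moreover have "(\<Sum>k<n. ?f (Suc k) x - ?f k x) = ?f n x - ?f 0 x" for n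
      by (rule sum_lessThan_telescope[of "\<lambda>n. ?f n x"])
    ultimately show "convergent (\<lambda>n. ?f n x)" by simp
  qed
qed

text \<open>A fast subsequence converges almost everywhere, and Fatou's lemma bounds its distance to
  the pointwise limit \<open>g\<close>. Where it diverges \<open>lim\<close> is an arbitrary value,
  but only on a null set.\<close>

instance l2 :: (euclidean_space) banach
proof
  fix X :: "nat \<Rightarrow> 'a l2" assume C: "Cauchy X"
  have "\<exists>N. \<forall>m\<ge>N. \<forall>n\<ge>N. norm (X m - X n) < sqrt ((1 / 8) ^ k)" for k
    using C unfolding Cauchy_iff by (meson real_sqrt_gt_zero zero_less_divide_1_iff zero_less_numeral zero_less_power)
  then obtain N where N: "\<And>k m n. m \<ge> N k \<Longrightarrow> n \<ge> N k \<Longrightarrow> norm (X m - X n) < sqrt ((1 / 8) ^ k)"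
    by metis
  \<comment> \<open>The sum dominates \<open>N k\<close>, and the extra \<open>k\<close> makes the
    indices strictly increasing.\<close>
  define r where "r k = (\<Sum>i\<le>k. N i) + k" for k
  have r: "strict_mono r" by (rule strict_monoI_Suc) (simp add: r_def)
  have rN: "r k \<ge> N k" for k using member_le_sum[of k "{..k}" N] by (simp add: r_def)
  have fast: "(norm (X (r (Suc k)) - X (r k)))\<^sup>2 \<le> (1 / 8) ^ k" for k
  proof -
    have "r (Suc k) \<ge> N k" using rN[of k] strict_mono_leD[OF r, of k "Suc k"] by simp
    then have "norm (X (r (Suc k)) - X (r k)) \<le> sqrt ((1 / 8) ^ k)" using N rN less_imp_le by blast
    then have "(norm (X (r (Suc k)) - X (r k)))\<^sup>2 \<le> (sqrt ((1 / 8) ^ k))\<^sup>2" by (rule power_mono) simp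
    then show ?thesis by simp
  qed
  let ?f = "\<lambda>n. rep_l2 (X (r n))"
  define g where "g x = lim (\<lambda>n. ?f n x)" for x
  have [measurable]: "g \<in> borel_measurable borel"
    unfolding g_def[abs_def] by (rule borel_measurable_lim_metric) measurable
  have lim: "AE x in lborel. (\<lambda>n. ?f n x) \<longlonglongrightarrow> g x"
    using fast_Cauchy_AE_convergent[of "\<lambda>n. X (r n)"] fast by (auto simp: g_def convergent_LIMSEQ_iff)
  have fatou: "(\<integral>\<^sup>+x. ennreal ((?f n x - g x)\<^sup>2) \<partial>lborel) \<le> ennreal ((1 / 8) ^ k)" if n: "r n \<ge> N k" for n k
  proof -
    have "(\<integral>\<^sup>+x. ennreal ((?f n x - g x)\<^sup>2) \<partial>lborel) = (\<integral>\<^sup>+x. liminf (\<lambda>m. ennreal ((?f n x - ?f m x)\<^sup>2)) \<partial>lborel)"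
    proof (rule nn_integral_cong_AE)
      from lim show "AE x in lborel. ennreal ((?f n x - g x)\<^sup>2) = liminf (\<lambda>m. ennreal ((?f n x - ?f m x)\<^sup>2))"
      proof eventually_elim
        fix x assume "(\<lambda>n. ?f n x) \<longlonglongrightarrow> g x"
        then have "(\<lambda>m. ennreal ((?f n x - ?f m x)\<^sup>2)) \<longlonglongrightarrow> ennreal ((?f n x - g x)\<^sup>2)"
          by (intro tendsto_ennrealI tendsto_intros)
        then show "ennreal ((?f n x - g x)\<^sup>2) = liminf (\<lambda>m. ennreal ((?f n x - ?f m x)\<^sup>2))"
          by (intro lim_imp_Liminf[symmetric]) auto
      qed
    qed
    also have "\<dots> \<le> liminf (\<lambda>m. \<integral>\<^sup>+x. ennreal ((?f n x - ?f m x)\<^sup>2) \<partial>lborel)"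
      by (rule nn_integral_liminf) measurable
    also have "\<dots> \<le> ennreal ((1 / 8) ^ k)"
    proof (rule Liminf_le)
      have "ennreal ((norm (X (r n) - X (r m)))\<^sup>2) \<le> ennreal ((1 / 8) ^ k)" if "m \<ge> N k" for m
      proof -
        have "norm (X (r n) - X (r m)) \<le> sqrt ((1 / 8) ^ k)"
          using N[OF n, of "r m"] seq_suble[OF r, of m] that by simp
        then have "(norm (X (r n) - X (r m)))\<^sup>2 \<le> (sqrt ((1 / 8) ^ k))\<^sup>2" by (rule power_mono) simp
        then show ?thesis by (intro ennreal_leI) simp
      qed
      then show "\<forall>\<^sub>F m in sequentially. (\<integral>\<^sup>+x. ennreal ((?f n x - ?f m x)\<^sup>2) \<partial>lborel) \<le> ennreal ((1 / 8) ^ k)"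
        unfolding nn_integral_square_diff eventually_sequentially by blast
    qed simp
    finally show ?thesis .
  qed
  have sq: "square_integrable (\<lambda>x. ?f n x - g x)" if "r n \<ge> N k" for n k
    using fatou[OF that] by (auto simp: square_integrable_def integrable_iff_bounded intro: le_less_trans)
  have "square_integrable (\<lambda>x. ?f 0 x - (?f 0 x - g x))"
    by (intro square_integrable_diff square_integrable_rep sq[OF rN])
  then have g: "square_integrable g" by simp
  have "(\<lambda>n. X (r n)) \<longlonglongrightarrow> abs_l2 g"
  proof (rule LIMSEQ_I)
    fix \<epsilon> :: real assume \<epsilon>: "\<epsilon> > 0"
    obtain k where k: "(1 / 8 :: real) ^ k < \<epsilon>\<^sup>2" using real_arch_pow_inv[of "\<epsilon>\<^sup>2" "1 / 8"] \<epsilon> by auto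
    have "norm (X (r n) - abs_l2 g) < \<epsilon>" if "n \<ge> N k" for n
    proof -
      have n: "r n \<ge> N k" using seq_suble[OF r, of n] that by simp
      have "ennreal ((norm (X (r n) - abs_l2 g))\<^sup>2) = (\<integral>\<^sup>+x. ennreal ((?f n x - g x)\<^sup>2) \<partial>lborel)"
        unfolding nn_integral_square_diff[symmetric]
        by (rule nn_integral_cong_AE) (use rep_abs_l2[OF g] in \<open>auto elim: eventually_mono\<close>)
      also have "\<dots> \<le> ennreal ((1 / 8) ^ k)" by (rule fatou[OF n])
      finally have "(norm (X (r n) - abs_l2 g))\<^sup>2 < \<epsilon>\<^sup>2" using k by (simp add: ennreal_le_iff)
      then show ?thesis by (rule power2_less_imp_less) (use \<epsilon> in simp)
    qed
    then show "\<exists>M. \<forall>n\<ge>M. norm (X (r n) - abs_l2 g) < \<epsilon>" by blast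
  qed
  then show "convergent X"
    using Cauchy_converges_subseq[OF C r] by (auto simp: convergent_def comp_def)
qed

lemma subspace_L2_on: "subspace (L2_on \<Omega>)"
proof (unfold subspace_def, intro conjI ballI allI)
  show "0 \<in> L2_on \<Omega>" using rep_zero by (auto simp: L2_on_def elim: eventually_mono)
  show "u + v \<in> L2_on \<Omega>" if "u \<in> L2_on \<Omega>" "v \<in> L2_on \<Omega>" for u v
    using that rep_add[of u v] unfolding L2_on_def mem_Collect_eq by eventually_elim simp
  show "c *\<^sub>R u \<in> L2_on \<Omega>" if "u \<in> L2_on \<Omega>" for u c
    using that rep_scaleR[of c u] unfolding L2_on_def mem_Collect_eq by eventually_elim simp
qed

lemma closed_L2_on: "closed (L2_on \<Omega>)"
  unfolding closed_sequential_limits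
proof (intro allI impI, elim conjE)
  fix X u assume X: "\<forall>n. X n \<in> L2_on \<Omega>" and "X \<longlonglongrightarrow> u"
  then obtain r where "strict_mono r" and r: "AE x in lborel. (\<lambda>n. rep_l2 (X (r n)) x) \<longlonglongrightarrow> rep_l2 u x"
    using l2_limit_AE_subseq by blast
  have "AE x in lborel. \<forall>n. x \<notin> \<Omega> \<longrightarrow> rep_l2 (X n) x = 0"
    using X by (subst AE_all_countable) (auto simp: L2_on_def)
  with r have "AE x in lborel. x \<notin> \<Omega> \<longrightarrow> rep_l2 u x = 0"
  proof eventually_elim
    fix x assume "(\<lambda>n. rep_l2 (X (r n)) x) \<longlonglongrightarrow> rep_l2 u x" "\<forall>n. x \<notin> \<Omega> \<longrightarrow> rep_l2 (X n) x = 0"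
    then show "x \<notin> \<Omega> \<longrightarrow> rep_l2 u x = 0" by (auto simp: LIMSEQ_const_iff)
  qed
  then show "u \<in> L2_on \<Omega>" by (simp add: L2_on_def)
qed

section \<open>The Gagliardo form\<close>

lemma AE_pair_both:
  fixes P :: "'a::euclidean_space \<Rightarrow> bool"
  assumes "AE x in lborel. P x"
  shows "AE p in lborel \<Otimes>\<^sub>M lborel. P (fst p) \<and> P (snd p)"
proof -
  obtain N where N: "{x. \<not> P x} \<subseteq> N" "N \<in> null_sets lborel" using assms by (auto simp: eventually_ae_filter)
  have "N \<times> UNIV \<union> UNIV \<times> N \<in> null_sets (lborel \<Otimes>\<^sub>M lborel :: ('a \<times> 'a) measure)"
    using N(2) by (intro null_sets.Un) (auto simp: null_sets_def lborel.emeasure_pair_measure_Times)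
  then show ?thesis by (rule AE_I') (use N(1) in auto)
qed

lemma gagliardo_cong_AE:
  assumes "AE x in lborel. f x = g x"
  shows "gagliardo s f = gagliardo s g"
  unfolding gagliardo_def
proof (rule nn_integral_cong_AE)
  from AE_pair_both[OF assms]
  show "AE p in lborel \<Otimes>\<^sub>M lborel. (case p of (x, y) \<Rightarrow> ennreal ((f x - f y)\<^sup>2 * riesz_kernel s (x - y))) =
      (case p of (x, y) \<Rightarrow> ennreal ((g x - g y)\<^sup>2 * riesz_kernel s (x - y)))"
    by eventually_elim (simp add: case_prod_beta)
qed

lemma gagliardo_zero: "gagliardo s (\<lambda>x. 0) = 0"
  by (simp add: gagliardo_def case_prod_beta')

text \<open>Fatou's lemma on the product space. This lower semicontinuity is what makes the form
  closed.\<close>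

lemma gagliardo_liminf:
  fixes f :: "nat \<Rightarrow> 'a::euclidean_space \<Rightarrow> real"
  assumes [measurable]: "\<And>n. f n \<in> borel_measurable borel" "g \<in> borel_measurable borel"
    and lim: "AE x in lborel. (\<lambda>n. f n x) \<longlonglongrightarrow> g x"
  shows "gagliardo s g \<le> liminf (\<lambda>n. gagliardo s (f n))"
proof -
  have "gagliardo s g = (\<integral>\<^sup>+p. liminf (\<lambda>n. case p of (x, y) \<Rightarrow> ennreal ((f n x - f n y)\<^sup>2 * riesz_kernel s (x - y))) \<partial>(lborel \<Otimes>\<^sub>M lborel))"
    unfolding gagliardo_def
  proof (rule nn_integral_cong_AE)
    from AE_pair_both[OF lim]
    show "AE p in lborel \<Otimes>\<^sub>M lborel. (case p of (x, y) \<Rightarrow> ennreal ((g x - g y)\<^sup>2 * riesz_kernel s (x - y))) =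
      liminf (\<lambda>n. case p of (x, y) \<Rightarrow> ennreal ((f n x - f n y)\<^sup>2 * riesz_kernel s (x - y)))"
    proof eventually_elim
      fix p :: "'a \<times> 'a" assume "(\<lambda>n. f n (fst p)) \<longlonglongrightarrow> g (fst p) \<and> (\<lambda>n. f n (snd p)) \<longlonglongrightarrow> g (snd p)"
      then have "(\<lambda>n. ennreal ((f n (fst p) - f n (snd p))\<^sup>2 * riesz_kernel s (fst p - snd p))) \<longlonglongrightarrow>
          ennreal ((g (fst p) - g (snd p))\<^sup>2 * riesz_kernel s (fst p - snd p))"
        by (intro tendsto_ennrealI tendsto_intros) auto
      then show "(case p of (x, y) \<Rightarrow> ennreal ((g x - g y)\<^sup>2 * riesz_kernel s (x - y))) =
        liminf (\<lambda>n. case p of (x, y) \<Rightarrow> ennreal ((f n x - f n y)\<^sup>2 * riesz_kernel s (x - y)))"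
        unfolding case_prod_beta by (intro lim_imp_Liminf[symmetric]) auto
    qed
  qed
  also have "\<dots> \<le> liminf (\<lambda>n. gagliardo s (f n))"
    unfolding gagliardo_def by (rule nn_integral_liminf) measurable
  finally show ?thesis .
qed

definition gagliardo_form :: "real \<Rightarrow> ('a::euclidean_space \<Rightarrow> real) \<Rightarrow> ('a \<Rightarrow> real) \<Rightarrow> real" where
  "gagliardo_form s f g = (\<integral>(x, y). (f x - f y) * (g x - g y) * riesz_kernel s (x - y) \<partial>(lborel \<Otimes>\<^sub>M lborel))"

lemma gagliardo_finite_iff:
  fixes f :: "'a::euclidean_space \<Rightarrow> real"
  assumes [measurable]: "f \<in> borel_measurable borel"
  shows "gagliardo s f < \<infinity> \<longleftrightarrow> integrable (lborel \<Otimes>\<^sub>M lborel) (\<lambda>(x, y). (f x - f y)\<^sup>2 * riesz_kernel s (x - y))"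
proof -
  have "(\<lambda>(x, y). (f x - f y)\<^sup>2 * riesz_kernel s (x - y)) \<in> borel_measurable (lborel \<Otimes>\<^sub>M lborel)" by measurable
  moreover have "(\<integral>\<^sup>+p. ennreal (norm (case p of (x, y) \<Rightarrow> (f x - f y)\<^sup>2 * riesz_kernel s (x - y))) \<partial>(lborel \<Otimes>\<^sub>M lborel)) = gagliardo s f"
    unfolding gagliardo_def by (intro nn_integral_cong) (auto simp: abs_mult)
  ultimately show ?thesis unfolding integrable_iff_bounded by simp
qed

lemma sobolev_space_iff: "u \<in> sobolev_space s \<longleftrightarrow> gagliardo s (rep_l2 u) < \<infinity>"
  unfolding gagliardo_finite_iff[OF borel_measurable_rep_l2]
  by (simp add: sobolev_space_def riesz_kernel_def)

lemma integrable_gagliardo_form: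
  fixes f g :: "'a::euclidean_space \<Rightarrow> real"
  assumes [measurable]: "f \<in> borel_measurable borel" "g \<in> borel_measurable borel"
    and fin: "gagliardo s f < \<infinity>" "gagliardo s g < \<infinity>"
  shows "integrable (lborel \<Otimes>\<^sub>M lborel) (\<lambda>(x, y). (f x - f y) * (g x - g y) * riesz_kernel s (x - y))"
proof (rule Bochner_Integration.integrable_bound)
  show "integrable (lborel \<Otimes>\<^sub>M lborel) (\<lambda>p. (case p of (x, y) \<Rightarrow> (f x - f y)\<^sup>2 * riesz_kernel s (x - y)) +
      (case p of (x, y) \<Rightarrow> (g x - g y)\<^sup>2 * riesz_kernel s (x - y)))"
    using fin[unfolded gagliardo_finite_iff[OF assms(1)] gagliardo_finite_iff[OF assms(2)]]
    by (rule Bochner_Integration.integrable_add)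
  have "\<bar>a * b\<bar> \<le> a\<^sup>2 + b\<^sup>2" for a b :: real
  proof -
    have "2 * (\<bar>a\<bar> * \<bar>b\<bar>) \<le> a\<^sup>2 + b\<^sup>2" using sum_squares_bound[of "\<bar>a\<bar>" "\<bar>b\<bar>"] by simp
    moreover have "0 \<le> \<bar>a\<bar> * \<bar>b\<bar>" by simp
    ultimately show ?thesis unfolding abs_mult by linarith
  qed
  then have "norm ((f x - f y) * (g x - g y) * riesz_kernel s (x - y)) \<le>
      norm ((f x - f y)\<^sup>2 * riesz_kernel s (x - y) + (g x - g y)\<^sup>2 * riesz_kernel s (x - y))" for x y
  proof -
    assume le: "\<And>a b :: real. \<bar>a * b\<bar> \<le> a\<^sup>2 + b\<^sup>2"
    have "\<bar>(f x - f y) * (g x - g y)\<bar> * riesz_kernel s (x - y) \<le> ((f x - f y)\<^sup>2 + (g x - g y)\<^sup>2) * riesz_kernel s (x - y)"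
      by (rule mult_right_mono[OF le]) simp
    then show ?thesis by (simp add: abs_mult distrib_right)
  qed
  then show "AE p in lborel \<Otimes>\<^sub>M lborel. norm (case p of (x, y) \<Rightarrow> (f x - f y) * (g x - g y) * riesz_kernel s (x - y)) \<le>
      norm ((case p of (x, y) \<Rightarrow> (f x - f y)\<^sup>2 * riesz_kernel s (x - y)) + (case p of (x, y) \<Rightarrow> (g x - g y)\<^sup>2 * riesz_kernel s (x - y)))"
    by (intro AE_I2) (simp add: case_prod_beta)
qed measurable

lemma gagliardo_form_self:
  fixes f :: "'a::euclidean_space \<Rightarrow> real"
  assumes [measurable]: "f \<in> borel_measurable borel" and fin: "gagliardo s f < \<infinity>"
  shows "ennreal (gagliardo_form s f f) = gagliardo s f"
proof -
  have i: "integrable (lborel \<Otimes>\<^sub>M lborel) (\<lambda>p. case p of (x, y) \<Rightarrow> (f x - f y)\<^sup>2 * riesz_kernel s (x - y))"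
    using fin unfolding gagliardo_finite_iff[OF assms(1)] .
  have "gagliardo s f = (\<integral>\<^sup>+p. ennreal (case p of (x, y) \<Rightarrow> (f x - f y)\<^sup>2 * riesz_kernel s (x - y)) \<partial>(lborel \<Otimes>\<^sub>M lborel))"
    unfolding gagliardo_def by (intro nn_integral_cong) (simp add: case_prod_beta)
  also have "\<dots> = ennreal (\<integral>p. (case p of (x, y) \<Rightarrow> (f x - f y)\<^sup>2 * riesz_kernel s (x - y)) \<partial>(lborel \<Otimes>\<^sub>M lborel))"
    by (rule nn_integral_eq_integral[OF i]) (auto simp: case_prod_beta)
  finally show ?thesis by (simp add: gagliardo_form_def power2_eq_square)
qed

lemma gagliardo_form_nonneg: "0 \<le> gagliardo_form s f f"
  unfolding gagliardo_form_def by (intro Bochner_Integration.integral_nonneg) (auto simp: power2_eq_square[symmetric])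

lemma gagliardo_affine_finite:
  fixes f g :: "'a::euclidean_space \<Rightarrow> real"
  assumes [measurable]: "f \<in> borel_measurable borel" "g \<in> borel_measurable borel"
    and fin: "gagliardo s f < \<infinity>" "gagliardo s g < \<infinity>"
  shows "gagliardo s (\<lambda>x. f x + c * g x) < \<infinity>"
proof -
  have eq: "(\<lambda>(x, y). ((f x + c * g x) - (f y + c * g y))\<^sup>2 * riesz_kernel s (x - y)) =
     (\<lambda>p. (case p of (x, y) \<Rightarrow> (f x - f y)\<^sup>2 * riesz_kernel s (x - y)) +
      2 * c * (case p of (x, y) \<Rightarrow> (f x - f y) * (g x - g y) * riesz_kernel s (x - y)) +
      c\<^sup>2 * (case p of (x, y) \<Rightarrow> (g x - g y)\<^sup>2 * riesz_kernel s (x - y)))"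
    by (auto simp: fun_eq_iff power2_eq_square algebra_simps)
  have "integrable (lborel \<Otimes>\<^sub>M lborel) (\<lambda>(x, y). ((f x + c * g x) - (f y + c * g y))\<^sup>2 * riesz_kernel s (x - y))"
    unfolding eq
    by (intro Bochner_Integration.integrable_add integrable_mult_right integrable_gagliardo_form assms
         fin[unfolded gagliardo_finite_iff[OF assms(1)] gagliardo_finite_iff[OF assms(2)]])
  then show ?thesis by (subst gagliardo_finite_iff) auto
qed

lemma subspace_H0: "subspace (H0 s \<Omega>)"
proof -
  have H0_eq: "H0 s \<Omega> = sobolev_space s \<inter> L2_on \<Omega>" by (auto simp: H0_def L2_on_def)
  have "subspace (sobolev_space s :: 'a l2 set)"
  proof (unfold subspace_def, intro conjI ballI allI)
    have "gagliardo s (rep_l2 (0 :: 'a l2)) = gagliardo s (\<lambda>x::'a. 0)" by (rule gagliardo_cong_AE[OF rep_zero])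
    then show "(0 :: 'a l2) \<in> sobolev_space s" by (simp add: sobolev_space_iff gagliardo_zero)
    fix u :: "'a l2" assume u: "u \<in> sobolev_space s"
    show "u + v \<in> sobolev_space s" if v: "v \<in> sobolev_space s" for v
    proof -
      have "gagliardo s (rep_l2 (u + v)) = gagliardo s (\<lambda>x. rep_l2 u x + 1 * rep_l2 v x)"
        by (rule gagliardo_cong_AE) (use rep_add[of u v] in simp)
      also have "\<dots> < \<infinity>" using u v by (intro gagliardo_affine_finite) (auto simp: sobolev_space_iff)
      finally show ?thesis by (simp add: sobolev_space_iff)
    qed
    show "c *\<^sub>R u \<in> sobolev_space s" for c
    proof -
      have "gagliardo s (rep_l2 (c *\<^sub>R u)) = gagliardo s (\<lambda>x. 0 + c * rep_l2 u x)"
        by (rule gagliardo_cong_AE) (use rep_scaleR[of c u] in simp)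
      also have "\<dots> < \<infinity>" using u by (intro gagliardo_affine_finite) (auto simp: sobolev_space_iff gagliardo_zero)
      finally show ?thesis by (simp add: sobolev_space_iff)
    qed
  qed
  then show ?thesis unfolding H0_eq using subspace_L2_on by (rule subspace_inter)
qed

lemma frac_form_eq:
  fixes \<Omega> :: "'a::euclidean_space set"
  assumes [measurable]: "\<Omega> \<in> sets borel" and "u \<in> L2_on \<Omega>"
  shows "frac_form s \<Omega> u v = inner u v + frac_const DIM('a) s / 2 * gagliardo_form s (rep_l2 u) (rep_l2 v)"
proof -
  have eq: "AE x in lborel. indicator \<Omega> x *\<^sub>R (rep_l2 u x * rep_l2 v x) = rep_l2 u x * rep_l2 v x"
    using assms(2) by (auto simp: L2_on_def indicator_def elim!: eventually_mono)
  have "(LINT x:\<Omega>|lborel. rep_l2 u x * rep_l2 v x) = inner u v"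
    unfolding set_lebesgue_integral_def inner_rep
    by (rule integral_cong_AE[OF _ _ eq]) measurable
  then show ?thesis by (simp add: frac_form_def gagliardo_form_def riesz_kernel_def)
qed

section \<open>Lipschitz functions have finite Gagliardo seminorm\<close>

lemma abs_cos_diff_le: "\<bar>cos a - cos b\<bar> \<le> \<bar>a - b\<bar>" for a b :: real
proof -
  have "\<bar>cos a - cos b\<bar> = 2 * (\<bar>sin ((a + b) / 2)\<bar> * \<bar>sin ((b - a) / 2)\<bar>)"
    by (simp add: cos_diff_cos abs_mult)
  also have "\<dots> \<le> 2 * (1 * \<bar>(b - a) / 2\<bar>)"
    by (intro mult_left_mono mult_mono abs_sin_x_le_abs_x) auto
  finally show ?thesis by simp
qed

lemma abs_sin_diff_le: "\<bar>sin a - sin b\<bar> \<le> \<bar>a - b\<bar>" for a b :: real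
  using abs_cos_diff_le[of "pi / 2 - a" "pi / 2 - b"] by (simp add: cos_diff)

lemma nn_integral_reflect:
  fixes g :: "'a::euclidean_space \<Rightarrow> ennreal"
  assumes [measurable]: "g \<in> borel_measurable borel"
  shows "(\<integral>\<^sup>+y. g (x - y) \<partial>lborel) = (\<integral>\<^sup>+y. g y \<partial>lborel)"
  by (subst (2) lborel_distr_reflect[of x, symmetric]) (simp add: nn_integral_distr)

lemma powr_le_gaussian:
  fixes \<xi> :: "'a::euclidean_space"
  assumes s: "0 < s" "s < 1"
  shows "norm \<xi> powr (2 * s) * exp (- (1 / 4) * (norm \<xi>)\<^sup>2) \<le> 8 * exp (- (1 / 8) * (norm \<xi>)\<^sup>2)"
proof -
  define t where "t = (norm \<xi>)\<^sup>2"
  have "norm \<xi> powr (2 * s) \<le> 1 + t"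
  proof (cases "norm \<xi> \<le> 1")
    case True
    then have "norm \<xi> powr (2 * s) \<le> 1" using s by (intro powr_le1) auto
    then show ?thesis by (simp add: t_def add_increasing2)
  next
    case False
    then have "norm \<xi> powr (2 * s) \<le> norm \<xi> powr 2" using s by (intro powr_mono) auto
    then show ?thesis using False by (simp add: t_def)
  qed
  \<comment> \<open>Half of the Gaussian decay is spent on absorbing the power; the other half keeps
    the bound integrable.\<close>
  also have "\<dots> \<le> 8 * exp (t / 8)" using exp_ge_add_one_self[of "t / 8"] by linarith
  finally have "norm \<xi> powr (2 * s) * exp (- t / 4) \<le> 8 * exp (t / 8) * exp (- t / 4)"
    by (rule mult_right_mono) simp
  also have "\<dots> = 8 * exp (- t / 8)" by (simp add: exp_add[symmetric] mult.assoc)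
  finally show ?thesis by (simp add: t_def)
qed

text \<open>The weight \<open>1 - exp(-|z|^2)\<close> is a Gaussian average of the functions $1-\cos\xi z$.\<close>

lemma riesz_kernel_weight_finite:
  assumes s: "0 < s" "s < 1"
  shows "(\<integral>\<^sup>+(z::'a::euclidean_space). ennreal ((1 - exp (- (norm z)\<^sup>2)) * riesz_kernel s z) \<partial>lborel) < \<infinity>"
proof -
  let ?k = "riesz_kernel s :: 'a \<Rightarrow> real" and ?C = "frac_const DIM('a) s"
  \<comment> \<open>The width \<open>1 / 4\<close> is the one for which
    \<open>exp (- (norm z)\<^sup>2 / (4 * r))\<close> becomes
    \<open>exp (- (norm z)\<^sup>2)\<close>.\<close>
  define c where "c = (pi / (1 / 4)) powr (real DIM('a) / 2)"
  have c: "c > 0" by (simp add: c_def)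
  have C: "?C > 0" using s by (intro frac_const_pos) auto
  have r: "(0::real) < 1 / 4" "(0::real) < 1 / 8" by simp_all
  have c1: "0 \<le> 1 - cos x" for x :: real by simp
  have "ennreal c * (\<integral>\<^sup>+(z::'a). ennreal ((1 - exp (- (norm z)\<^sup>2)) * ?k z) \<partial>lborel) =
     (\<integral>\<^sup>+(z::'a). (\<integral>\<^sup>+(\<xi>::'a). ennreal ((1 - cos (z \<bullet> \<xi>)) * exp (- (1 / 4) * (norm \<xi>)\<^sup>2)) * ennreal (?k z) \<partial>lborel) \<partial>lborel)"
  proof (subst nn_integral_cmult[symmetric])
    show "(\<integral>\<^sup>+(z::'a). ennreal c * ennreal ((1 - exp (- (norm z)\<^sup>2)) * ?k z) \<partial>lborel) =
     (\<integral>\<^sup>+(z::'a). (\<integral>\<^sup>+(\<xi>::'a). ennreal ((1 - cos (z \<bullet> \<xi>)) * exp (- (1 / 4) * (norm \<xi>)\<^sup>2)) * ennreal (?k z) \<partial>lborel) \<partial>lborel)"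
    proof (rule nn_integral_cong)
      fix z :: 'a
      have "(\<integral>\<^sup>+(\<xi>::'a). ennreal ((1 - cos (z \<bullet> \<xi>)) * exp (- (1 / 4) * (norm \<xi>)\<^sup>2)) * ennreal (?k z) \<partial>lborel) =
          ennreal (c * (1 - exp (- (norm z)\<^sup>2))) * ennreal (?k z)"
        using nn_integral_gaussian(2)[OF r(1), of z] by (subst nn_integral_multc) (simp_all add: c_def)
      also have "\<dots> = ennreal c * ennreal ((1 - exp (- (norm z)\<^sup>2)) * ?k z)"
        using c by (simp add: ennreal_mult mult.assoc)
      finally show "ennreal c * ennreal ((1 - exp (- (norm z)\<^sup>2)) * ?k z) =
          (\<integral>\<^sup>+(\<xi>::'a). ennreal ((1 - cos (z \<bullet> \<xi>)) * exp (- (1 / 4) * (norm \<xi>)\<^sup>2)) * ennreal (?k z) \<partial>lborel)" by simp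
    qed
  qed measurable
  also have "\<dots> = (\<integral>\<^sup>+(\<xi>::'a). (\<integral>\<^sup>+(z::'a). ennreal ((1 - cos (z \<bullet> \<xi>)) * exp (- (1 / 4) * (norm \<xi>)\<^sup>2)) * ennreal (?k z) \<partial>lborel) \<partial>lborel)"
    by (rule lborel_pair.Fubini') measurable
  also have "\<dots> \<le> (\<integral>\<^sup>+(\<xi>::'a). ennreal (8 / ?C) * ennreal (exp (- (1 / 8) * (norm \<xi>)\<^sup>2)) \<partial>lborel)"
  proof (rule nn_integral_mono)
    fix \<xi> :: 'a
    have "(\<integral>\<^sup>+(z::'a). ennreal ((1 - cos (z \<bullet> \<xi>)) * exp (- (1 / 4) * (norm \<xi>)\<^sup>2)) * ennreal (?k z) \<partial>lborel) =
        (\<integral>\<^sup>+(z::'a). ennreal (exp (- (1 / 4) * (norm \<xi>)\<^sup>2)) * ennreal ((1 - cos (\<xi> \<bullet> z)) * ?k z) \<partial>lborel)"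
      by (intro nn_integral_cong) (simp add: ennreal_mult'[symmetric] inner_commute mult_ac)
    also have "\<dots> = ennreal (exp (- (1 / 4) * (norm \<xi>)\<^sup>2)) * ennreal (norm \<xi> powr (2 * s) / ?C)"
      by (subst nn_integral_cmult) (simp_all add: nn_integral_riesz_kernel[OF s])
    also have "\<dots> = ennreal (norm \<xi> powr (2 * s) * exp (- (1 / 4) * (norm \<xi>)\<^sup>2) / ?C)"
      using C by (simp add: ennreal_mult'[symmetric] mult.commute)
    also have "\<dots> \<le> ennreal (8 * exp (- (1 / 8) * (norm \<xi>)\<^sup>2) / ?C)"
      using powr_le_gaussian[OF s, of \<xi>] C by (intro ennreal_leI divide_right_mono) auto
    also have "\<dots> = ennreal (8 / ?C) * ennreal (exp (- (1 / 8) * (norm \<xi>)\<^sup>2))"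
      by (simp add: ennreal_mult''[symmetric])
    finally show "(\<integral>\<^sup>+(z::'a). ennreal ((1 - cos (z \<bullet> \<xi>)) * exp (- (1 / 4) * (norm \<xi>)\<^sup>2)) * ennreal (?k z) \<partial>lborel) \<le>
        ennreal (8 / ?C) * ennreal (exp (- (1 / 8) * (norm \<xi>)\<^sup>2))" .
  qed
  also have "\<dots> = ennreal (8 / ?C) * ennreal ((pi / (1 / 8)) powr (real DIM('a) / 2))"
    using nn_integral_gaussian(1)[OF r(2), where 'a = 'a] by (subst nn_integral_cmult) simp_all
  also have "\<dots> < \<infinity>" by (simp add: ennreal_mult_less_top)
  finally show ?thesis using c by (auto simp: ennreal_mult_less_top)
qed

text \<open>The Lipschitz bound acts near the diagonal and the uniform bound away from it; together
  they dominate the squared difference by a multiple of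
  \<open>1 - exp (- (norm (x - y))\<^sup>2)\<close>. This weight times the kernel is integrable, and
  one of the two points must lie in the set \<open>\<Omega>\<close> of finite measure.\<close>

lemma gagliardo_lipschitz_finite:
  fixes f :: "'a::euclidean_space \<Rightarrow> real"
  assumes s: "0 < s" "s < 1" and [measurable]: "\<Omega> \<in> sets borel" and fin: "emeasure lborel \<Omega> < \<infinity>"
    and L: "\<And>x y. \<bar>f x - f y\<bar> \<le> L * norm (x - y)" and M: "\<And>x. \<bar>f x\<bar> \<le> M" and z: "\<And>x. x \<notin> \<Omega> \<Longrightarrow> f x = 0"
  shows "gagliardo s f < \<infinity>"
proof -
  define A where "A = L\<^sup>2 + 4 * M\<^sup>2"
  define w where "w z = ennreal ((1 - exp (- (norm z)\<^sup>2)) * riesz_kernel s z)" for z :: 'a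
  have [measurable]: "w \<in> borel_measurable borel" unfolding w_def[abs_def] by measurable
  have pt: "(f x - f y)\<^sup>2 \<le> A * (1 - exp (- (norm (x - y))\<^sup>2))" for x y
  proof -
    define t where "t = (norm (x - y))\<^sup>2"
    have t: "t \<ge> 0" by (simp add: t_def)
    have "(f x - f y)\<^sup>2 \<le> (L * norm (x - y))\<^sup>2" using power_mono[OF L[of x y], of 2] by simp
    then have 1: "(f x - f y)\<^sup>2 \<le> L\<^sup>2 * t" by (simp add: t_def power_mult_distrib)
    have "\<bar>f x - f y\<bar> \<le> 2 * M" using M[of x] M[of y] by linarith
    then have "(f x - f y)\<^sup>2 \<le> 4 * M\<^sup>2" using power_mono[of "\<bar>f x - f y\<bar>" "2 * M" 2] by (simp add: power_mult_distrib)
    then have "(f x - f y)\<^sup>2 * t \<le> 4 * M\<^sup>2 * t" using t by (rule mult_right_mono)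
    with 1 have "(f x - f y)\<^sup>2 * (1 + t) \<le> A * t" by (simp add: A_def algebra_simps)
    then have "(f x - f y)\<^sup>2 \<le> A * (t / (1 + t))" using t by (simp add: field_simps)
    also have "t / (1 + t) \<le> 1 - exp (- t)"
    proof -
      have "exp (- t) \<le> 1 / (1 + t)"
        using exp_ge_add_one_self[of t] t by (simp add: exp_minus inverse_eq_divide frac_le)
      then show ?thesis using t by (simp add: field_simps)
    qed
    then have "A * (t / (1 + t)) \<le> A * (1 - exp (- t))" by (intro mult_left_mono) (auto simp: A_def)
    finally show ?thesis by (simp add: t_def)
  qed
  have A: "A \<ge> 0" by (simp add: A_def)
  have "gagliardo s f \<le> (\<integral>\<^sup>+(x, y). ennreal A * (indicator \<Omega> x * w (x - y) + indicator \<Omega> y * w (x - y)) \<partial>(lborel \<Otimes>\<^sub>M lborel))"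
    unfolding gagliardo_def
  proof (rule nn_integral_mono)
    fix p :: "'a \<times> 'a"
    obtain x y where p: "p = (x, y)" by (cases p)
    have "ennreal ((f x - f y)\<^sup>2 * riesz_kernel s (x - y)) \<le> ennreal A * (indicator \<Omega> x * w (x - y) + indicator \<Omega> y * w (x - y))"
    proof (cases "x \<in> \<Omega> \<or> y \<in> \<Omega>")
      case True
      have "ennreal ((f x - f y)\<^sup>2 * riesz_kernel s (x - y)) \<le> ennreal (A * ((1 - exp (- (norm (x - y))\<^sup>2)) * riesz_kernel s (x - y)))"
        unfolding mult.assoc[symmetric] by (intro ennreal_leI mult_right_mono pt) simp
      also have "\<dots> = ennreal A * w (x - y)" using A by (simp add: w_def ennreal_mult)
      also have "\<dots> \<le> ennreal A * (indicator \<Omega> x * w (x - y) + indicator \<Omega> y * w (x - y))"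
        using True by (intro mult_left_mono) (auto simp: indicator_def)
      finally show ?thesis .
    qed (simp add: z)
    then show "(case p of (x, y) \<Rightarrow> ennreal ((f x - f y)\<^sup>2 * riesz_kernel s (x - y))) \<le>
        (case p of (x, y) \<Rightarrow> ennreal A * (indicator \<Omega> x * w (x - y) + indicator \<Omega> y * w (x - y)))"
      by (simp add: p)
  qed
  also have "\<dots> = ennreal A * (\<integral>\<^sup>+(x, y). (indicator \<Omega> x * w (x - y) + indicator \<Omega> y * w (x - y)) \<partial>(lborel \<Otimes>\<^sub>M lborel))"
    unfolding case_prod_beta' by (rule nn_integral_cmult) measurable
  also have "(\<integral>\<^sup>+(x, y). (indicator \<Omega> x * w (x - y) + indicator \<Omega> y * w (x - y)) \<partial>(lborel \<Otimes>\<^sub>M lborel)) =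
      (\<integral>\<^sup>+(x, y). indicator \<Omega> x * w (x - y) \<partial>(lborel \<Otimes>\<^sub>M lborel)) + (\<integral>\<^sup>+(x, y). indicator \<Omega> y * w (x - y) \<partial>(lborel \<Otimes>\<^sub>M lborel))"
    unfolding case_prod_beta' by (rule nn_integral_add) measurable
  also have "(\<integral>\<^sup>+(x, y). indicator \<Omega> x * w (x - y) \<partial>(lborel \<Otimes>\<^sub>M lborel)) = emeasure lborel \<Omega> * (\<integral>\<^sup>+z. w z \<partial>lborel)"
    by (subst lborel.nn_integral_fst[symmetric])
       (simp_all add: nn_integral_cmult nn_integral_reflect nn_integral_multc)
  also have "(\<integral>\<^sup>+(x, y). indicator \<Omega> y * w (x - y) \<partial>(lborel \<Otimes>\<^sub>M lborel)) = emeasure lborel \<Omega> * (\<integral>\<^sup>+z. w z \<partial>lborel)"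
  proof -
    have wm: "w (x - y) = w (y - x)" for x y
      using riesz_kernel_minus[of s "x - y"] by (simp add: w_def norm_minus_commute)
    have "(\<integral>\<^sup>+(x, y). indicator \<Omega> y * w (x - y) \<partial>(lborel \<Otimes>\<^sub>M lborel)) = (\<integral>\<^sup>+y. (\<integral>\<^sup>+x. indicator \<Omega> y * w (x - y) \<partial>lborel) \<partial>lborel)"
      using lborel_pair.nn_integral_snd[of "\<lambda>(x, y). indicator \<Omega> y * w (x - y)"] by simp
    also have "\<dots> = (\<integral>\<^sup>+y. (\<integral>\<^sup>+x. indicator \<Omega> y * w (y - x) \<partial>lborel) \<partial>lborel)" by (simp add: wm)
    also have "\<dots> = emeasure lborel \<Omega> * (\<integral>\<^sup>+z. w z \<partial>lborel)"
      by (simp add: nn_integral_cmult nn_integral_reflect nn_integral_multc)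
    finally show ?thesis .
  qed
  also have "ennreal A * (emeasure lborel \<Omega> * (\<integral>\<^sup>+z. w z \<partial>lborel) + emeasure lborel \<Omega> * (\<integral>\<^sup>+z. w z \<partial>lborel)) < \<infinity>"
    using fin riesz_kernel_weight_finite[OF s, where 'a = 'a] by (simp add: ennreal_mult_less_top w_def)
  finally show ?thesis .
qed

section \<open>Lipschitz cut-off functions\<close>

lemma borel_measurable_lipschitz:
  fixes f :: "'a::euclidean_space \<Rightarrow> real"
  assumes L: "\<And>x y. \<bar>f x - f y\<bar> \<le> L * norm (x - y)"
  shows "f \<in> borel_measurable borel"
proof (rule borel_measurable_continuous_onI)
  have "\<bar>L\<bar>-lipschitz_on UNIV f"
  proof (rule lipschitz_onI)
    fix x y :: 'a
    have "L * norm (x - y) \<le> \<bar>L\<bar> * norm (x - y)" by (intro mult_right_mono) auto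
    then show "dist (f x) (f y) \<le> \<bar>L\<bar> * dist x y" using L[of x y] by (simp add: dist_norm)
  qed simp
  then show "continuous_on UNIV f" by (rule lipschitz_on_continuous_on)
qed

text \<open>A Lipschitz approximation of the indicator of \<open>U\<close> from below; Lipschitz
  regularity already gives a finite seminorm for every \<open>s\<close> between 0 and 1. If
  \<open>- U\<close> were empty, \<open>infdist\<close> would be 0 by convention, hence the
  boundedness of \<open>U\<close> in the limit statements.\<close>

definition tent :: "nat \<Rightarrow> 'a::euclidean_space set \<Rightarrow> 'a \<Rightarrow> real" where
  "tent n U x = min 1 (real n * infdist x (- U))"

lemma tent_bounds: "0 \<le> tent n U x" "tent n U x \<le> 1"
  by (auto simp: tent_def infdist_nonneg)

lemma tent_outside: "x \<notin> U \<Longrightarrow> tent n U x = 0"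
  by (simp add: tent_def)

lemma tent_lipschitz: "\<bar>tent n U x - tent n U y\<bar> \<le> real n * norm (x - y)"
proof -
  have "\<bar>tent n U x - tent n U y\<bar> \<le> \<bar>real n * infdist x (- U) - real n * infdist y (- U)\<bar>"
    by (auto simp: tent_def min_def)
  also have "\<dots> = real n * \<bar>infdist x (- U) - infdist y (- U)\<bar>"
    by (simp add: right_diff_distrib[symmetric] abs_mult)
  also have "\<dots> \<le> real n * norm (x - y)"
    using infdist_triangle_abs[of x "- U" y] by (intro mult_left_mono) (auto simp: dist_norm)
  finally show ?thesis .
qed

lemma borel_measurable_tent [measurable]: "tent n U \<in> borel_measurable borel"
  by (rule borel_measurable_lipschitz[OF tent_lipschitz])

lemma infdist_compl_pos:
  fixes U :: "'a::euclidean_space set"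
  assumes "open U" "bounded U" "x \<in> U"
  shows "infdist x (- U) > 0"
proof (rule infdist_pos_not_in_closed)
  show "- U \<noteq> {}"
  proof
    assume "- U = {}"
    then have "U = UNIV" by auto
    then show False using assms(2) not_bounded_UNIV by auto
  qed
qed (use assms in auto)

lemma tent_limit:
  fixes U :: "'a::euclidean_space set"
  assumes U: "open U" "bounded U"
  shows "(\<lambda>n. tent n U x) \<longlonglongrightarrow> indicator U x"
proof (cases "x \<in> U")
  case True
  then have p: "infdist x (- U) > 0" by (intro infdist_compl_pos U)
  obtain m where m: "1 / infdist x (- U) \<le> real m" using real_arch_simple by blast
  have "tent n U x = indicator U x" if "n \<ge> m" for n
  proof -
    have "1 / infdist x (- U) \<le> real n" using m that by linarith
    then have "1 \<le> real n * infdist x (- U)" using p by (simp add: field_simps)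
    then show ?thesis using True by (simp add: tent_def)
  qed
  then show ?thesis by (intro tendsto_eventually) (auto simp: eventually_sequentially)
qed (simp add: tent_outside)

lemma tent_pos:
  fixes U :: "'a::euclidean_space set"
  assumes "open U" "bounded U" "x \<in> U" "n > 0"
  shows "tent n U x > 0"
  using infdist_compl_pos[OF assms(1-3)] assms(4) by (simp add: tent_def)

section \<open>Compactness\<close>

text \<open>If finitely many \<open>\<epsilon>\<close>-balls never cover \<open>K\<close>, a greedy
  choice of uncovered points produces an infinite \<open>\<epsilon>\<close>-separated sequence.
  Compactness is thereby reduced to finding two close members in any given sequence.\<close>

lemma compactI_separated:
  fixes K :: "'b::complete_space set"
  assumes cl: "closed K"
    and sep: "\<And>\<epsilon> x. \<epsilon> > 0 \<Longrightarrow> (\<And>n::nat. x n \<in> K) \<Longrightarrow> (\<And>m n. m < n \<Longrightarrow> \<epsilon> \<le> dist (x m) (x n)) \<Longrightarrow> False"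
  shows "compact K"
proof -
  have "\<exists>k. finite k \<and> K \<subseteq> (\<Union>x\<in>k. ball x \<epsilon>)" if \<epsilon>: "0 < \<epsilon>" for \<epsilon>
  proof (rule ccontr)
    assume *: "\<not> (\<exists>k. finite k \<and> K \<subseteq> (\<Union>x\<in>k. ball x \<epsilon>))"
    let ?Q = "\<lambda>x (n::nat) r. r \<in> K \<and> (\<forall>m<n. \<not> dist (x m) r < \<epsilon>)"
    have "\<exists>x. \<forall>n::nat. ?Q x n (x n)"
    proof (rule dependent_wellorder_choice)
      fix n :: nat and x :: "nat \<Rightarrow> 'b"
      have "\<not> K \<subseteq> (\<Union>y\<in>x ` {0..<n}. ball y \<epsilon>)" using * by blast
      then obtain z where "z \<in> K" "z \<notin> (\<Union>y\<in>x ` {0..<n}. ball y \<epsilon>)" by blast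
      then show "\<exists>r. ?Q x n r" by (auto intro!: exI[of _ z])
    qed simp
    then obtain x where x: "\<forall>n::nat. ?Q x n (x n)" ..
    show False by (rule sep[OF \<epsilon>, of x]) (use x in \<open>auto simp: not_less\<close>)
  qed
  then show ?thesis using cl by (simp add: compact_eq_totally_bounded complete_eq_closed)
qed

locale fractional_domain =
  fixes \<Omega> :: "'a::euclidean_space set" and s :: real
  assumes open_\<Omega>: "open \<Omega>" and bounded_\<Omega>: "bounded \<Omega>" and nonempty_\<Omega>: "\<Omega> \<noteq> {}"
    and s: "0 < s" "s < 1"
begin

abbreviation "H \<equiv> L2_on \<Omega>"
abbreviation "D \<equiv> H0 s \<Omega>"
abbreviation "a \<equiv> frac_form s \<Omega>"

definition c :: real where "c = frac_const DIM('a) s / 2"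

definition seminorm :: "'a l2 \<Rightarrow> real" where "seminorm u = gagliardo_form s (rep_l2 u) (rep_l2 u)"

lemma c_pos: "c > 0"
  using s frac_const_pos[of s "DIM('a)"] by (simp add: c_def)

lemma measurable_\<Omega> [measurable]: "\<Omega> \<in> sets borel"
  using open_\<Omega> by simp

lemma emeasure_\<Omega>: "emeasure lborel \<Omega> < \<infinity>"
  using emeasure_bounded_finite[OF bounded_\<Omega>] by (simp add: less_top)

lemma emeasure_\<Omega>_eq: "emeasure lborel \<Omega> = ennreal (measure lborel \<Omega>)"
  using emeasure_\<Omega> by (intro emeasure_eq_ennreal_measure) auto

lemma measure_\<Omega>_pos: "measure lborel \<Omega> > 0"
proof -
  obtain p r where "r > 0" "ball p r \<subseteq> \<Omega>" using nonempty_\<Omega> open_\<Omega> by (meson ex_in_conv openE)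
  then have "emeasure lborel (ball p r) \<le> emeasure lborel \<Omega>" by (intro emeasure_mono) auto
  moreover have "emeasure lborel (ball p r) > 0" using \<open>r > 0\<close> by (simp add: emeasure_ball ennreal_zero_less_mult_iff unit_ball_vol_pos)
  ultimately show ?thesis unfolding emeasure_\<Omega>_eq by (metis ennreal_less_zero_iff less_le_trans)
qed

lemma D_iff: "u \<in> D \<longleftrightarrow> u \<in> H \<and> gagliardo s (rep_l2 u) < \<infinity>"
  by (auto simp: H0_def L2_on_def sobolev_space_iff)

lemma D_H: "D \<subseteq> H"
  by (auto simp: D_iff)

lemma a_eq: "u \<in> H \<Longrightarrow> a u v = inner u v + c * gagliardo_form s (rep_l2 u) (rep_l2 v)"
  by (simp add: frac_form_eq c_def)

lemma a_self: "u \<in> H \<Longrightarrow> a u u = inner u u + c * seminorm u"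
  by (simp add: a_eq seminorm_def)

lemma seminorm_nonneg: "0 \<le> seminorm u"
  by (simp add: seminorm_def gagliardo_form_nonneg)

lemma gagliardo_seminorm: "u \<in> D \<Longrightarrow> gagliardo s (rep_l2 u) = ennreal (seminorm u)"
  by (simp add: seminorm_def gagliardo_form_self D_iff)

lemma gagliardo_form_rep_linear:
  assumes u: "u \<in> D" and v: "v \<in> D" and w: "w \<in> D"
  shows "gagliardo_form s (rep_l2 (u + b *\<^sub>R v)) (rep_l2 w) =
    gagliardo_form s (rep_l2 u) (rep_l2 w) + b * gagliardo_form s (rep_l2 v) (rep_l2 w)"
proof -
  let ?P = "lborel \<Otimes>\<^sub>M lborel :: ('a \<times> 'a) measure"
  let ?F = "\<lambda>u p. case p of (x, y) \<Rightarrow> (rep_l2 u x - rep_l2 u y) * (rep_l2 w x - rep_l2 w y) * riesz_kernel s (x - y)"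
  have int: "integrable ?P (?F u)" "integrable ?P (?F v)"
    using u v w by (auto simp: D_iff intro!: integrable_gagliardo_form)
  have "AE x in lborel. rep_l2 (u + b *\<^sub>R v) x = rep_l2 u x + b * rep_l2 v x"
    using rep_add[of u "b *\<^sub>R v"] rep_scaleR[of b v] by eventually_elim simp
  from AE_pair_both[OF this] have "AE p in ?P. ?F (u + b *\<^sub>R v) p = ?F u p + b * ?F v p"
    by eventually_elim (simp add: case_prod_beta algebra_simps)
  then have "(\<integral>p. ?F (u + b *\<^sub>R v) p \<partial>?P) = (\<integral>p. ?F u p + b * ?F v p \<partial>?P)"
    by (intro integral_cong_AE) auto
  also have "\<dots> = (\<integral>p. ?F u p \<partial>?P) + b * (\<integral>p. ?F v p \<partial>?P)"
    using int by (subst Bochner_Integration.integral_add) auto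
  finally show ?thesis by (simp add: gagliardo_form_def)
qed

lemma a_linear:
  assumes "u \<in> D" "v \<in> D" "w \<in> D"
  shows "a (u + b *\<^sub>R v) w = a u w + b * a v w"
proof -
  have "u + b *\<^sub>R v \<in> D" using assms by (simp add: subspace_add[OF subspace_H0] subspace_scale[OF subspace_H0])
  then show ?thesis
    using assms D_H gagliardo_form_rep_linear[OF assms, of b]
    by (simp add: a_eq subset_iff inner_add_left algebra_simps)
qed

lemma a_sym: "u \<in> D \<Longrightarrow> v \<in> D \<Longrightarrow> a u v = a v u"
  using D_H by (simp add: a_eq subset_iff gagliardo_form_def inner_commute mult.commute case_prod_beta)

text \<open>The parallelogram identity with its nonnegative term \<open>a (u + v) (u + v)\<close>
  dropped; it bounds the form on differences of members of a sublevel set.\<close>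

lemma a_parallelogram:
  assumes u: "u \<in> D" and v: "v \<in> D"
  shows "a (u - v) (u - v) \<le> 2 * a u u + 2 * a v v"
proof -
  have uv: "u - v \<in> D" "u + v \<in> D" using u v by (auto simp: subspace_diff[OF subspace_H0] subspace_add[OF subspace_H0])
  have q: "a (u + b *\<^sub>R v) (u + b *\<^sub>R v) = a u u + 2 * b * a u v + b\<^sup>2 * a v v" for b
  proof -
    have m: "u + b *\<^sub>R v \<in> D" using u v by (simp add: subspace_add[OF subspace_H0] subspace_scale[OF subspace_H0])
    have "a (u + b *\<^sub>R v) (u + b *\<^sub>R v) = a u (u + b *\<^sub>R v) + b * a v (u + b *\<^sub>R v)"
      by (rule a_linear[OF u v m])
    also have "a u (u + b *\<^sub>R v) = a u u + b * a v u" using a_linear[OF u v u, of b] by (simp add: a_sym[OF u m])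
    also have "a v (u + b *\<^sub>R v) = a u v + b * a v v" using a_linear[OF u v v, of b] by (simp add: a_sym[OF v m])
    finally show ?thesis by (simp add: a_sym[OF v u] power2_eq_square algebra_simps)
  qed
  have "0 \<le> a (u + v) (u + v)"
    using uv(2) D_H c_pos seminorm_nonneg[of "u + v"] by (auto simp: a_self)
  then show ?thesis using q[of 1] q[of "-1"] by simp
qed

text \<open>\<open>\<bar>b\<bar> \<le> 1 + b\<^sup>2\<close> on the set \<open>\<Omega>\<close> of
  finite measure stands in for Cauchy-Schwarz. Integrability gives the transforms pointwise meaning,
  and the quantitative bound makes them uniformly bounded on sublevel sets.\<close>

lemma integrable_rep:
  assumes u: "u \<in> H"
  shows "integrable lborel (rep_l2 u)" "(\<integral>x. \<bar>rep_l2 u x\<bar> \<partial>lborel) \<le> measure lborel \<Omega> + inner u u"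
proof -
  have i: "integrable lborel (\<lambda>x. indicator \<Omega> x + (rep_l2 u x)\<^sup>2)"
    using emeasure_\<Omega> integrable_rep_square by (intro Bochner_Integration.integrable_add integrable_real_indicator) auto
  have le: "AE x in lborel. \<bar>rep_l2 u x\<bar> \<le> indicator \<Omega> x + (rep_l2 u x)\<^sup>2"
    using u unfolding L2_on_def mem_Collect_eq
  proof eventually_elim
    fix x assume 0: "x \<notin> \<Omega> \<longrightarrow> rep_l2 u x = 0"
    have "\<bar>b\<bar> \<le> 1 + b\<^sup>2" for b :: real
      using sum_squares_bound[of 1 "\<bar>b\<bar>"] by (simp add: abs_if split: if_splits)
    then show "\<bar>rep_l2 u x\<bar> \<le> indicator \<Omega> x + (rep_l2 u x)\<^sup>2" using 0 by (cases "x \<in> \<Omega>") auto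
  qed
  show 1: "integrable lborel (rep_l2 u)"
    by (rule Bochner_Integration.integrable_bound[OF i]) (use le in \<open>auto elim!: eventually_mono\<close>)
  have "(\<integral>x. \<bar>rep_l2 u x\<bar> \<partial>lborel) \<le> (\<integral>x. indicator \<Omega> x + (rep_l2 u x)\<^sup>2 \<partial>lborel)"
    using 1 i le by (intro integral_mono_AE) auto
  also have "\<dots> = measure lborel \<Omega> + inner u u"
    using emeasure_\<Omega> integrable_rep_square[of u]
    by (subst Bochner_Integration.integral_add) (auto simp: norm_square_rep[symmetric] power2_norm_eq_inner)
  finally show "(\<integral>x. \<bar>rep_l2 u x\<bar> \<partial>lborel) \<le> measure lborel \<Omega> + inner u u" .
qed

abbreviation spectrum :: "'a l2 \<Rightarrow> 'a \<Rightarrow> real" where "spectrum u \<equiv> power_spectrum (rep_l2 u)"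

text \<open>Members of \<open>D\<close> are integrable and have finite seminorm, so both halves of
  the Plancherel estimate apply to them.\<close>

lemma plancherel:
  assumes u: "u \<in> D"
  shows "integrable lborel (spectrum u)" "(\<integral>\<xi>. spectrum u \<xi> \<partial>lborel) = (2 * pi) ^ DIM('a) * inner u u"
    "integrable lborel (\<lambda>\<xi>. norm \<xi> powr (2 * s) * spectrum u \<xi>)"
    "(\<integral>\<xi>. norm \<xi> powr (2 * s) * spectrum u \<xi> \<partial>lborel) \<le> (2 * pi) ^ DIM('a) * (c * seminorm u)"
proof -
  have i: "integrable lborel (rep_l2 u)" using u D_H by (intro integrable_rep) auto
  have G: "gagliardo s (rep_l2 u) < \<infinity>" using u by (simp add: D_iff)
  have ii: "(\<integral>x. (rep_l2 u x)\<^sup>2 \<partial>lborel) = inner u u" by (simp add: norm_square_rep[symmetric] power2_norm_eq_inner)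
  have nn: "(\<integral>\<^sup>+\<xi>. ennreal (spectrum u \<xi>) \<partial>lborel) = ennreal ((2 * pi) ^ DIM('a) * inner u u)"
    using power_spectrum_integral_le[OF i integrable_rep_square]
      power_spectrum_integral_ge[OF i integrable_rep_square s(1)] G
    unfolding gagliardo_finite_iff[OF borel_measurable_rep_l2] ii by (intro antisym) auto
  show 1: "integrable lborel (spectrum u)"
    unfolding integrable_iff_bounded using nn by simp
  show "(\<integral>\<xi>. spectrum u \<xi> \<partial>lborel) = (2 * pi) ^ DIM('a) * inner u u"
    using nn by (subst integral_eq_nn_integral) auto
  have nn2: "(\<integral>\<^sup>+\<xi>. ennreal (norm \<xi> powr (2 * s) * spectrum u \<xi>) \<partial>lborel) \<le> ennreal ((2 * pi) ^ DIM('a) * (c * seminorm u))"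
    using power_spectrum_gagliardo[OF i integrable_rep_square s] c_pos seminorm_nonneg[of u]
    by (simp add: gagliardo_seminorm[OF u] c_def ennreal_mult[symmetric] mult.assoc)
  show 2: "integrable lborel (\<lambda>\<xi>. norm \<xi> powr (2 * s) * spectrum u \<xi>)"
    unfolding integrable_iff_bounded using nn2 by (auto simp: abs_mult intro: le_less_trans)
  show "(\<integral>\<xi>. norm \<xi> powr (2 * s) * spectrum u \<xi> \<partial>lborel) \<le> (2 * pi) ^ DIM('a) * (c * seminorm u)"
  proof -
    have "ennreal (\<integral>\<xi>. norm \<xi> powr (2 * s) * spectrum u \<xi> \<partial>lborel) \<le> ennreal ((2 * pi) ^ DIM('a) * (c * seminorm u))"
      using nn2 by (subst nn_integral_eq_integral[OF 2, symmetric]) auto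
    then show ?thesis using c_pos seminorm_nonneg[of u] by (subst (asm) ennreal_le_iff) auto
  qed
qed

lemma transform_diff:
  assumes u: "u \<in> H" and v: "v \<in> H"
  shows "cos_transform (rep_l2 (u - v)) \<xi> = cos_transform (rep_l2 u) \<xi> - cos_transform (rep_l2 v) \<xi>"
    "sin_transform (rep_l2 (u - v)) \<xi> = sin_transform (rep_l2 u) \<xi> - sin_transform (rep_l2 v) \<xi>"
proof -
  note i = integrable_trig[OF integrable_rep(1)[OF u]] integrable_trig[OF integrable_rep(1)[OF v]]
  have "cos_transform (rep_l2 (u - v)) \<xi> = (\<integral>x. rep_l2 u x * cos (\<xi> \<bullet> x) - rep_l2 v x * cos (\<xi> \<bullet> x) \<partial>lborel)"
    unfolding cos_transform_def
    by (rule integral_cong_AE) (use rep_diff[of u v] in \<open>auto elim!: eventually_mono simp: left_diff_distrib\<close>)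
  then show "cos_transform (rep_l2 (u - v)) \<xi> = cos_transform (rep_l2 u) \<xi> - cos_transform (rep_l2 v) \<xi>"
    using i by (simp add: cos_transform_def)
  have "sin_transform (rep_l2 (u - v)) \<xi> = (\<integral>x. rep_l2 u x * sin (\<xi> \<bullet> x) - rep_l2 v x * sin (\<xi> \<bullet> x) \<partial>lborel)"
    unfolding sin_transform_def
    by (rule integral_cong_AE) (use rep_diff[of u v] in \<open>auto elim!: eventually_mono simp: left_diff_distrib\<close>)
  then show "sin_transform (rep_l2 (u - v)) \<xi> = sin_transform (rep_l2 u) \<xi> - sin_transform (rep_l2 v) \<xi>"
    using i by (simp add: sin_transform_def)
qed

lemma transform_lipschitz:
  assumes \<rho>: "\<And>x. x \<in> \<Omega> \<Longrightarrow> norm x \<le> \<rho>" and u: "u \<in> H"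
  shows "\<bar>cos_transform (rep_l2 u) \<xi> - cos_transform (rep_l2 u) \<eta>\<bar> \<le> \<rho> * norm (\<xi> - \<eta>) * (\<integral>x. \<bar>rep_l2 u x\<bar> \<partial>lborel)"
    "\<bar>sin_transform (rep_l2 u) \<xi> - sin_transform (rep_l2 u) \<eta>\<bar> \<le> \<rho> * norm (\<xi> - \<eta>) * (\<integral>x. \<bar>rep_l2 u x\<bar> \<partial>lborel)"
proof -
  let ?f = "rep_l2 u"
  have i: "integrable lborel ?f" by (rule integrable_rep[OF u])
  have gen: "\<bar>\<integral>x. ?f x * (t (\<xi> \<bullet> x) - t (\<eta> \<bullet> x)) \<partial>lborel\<bar> \<le> \<rho> * norm (\<xi> - \<eta>) * (\<integral>x. \<bar>?f x\<bar> \<partial>lborel)"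
    if t: "\<And>a b. \<bar>t a - t b\<bar> \<le> \<bar>a - b\<bar>" and it: "integrable lborel (\<lambda>x. ?f x * (t (\<xi> \<bullet> x) - t (\<eta> \<bullet> x)))" for t :: "real \<Rightarrow> real"
  proof -
    have "\<bar>\<integral>x. ?f x * (t (\<xi> \<bullet> x) - t (\<eta> \<bullet> x)) \<partial>lborel\<bar> \<le> (\<integral>x. norm (?f x * (t (\<xi> \<bullet> x) - t (\<eta> \<bullet> x))) \<partial>lborel)"
      using integral_norm_bound[of lborel "\<lambda>x. ?f x * (t (\<xi> \<bullet> x) - t (\<eta> \<bullet> x))"] by simp
    also have "\<dots> \<le> (\<integral>x. \<rho> * norm (\<xi> - \<eta>) * \<bar>?f x\<bar> \<partial>lborel)"
    proof (rule integral_mono_AE)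
      show "AE x in lborel. norm (?f x * (t (\<xi> \<bullet> x) - t (\<eta> \<bullet> x))) \<le> \<rho> * norm (\<xi> - \<eta>) * \<bar>?f x\<bar>"
        using u unfolding L2_on_def mem_Collect_eq
      proof eventually_elim
        fix x assume 0: "x \<notin> \<Omega> \<longrightarrow> ?f x = 0"
        show "norm (?f x * (t (\<xi> \<bullet> x) - t (\<eta> \<bullet> x))) \<le> \<rho> * norm (\<xi> - \<eta>) * \<bar>?f x\<bar>"
        proof (cases "x \<in> \<Omega>")
          case True
          have "\<bar>t (\<xi> \<bullet> x) - t (\<eta> \<bullet> x)\<bar> \<le> \<bar>(\<xi> - \<eta>) \<bullet> x\<bar>" using t[of "\<xi> \<bullet> x" "\<eta> \<bullet> x"] by (simp add: inner_diff_left)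
          also have "\<dots> \<le> norm (\<xi> - \<eta>) * norm x" by (rule Cauchy_Schwarz_ineq2)
          also have "\<dots> \<le> norm (\<xi> - \<eta>) * \<rho>" using \<rho>[OF True] by (intro mult_left_mono) auto
          finally have "\<bar>?f x\<bar> * \<bar>t (\<xi> \<bullet> x) - t (\<eta> \<bullet> x)\<bar> \<le> \<bar>?f x\<bar> * (norm (\<xi> - \<eta>) * \<rho>)" by (rule mult_left_mono) simp
          then show ?thesis by (simp add: abs_mult mult_ac)
        qed (use 0 in simp)
      qed
    qed (intro integrable_norm it integrable_mult_right integrable_abs i)+
    finally show ?thesis by simp
  qed
  have "cos_transform ?f \<xi> - cos_transform ?f \<eta> = (\<integral>x. ?f x * (cos (\<xi> \<bullet> x) - cos (\<eta> \<bullet> x)) \<partial>lborel)"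
    unfolding cos_transform_def right_diff_distrib using integrable_trig[OF i] by simp
  then show "\<bar>cos_transform ?f \<xi> - cos_transform ?f \<eta>\<bar> \<le> \<rho> * norm (\<xi> - \<eta>) * (\<integral>x. \<bar>?f x\<bar> \<partial>lborel)"
    using gen[of cos] abs_cos_diff_le integrable_trig[OF i] by (simp add: right_diff_distrib)
  have "sin_transform ?f \<xi> - sin_transform ?f \<eta> = (\<integral>x. ?f x * (sin (\<xi> \<bullet> x) - sin (\<eta> \<bullet> x)) \<partial>lborel)"
    unfolding sin_transform_def right_diff_distrib using integrable_trig[OF i] by simp
  then show "\<bar>sin_transform ?f \<xi> - sin_transform ?f \<eta>\<bar> \<le> \<rho> * norm (\<xi> - \<eta>) * (\<integral>x. \<bar>?f x\<bar> \<partial>lborel)"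
    using gen[of sin] abs_sin_diff_le integrable_trig[OF i] by (simp add: right_diff_distrib)
qed

text \<open>The \<open>L^2\<close> part of the form converges, while the seminorm is only lower
  semicontinuous along an almost everywhere convergent subsequence. The bound is therefore rewritten
  as one on the seminorm, with the convergent right side \<open>b\<close>.\<close>

lemma closed_form_sublevel: "closed {u \<in> D. a u u \<le> C}"
  unfolding closed_sequential_limits
proof (intro allI impI, elim conjE)
  fix X u assume X: "\<forall>n. X n \<in> {u \<in> D. a u u \<le> C}" and lim: "X \<longlonglongrightarrow> u"
  have XD: "X n \<in> D" "X n \<in> H" and XC: "a (X n) (X n) \<le> C" for n using X D_H by auto
  have uH: "u \<in> H" using closed_L2_on XD(2) lim by (rule closed_sequentially)
  obtain r where r: "strict_mono r" "AE x in lborel. (\<lambda>n. rep_l2 (X (r n)) x) \<longlonglongrightarrow> rep_l2 u x"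
    using l2_limit_AE_subseq[OF lim] by blast
  define b where "b n = (C - inner (X (r n)) (X (r n))) / c" for n
  have sb: "seminorm (X n) \<le> (C - inner (X n) (X n)) / c" for n
    using XC[of n] a_self[OF XD(2), of n] c_pos by (simp add: pos_le_divide_eq mult.commute)
  have "(\<lambda>n. X (r n)) \<longlonglongrightarrow> u" using LIMSEQ_subseq_LIMSEQ[OF lim r(1)] by (simp add: comp_def)
  then have b: "b \<longlonglongrightarrow> (C - inner u u) / c"
    unfolding b_def using c_pos by (intro tendsto_intros) auto
  have "gagliardo s (rep_l2 u) \<le> liminf (\<lambda>n. gagliardo s (rep_l2 (X (r n))))"
    by (rule gagliardo_liminf[OF _ _ r(2)]) auto
  also have "\<dots> \<le> liminf (\<lambda>n. ennreal (b n))"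
    using sb XD by (intro Liminf_mono) (auto simp: gagliardo_seminorm b_def intro!: always_eventually ennreal_leI)
  also have "\<dots> = ennreal ((C - inner u u) / c)"
    using b by (intro lim_imp_Liminf tendsto_ennrealI) auto
  finally have le: "gagliardo s (rep_l2 u) \<le> ennreal ((C - inner u u) / c)" .
  then have uD: "u \<in> D" using uH by (auto simp: D_iff intro: le_less_trans)
  \<comment> \<open>\<open>ennreal\<close> sends negative numbers to 0, so the bound on the seminorm
    returns to the reals only once the limit of \<open>b\<close> is known to be nonnegative.\<close>
  have "0 \<le> b n" for n using sb[of "r n"] seminorm_nonneg[of "X (r n)"] by (simp add: b_def)
  then have "0 \<le> (C - inner u u) / c" using b by (intro LIMSEQ_le_const) auto
  then have "seminorm u \<le> (C - inner u u) / c"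
    using le by (simp add: gagliardo_seminorm[OF uD])
  then have "a u u \<le> C" using a_self[OF uH] c_pos by (simp add: pos_le_divide_eq mult.commute)
  then show "u \<in> {u \<in> D. a u u \<le> C}" using uD by simp
qed

text \<open>Low frequencies are controlled by Arzela--Ascoli, since the transforms of functions supported in
  a bounded set are equi-Lipschitz; high frequencies by the form.\<close>

lemma compact_form_sublevel: "compact {u \<in> D. a u u \<le> C}"
proof (rule compactI_separated[OF closed_form_sublevel])
  fix \<epsilon> :: real and x :: "nat \<Rightarrow> 'a l2"
  assume \<epsilon>: "\<epsilon> > 0" and xK: "\<And>n. x n \<in> {u \<in> D. a u u \<le> C}" and sep: "\<And>m n. m < n \<Longrightarrow> \<epsilon> \<le> dist (x m) (x n)"
  have xD: "x n \<in> D" "x n \<in> H" and xC: "a (x n) (x n) \<le> C" for n using xK[of n] D_H by auto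
  have C: "C \<ge> 0" using xC[of 0] a_self[OF xD(2)[of 0]] c_pos seminorm_nonneg[of "x 0"]
    by (smt (verit) inner_ge_zero mult_nonneg_nonneg)
  obtain \<rho> where \<rho>: "\<And>x. x \<in> \<Omega> \<Longrightarrow> norm x \<le> \<rho>" and \<rho>0: "\<rho> > 0" using bounded_\<Omega> by (auto simp: bounded_pos)
  define M where "M = measure lborel \<Omega> + C"
  have M: "(\<integral>y. \<bar>rep_l2 (x n) y\<bar> \<partial>lborel) \<le> M" for n
  proof -
    have "inner (x n) (x n) \<le> C"
      using xC[of n] a_self[OF xD(2)[of n]] mult_nonneg_nonneg[OF less_imp_le[OF c_pos] seminorm_nonneg[of "x n"]] by linarith
    then show ?thesis using integrable_rep(2)[OF xD(2)[of n]] by (simp add: M_def)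
  qed
  have M0: "M \<ge> 0" using C by (simp add: M_def)
  define K where "K = (2 * pi) ^ DIM('a)"
  have K: "K > 0" by (simp add: K_def)
  \<comment> \<open>The difference of two members has seminorm part at most \<open>4 * C\<close>, by
    the parallelogram bound. For this radius its frequencies beyond \<open>R\<close> contribute at
    most \<open>\<epsilon>\<^sup>2 / 4\<close> to its squared norm.\<close>
  obtain R where R: "R > 0" "4 * C / R powr (2 * s) \<le> \<epsilon>\<^sup>2 / 4"
  proof -
    define R where "R = (16 * C / \<epsilon>\<^sup>2 + 1) powr (1 / (2 * s))"
    have p: "16 * C / \<epsilon>\<^sup>2 + 1 > 0" using C \<epsilon> by (intro add_nonneg_pos) auto
    have Rp: "R powr (2 * s) = 16 * C / \<epsilon>\<^sup>2 + 1" using s p by (simp add: R_def powr_powr)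
    have "4 * C \<le> \<epsilon>\<^sup>2 / 4 * (16 * C / \<epsilon>\<^sup>2 + 1)" using \<epsilon> by (simp add: field_simps)
    then have "4 * C / R powr (2 * s) \<le> \<epsilon>\<^sup>2 / 4" unfolding Rp using p by (simp add: pos_divide_le_eq)
    moreover have "R > 0" using p by (simp add: R_def)
    ultimately show ?thesis using that by blast
  qed
  define F where "F n \<xi> = (cos_transform (rep_l2 (x n)) \<xi>, sin_transform (rep_l2 (x n)) \<xi>)" for n \<xi>
  have pair: "norm (p, q) \<le> \<bar>p\<bar> + \<bar>q\<bar>" for p q :: real
    using sqrt_sum_squares_le_sum_abs[of p q] by (simp add: norm_Pair)
  obtain g k where k: "strict_mono (k :: nat \<Rightarrow> nat)"
      and conv: "\<And>e. 0 < e \<Longrightarrow> \<exists>N. \<forall>n \<xi>. n \<ge> N \<and> \<xi> \<in> cball 0 R \<longrightarrow> norm (F (k n) \<xi> - g \<xi>) < e"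
  proof (rule Arzela_Ascoli[of "cball (0::'a) R" F "2 * M"])
    show "norm (F n \<xi>) \<le> 2 * M" for n \<xi>
      using pair[of "cos_transform (rep_l2 (x n)) \<xi>" "sin_transform (rep_l2 (x n)) \<xi>"]
        abs_transform_le[OF integrable_rep(1)[OF xD(2)[of n]], of \<xi>] M[of n] by (simp add: F_def)
    fix \<xi> :: 'a and e :: real assume e: "0 < e"
    define d where "d = e / (2 * \<rho> * M + 1)"
    have den: "2 * \<rho> * M + 1 > 0" using \<rho>0 M0 by (intro add_nonneg_pos) auto
    have "norm (F n \<xi> - F n \<eta>) < e" if "norm (\<xi> - \<eta>) < d" for n \<eta>
    proof -
      let ?B = "\<rho> * norm (\<xi> - \<eta>) * M"
      have B: "\<rho> * norm (\<xi> - \<eta>) * (\<integral>y. \<bar>rep_l2 (x n) y\<bar> \<partial>lborel) \<le> ?B"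
        using \<rho>0 M by (intro mult_left_mono) auto
      have "norm (F n \<xi> - F n \<eta>) \<le> ?B + ?B"
        unfolding F_def minus_prod_def fst_conv snd_conv
        using order_trans[OF pair add_mono[OF order_trans[OF transform_lipschitz(1)[OF \<rho> xD(2)[of n]] B]
            order_trans[OF transform_lipschitz(2)[OF \<rho> xD(2)[of n]] B]]] .
      also have "\<dots> = 2 * \<rho> * M * norm (\<xi> - \<eta>)" by simp
      also have "\<dots> \<le> 2 * \<rho> * M * d" using that \<rho>0 M0 by (intro mult_left_mono) auto
      also have "\<dots> < e" using den e by (simp add: d_def field_simps)
      finally show ?thesis .
    qed
    moreover have "d > 0" using e den by (simp add: d_def)
    ultimately show "\<exists>d. 0 < d \<and> (\<forall>n y. y \<in> cball 0 R \<and> norm (\<xi> - y) < d \<longrightarrow> norm (F n \<xi> - F n y) < e)" by blast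
  qed (rule compact_cball, blast intro: that)
  define V where "V = measure lborel (cball (0::'a) R)"
  \<comment> \<open>The low frequencies contribute at most \<open>\<delta>\<^sup>2 * V\<close>,
    which is to stay below \<open>K * \<epsilon>\<^sup>2 / 4\<close>; the total
    \<open>\<epsilon>\<^sup>2 / 2\<close> then contradicts the separation. Using
    \<open>V + 1\<close> keeps the denominator positive.\<close>
  define \<delta> where "\<delta> = sqrt (K * \<epsilon>\<^sup>2 / (4 * (V + 1)))"
  have V: "V \<ge> 0" by (simp add: V_def)
  have \<delta>: "\<delta> > 0" "\<delta>\<^sup>2 * V \<le> K * \<epsilon>\<^sup>2 / 4"
  proof -
    have p: "K * \<epsilon>\<^sup>2 / (4 * (V + 1)) > 0" using K \<epsilon> V by (intro divide_pos_pos mult_pos_pos) auto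
    then show "\<delta> > 0" by (simp add: \<delta>_def)
    have "\<delta>\<^sup>2 * V = K * \<epsilon>\<^sup>2 / (4 * (V + 1)) * V" using p by (simp add: \<delta>_def)
    also have "\<dots> = K * \<epsilon>\<^sup>2 / 4 * (V / (V + 1))" by simp
    also have "\<dots> \<le> K * \<epsilon>\<^sup>2 / 4 * 1" using K V by (intro mult_left_mono) auto
    finally show "\<delta>\<^sup>2 * V \<le> K * \<epsilon>\<^sup>2 / 4" by simp
  qed
  obtain N where N: "\<And>n \<xi>. n \<ge> N \<Longrightarrow> \<xi> \<in> cball 0 R \<Longrightarrow> norm (F (k n) \<xi> - g \<xi>) < \<delta> / 2"
    using conv[of "\<delta> / 2"] \<delta>(1) by auto
  define w where "w = x (k N) - x (k (Suc N))"
  have wD: "w \<in> D" using xD by (simp add: w_def subspace_diff[OF subspace_H0])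
  have wsem: "c * seminorm w \<le> 4 * C"
  proof -
    have "a w w \<le> 2 * a (x (k N)) (x (k N)) + 2 * a (x (k (Suc N))) (x (k (Suc N)))"
      unfolding w_def by (intro a_parallelogram xD)
    then have "a w w \<le> 4 * C" using xC[of "k N"] xC[of "k (Suc N)"] by linarith
    moreover have "w \<in> H" using wD D_H by auto
    ultimately show ?thesis using a_self[of w] inner_ge_zero[of w] by linarith
  qed
  have low: "spectrum w \<xi> \<le> \<delta>\<^sup>2" if "\<xi> \<in> cball 0 R" for \<xi>
  proof -
    have "norm (F (k N) \<xi> - F (k (Suc N)) \<xi>) \<le> norm (F (k N) \<xi> - g \<xi>) + norm (F (k (Suc N)) \<xi> - g \<xi>)"
      by (metis norm_triangle_ineq4 diff_diff_eq2 diff_add_cancel add_diff_eq)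
    also have "\<dots> \<le> \<delta>" using N[OF _ that, of N] N[OF _ that, of "Suc N"] by simp
    finally have "(norm (F (k N) \<xi> - F (k (Suc N)) \<xi>))\<^sup>2 \<le> \<delta>\<^sup>2" by (rule power_mono) simp
    then show ?thesis
      by (simp add: F_def norm_Pair power_spectrum_def w_def transform_diff[OF xD(2) xD(2)])
  qed
  have "K * inner w w = (\<integral>\<xi>. spectrum w \<xi> \<partial>lborel)" using plancherel(2)[OF wD] by (simp add: K_def)
  also have "\<dots> \<le> (\<integral>\<xi>. \<delta>\<^sup>2 * indicator (cball 0 R) \<xi> + 1 / R powr (2 * s) * (norm \<xi> powr (2 * s) * spectrum w \<xi>) \<partial>lborel)"
  proof (intro integral_mono plancherel wD Bochner_Integration.integrable_add integrable_mult_right integrable_real_indicator)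
    fix \<xi> :: 'a
    show "spectrum w \<xi> \<le> \<delta>\<^sup>2 * indicator (cball 0 R) \<xi> + 1 / R powr (2 * s) * (norm \<xi> powr (2 * s) * spectrum w \<xi>)"
    proof (cases "\<xi> \<in> cball 0 R")
      case True
      then show ?thesis using low[OF True] by (simp add: add_increasing2)
    next
      case False
      then have "R powr (2 * s) \<le> norm \<xi> powr (2 * s)" using R s by (intro powr_mono2) auto
      then have "1 \<le> 1 / R powr (2 * s) * norm \<xi> powr (2 * s)" using R by simp
      from mult_right_mono[OF this, of "spectrum w \<xi>"] show ?thesis using False by (simp add: mult.assoc)
    qed
  qed (use emeasure_lborel_cball_finite[of "0::'a" R] in auto)
  also have "\<dots> = \<delta>\<^sup>2 * V + 1 / R powr (2 * s) * (\<integral>\<xi>. norm \<xi> powr (2 * s) * spectrum w \<xi> \<partial>lborel)"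
    using plancherel(3)[OF wD] emeasure_lborel_cball_finite[of "0::'a" R]
    by (subst Bochner_Integration.integral_add) (auto simp: V_def intro!: integrable_mult_right integrable_real_indicator)
  also have "\<dots> \<le> K * \<epsilon>\<^sup>2 / 4 + 1 / R powr (2 * s) * (K * (4 * C))"
  proof -
    have "(\<integral>\<xi>. norm \<xi> powr (2 * s) * spectrum w \<xi> \<partial>lborel) \<le> K * (4 * C)"
      using plancherel(4)[OF wD] mult_left_mono[OF wsem less_imp_le[OF K]] unfolding K_def by (rule order_trans)
    then have "1 / R powr (2 * s) * (\<integral>\<xi>. norm \<xi> powr (2 * s) * spectrum w \<xi> \<partial>lborel) \<le> 1 / R powr (2 * s) * (K * (4 * C))"
      by (rule mult_left_mono) simp
    then show ?thesis using \<delta>(2) by linarith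
  qed
  also have "\<dots> \<le> K * \<epsilon>\<^sup>2 / 4 + K * (\<epsilon>\<^sup>2 / 4)"
  proof -
    have eq: "1 / R powr (2 * s) * (K * (4 * C)) = K * (4 * C / R powr (2 * s))" by simp
    show ?thesis unfolding eq by (intro add_left_mono mult_left_mono R(2) less_imp_le[OF K])
  qed
  finally have "K * inner w w \<le> K * (\<epsilon>\<^sup>2 / 2)" by simp
  then have "inner w w \<le> \<epsilon>\<^sup>2 / 2" using K by simp
  also have "\<dots> < \<epsilon>\<^sup>2" using \<epsilon> by simp
  finally have "(norm w)\<^sup>2 < \<epsilon>\<^sup>2" by (simp add: power2_norm_eq_inner)
  then have "norm w < \<epsilon>" by (rule power2_less_imp_less) (use \<epsilon> in simp)
  moreover have "\<epsilon> \<le> norm w" using sep[of "k N" "k (Suc N)"] k by (simp add: w_def dist_norm strict_mono_less)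
  ultimately show False by simp
qed

end

section \<open>Density and the eigenbasis\<close>

lemma emeasure_open_pos:
  fixes U :: "'a::euclidean_space set"
  assumes "open U" "U \<noteq> {}"
  shows "emeasure lborel U > 0"
proof -
  obtain p r where "r > 0" "ball p r \<subseteq> U" using assms by (meson ex_in_conv openE)
  moreover have "emeasure lborel (ball p r) > 0" using \<open>r > 0\<close> by (simp add: emeasure_ball)
  ultimately show ?thesis
    using emeasure_mono[of "ball p r" U lborel] assms(1) by (simp add: less_le_trans)
qed

context fractional_domain
begin

lemma lipschitz_test:
  assumes L: "\<And>x y. \<bar>f x - f y\<bar> \<le> L * norm (x - y)" and M: "\<And>x. \<bar>f x\<bar> \<le> M" and z: "\<And>x. x \<notin> \<Omega> \<Longrightarrow> f x = 0"
  shows "square_integrable f" "gagliardo s f < \<infinity>" "abs_l2 f \<in> D"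
    "seminorm (abs_l2 f) = enn2real (gagliardo s f)"
proof -
  have [measurable]: "f \<in> borel_measurable borel" by (rule borel_measurable_lipschitz[OF L])
  show sq: "square_integrable f"
    unfolding square_integrable_def
  proof (intro conjI, simp, rule Bochner_Integration.integrable_bound)
    show "integrable lborel (\<lambda>x. M\<^sup>2 * indicator \<Omega> x)"
      using emeasure_\<Omega> by (intro integrable_mult_right integrable_real_indicator) auto
    have "(f x)\<^sup>2 \<le> M\<^sup>2" for x using power_mono[OF M[of x], of 2] by simp
    then have "norm ((f x)\<^sup>2) \<le> norm (M\<^sup>2 * indicator \<Omega> x)" for x using z by (cases "x \<in> \<Omega>") auto
    then show "AE x in lborel. norm ((f x)\<^sup>2) \<le> norm (M\<^sup>2 * indicator \<Omega> x)" by simp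
  qed auto
  show G: "gagliardo s f < \<infinity>"
    by (rule gagliardo_lipschitz_finite[OF s measurable_\<Omega> emeasure_\<Omega> L M z])
  have g: "gagliardo s (rep_l2 (abs_l2 f)) = gagliardo s f" by (rule gagliardo_cong_AE[OF rep_abs_l2[OF sq]])
  have "abs_l2 f \<in> H"
    using rep_abs_l2[OF sq] z unfolding L2_on_def by (auto elim: eventually_mono)
  then show D: "abs_l2 f \<in> D" using G g by (simp add: D_iff)
  show "seminorm (abs_l2 f) = enn2real (gagliardo s f)"
    using gagliardo_seminorm[OF D] g seminorm_nonneg[of "abs_l2 f"] by simp
qed

lemma tent_test:
  assumes "U \<subseteq> \<Omega>"
  shows "square_integrable (tent n U)" "gagliardo s (tent n U) < \<infinity>" "abs_l2 (tent n U) \<in> D"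
proof -
  have bd: "\<bar>tent n U x\<bar> \<le> 1" for x using tent_bounds[of n U x] by simp
  have z: "tent n U x = 0" if "x \<notin> \<Omega>" for x using that assms by (intro tent_outside) auto
  show "square_integrable (tent n U)" "gagliardo s (tent n U) < \<infinity>" "abs_l2 (tent n U) \<in> D"
    using lipschitz_test(1,2,3)[of "tent n U", OF tent_lipschitz bd z] by simp_all
qed

text \<open>Tents increasing to the indicator of \<open>U \<inter> \<Omega>\<close> show that
  \<open>f\<close> has integral 0 over every open \<open>U\<close>. The finite measures with the
  positive and the negative part of \<open>f\<close> as densities then agree on the open sets, an
  intersection-stable generator, so the two densities coincide almost everywhere.\<close>

lemma D_total:
  assumes f: "f \<in> H" and orth: "\<And>d. d \<in> D \<Longrightarrow> inner f d = 0"
  shows "f = 0"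
proof -
  define g where "g = rep_l2 f"
  have [measurable]: "g \<in> borel_measurable borel" by (simp add: g_def)
  have g: "integrable lborel g" unfolding g_def by (rule integrable_rep[OF f])
  have zero: "(\<integral>x. g x * indicator U x \<partial>lborel) = 0" if U: "open U" for U
  proof -
    let ?V = "U \<inter> \<Omega>"
    have V: "open ?V" "bounded ?V" using U open_\<Omega> bounded_\<Omega> by auto
    have [measurable]: "U \<in> sets borel" using U by simp
    have "(\<lambda>n. \<integral>x. g x * tent n ?V x \<partial>lborel) \<longlonglongrightarrow> (\<integral>x. g x * indicator ?V x \<partial>lborel)"
    proof (rule integral_dominated_convergence[where w = "\<lambda>x. \<bar>g x\<bar>"])
      show "AE x in lborel. (\<lambda>n. g x * tent n ?V x) \<longlonglongrightarrow> g x * indicator ?V x"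
        using tent_limit[OF V] by (intro AE_I2 tendsto_intros)
      show "AE x in lborel. norm (g x * tent n ?V x) \<le> \<bar>g x\<bar>" for n
        using tent_bounds[of n ?V] by (intro AE_I2) (simp add: abs_mult mult_left_le)
    qed (use g in auto)
    moreover have "(\<integral>x. g x * tent n ?V x \<partial>lborel) = 0" for n
      using orth[OF tent_test(3)[of ?V n]] inner_abs_right[OF tent_test(1)[of ?V n], of f] by (simp add: g_def)
    ultimately have "(\<integral>x. g x * indicator ?V x \<partial>lborel) = 0" by (simp add: LIMSEQ_const_iff)
    also have "(\<integral>x. g x * indicator ?V x \<partial>lborel) = (\<integral>x. g x * indicator U x \<partial>lborel)"
    proof (rule integral_cong_AE)
      show "AE x in lborel. g x * indicator ?V x = g x * indicator U x"
        using f unfolding L2_on_def mem_Collect_eq g_def by eventually_elim (auto simp: indicator_def)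
    qed measurable
    finally show ?thesis .
  qed
  define p q where "p x = ennreal (max 0 (g x))" and "q x = ennreal (max 0 (- g x))" for x
  have [measurable]: "p \<in> borel_measurable borel" "q \<in> borel_measurable borel"
    unfolding p_def[abs_def] q_def[abs_def] by measurable
  have emp: "emeasure (density lborel p) U = ennreal (\<integral>x. max 0 (g x) * indicator U x \<partial>lborel)"
    and emq: "emeasure (density lborel q) U = ennreal (\<integral>x. max 0 (- g x) * indicator U x \<partial>lborel)"
    and ip: "integrable lborel (\<lambda>x. max 0 (g x) * indicator U x)"
    and iq: "integrable lborel (\<lambda>x. max 0 (- g x) * indicator U x)" if U: "U \<in> sets borel" for U
  proof -
    note U[measurable]
    show ip: "integrable lborel (\<lambda>x. max 0 (g x) * indicator U x)"
      by (rule Bochner_Integration.integrable_bound[OF g]) (auto simp: indicator_def)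
    show iq: "integrable lborel (\<lambda>x. max 0 (- g x) * indicator U x)"
      by (rule Bochner_Integration.integrable_bound[OF g]) (auto simp: indicator_def)
    show "emeasure (density lborel p) U = ennreal (\<integral>x. max 0 (g x) * indicator U x \<partial>lborel)"
      by (subst nn_integral_eq_integral[OF ip, symmetric])
         (auto simp: emeasure_density p_def indicator_def intro!: nn_integral_cong)
    show "emeasure (density lborel q) U = ennreal (\<integral>x. max 0 (- g x) * indicator U x \<partial>lborel)"
      by (subst nn_integral_eq_integral[OF iq, symmetric])
         (auto simp: emeasure_density q_def indicator_def intro!: nn_integral_cong)
  qed
  have "density lborel p = density lborel q"
  proof (rule measure_eqI_generator_eq[where E = "{U. open U}" and \<Omega> = UNIV and A = "\<lambda>_. UNIV"])
    show "Int_stable {U::'a set. open U}" by (auto simp: Int_stable_def)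
    show "emeasure (density lborel p) U = emeasure (density lborel q) U" if "U \<in> {U. open U}" for U
    proof -
      have U: "open U" "U \<in> sets borel" using that by auto
      have "(\<integral>x. max 0 (g x) * indicator U x \<partial>lborel) - (\<integral>x. max 0 (- g x) * indicator U x \<partial>lborel) =
          (\<integral>x. max 0 (g x) * indicator U x - max 0 (- g x) * indicator U x \<partial>lborel)"
        using ip[OF U(2)] iq[OF U(2)] by simp
      also have "\<dots> = (\<integral>x. g x * indicator U x \<partial>lborel)"
        by (intro Bochner_Integration.integral_cong) (auto simp: indicator_def max_def)
      finally show ?thesis using zero[OF U(1)] by (simp add: emp emq U(2))
    qed
    show "emeasure (density lborel p) UNIV \<noteq> \<infinity>" by (simp add: emp)
  qed (auto simp: borel_def)
  then have "AE x in lborel. p x = q x"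
  proof (subst (asm) finite_density_unique)
    show "integral\<^sup>N lborel p \<noteq> \<infinity>"
      using emp[of UNIV] by (simp add: emeasure_density)
  qed auto
  then have "AE x in lborel. g x = 0"
    by eventually_elim (auto simp: p_def q_def max_def split: if_splits)
  with rep_zero have "AE x in lborel. rep_l2 f x = rep_l2 0 x"
    unfolding g_def by eventually_elim simp
  then show ?thesis by (rule l2_eqI)
qed

text \<open>Tents over disjoint concentric shells inside one ball are nonzero and pairwise
  orthogonal, hence infinitely many independent members of \<open>D\<close>.\<close>

lemma D_infinite:
  assumes F: "finite F"
  shows "\<not> D \<subseteq> span F"
proof
  assume D: "D \<subseteq> span F"
  obtain p r where r: "r > 0" and ball: "ball p r \<subseteq> \<Omega>" using nonempty_\<Omega> open_\<Omega> by (meson ex_in_conv openE)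
  define U where "U n = ball p (r / real (n + 1)) - cball p (r / real (n + 2))" for n :: nat
  have dec: "r / real (n + 1) \<le> r / real (m + 2)" if "m < n" for m n
    using that r by (intro divide_left_mono) auto
  have "r / real (n + 1) \<le> r" for n using r by (simp add: divide_le_eq)
  then have Usub: "U n \<subseteq> \<Omega>" for n
    using ball by (force simp: U_def intro: less_le_trans)
  have Uopen: "open (U n)" for n by (auto simp: U_def intro!: open_Diff)
  have Ubdd: "bounded (U n)" for n using bounded_\<Omega> Usub by (rule bounded_subset)
  have disj: "U m \<inter> U n = {}" if "m < n" for m n
    using dec[OF that] by (auto simp: U_def)
  have Une: "U n \<noteq> {}" for n
  proof -
    define \<rho> where "\<rho> = (r / real (n + 1) + r / real (n + 2)) / 2"
    have lt: "r / real (n + 2) < r / real (n + 1)" using r by (intro divide_strict_left_mono) auto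
    have "\<rho> > 0" using r by (simp add: \<rho>_def add_pos_pos)
    then have "dist p (p + \<rho> *\<^sub>R (SOME b. b \<in> Basis)) = \<rho>"
      by (simp add: dist_norm SOME_Basis norm_Basis)
    then have "p + \<rho> *\<^sub>R (SOME b. b \<in> Basis) \<in> U n" using lt by (simp add: U_def \<rho>_def)
    then show ?thesis by blast
  qed
  define t where "t n = abs_l2 (tent 1 (U n))" for n
  note T = tent_test[OF Usub]
  have orth: "inner (t m) (t n) = 0" if "m \<noteq> n" for m n
  proof -
    have "U m \<inter> U n = {}" using that disj[of m n] disj[of n m] by (cases "m < n") auto
    then have "tent 1 (U m) x * tent 1 (U n) x = 0" for x using tent_outside[of x "U m"] tent_outside[of x "U n"] by auto
    then have "(\<lambda>x. tent 1 (U m) x * tent 1 (U n) x) = (\<lambda>x. 0)" by (rule ext)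
    then show ?thesis unfolding t_def inner_abs[OF T(1) T(1)] by (simp only: Bochner_Integration.integral_zero)
  qed
  have t0: "t n \<noteq> 0" for n
  proof
    assume "t n = 0"
    then have "(\<integral>x. tent 1 (U n) x * tent 1 (U n) x \<partial>lborel) = 0"
      using inner_abs[OF T(1) T(1), of 1 n 1 n] by (simp add: t_def)
    then have "AE x in lborel. tent 1 (U n) x * tent 1 (U n) x = 0"
      using T(1)[of 1 n] by (subst (asm) integral_nonneg_eq_0_iff_AE) (auto simp: square_integrable_mult)
    then have "AE x in lborel. x \<notin> U n"
    proof eventually_elim
      fix x assume "tent 1 (U n) x * tent 1 (U n) x = 0"
      then have "tent 1 (U n) x = 0" by simp
      then show "x \<notin> U n" using tent_pos[OF Uopen Ubdd, of x n 1] by auto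
    qed
    then have "emeasure lborel (U n) = 0"
      using Uopen by (subst (asm) AE_iff_measurable[of "U n"]) auto
    then show False using emeasure_open_pos[OF Uopen Une, of n] by simp
  qed
  have "inj t" by (rule injI) (metis orth t0 inner_eq_zero_iff)
  have "independent (range t)"
  proof (rule pairwise_orthogonal_independent)
    show "pairwise orthogonal (range t)"
      unfolding pairwise_def orthogonal_def using orth by (metis rangeE)
    show "0 \<notin> range t" using t0 by (metis rangeE)
  qed
  moreover have "range t \<subseteq> span F" using D T(3) by (auto simp: t_def)
  ultimately have "finite (range t)" using independent_span_bound[OF F] by blast
  then show False using \<open>inj t\<close> by (simp add: finite_image_iff)
qed

lemma a_zero: "w \<in> D \<Longrightarrow> a 0 w = 0"
  using a_linear[of 0 0 w 1] subspace_0[OF subspace_H0, of s \<Omega>] by simp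

sublocale form: compact_form "L2_on \<Omega>" "H0 s \<Omega>" "frac_form s \<Omega>"
proof
  show "subspace H" "closed H" by (rule subspace_L2_on, rule closed_L2_on)
  show "subspace D" by (rule subspace_H0)
  show "a (u + v) w = a u w + a v w" if "u \<in> D" "v \<in> D" "w \<in> D" for u v w
    using a_linear[OF that, of 1] by simp
  show "a (b *\<^sub>R u) w = b * a u w" if "u \<in> D" "w \<in> D" for u w b
    using a_linear[of 0 u w b] subspace_0[OF subspace_H0, of s \<Omega>] that by (simp add: a_zero)
  show "inner u u \<le> a u u" if "u \<in> D" for u
    using that D_H c_pos seminorm_nonneg[of u] by (auto simp: a_self)
qed (fact D_H, fact a_sym, fact compact_form_sublevel, fact D_total, fact D_infinite)

end

section \<open>Riesz means of the eigenvalues\<close>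

text \<open>Layer cake: the positive part of \<open>x - b\<close> is the length of
  \<open>{b<..x}\<close>. Exchanging the integrals leaves the volumes of the balls of radius
  \<open>y powr (1 / (2 * s))\<close>, which is where the exponent \<open>\<theta>\<close> comes
  from.\<close>

lemma riesz_mean_volume:
  fixes x s :: real
  assumes s: "0 < s" and x: "0 \<le> x"
  defines "\<theta> \<equiv> real DIM('a::euclidean_space) / (2 * s)"
  shows "integrable lborel (\<lambda>\<xi>::'a. max 0 (x - norm \<xi> powr (2 * s)))"
    and "(\<integral>(\<xi>::'a). max 0 (x - norm \<xi> powr (2 * s)) \<partial>lborel) = measure lborel (ball (0::'a) 1) * x powr (\<theta> + 1) / (\<theta> + 1)"
    and "emeasure lborel {\<xi>::'a. norm \<xi> powr (2 * s) < x} = ennreal (measure lborel (ball (0::'a) 1) * x powr \<theta>)"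
proof -
  let ?\<omega> = "measure lborel (ball (0::'a) 1)"
  have \<theta>: "\<theta> > 0" using s by (simp add: \<theta>_def)
  have em: "emeasure lborel {\<xi>::'a. norm \<xi> powr (2 * s) < y} = ennreal (?\<omega> * y powr \<theta>)" if y: "0 \<le> y" for y
  proof (cases "y = 0")
    case True
    have "norm \<xi> powr (2 * s) \<ge> 0" for \<xi> :: 'a by simp
    then have e: "{\<xi>::'a. norm \<xi> powr (2 * s) < y} = {}" using True by (auto simp: not_less)
    show ?thesis unfolding e using True by simp
  next
    case False
    then have y: "y > 0" using that by simp
    have iff: "norm \<xi> powr (2 * s) < y \<longleftrightarrow> norm \<xi> < y powr (1 / (2 * s))" for \<xi> :: 'a
    proof
      assume "norm \<xi> < y powr (1 / (2 * s))"
      then have "norm \<xi> powr (2 * s) < (y powr (1 / (2 * s))) powr (2 * s)" using s by (intro powr_less_mono2) auto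
      then show "norm \<xi> powr (2 * s) < y" using s y by (simp add: powr_powr)
    next
      assume "norm \<xi> powr (2 * s) < y"
      then have "(norm \<xi> powr (2 * s)) powr (1 / (2 * s)) < y powr (1 / (2 * s))" using s by (intro powr_less_mono2) auto
      then show "norm \<xi> < y powr (1 / (2 * s))" using s by (simp add: powr_powr)
    qed
    have "{\<xi>::'a. norm \<xi> powr (2 * s) < y} = ball 0 (y powr (1 / (2 * s)))"
      unfolding set_eq_iff mem_Collect_eq mem_ball dist_0_norm iff by simp
    moreover have "emeasure lborel (ball (0::'a) (y powr (1 / (2 * s)))) = ennreal (?\<omega> * y powr \<theta>)"
    proof -
      have "(y powr (1 / (2 * s))) ^ DIM('a) = (y powr (1 / (2 * s))) powr real DIM('a)"
        using powr_realpow[of "y powr (1 / (2 * s))" "DIM('a)"] y by simp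
      also have "\<dots> = y powr \<theta>" by (simp add: powr_powr \<theta>_def)
      finally show ?thesis by (simp add: emeasure_ball content_ball)
    qed
    ultimately show ?thesis by simp
  qed
  show "emeasure lborel {\<xi>::'a. norm \<xi> powr (2 * s) < x} = ennreal (?\<omega> * x powr \<theta>)" by (rule em[OF x])
  have "(\<integral>\<^sup>+(\<xi>::'a). ennreal (max 0 (x - norm \<xi> powr (2 * s))) \<partial>lborel) =
      (\<integral>\<^sup>+(\<xi>::'a). (\<integral>\<^sup>+y. indicator {0..x} y * indicator {\<xi>. norm \<xi> powr (2 * s) < y} \<xi> \<partial>lborel) \<partial>lborel)"
  proof (rule nn_integral_cong)
    fix \<xi> :: 'a
    let ?b = "norm \<xi> powr (2 * s)"
    have "?b \<ge> 0" by simp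
    have "(\<integral>\<^sup>+y. indicator {0..x} y * indicator {\<xi>. norm \<xi> powr (2 * s) < y} \<xi> \<partial>lborel) = (\<integral>\<^sup>+y. indicator {?b<..x} y \<partial>lborel)"
    proof (rule nn_integral_cong)
      fix y :: real
      have "0 \<le> y" if "?b < y" using that \<open>?b \<ge> 0\<close> by linarith
      then show "indicator {0..x} y * indicator {\<xi>. norm \<xi> powr (2 * s) < y} \<xi> = (indicator {?b<..x} y :: ennreal)"
        unfolding indicator_def by (cases "?b < y") simp_all
    qed
    also have "\<dots> = ennreal (max 0 (x - ?b))" by (cases "?b \<le> x") (auto simp: max_def)
    finally show "ennreal (max 0 (x - norm \<xi> powr (2 * s))) =
        (\<integral>\<^sup>+y. indicator {0..x} y * indicator {\<xi>. norm \<xi> powr (2 * s) < y} \<xi> \<partial>lborel)" by simp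
  qed
  also have "\<dots> = (\<integral>\<^sup>+y. (\<integral>\<^sup>+(\<xi>::'a). indicator {0..x} y * indicator {\<xi>. norm \<xi> powr (2 * s) < y} \<xi> \<partial>lborel) \<partial>lborel)"
    by (rule lborel_pair.Fubini'[symmetric]) (unfold indicator_def, measurable)
  also have "\<dots> = (\<integral>\<^sup>+y. ennreal ?\<omega> * (ennreal (y powr \<theta>) * indicator {0..x} y) \<partial>lborel)"
  proof (rule nn_integral_cong)
    fix y :: real
    show "(\<integral>\<^sup>+(\<xi>::'a). indicator {0..x} y * indicator {\<xi>. norm \<xi> powr (2 * s) < y} \<xi> \<partial>lborel) =
        ennreal ?\<omega> * (ennreal (y powr \<theta>) * indicator {0..x} y)"
      by (cases "y \<in> {0..x}") (auto simp: em ennreal_mult)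
  qed
  also have "\<dots> = ennreal ?\<omega> * ennreal (x powr (\<theta> + 1) / (\<theta> + 1))"
    using nn_integral_has_integral_lebesgue'[OF _ has_integral_powr_from_0[of \<theta> x]] \<theta> x
    by (subst nn_integral_cmult) auto
  also have "\<dots> = ennreal (?\<omega> * x powr (\<theta> + 1) / (\<theta> + 1))"
    by (simp add: ennreal_mult'[symmetric])
  finally have nn: "(\<integral>\<^sup>+(\<xi>::'a). ennreal (max 0 (x - norm \<xi> powr (2 * s))) \<partial>lborel) = ennreal (?\<omega> * x powr (\<theta> + 1) / (\<theta> + 1))" .
  show "integrable lborel (\<lambda>\<xi>::'a. max 0 (x - norm \<xi> powr (2 * s)))"
    unfolding integrable_iff_bounded using nn by simp
  show "(\<integral>(\<xi>::'a). max 0 (x - norm \<xi> powr (2 * s)) \<partial>lborel) = ?\<omega> * x powr (\<theta> + 1) / (\<theta> + 1)"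
    using nn \<theta> by (subst integral_eq_nn_integral) auto
qed

lemma nn_integral_convolution:
  fixes g w :: "'a::euclidean_space \<Rightarrow> ennreal"
  assumes [measurable]: "g \<in> borel_measurable borel" "w \<in> borel_measurable borel" and w: "\<And>z. w (- z) = w z"
  shows "(\<integral>\<^sup>+(x, y). g x * w (x - y) \<partial>(lborel \<Otimes>\<^sub>M lborel)) = (\<integral>\<^sup>+x. g x \<partial>lborel) * (\<integral>\<^sup>+z. w z \<partial>lborel)"
    and "(\<integral>\<^sup>+(x, y). g y * w (x - y) \<partial>(lborel \<Otimes>\<^sub>M lborel)) = (\<integral>\<^sup>+x. g x \<partial>lborel) * (\<integral>\<^sup>+z. w z \<partial>lborel)"
proof -
  show "(\<integral>\<^sup>+(x, y). g x * w (x - y) \<partial>(lborel \<Otimes>\<^sub>M lborel)) = (\<integral>\<^sup>+x. g x \<partial>lborel) * (\<integral>\<^sup>+z. w z \<partial>lborel)"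
    by (subst lborel.nn_integral_fst[symmetric]) (simp_all add: nn_integral_cmult nn_integral_reflect nn_integral_multc)
  have wm: "w (x - y) = w (y - x)" for x y using w[of "x - y"] by simp
  have "(\<integral>\<^sup>+(x, y). g y * w (x - y) \<partial>(lborel \<Otimes>\<^sub>M lborel)) = (\<integral>\<^sup>+y. (\<integral>\<^sup>+x. g y * w (x - y) \<partial>lborel) \<partial>lborel)"
    using lborel_pair.nn_integral_snd[of "\<lambda>(x, y). g y * w (x - y)"] by simp
  also have "\<dots> = (\<integral>\<^sup>+y. (\<integral>\<^sup>+x. g y * w (y - x) \<partial>lborel) \<partial>lborel)" by (simp add: wm)
  also have "\<dots> = (\<integral>\<^sup>+x. g x \<partial>lborel) * (\<integral>\<^sup>+z. w z \<partial>lborel)"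
    by (simp add: nn_integral_cmult nn_integral_reflect nn_integral_multc)
  finally show "(\<integral>\<^sup>+(x, y). g y * w (x - y) \<partial>(lborel \<Otimes>\<^sub>M lborel)) = (\<integral>\<^sup>+x. g x \<partial>lborel) * (\<integral>\<^sup>+z. w z \<partial>lborel)" .
qed

text \<open>For $f=\phi e^{i\xi x}$ one has
  $|f(x)-f(y)|^2=(\phi(x)-\phi(y))^2+2\phi(x)\phi(y)(1-\cos\xi(x-y))$.\<close>

lemma gagliardo_modulated_le:
  fixes \<phi> :: "'a::euclidean_space \<Rightarrow> real"
  assumes s: "0 < s" "s < 1" and [measurable]: "\<phi> \<in> borel_measurable borel" and i2: "integrable lborel (\<lambda>x. (\<phi> x)\<^sup>2)"
  shows "gagliardo s (\<lambda>x. \<phi> x * cos (\<xi> \<bullet> x)) + gagliardo s (\<lambda>x. \<phi> x * sin (\<xi> \<bullet> x)) \<le>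
    gagliardo s \<phi> + ennreal ((\<integral>x. (\<phi> x)\<^sup>2 \<partial>lborel) * (norm \<xi> powr (2 * s) / (frac_const DIM('a) s / 2)))"
proof -
  let ?P = "lborel \<Otimes>\<^sub>M lborel :: ('a \<times> 'a) measure" and ?k = "riesz_kernel s :: 'a \<Rightarrow> real"
  let ?I = "\<integral>x. (\<phi> x)\<^sup>2 \<partial>lborel" and ?C = "frac_const DIM('a) s"
  have C: "?C > 0" using s by (intro frac_const_pos) auto
  define w where "w z = ennreal ((1 - cos (\<xi> \<bullet> z)) * ?k z)" for z
  have [measurable]: "w \<in> borel_measurable borel" unfolding w_def[abs_def] by measurable
  have wm: "w (- z) = w z" for z by (simp add: w_def)
  have c1: "0 \<le> 1 - cos x" for x :: real by simp
  let ?fc = "\<lambda>x. \<phi> x * cos (\<xi> \<bullet> x)" and ?fs = "\<lambda>x. \<phi> x * sin (\<xi> \<bullet> x)"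
  have pt: "ennreal ((?fc x - ?fc y)\<^sup>2 * ?k (x - y)) + ennreal ((?fs x - ?fs y)\<^sup>2 * ?k (x - y)) \<le>
      ennreal ((\<phi> x - \<phi> y)\<^sup>2 * ?k (x - y)) + (ennreal ((\<phi> x)\<^sup>2) * w (x - y) + ennreal ((\<phi> y)\<^sup>2) * w (x - y))" for x y
  proof -
    have id: "(p * c - q * c')\<^sup>2 + (p * d - q * d')\<^sup>2 = p\<^sup>2 * (c\<^sup>2 + d\<^sup>2) + q\<^sup>2 * (c'\<^sup>2 + d'\<^sup>2) - 2 * p * q * (c * c' + d * d')" for p q c c' d d' :: real
      by (simp add: power2_eq_square algebra_simps)
    have "(?fc x - ?fc y)\<^sup>2 + (?fs x - ?fs y)\<^sup>2 = (\<phi> x)\<^sup>2 + (\<phi> y)\<^sup>2 - 2 * \<phi> x * \<phi> y * cos (\<xi> \<bullet> (x - y))"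
      unfolding id by (simp add: inner_diff_right cos_diff)
    also have "\<dots> = (\<phi> x - \<phi> y)\<^sup>2 + 2 * \<phi> x * \<phi> y * (1 - cos (\<xi> \<bullet> (x - y)))"
      by (simp add: power2_eq_square algebra_simps)
    also have "\<dots> \<le> (\<phi> x - \<phi> y)\<^sup>2 + ((\<phi> x)\<^sup>2 + (\<phi> y)\<^sup>2) * (1 - cos (\<xi> \<bullet> (x - y)))"
      using sum_squares_bound[of "\<phi> x" "\<phi> y"] by (intro add_left_mono mult_right_mono) auto
    finally have "((?fc x - ?fc y)\<^sup>2 + (?fs x - ?fs y)\<^sup>2) * ?k (x - y) \<le>
        ((\<phi> x - \<phi> y)\<^sup>2 + ((\<phi> x)\<^sup>2 + (\<phi> y)\<^sup>2) * (1 - cos (\<xi> \<bullet> (x - y)))) * ?k (x - y)"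
      by (rule mult_right_mono) simp
    then have "ennreal ((?fc x - ?fc y)\<^sup>2 * ?k (x - y) + (?fs x - ?fs y)\<^sup>2 * ?k (x - y)) \<le>
        ennreal ((\<phi> x - \<phi> y)\<^sup>2 * ?k (x - y) + ((\<phi> x)\<^sup>2 * ((1 - cos (\<xi> \<bullet> (x - y))) * ?k (x - y)) + (\<phi> y)\<^sup>2 * ((1 - cos (\<xi> \<bullet> (x - y))) * ?k (x - y))))"
      by (intro ennreal_leI) (simp add: algebra_simps)
    then show ?thesis by (simp add: w_def ennreal_plus ennreal_mult)
  qed
  have "gagliardo s ?fc + gagliardo s ?fs =
      (\<integral>\<^sup>+p. (case p of (x, y) \<Rightarrow> ennreal ((?fc x - ?fc y)\<^sup>2 * ?k (x - y))) + (case p of (x, y) \<Rightarrow> ennreal ((?fs x - ?fs y)\<^sup>2 * ?k (x - y))) \<partial>?P)"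
    unfolding gagliardo_def by (rule nn_integral_add[symmetric]) measurable
  also have "\<dots> \<le> (\<integral>\<^sup>+p. (case p of (x, y) \<Rightarrow> ennreal ((\<phi> x - \<phi> y)\<^sup>2 * ?k (x - y))) +
      ((case p of (x, y) \<Rightarrow> ennreal ((\<phi> x)\<^sup>2) * w (x - y)) + (case p of (x, y) \<Rightarrow> ennreal ((\<phi> y)\<^sup>2) * w (x - y))) \<partial>?P)"
    using pt by (intro nn_integral_mono) (auto simp: case_prod_beta)
  also have "\<dots> = gagliardo s \<phi> + ((\<integral>\<^sup>+(x, y). ennreal ((\<phi> x)\<^sup>2) * w (x - y) \<partial>?P) + (\<integral>\<^sup>+(x, y). ennreal ((\<phi> y)\<^sup>2) * w (x - y) \<partial>?P))"
    unfolding gagliardo_def by (subst nn_integral_add, measurable, subst nn_integral_add, measurable)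
  also have "\<dots> = gagliardo s \<phi> + (ennreal ?I * ennreal (norm \<xi> powr (2 * s) / ?C) + ennreal ?I * ennreal (norm \<xi> powr (2 * s) / ?C))"
  proof -
    have "(\<integral>\<^sup>+x. ennreal ((\<phi> x)\<^sup>2) \<partial>lborel) = ennreal ?I" by (rule nn_integral_eq_integral[OF i2]) simp
    moreover have "(\<integral>\<^sup>+z. w z \<partial>lborel) = ennreal (norm \<xi> powr (2 * s) / ?C)" unfolding w_def by (rule nn_integral_riesz_kernel[OF s])
    moreover have m: "(\<lambda>x. ennreal ((\<phi> x)\<^sup>2)) \<in> borel_measurable borel" by measurable
    ultimately show ?thesis
      unfolding nn_integral_convolution[OF m \<open>w \<in> borel_measurable borel\<close> wm] by simp
  qed
  also have "ennreal ?I * ennreal (norm \<xi> powr (2 * s) / ?C) + ennreal ?I * ennreal (norm \<xi> powr (2 * s) / ?C) =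
      ennreal (?I * (norm \<xi> powr (2 * s) / (?C / 2)))"
    using C by (simp add: ennreal_mult[symmetric] ennreal_plus[symmetric] del: ennreal_plus)
  finally show ?thesis .
qed

locale fractional_eigenbasis = fractional_domain \<Omega> s
  for \<Omega> :: "'a::euclidean_space set" and s :: real +
  fixes e :: "nat \<Rightarrow> 'a l2" and l :: "nat \<Rightarrow> real"
  assumes basis: "compact_form_basis (L2_on \<Omega>) (H0 s \<Omega>) (frac_form s \<Omega>) e l"
begin

sublocale B: compact_form_basis "L2_on \<Omega>" "H0 s \<Omega>" "frac_form s \<Omega>" e l
  by (rule basis)

definition riesz_mean :: "real \<Rightarrow> real" where "riesz_mean x = (\<Sum>j\<in>{j. l j \<le> x}. x - l j)"

definition K :: real where "K = (2 * pi) ^ DIM('a)"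
definition \<omega> :: real where "\<omega> = measure lborel (ball (0::'a) 1)"
definition \<theta> :: real where "\<theta> = real DIM('a) / (2 * s)"

lemma K_pos: "K > 0" by (simp add: K_def)
lemma \<omega>_pos: "\<omega> > 0" by (simp add: \<omega>_def content_ball)
lemma \<theta>_pos: "\<theta> > 0" using s by (simp add: \<theta>_def)

text \<open>At a fixed frequency the transforms of the \<open>e j\<close> are their inner products
  with the real and imaginary parts of the plane wave cut off to \<open>\<Omega>\<close>. Bessel
  applied to both parts and \<open>cos\<^sup>2 + sin\<^sup>2 = 1\<close> give a bound independent of
  \<open>J\<close> and \<open>\<xi>\<close>.\<close>

lemma spectrum_sum_le:
  assumes "finite J"
  shows "(\<Sum>j\<in>J. spectrum (e j) \<xi>) \<le> measure lborel \<Omega>"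
proof -
  have sq: "square_integrable (\<lambda>x. indicator \<Omega> x * t (\<xi> \<bullet> x))"
    if [measurable]: "t \<in> borel_measurable borel" and t: "\<And>x. \<bar>t x\<bar> \<le> 1" for t :: "real \<Rightarrow> real"
    unfolding square_integrable_def
  proof (intro conjI)
    show "integrable lborel (\<lambda>x. (indicator \<Omega> x * t (\<xi> \<bullet> x))\<^sup>2)"
    proof (rule Bochner_Integration.integrable_bound)
      show "integrable lborel (indicator \<Omega> :: 'a \<Rightarrow> real)" using emeasure_\<Omega> by simp
      have "(t x)\<^sup>2 \<le> 1" for x using power_mono[OF t[of x], of 2] by simp
      then show "AE x in lborel. norm ((indicator \<Omega> x * t (\<xi> \<bullet> x))\<^sup>2) \<le> norm (indicator \<Omega> x :: real)"
        by (simp add: indicator_def)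
    qed measurable
  qed measurable
  define u v where "u = abs_l2 (\<lambda>x. indicator \<Omega> x * cos (\<xi> \<bullet> x))" and "v = abs_l2 (\<lambda>x. indicator \<Omega> x * sin (\<xi> \<bullet> x))"
  have sc: "square_integrable (\<lambda>x. indicator \<Omega> x * cos (\<xi> \<bullet> x))" and ss: "square_integrable (\<lambda>x. indicator \<Omega> x * sin (\<xi> \<bullet> x))"
    by (rule sq; simp)+
  have AE: "AE x in lborel. x \<notin> \<Omega> \<longrightarrow> rep_l2 (e j) x = 0" for j
    using B.e_H[of j] by (simp add: L2_on_def)
  have "inner u (e j) = cos_transform (rep_l2 (e j)) \<xi>" for j
    unfolding u_def inner_abs_left[OF sc] cos_transform_def
    by (rule integral_cong_AE) (use AE[of j] in \<open>auto elim!: eventually_mono simp: indicator_def\<close>)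
  moreover have "inner v (e j) = sin_transform (rep_l2 (e j)) \<xi>" for j
    unfolding v_def inner_abs_left[OF ss] sin_transform_def
    by (rule integral_cong_AE) (use AE[of j] in \<open>auto elim!: eventually_mono simp: indicator_def\<close>)
  ultimately have "(\<Sum>j\<in>J. spectrum (e j) \<xi>) = (\<Sum>j\<in>J. (inner u (e j))\<^sup>2) + (\<Sum>j\<in>J. (inner v (e j))\<^sup>2)"
    by (simp add: power_spectrum_def sum.distrib)
  also have "\<dots> \<le> inner u u + inner v v"
    by (intro add_mono bessel_inequality assms) (auto simp: B.e_orthonormal)
  also have "\<dots> = (\<integral>x. (indicator \<Omega> x * cos (\<xi> \<bullet> x)) * (indicator \<Omega> x * cos (\<xi> \<bullet> x)) +
      (indicator \<Omega> x * sin (\<xi> \<bullet> x)) * (indicator \<Omega> x * sin (\<xi> \<bullet> x)) \<partial>lborel)"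
    unfolding u_def v_def inner_abs[OF sc sc] inner_abs[OF ss ss]
    by (rule Bochner_Integration.integral_add[symmetric]; rule square_integrable_mult) (rule sc ss)+
  also have "\<dots> = (\<integral>x. indicator \<Omega> x \<partial>lborel)"
  proof (intro Bochner_Integration.integral_cong refl)
    fix x
    have "cos b * cos b + sin b * sin b = 1" for b :: real
      using sin_cos_squared_add2[of b] by (simp add: power2_eq_square add.commute)
    then show "(indicator \<Omega> x * cos (\<xi> \<bullet> x)) * (indicator \<Omega> x * cos (\<xi> \<bullet> x)) +
      (indicator \<Omega> x * sin (\<xi> \<bullet> x)) * (indicator \<Omega> x * sin (\<xi> \<bullet> x)) = (indicator \<Omega> x :: real)" by (simp add: indicator_def)
  qed
  finally show ?thesis by simp
qed

text \<open>Each \<open>K * (x - l j)\<close> is bounded by an average of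
  \<open>x - norm \<xi> powr (2 * s)\<close> against the spectrum of \<open>e j\<close>. The weight
  is replaced by its positive part before summation, because the uniform bound on the summed spectra
  can be inserted only under a nonnegative weight.\<close>

lemma riesz_mean_upper:
  assumes x: "0 \<le> x"
  shows "K * riesz_mean x \<le> measure lborel \<Omega> * (\<omega> * x powr (\<theta> + 1) / (\<theta> + 1))"
proof -
  let ?J = "{j. l j \<le> x}" and ?h = "\<lambda>\<xi>::'a. max 0 (x - norm \<xi> powr (2 * s))"
  note V = riesz_mean_volume[OF s(1) x, where 'a = 'a, folded \<theta>_def \<omega>_def]
  have iP: "integrable lborel (\<lambda>\<xi>. ?h \<xi> * spectrum (e j) \<xi>)" for j
  proof (rule Bochner_Integration.integrable_bound)
    show "integrable lborel (\<lambda>\<xi>. x * spectrum (e j) \<xi>)" by (intro integrable_mult_right plancherel B.e_D)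
    show "AE \<xi> in lborel. norm (?h \<xi> * spectrum (e j) \<xi>) \<le> norm (x * spectrum (e j) \<xi>)"
      using x by (intro AE_I2) (auto simp: abs_mult intro!: mult_right_mono)
  qed measurable
  have single: "K * (x - l j) \<le> (\<integral>\<xi>. ?h \<xi> * spectrum (e j) \<xi> \<partial>lborel)" for j
  proof -
    note P = plancherel[OF B.e_D[of j]]
    have one: "inner (e j) (e j) = 1" by (simp add: B.e_orthonormal)
    have "l j = 1 + c * seminorm (e j)"
      using B.eigen[OF B.e_D[of j], of j] a_self[OF B.e_H[of j]] by (simp add: one)
    \<comment> \<open>The 1 that the identity contributes to \<open>l j\<close> is dropped here; its
      effect is of lower order.\<close>
    then have "K * (x - l j) \<le> x * (K * 1) - K * (c * seminorm (e j))"
      using K_pos by (simp add: algebra_simps)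
    also have "\<dots> \<le> x * (\<integral>\<xi>. spectrum (e j) \<xi> \<partial>lborel) - (\<integral>\<xi>. norm \<xi> powr (2 * s) * spectrum (e j) \<xi> \<partial>lborel)"
      using P(2,4) by (simp add: one K_def)
    also have "\<dots> = (\<integral>\<xi>. x * spectrum (e j) \<xi> - norm \<xi> powr (2 * s) * spectrum (e j) \<xi> \<partial>lborel)"
      using P(1,3) by (subst Bochner_Integration.integral_diff) auto
    also have "\<dots> \<le> (\<integral>\<xi>. ?h \<xi> * spectrum (e j) \<xi> \<partial>lborel)"
      using P(1,3) unfolding left_diff_distrib[symmetric]
      by (intro integral_mono iP mult_right_mono)
         (auto simp: left_diff_distrib intro!: Bochner_Integration.integrable_diff)
    finally show ?thesis .
  qed
  have "K * riesz_mean x = (\<Sum>j\<in>?J. K * (x - l j))" by (simp add: riesz_mean_def sum_distrib_left)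
  also have "\<dots> \<le> (\<Sum>j\<in>?J. (\<integral>\<xi>. ?h \<xi> * spectrum (e j) \<xi> \<partial>lborel))" by (intro sum_mono single)
  also have "\<dots> = (\<integral>\<xi>. ?h \<xi> * (\<Sum>j\<in>?J. spectrum (e j) \<xi>) \<partial>lborel)"
    using iP by (subst Bochner_Integration.integral_sum[symmetric]) (auto simp: sum_distrib_left)
  also have "\<dots> \<le> (\<integral>\<xi>. ?h \<xi> * measure lborel \<Omega> \<partial>lborel)"
    using V(1) iP by (intro integral_mono mult_left_mono spectrum_sum_le B.l_finite)
       (auto simp: sum_distrib_left intro!: integrable_mult_left)
  also have "\<dots> = measure lborel \<Omega> * (\<omega> * x powr (\<theta> + 1) / (\<theta> + 1))" using V(2) by simp
  finally show ?thesis .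
qed

text \<open>The lower bound uses the modulated cut-offs $\phi(x)e^{i\xi x}$ as trial functions, averaged
  over the ball $|\xi|^{2s}<x$.\<close>

lemma riesz_mean_lower:
  fixes n :: nat
  defines "\<phi> \<equiv> tent n \<Omega>"
  defines "I \<equiv> (\<integral>y. (\<phi> y)\<^sup>2 \<partial>lborel)"
  assumes x: "0 \<le> x"
  shows "I * (\<omega> * x powr (\<theta> + 1) / (\<theta> + 1)) - (I + c * enn2real (gagliardo s \<phi>)) * (\<omega> * x powr \<theta>) \<le> K * riesz_mean x"
proof -
  let ?J = "{j. l j \<le> x}" and ?h = "\<lambda>\<xi>::'a. max 0 (x - norm \<xi> powr (2 * s))"
  let ?B = "{\<xi>::'a. norm \<xi> powr (2 * s) < x}"
  note V = riesz_mean_volume[OF s(1) x, where 'a = 'a, folded \<theta>_def \<omega>_def]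
  have [measurable]: "\<phi> \<in> borel_measurable borel" by (simp add: \<phi>_def)
  have \<phi>: "0 \<le> \<phi> y" "\<phi> y \<le> 1" for y by (auto simp: \<phi>_def tent_bounds)
  have \<phi>sq: "square_integrable \<phi>" and \<phi>G: "gagliardo s \<phi> < \<infinity>" unfolding \<phi>_def by (rule tent_test; simp)+
  have i2: "integrable lborel (\<lambda>y. (\<phi> y)\<^sup>2)" using \<phi>sq by (simp add: square_integrable_def)
  have I0: "I \<ge> 0" by (simp add: I_def)
  define G where "G = enn2real (gagliardo s \<phi>)"
  have G: "gagliardo s \<phi> = ennreal G" "G \<ge> 0" using \<phi>G by (auto simp: G_def)
  \<comment> \<open>The inner product of \<open>e j\<close> with the modulated cut-off is the
    transform of \<open>\<phi>\<close> times \<open>e j\<close> at \<open>\<xi>\<close>. Averaging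
    over the frequency is thus a Plancherel estimate for this product.\<close>
  define q where "q j = power_spectrum (\<lambda>y. \<phi> y * rep_l2 (e j) y)" for j
  have trial: "(x - norm \<xi> powr (2 * s)) * I - (I + c * G) \<le> (\<Sum>j\<in>?J. (x - l j) * q j \<xi>)" for \<xi> :: 'a
  proof -
    define fc where "fc = (\<lambda>y. \<phi> y * cos (\<xi> \<bullet> y))"
    define fs where "fs = (\<lambda>y. \<phi> y * sin (\<xi> \<bullet> y))"
    have lip: "\<bar>\<phi> y * t (\<xi> \<bullet> y) - \<phi> z * t (\<xi> \<bullet> z)\<bar> \<le> (real n + norm \<xi>) * norm (y - z)"
      if t: "\<And>x. \<bar>t x\<bar> \<le> 1" "\<And>x y. \<bar>t x - t y\<bar> \<le> \<bar>x - y\<bar>" for t :: "real \<Rightarrow> real" and y z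
    proof -
      have "\<phi> y * t (\<xi> \<bullet> y) - \<phi> z * t (\<xi> \<bullet> z) = (\<phi> y - \<phi> z) * t (\<xi> \<bullet> y) + \<phi> z * (t (\<xi> \<bullet> y) - t (\<xi> \<bullet> z))"
        by (simp add: algebra_simps)
      then have "\<bar>\<phi> y * t (\<xi> \<bullet> y) - \<phi> z * t (\<xi> \<bullet> z)\<bar> \<le> \<bar>\<phi> y - \<phi> z\<bar> * \<bar>t (\<xi> \<bullet> y)\<bar> + \<bar>\<phi> z\<bar> * \<bar>t (\<xi> \<bullet> y) - t (\<xi> \<bullet> z)\<bar>"
        by (metis abs_mult abs_triangle_ineq)
      also have "\<dots> \<le> (real n * norm (y - z)) * 1 + 1 * (norm \<xi> * norm (y - z))"
      proof (intro add_mono mult_mono)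
        show "\<bar>\<phi> y - \<phi> z\<bar> \<le> real n * norm (y - z)" unfolding \<phi>_def by (rule tent_lipschitz)
        have "\<bar>t (\<xi> \<bullet> y) - t (\<xi> \<bullet> z)\<bar> \<le> \<bar>\<xi> \<bullet> (y - z)\<bar>" using t(2)[of "\<xi> \<bullet> y" "\<xi> \<bullet> z"] by (simp add: inner_diff_right)
        also have "\<dots> \<le> norm \<xi> * norm (y - z)" by (rule Cauchy_Schwarz_ineq2)
        finally show "\<bar>t (\<xi> \<bullet> y) - t (\<xi> \<bullet> z)\<bar> \<le> norm \<xi> * norm (y - z)" .
        show "\<bar>\<phi> z\<bar> \<le> 1" using \<phi>[of z] by simp
      qed (use t in auto)
      finally show ?thesis by (simp add: algebra_simps)
    qed
    have bd: "\<bar>\<phi> y * t (\<xi> \<bullet> y)\<bar> \<le> 1" if "\<And>x. \<bar>t x\<bar> \<le> 1" for t :: "real \<Rightarrow> real" and y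
      using \<phi>[of y] that[of "\<xi> \<bullet> y"] by (simp add: abs_mult mult_le_one)
    have z: "\<phi> y * t (\<xi> \<bullet> y) = 0" if "y \<notin> \<Omega>" for y and t :: "real \<Rightarrow> real"
      using that by (simp add: \<phi>_def tent_outside)
    have c: "square_integrable fc" "gagliardo s fc < \<infinity>" "abs_l2 fc \<in> D" "seminorm (abs_l2 fc) = enn2real (gagliardo s fc)"
      unfolding fc_def
      using lipschitz_test[of "\<lambda>y. \<phi> y * cos (\<xi> \<bullet> y)", OF lip[of cos, OF abs_cos_le_one abs_cos_diff_le] bd[of cos, OF abs_cos_le_one] z[where t = cos]]
      by simp_all
    have s': "square_integrable fs" "gagliardo s fs < \<infinity>" "abs_l2 fs \<in> D" "seminorm (abs_l2 fs) = enn2real (gagliardo s fs)"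
      unfolding fs_def
      using lipschitz_test[of "\<lambda>y. \<phi> y * sin (\<xi> \<bullet> y)", OF lip[of sin, OF abs_sin_le_one abs_sin_diff_le] bd[of sin, OF abs_sin_le_one] z[where t = sin]]
      by simp_all
    let ?u = "abs_l2 fc" and ?v = "abs_l2 fs"
    have H: "?u \<in> H" "?v \<in> H" using c(3) s'(3) D_H by auto
    have uv: "inner ?u ?u + inner ?v ?v = I"
    proof -
      have "inner ?u ?u + inner ?v ?v = (\<integral>y. fc y * fc y + fs y * fs y \<partial>lborel)"
        unfolding inner_abs[OF c(1) c(1)] inner_abs[OF s'(1) s'(1)]
        by (rule Bochner_Integration.integral_add[symmetric]; rule square_integrable_mult) (rule c(1) s'(1))+
      also have "\<dots> = I" unfolding I_def
      proof (intro Bochner_Integration.integral_cong refl)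
        fix y
        have id: "(p * b) * (p * b) + (p * d) * (p * d) = p\<^sup>2 * (b\<^sup>2 + d\<^sup>2)" for p b d :: real
          by (simp add: power2_eq_square algebra_simps)
        show "fc y * fc y + fs y * fs y = (\<phi> y)\<^sup>2" unfolding fc_def fs_def id by simp
      qed
      finally show ?thesis .
    qed
    have "seminorm ?u + seminorm ?v \<le> G + I * (norm \<xi> powr (2 * s) / c)"
    proof -
      have "ennreal (seminorm ?u + seminorm ?v) = gagliardo s fc + gagliardo s fs"
        using c(2,4) s'(2,4) by (simp add: ennreal_plus)
      also have "\<dots> \<le> ennreal (G + I * (norm \<xi> powr (2 * s) / c))"
        using gagliardo_modulated_le[OF s \<open>\<phi> \<in> borel_measurable borel\<close> i2, of \<xi>] G(2) I0 c_pos
        unfolding fc_def fs_def G(1) I_def[symmetric] c_def[symmetric] by (simp add: ennreal_plus)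
      finally show ?thesis using G(2) I0 c_pos by (subst (asm) ennreal_le_iff) auto
    qed
    then have "c * (seminorm ?u + seminorm ?v) \<le> c * (G + I * (norm \<xi> powr (2 * s) / c))"
      using c_pos by (intro mult_left_mono) auto
    also have "\<dots> = c * G + I * norm \<xi> powr (2 * s)" using c_pos by (simp add: field_simps)
    finally have "x * I - (I + (c * G + I * norm \<xi> powr (2 * s))) \<le> (x * inner ?u ?u - a ?u ?u) + (x * inner ?v ?v - a ?v ?v)"
      unfolding uv[symmetric] a_self[OF H(1)] a_self[OF H(2)] by (simp add: algebra_simps)
    also have "\<dots> \<le> (\<Sum>j\<in>?J. (x - l j) * (inner ?u (e j))\<^sup>2) + (\<Sum>j\<in>?J. (x - l j) * (inner ?v (e j))\<^sup>2)"
      using c(3) s'(3) x by (intro add_mono B.variational_bound)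
    also have "\<dots> = (\<Sum>j\<in>?J. (x - l j) * q j \<xi>)"
    proof -
      have "inner ?u (e j) = cos_transform (\<lambda>y. \<phi> y * rep_l2 (e j) y) \<xi>"
        "inner ?v (e j) = sin_transform (\<lambda>y. \<phi> y * rep_l2 (e j) y) \<xi>" for j
        unfolding inner_abs_left[OF c(1)] inner_abs_left[OF s'(1)] cos_transform_def sin_transform_def
        by (intro Bochner_Integration.integral_cong; simp add: fc_def fs_def)+
      then show ?thesis by (simp add: sum.distrib[symmetric] q_def power_spectrum_def distrib_left)
    qed
    finally show ?thesis by (simp add: algebra_simps)
  qed
  \<comment> \<open>Since \<open>0 \<le> \<phi> \<le> 1\<close>, multiplication by the cut-off does
    not increase the norm of \<open>e j\<close>, so each eigenfunction is counted with total weight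
    at most \<open>K\<close>.\<close>
  have q: "integrable lborel (q j)" "(\<integral>\<xi>. q j \<xi> \<partial>lborel) \<le> K" for j
  proof -
    let ?g = "\<lambda>y. \<phi> y * rep_l2 (e j) y"
    have i: "integrable lborel ?g"
      by (rule Bochner_Integration.integrable_bound[OF integrable_rep(1)[OF B.e_H[of j]]])
         (use \<phi> in \<open>auto simp: abs_mult intro!: mult_left_le_one_le\<close>)
    have le: "(?g y)\<^sup>2 \<le> (rep_l2 (e j) y)\<^sup>2" for y
      using \<phi>[of y] by (auto simp: power_mult_distrib power_le_one intro!: mult_left_le_one_le)
    have ii: "integrable lborel (\<lambda>y. (?g y)\<^sup>2)"
      by (rule Bochner_Integration.integrable_bound[OF integrable_rep_square[of "e j"]]) (use le in auto)
    have "(\<integral>y. (?g y)\<^sup>2 \<partial>lborel) \<le> (\<integral>y. (rep_l2 (e j) y)\<^sup>2 \<partial>lborel)"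
      by (intro integral_mono ii integrable_rep_square le)
    also have "\<dots> = 1" by (simp add: norm_square_rep[symmetric] power2_norm_eq_inner B.e_orthonormal)
    finally have le1: "(\<integral>y. (?g y)\<^sup>2 \<partial>lborel) \<le> 1" .
    have "(\<integral>\<^sup>+\<xi>. ennreal (q j \<xi>) \<partial>lborel) \<le> ennreal (K * (\<integral>y. (?g y)\<^sup>2 \<partial>lborel))"
      unfolding q_def K_def by (rule power_spectrum_integral_le[OF i ii])
    also have "\<dots> \<le> ennreal (K * 1)" using K_pos le1 by (intro ennreal_leI mult_left_mono) auto
    finally have nn: "(\<integral>\<^sup>+\<xi>. ennreal (q j \<xi>) \<partial>lborel) \<le> ennreal K" by simp
    have q0: "0 \<le> q j \<xi>" for \<xi> by (simp add: q_def)
    have [measurable]: "q j \<in> borel_measurable borel" unfolding q_def by measurable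
    show iq: "integrable lborel (q j)"
      unfolding integrable_iff_bounded using nn q0 by (auto intro: le_less_trans)
    show "(\<integral>\<xi>. q j \<xi> \<partial>lborel) \<le> K"
      using nn q0 K_pos by (subst (asm) nn_integral_eq_integral[OF iq]) auto
  qed
  have q0: "0 \<le> q j \<xi>" for j \<xi> by (simp add: q_def)
  have mB: "measure lborel ?B = \<omega> * x powr \<theta>" "emeasure lborel ?B < \<infinity>"
    using V(3) \<omega>_pos by (simp_all add: measure_def)
  have [measurable]: "?B \<in> sets borel" by measurable
  have iS: "integrable lborel (\<lambda>\<xi>. \<Sum>j\<in>?J. (x - l j) * q j \<xi>)" using q(1) by (intro Bochner_Integration.integrable_sum integrable_mult_right)
  have iB: "integrable lborel (\<lambda>\<xi>. (I + c * G) * indicator ?B \<xi>)"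
    using mB by (intro integrable_mult_right integrable_real_indicator) auto
  have "I * (\<omega> * x powr (\<theta> + 1) / (\<theta> + 1)) = (\<integral>\<xi>. I * ?h \<xi> \<partial>lborel)" using V(2) by simp
  also have "\<dots> \<le> (\<integral>\<xi>. (\<Sum>j\<in>?J. (x - l j) * q j \<xi>) + (I + c * G) * indicator ?B \<xi> \<partial>lborel)"
  proof (rule integral_mono[OF integrable_mult_right[OF V(1)] Bochner_Integration.integrable_add[OF iS iB]])
    fix \<xi> :: 'a
    have S0: "0 \<le> (\<Sum>j\<in>?J. (x - l j) * q j \<xi>)" using q0 by (intro sum_nonneg mult_nonneg_nonneg) auto
    \<comment> \<open>The constant loss \<open>I + c * G\<close> is charged only on
      \<open>?B\<close>. Elsewhere the left side is 0 and the sum nonnegative, so the loss stays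
      integrable and costs only the volume of \<open>?B\<close>.\<close>
    show "I * ?h \<xi> \<le> (\<Sum>j\<in>?J. (x - l j) * q j \<xi>) + (I + c * G) * indicator ?B \<xi>"
    proof (cases "norm \<xi> powr (2 * s) < x")
      case True
      then have "?h \<xi> = x - norm \<xi> powr (2 * s)" by simp
      then show ?thesis using trial[of \<xi>] True by (simp add: mult.commute)
    next
      case False
      then show ?thesis using S0 by simp
    qed
  qed
  also have "\<dots> = (\<Sum>j\<in>?J. (x - l j) * (\<integral>\<xi>. q j \<xi> \<partial>lborel)) + (I + c * G) * (\<omega> * x powr \<theta>)"
    using iS iB q(1) mB by (subst Bochner_Integration.integral_add) (simp_all add: Bochner_Integration.integral_sum)
  also have "(\<Sum>j\<in>?J. (x - l j) * (\<integral>\<xi>. q j \<xi> \<partial>lborel)) \<le> (\<Sum>j\<in>?J. (x - l j) * K)"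
    using q(2) by (intro sum_mono mult_left_mono) auto
  also have "(\<Sum>j\<in>?J. (x - l j) * K) = K * riesz_mean x"
    by (simp add: riesz_mean_def sum_distrib_left mult.commute)
  finally show ?thesis by (simp add: G_def)
qed

end

section \<open>From Riesz means to eigenvalues\<close>

lemma eventually_ge_of_finite_sublevels:
  fixes l :: "nat \<Rightarrow> real"
  assumes "\<And>C. finite {j. l j \<le> C}"
  shows "filterlim l at_top sequentially"
  unfolding filterlim_at_top
proof
  fix C
  obtain n where "\<And>j. l j \<le> C \<Longrightarrow> j \<le> n"
    using assms[of C] by (auto simp: finite_nat_set_iff_bounded_le)
  then have "C \<le> l j" if "j > n" for j using that by (meson le_cases not_less)
  then show "eventually (\<lambda>j. C \<le> l j) sequentially"
    unfolding eventually_sequentially by (intro exI[of _ "Suc n"]) auto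
qed

text \<open>The counting function is the derivative of the Riesz mean, so it is squeezed between difference
  quotients of the latter.\<close>

lemma riesz_mean_tauberian:
  fixes l :: "nat \<Rightarrow> real" and A \<theta> :: real
  defines "S \<equiv> \<lambda>x. \<Sum>j\<in>{j. l j \<le> x}. x - l j"
  assumes mono: "mono l" and fin: "\<And>C. finite {j. l j \<le> C}" and \<theta>: "\<theta> > 0"
    and lim: "((\<lambda>x. S x / x powr (\<theta> + 1)) \<longlongrightarrow> A) at_top"
  shows "(\<lambda>j. real (Suc j) / l j powr \<theta>) \<longlonglongrightarrow> A * (\<theta> + 1)"
proof -
  have l_top: "filterlim l at_top sequentially" by (rule eventually_ge_of_finite_sublevels[OF fin])
  \<comment> \<open>Indices start at 0, so by monotonicity at least the \<open>Suc j\<close> indices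
    up to \<open>j\<close> satisfy \<open>l i \<le> l j\<close>, and each contributes the full
    increment \<open>y - l j\<close>.\<close>
  have up: "(y - l j) * real (Suc j) \<le> S y - S (l j)" if "l j < y" for j y
  proof -
    have sub: "{i. l i \<le> l j} \<subseteq> {i. l i \<le> y}" using that by auto
    have "{..j} \<subseteq> {i. l i \<le> l j}" using monoD[OF mono] by auto
    from card_mono[OF fin this] have "Suc j \<le> card {i. l i \<le> l j}" by simp
    then have "(y - l j) * real (Suc j) \<le> (y - l j) * real (card {i. l i \<le> l j})"
      using that by (intro mult_left_mono) auto
    also have "\<dots> = (\<Sum>i\<in>{i. l i \<le> l j}. y - l i) - S (l j)"
      by (simp add: S_def sum_subtractf[symmetric])
    also have "\<dots> \<le> S y - S (l j)"
      unfolding S_def by (intro diff_right_mono sum_mono2 fin sub) auto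
    finally show ?thesis .
  qed
  \<comment> \<open>With multiplicities the count must be strict here: at most \<open>j\<close>
    indices have \<open>l i < l j\<close>, and those with equality contribute 0 to
    \<open>S (l j)\<close>.\<close>
  have down: "S (l j) - S y \<le> (l j - y) * real (Suc j)" if "y < l j" for j y
  proof -
    let ?J = "{i. l i < l j}"
    have fJ: "finite ?J" by (rule finite_subset[OF _ fin[of "l j"]]) auto
    have "?J \<subseteq> {..<j}" using mono by (auto simp: mono_def not_le[symmetric])
    then have card: "card ?J \<le> j" using card_mono[of "{..<j}" ?J] by simp
    have "S (l j) = (\<Sum>i\<in>?J. l j - l i)"
      unfolding S_def by (rule sum.mono_neutral_right[OF fin]) auto
    moreover have "(\<Sum>i\<in>?J. y - l i) \<le> S y"
    proof -
      have "(\<Sum>i\<in>?J. y - l i) = (\<Sum>i\<in>{i. l i \<le> y}. y - l i) + (\<Sum>i\<in>?J - {i. l i \<le> y}. y - l i)"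
        using that fJ by (subst sum.subset_diff[of "{i. l i \<le> y}" ?J]) auto
      also have "\<dots> \<le> S y + 0" unfolding S_def by (intro add_left_mono sum_nonpos) auto
      finally show ?thesis by simp
    qed
    ultimately have "S (l j) - S y \<le> (\<Sum>i\<in>?J. l j - l i) - (\<Sum>i\<in>?J. y - l i)" by linarith
    also have "\<dots> = (l j - y) * real (card ?J)" by (simp add: sum_subtractf[symmetric])
    also have "\<dots> \<le> (l j - y) * real (Suc j)" using that card by (intro mult_left_mono) auto
    finally show ?thesis .
  qed
  \<comment> \<open>The difference quotient of \<open>S\<close> between \<open>l j\<close> and
    \<open>(1 + h) * l j\<close>, rescaled by the growth of \<open>S\<close>. Positive
    \<open>h\<close> bounds the counting ratio from above, negative \<open>h\<close> from
    below.\<close>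
  define Q where "Q h j = (S ((1 + h) * l j) - S (l j)) / (h * l j powr (\<theta> + 1))" for h j
  have pos: "eventually (\<lambda>j. l j > 0) sequentially"
    using l_top by (simp add: filterlim_at_top_dense)
  have Q_lim: "Q h \<longlonglongrightarrow> A * (((1 + h) powr (\<theta> + 1) - 1) / h)" if h: "-1 < h" "h \<noteq> 0" for h
  proof -
    have "filterlim (\<lambda>j. (1 + h) * l j) at_top sequentially"
      using h by (intro filterlim_tendsto_pos_mult_at_top[OF tendsto_const _ l_top]) auto
    from filterlim_compose[OF lim this]
    have 1: "(\<lambda>j. S ((1 + h) * l j) / ((1 + h) * l j) powr (\<theta> + 1)) \<longlonglongrightarrow> A" .
    have 2: "(\<lambda>j. S (l j) / l j powr (\<theta> + 1)) \<longlonglongrightarrow> A" by (rule filterlim_compose[OF lim l_top])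
    have "(\<lambda>j. ((1 + h) powr (\<theta> + 1) * (S ((1 + h) * l j) / ((1 + h) * l j) powr (\<theta> + 1)) - S (l j) / l j powr (\<theta> + 1)) / h)
        \<longlonglongrightarrow> ((1 + h) powr (\<theta> + 1) * A - A) / h"
      using h by (intro tendsto_intros 1 2) auto
    also have "((1 + h) powr (\<theta> + 1) * A - A) / h = A * (((1 + h) powr (\<theta> + 1) - 1) / h)"
      by (simp add: algebra_simps)
    finally have "(\<lambda>j. ((1 + h) powr (\<theta> + 1) * (S ((1 + h) * l j) / ((1 + h) * l j) powr (\<theta> + 1)) - S (l j) / l j powr (\<theta> + 1)) / h)
        \<longlonglongrightarrow> A * (((1 + h) powr (\<theta> + 1) - 1) / h)" .
    moreover have "eventually (\<lambda>j. ((1 + h) powr (\<theta> + 1) * (S ((1 + h) * l j) / ((1 + h) * l j) powr (\<theta> + 1)) -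
        S (l j) / l j powr (\<theta> + 1)) / h = Q h j) sequentially"
      using pos
    proof eventually_elim
      fix j assume "l j > 0"
      then have "(1 + h) powr (\<theta> + 1) * (S ((1 + h) * l j) / ((1 + h) * l j) powr (\<theta> + 1)) = S ((1 + h) * l j) / l j powr (\<theta> + 1)"
        using h by (simp add: powr_mult)
      then show "((1 + h) powr (\<theta> + 1) * (S ((1 + h) * l j) / ((1 + h) * l j) powr (\<theta> + 1)) -
          S (l j) / l j powr (\<theta> + 1)) / h = Q h j"
        by (simp add: Q_def diff_divide_distrib mult.commute)
    qed
    ultimately show ?thesis by (rule Lim_transform_eventually)
  qed
  have Q_up: "eventually (\<lambda>j. real (Suc j) / l j powr \<theta> \<le> Q h j) sequentially" if h: "h > 0" for h
    using pos
  proof eventually_elim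
    fix j assume p: "l j > 0"
    then have "l j < (1 + h) * l j" using h by (simp add: algebra_simps)
    from up[OF this] have "h * l j * real (Suc j) \<le> S ((1 + h) * l j) - S (l j)" by (simp add: algebra_simps)
    then have "h * l j * real (Suc j) / (h * l j powr (\<theta> + 1)) \<le> Q h j"
      unfolding Q_def using h by (intro divide_right_mono) auto
    moreover have "h * l j * real (Suc j) / (h * l j powr (\<theta> + 1)) = real (Suc j) / l j powr \<theta>"
      using h p by (simp add: powr_add)
    ultimately show "real (Suc j) / l j powr \<theta> \<le> Q h j" by simp
  qed
  have Q_down: "eventually (\<lambda>j. Q h j \<le> real (Suc j) / l j powr \<theta>) sequentially" if h: "-1 < h" "h < 0" for h
    using pos
  proof eventually_elim
    fix j assume p: "l j > 0"
    then have "(1 + h) * l j < l j" using h by (simp add: algebra_simps mult_less_0_iff)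
    from down[OF this] have "S (l j) - S ((1 + h) * l j) \<le> (- h) * l j * real (Suc j)" by (simp add: algebra_simps)
    then have "(S (l j) - S ((1 + h) * l j)) / ((- h) * l j powr (\<theta> + 1)) \<le> (- h) * l j * real (Suc j) / ((- h) * l j powr (\<theta> + 1))"
      using h by (intro divide_right_mono mult_nonneg_nonneg) auto
    moreover have "(- h) * l j * real (Suc j) / ((- h) * l j powr (\<theta> + 1)) = real (Suc j) / l j powr \<theta>"
      using h p by (simp add: powr_add)
    moreover have "(S (l j) - S ((1 + h) * l j)) / ((- h) * l j powr (\<theta> + 1)) = Q h j"
      using h unfolding Q_def by (simp add: minus_divide_left[symmetric] diff_divide_distrib)
    ultimately show "Q h j \<le> real (Suc j) / l j powr \<theta>" by simp
  qed
  \<comment> \<open>The limits of the quotients are themselves difference quotients of a power at 1.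
    So \<open>h\<close> is fixed first, close to 0, and only then does \<open>j\<close>
    grow.\<close>
  have "((\<lambda>y. y powr (\<theta> + 1)) has_real_derivative (\<theta> + 1)) (at 1)"
    by (auto intro!: derivative_eq_intros)
  then have "((\<lambda>h. A * (((1 + h) powr (\<theta> + 1) - 1) / h)) \<longlongrightarrow> A * (\<theta> + 1)) (at 0)"
    unfolding DERIV_def by (intro tendsto_mult tendsto_const) simp
  then have D: "eventually (\<lambda>h. dist (A * (((1 + h) powr (\<theta> + 1) - 1) / h)) (A * (\<theta> + 1)) < \<epsilon>) (at 0)" if "\<epsilon> > 0" for \<epsilon>
    using that by (rule tendstoD)
  show ?thesis
  proof (rule tendstoI)
    fix \<epsilon> :: real assume \<epsilon>: "\<epsilon> > 0"
    obtain d where d: "d > 0" and dd: "\<And>h. h \<noteq> 0 \<Longrightarrow> dist h 0 < d \<Longrightarrow>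
        dist (A * (((1 + h) powr (\<theta> + 1) - 1) / h)) (A * (\<theta> + 1)) < \<epsilon> / 2"
      using D[of "\<epsilon> / 2"] \<epsilon> unfolding eventually_at by auto
    define h where "h = min (d / 2) (1 / 2)"
    have h: "0 < h" "h < 1" "dist h 0 < d" "dist (- h) 0 < d" using d by (auto simp: h_def)
    have qd: "eventually (\<lambda>j. Q (- h) j \<le> real (Suc j) / l j powr \<theta>) sequentially"
      using h by (intro Q_down) auto
    have "eventually (\<lambda>j. dist (Q h j) (A * (((1 + h) powr (\<theta> + 1) - 1) / h)) < \<epsilon> / 2) sequentially"
      using Q_lim[of h] h \<epsilon> by (intro tendstoD) auto
    moreover have "eventually (\<lambda>j. dist (Q (- h) j) (A * (((1 + - h) powr (\<theta> + 1) - 1) / (- h))) < \<epsilon> / 2) sequentially"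
      using Q_lim[of "- h"] h \<epsilon> by (intro tendstoD) auto
    ultimately show "eventually (\<lambda>j. dist (real (Suc j) / l j powr \<theta>) (A * (\<theta> + 1)) < \<epsilon>) sequentially"
      using Q_up[of h, OF h(1)] qd
    proof (eventually_elim, goal_cases)
      case (1 j)
      then show ?case using dd[of h] dd[of "- h"] h unfolding dist_real_def by linarith
    qed
  qed
qed

section \<open>Norm bounds for diagonal operators\<close>

context hilbert_basis
begin

lemma diag_norm_le:
  assumes uv: "(u, v) \<in> diag c" and c: "\<And>j. \<bar>c j\<bar> \<le> B"
  shows "inner v v \<le> B\<^sup>2 * inner u u"
proof (rule sums_le)
  have u: "u \<in> H" and v: "v \<in> H" and vc: "\<And>j. inner v (e j) = c j * inner u (e j)" using uv by (auto simp: diag_def)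
  show "(\<lambda>j. inner v (e j) * inner v (e j)) sums inner v v" by (rule parseval[OF v])
  show "(\<lambda>j. B\<^sup>2 * (inner u (e j) * inner u (e j))) sums (B\<^sup>2 * inner u u)" by (intro sums_mult parseval u)
  fix j
  have "(c j)\<^sup>2 \<le> B\<^sup>2" using power_mono[OF c[of j], of 2] by simp
  then have "(c j)\<^sup>2 * (inner u (e j) * inner u (e j)) \<le> B\<^sup>2 * (inner u (e j) * inner u (e j))"
    by (rule mult_right_mono) simp
  then show "inner v (e j) * inner v (e j) \<le> B\<^sup>2 * (inner u (e j) * inner u (e j))"
    by (simp add: vc power2_eq_square mult_ac)
qed

lemma subspace_diag: "subspace (diag c)"
  using subspace_H by (auto simp: subspace_def diag_def zero_prod_def inner_add_left algebra_simps)

end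

section \<open>Weyl's law\<close>

context fractional_eigenbasis
begin

lemma tent_square_limit: "(\<lambda>n. \<integral>y. (tent n \<Omega> y)\<^sup>2 \<partial>lborel) \<longlonglongrightarrow> measure lborel \<Omega>"
proof -
  have "(\<lambda>n. \<integral>y. (tent n \<Omega> y)\<^sup>2 \<partial>lborel) \<longlonglongrightarrow> (\<integral>y. (indicator \<Omega> y)\<^sup>2 \<partial>lborel)"
  proof (rule integral_dominated_convergence[where w = "indicator \<Omega>"])
    show "integrable lborel (indicator \<Omega> :: 'a \<Rightarrow> real)" using emeasure_\<Omega> by simp
    show "AE y in lborel. (\<lambda>n. (tent n \<Omega> y)\<^sup>2) \<longlonglongrightarrow> (indicator \<Omega> y)\<^sup>2"
      using tent_limit[OF open_\<Omega> bounded_\<Omega>] by (intro AE_I2 tendsto_power)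
    have "(tent n \<Omega> y)\<^sup>2 \<le> indicator \<Omega> y" for n y
      using tent_bounds[of n \<Omega> y] tent_outside[of y \<Omega> n] by (cases "y \<in> \<Omega>") (auto simp: power_le_one)
    then show "AE y in lborel. norm ((tent n \<Omega> y)\<^sup>2) \<le> indicator \<Omega> y" for n by simp
  qed measurable
  moreover have "(\<integral>y. (indicator \<Omega> y)\<^sup>2 \<partial>lborel) = measure lborel \<Omega>"
  proof -
    have "(indicator \<Omega> y)\<^sup>2 = (indicator \<Omega> y :: real)" for y by (simp add: indicator_def)
    then show ?thesis by simp
  qed
  ultimately show ?thesis by simp
qed

text \<open>In the lower bound the cut-off is fixed before \<open>x\<close> grows: its seminorm is
  not controlled as \<open>n\<close> increases, but for fixed \<open>n\<close> it enters only with a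
  factor \<open>1 / x\<close>.\<close>

lemma riesz_mean_asymptotics:
  "((\<lambda>x. riesz_mean x / x powr (\<theta> + 1)) \<longlongrightarrow> measure lborel \<Omega> * \<omega> / (K * (\<theta> + 1))) at_top"
proof (rule order_tendstoI)
  let ?A = "measure lborel \<Omega> * \<omega> / (K * (\<theta> + 1))"
  fix y assume y: "?A < y"
  have lt: "riesz_mean x / x powr (\<theta> + 1) < y" if x: "x > 0" for x
  proof -
    have "K * (?A * x powr (\<theta> + 1)) = measure lborel \<Omega> * (\<omega> * x powr (\<theta> + 1) / (\<theta> + 1))"
      using K_pos by simp
    then have "K * riesz_mean x \<le> K * (?A * x powr (\<theta> + 1))" using riesz_mean_upper[of x] x by simp
    then have "riesz_mean x \<le> ?A * x powr (\<theta> + 1)" using K_pos by (simp only: mult_le_cancel_left_pos)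
    then have "riesz_mean x / x powr (\<theta> + 1) \<le> ?A" using x by (simp only: pos_divide_le_eq powr_gt_zero)
    then show ?thesis using y by simp
  qed
  show "eventually (\<lambda>x. riesz_mean x / x powr (\<theta> + 1) < y) at_top"
    by (rule eventually_mono[OF eventually_gt_at_top[of 0]]) (rule lt)
next
  let ?A = "measure lborel \<Omega> * \<omega> / (K * (\<theta> + 1))"
  let ?I = "\<lambda>n. \<integral>y. (tent n \<Omega> y)\<^sup>2 \<partial>lborel"
  fix y assume y: "y < ?A"
  have "(\<lambda>n. ?I n * \<omega> / (K * (\<theta> + 1))) \<longlonglongrightarrow> ?A"
    using K_pos \<theta>_pos by (intro tendsto_intros tent_square_limit) auto
  then have "eventually (\<lambda>n. y < ?I n * \<omega> / (K * (\<theta> + 1))) sequentially" using y by (rule order_tendstoD)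
  then obtain n where n: "y < ?I n * \<omega> / (K * (\<theta> + 1))" by (auto simp: eventually_sequentially)
  define b where "b = (?I n + c * enn2real (gagliardo s (tent n \<Omega>))) * \<omega> / K"
  have "((\<lambda>x. ?I n * \<omega> / (K * (\<theta> + 1)) - b / x) \<longlongrightarrow> ?I n * \<omega> / (K * (\<theta> + 1)) - 0) at_top"
    by (intro tendsto_diff tendsto_const tendsto_divide_0[OF tendsto_const] filterlim_at_top_imp_at_infinity filterlim_ident)
  then have "eventually (\<lambda>x. y < ?I n * \<omega> / (K * (\<theta> + 1)) - b / x) at_top"
    using n by (intro order_tendstoD) auto
  then show "eventually (\<lambda>x. y < riesz_mean x / x powr (\<theta> + 1)) at_top"
    using eventually_gt_at_top[of 0]
  proof eventually_elim
    fix x :: real assume lt: "y < ?I n * \<omega> / (K * (\<theta> + 1)) - b / x" and x: "x > 0"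
    have "?I n * \<omega> / (K * (\<theta> + 1)) - b / x =
        (?I n * (\<omega> * x powr (\<theta> + 1) / (\<theta> + 1)) - (?I n + c * enn2real (gagliardo s (tent n \<Omega>))) * (\<omega> * x powr \<theta>)) / (K * x powr (\<theta> + 1))"
    proof -
      have gen: "I * w / (k * m) - C * w / k / x = (I * (w * (X * x) / m) - C * (w * X)) / (k * (X * x))"
        if "X > 0" "m > 0" "k > 0" for I w k m C X :: real
        using that x by (simp add: diff_divide_distrib)
      have X: "x powr (\<theta> + 1) = x powr \<theta> * x" using x by (simp add: powr_add)
      show ?thesis unfolding b_def X by (rule gen) (use x K_pos \<theta>_pos in simp_all)
    qed
    also have "\<dots> \<le> K * riesz_mean x / (K * x powr (\<theta> + 1))"
      using riesz_mean_lower[of x n] x K_pos by (intro divide_right_mono) auto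
    also have "\<dots> = riesz_mean x / x powr (\<theta> + 1)" using K_pos by simp
    finally show "y < riesz_mean x / x powr (\<theta> + 1)" using lt by simp
  qed
qed

lemma l_at_top: "filterlim l at_top sequentially"
  by (rule eventually_ge_of_finite_sublevels[OF B.l_finite])

text \<open>The ratio \<open>real (Suc j) / l j powr \<theta>\<close> tends to
  \<open>measure lborel \<Omega> * \<omega> / K\<close>; this is the power
  \<open>- 1 / \<theta>\<close> of that limit.\<close>

definition weyl_const :: real where
  "weyl_const = (2 * pi) powr (2 * s) * \<omega> powr (- 2 * s / real DIM('a)) * measure lborel \<Omega> powr (- 2 * s / real DIM('a))"

lemma weyl_const_pos: "weyl_const > 0"
  using \<omega>_pos measure_\<Omega>_pos by (simp add: weyl_const_def)

lemma weyl_law: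
  assumes mono: "mono l"
  shows "(\<lambda>j. l j / real (Suc j) powr (2 * s / real DIM('a))) \<longlonglongrightarrow> weyl_const"
proof -
  let ?N = "real DIM('a)"
  define b where "b = measure lborel \<Omega> * \<omega> / K"
  have b: "b > 0" using measure_\<Omega>_pos \<omega>_pos K_pos by (simp add: b_def)
  have "(\<lambda>j. real (Suc j) / l j powr \<theta>) \<longlonglongrightarrow> measure lborel \<Omega> * \<omega> / (K * (\<theta> + 1)) * (\<theta> + 1)"
    using riesz_mean_tauberian[OF mono B.l_finite \<theta>_pos] riesz_mean_asymptotics unfolding riesz_mean_def by blast
  then have "(\<lambda>j. real (Suc j) / l j powr \<theta>) \<longlonglongrightarrow> b" using \<theta>_pos by (simp add: b_def)
  then have "(\<lambda>j. (real (Suc j) / l j powr \<theta>) powr (- 1 / \<theta>)) \<longlonglongrightarrow> b powr (- 1 / \<theta>)"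
    using b by (intro tendsto_powr tendsto_const) auto
  moreover have "(real (Suc j) / l j powr \<theta>) powr (- 1 / \<theta>) = l j / real (Suc j) powr (2 * s / ?N)" for j
  proof -
    have lj: "l j > 0" using B.l_ge_1[of j] by simp
    have "(real (Suc j) / l j powr \<theta>) powr (- 1 / \<theta>) = real (Suc j) powr (- 1 / \<theta>) / (l j powr \<theta>) powr (- 1 / \<theta>)"
      by (simp add: powr_divide)
    also have "(l j powr \<theta>) powr (- 1 / \<theta>) = 1 / l j"
      using lj \<theta>_pos by (simp add: powr_powr powr_minus_divide)
    also have "real (Suc j) powr (- 1 / \<theta>) = 1 / real (Suc j) powr (2 * s / ?N)"
      using s by (simp add: \<theta>_def powr_minus_divide[symmetric])
    finally show ?thesis by simp
  qed
  moreover have "b powr (- 1 / \<theta>) = weyl_const"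
  proof -
    have e: "- 1 / \<theta> = - 2 * s / ?N" using s by (simp add: \<theta>_def)
    have "K = (2 * pi) powr ?N" by (simp add: K_def powr_realpow)
    then have "K powr (- 2 * s / ?N) = (2 * pi) powr (- 2 * s)" by (simp add: powr_powr)
    then show ?thesis
      unfolding b_def e weyl_const_def using measure_\<Omega>_pos \<omega>_pos K_pos
      by (simp add: powr_divide powr_mult powr_minus_divide)
  qed
  ultimately show ?thesis by simp
qed

section \<open>Singular values and compactness of the forward operator\<close>

definition sing :: "real \<Rightarrow> nat \<Rightarrow> real" where
  "sing t j = l j powr (- 1 / 2) * exp (- t * l j)"

lemma sing_pos: "sing t j > 0"
  using B.l_ge_1[of j] by (simp add: sing_def)

lemma powr_half_le_1: "l j powr (- 1 / 2) \<le> 1"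
proof -
  have "1 \<le> l j powr (1 / 2)" using B.l_ge_1[of j] by (intro ge_one_powr_ge_zero) auto
  from le_imp_inverse_le[OF this] show ?thesis
    unfolding minus_divide_left[symmetric] powr_minus by simp
qed

lemma sing_le: "sing t j \<le> exp (- t * l j)"
  using powr_half_le_1[of j] by (simp add: sing_def mult_left_le_one_le)

text \<open>The second bound expresses smoothing: the forward operator maps \<open>H\<close>
  boundedly into the domain of the fractional operator. Compactness rests on it.\<close>

lemma sing_bounds: "t > 0 \<Longrightarrow> \<bar>sing t j\<bar> \<le> 1" "t > 0 \<Longrightarrow> \<bar>l j * sing t j\<bar> \<le> 1 / t"
proof -
  assume t: "t > 0"
  have "exp (- t * l j) \<le> 1" using t B.l_ge_1[of j] by simp
  from order_trans[OF sing_le this] show "\<bar>sing t j\<bar> \<le> 1" using sing_pos[of t j] by simp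
  have l: "l j > 0" using B.l_ge_1[of j] by simp
  have "t * l j \<le> exp (t * l j)" using exp_ge_add_one_self[of "t * l j"] by linarith
  then have "l j * exp (- t * l j) \<le> 1 / t" using t by (simp add: exp_minus field_simps)
  moreover have "l j * sing t j \<le> l j * exp (- t * l j)" using sing_le l by (intro mult_left_mono) auto
  moreover have "0 \<le> l j * sing t j" using l sing_pos[of t j] by simp
  ultimately show "\<bar>l j * sing t j\<bar> \<le> 1 / t" by simp
qed

text \<open>The inverse square root acts first. It is bounded because all eigenvalues are at least
  1, so the composition of the graphs is the full diagonal operator.\<close>

lemma forward_operator_eq: "forward_operator s t \<Omega> = B.diag (sing t)"
proof -
  have "functional_calculus H (frac_operator s \<Omega>) f = B.diag (\<lambda>j. f (l j))" if "f \<in> borel_measurable borel" for f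
    unfolding frac_operator_def B.form_operator_eq_diag using that by (rule B.functional_calculus_diag)
  then have "forward_operator s t \<Omega> = B.diag (\<lambda>j. l j powr (- 1 / 2)) O B.diag (\<lambda>j. exp (- t * l j))"
    unfolding forward_operator_def by simp
  also have "\<dots> = B.diag (\<lambda>j. exp (- t * l j) * l j powr (- 1 / 2))"
    using powr_half_le_1 by (intro B.diag_compose[where B = 1]) auto
  finally show ?thesis by (simp add: sing_def[abs_def] mult.commute)
qed

text \<open>The operator is self-adjoint, so its singular values are the positive numbers
  \<open>sing t j\<close>, and squaring does not merge level sets. These are finite since a fixed
  value of \<open>sing t j\<close> bounds \<open>l j\<close> from above.\<close>

lemma singular_values_forward:
  assumes t: "t > 0" and mono: "mono l" and \<sigma>: "\<And>j. \<sigma> (Suc j) = sing t j"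
  shows "singular_values H (forward_operator s t \<Omega>) \<sigma>"
  unfolding singular_values_def forward_operator_eq
proof (intro conjI allI impI)
  have anti: "sing t k \<le> sing t j" if "j \<le> k" for j k
  proof -
    have le: "l j \<le> l k" using mono that by (rule monoD)
    have "l k powr (- 1 / 2) \<le> l j powr (- 1 / 2)"
      using le B.l_ge_1[of j] by (intro powr_mono2') auto
    moreover have "exp (- t * l k) \<le> exp (- t * l j)" using le t by simp
    ultimately show ?thesis unfolding sing_def by (intro mult_mono) auto
  qed
  show "antimono_on {1..} \<sigma>"
  proof (rule monotone_onI)
    fix i k :: nat assume ik: "i \<in> {1..}" "k \<in> {1..}" "i \<le> k"
    then have "\<sigma> i = sing t (i - 1)" "\<sigma> k = sing t (k - 1)" using \<sigma>[of "i - 1"] \<sigma>[of "k - 1"] by auto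
    then show "\<sigma> k \<le> \<sigma> i" using anti[of "i - 1" "k - 1"] ik by simp
  qed
  show "0 \<le> \<sigma> j" if "1 \<le> j" for j
    using \<sigma>[of "j - 1"] sing_pos[of t "j - 1"] that by simp
  fix \<mu> :: real assume \<mu>: "\<mu> > 0"
  have "B.diag (sing t) O adjoint_on H (B.diag (sing t)) = B.diag (\<lambda>j. sing t j * sing t j)"
    using sing_bounds(1)[OF t] by (simp add: B.diag_adjoint[where B = 1] B.diag_compose[where B = 1])
  moreover have eq: "{j. sing t j * sing t j = \<mu>\<^sup>2} = {j. sing t j = \<mu>}"
    using \<mu> sing_pos[of t] by (auto simp: power2_eq_square[symmetric] less_imp_le power2_eq_iff_nonneg)
  moreover have "finite {j. sing t j = \<mu>}"
  proof (rule finite_subset[OF _ B.l_finite[of "- ln \<mu> / t"]])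
    have "l j \<le> - ln \<mu> / t" if "sing t j = \<mu>" for j
    proof -
      have "\<mu> \<le> exp (- t * l j)" using sing_le[of t j] that by simp
      then have "ln \<mu> \<le> - t * l j" using \<mu> by (simp add: ln_le_cancel_iff[symmetric] del: ln_le_cancel_iff)
      then show ?thesis using t by (simp add: field_simps)
    qed
    then show "{j. sing t j = \<mu>} \<subseteq> {j. l j \<le> - ln \<mu> / t}" by auto
  qed
  ultimately have "dimension_matches (eigenspace (B.diag (sing t) O adjoint_on H (B.diag (sing t))) (\<mu>\<^sup>2)) {j. sing t j = \<mu>}"
    using B.dimension_matches_diag[of "\<lambda>j. sing t j * sing t j" "\<mu>\<^sup>2"] by simp
  moreover have "{j. sing t j = \<mu>} \<approx> {j. 1 \<le> j \<and> \<sigma> j = \<mu>}"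
  proof -
    have "bij_betw Suc {j. sing t j = \<mu>} {j. 1 \<le> j \<and> \<sigma> j = \<mu>}"
    proof (rule bij_betwI[where g = "\<lambda>j. j - 1"])
      show "(\<lambda>j. j - 1) \<in> {j. 1 \<le> j \<and> \<sigma> j = \<mu>} \<rightarrow> {j. sing t j = \<mu>}"
        using \<sigma> by (auto simp: Suc_le_eq) (metis Suc_pred)
    qed (auto simp: \<sigma>)
    then show ?thesis unfolding eqpoll_def by blast
  qed
  ultimately show "dimension_matches (eigenspace (B.diag (sing t) O adjoint_on H (B.diag (sing t))) (\<mu>\<^sup>2)) {j. 1 \<le> j \<and> \<sigma> j = \<mu>}"
    unfolding dimension_matches_def by (meson eqpoll_trans)
qed

text \<open>The image of the unit ball lies in one sublevel set of the form: for \<open>v\<close> in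
  the image, \<open>a v v\<close> is \<open>inner f v\<close>, where \<open>f\<close> has norm at
  most \<open>1 / t\<close> by the smoothing bound and \<open>v\<close> has norm at most 1.\<close>

lemma compact_forward:
  assumes t: "t > 0"
  shows "compact_operator H (forward_operator s t \<Omega>)"
  unfolding compact_operator_def forward_operator_eq
proof (intro conjI)
  show "B.diag (sing t) \<subseteq> H \<times> H" by (auto simp: B.diag_def)
  show "subspace (B.diag (sing t))" by (rule B.subspace_diag)
  show "single_valued (B.diag (sing t))" by (rule single_valuedI) (rule B.diag_unique)
  show "Domain (B.diag (sing t)) = H"
  proof
    show "H \<subseteq> Domain (B.diag (sing t))"
    proof
      fix u assume "u \<in> H"
      then obtain v where "(u, v) \<in> B.diag (sing t)" by (rule B.diag_total[OF _ sing_bounds(1)[OF t]])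
      then show "u \<in> Domain (B.diag (sing t))" by (rule DomainI)
    qed
  qed (auto simp: B.diag_def)
  let ?K = "{v \<in> D. a v v \<le> 1 / t}"
  have "B.diag (sing t) `` {u \<in> H. norm u \<le> 1} \<subseteq> ?K"
  proof
    fix v assume "v \<in> B.diag (sing t) `` {u \<in> H. norm u \<le> 1}"
    then obtain u where uv: "(u, v) \<in> B.diag (sing t)" and u: "u \<in> H" "norm u \<le> 1" by blast
    have uu: "inner u u \<le> 1" using u(2) by (simp add: power2_norm_eq_inner[symmetric] power_le_one)
    obtain f where uf: "(u, f) \<in> B.diag (\<lambda>j. l j * sing t j)"
      using B.diag_total[OF u(1) sing_bounds(2)[OF t]] .
    have "(v, f) \<in> B.diag l" using uv uf by (auto simp: B.diag_def)
    then have "(v, f) \<in> form_operator H D a" by (simp only: B.form_operator_eq_diag)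
    then have "v \<in> D \<and> f \<in> H \<and> (\<forall>w\<in>D. a v w = inner f w)" unfolding form_operator_def mem_Collect_eq case_prod_conv .
    note vf = this[THEN conjunct1] this[THEN conjunct2, THEN conjunct2, THEN bspec]
    have "inner v v \<le> 1\<^sup>2 * inner u u" by (rule B.diag_norm_le[OF uv sing_bounds(1)[OF t]])
    then have v1: "norm v \<le> 1" using uu by (simp add: norm_eq_sqrt_inner)
    have "inner f f \<le> (1 / t)\<^sup>2 * inner u u" by (rule B.diag_norm_le[OF uf sing_bounds(2)[OF t]])
    also have "\<dots> \<le> (1 / t)\<^sup>2 * 1" by (intro mult_left_mono uu) simp
    finally have "(norm f)\<^sup>2 \<le> (1 / t)\<^sup>2" by (simp add: power2_norm_eq_inner)
    then have f1: "norm f \<le> 1 / t" by (rule power2_le_imp_le) (use t in simp)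
    have "inner f v \<le> norm f * norm v" by (rule norm_cauchy_schwarz)
    also have "\<dots> \<le> 1 / t * 1" using f1 v1 t by (intro mult_mono) simp_all
    finally have "a v v \<le> 1 / t" unfolding vf(2)[OF vf(1)] by simp
    then show "v \<in> ?K" by (intro CollectI conjI vf(1))
  qed
  then have sub: "closure (B.diag (sing t) `` {u \<in> H. norm u \<le> 1}) \<subseteq> ?K"
    by (rule closure_minimal) (rule closed_form_sublevel)
  have "compact (?K \<inter> closure (B.diag (sing t) `` {u \<in> H. norm u \<le> 1}))"
    by (rule compact_Int_closed[OF compact_form_sublevel closed_closure])
  then show "compact (closure (B.diag (sing t) `` {u \<in> H. norm u \<le> 1}))"
    unfolding Int_absorb1[OF sub] .
qed

end

section \<open>Asymptotics and decay of the singular values\<close>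

lemma exp_powr_smallo:
  fixes k \<beta> \<alpha> :: real
  assumes k: "k > 0" and \<beta>: "\<beta> > 0"
  shows "(\<lambda>j. exp (- k * real j powr \<beta>)) \<in> o(\<lambda>j. real j powr (- \<alpha>))"
  using assms by real_asymp

text \<open>The informal indexing starts at 1, so the basis is indexed by the predecessor of \<open>j\<close>.\<close>

lemma eigenvalue_consequences:
  fixes \<Omega> :: "'a::euclidean_space set" and s t :: real and \<Lambda> :: "nat \<Rightarrow> real"
  defines "\<beta> \<equiv> 2 * s / real DIM('a)"
  defines "\<sigma> \<equiv> \<lambda>j. \<Lambda> j powr (- 1 / 2) * exp (- t * \<Lambda> j)"
  assumes E: "fractional_eigenbasis \<Omega> s e (\<lambda>j. \<Lambda> (Suc j))" and mono: "mono (\<lambda>j. \<Lambda> (Suc j))" and t: "t > 0"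
  shows "1 \<le> \<Lambda> 1" "filterlim \<Lambda> at_top sequentially" "\<forall>j\<ge>1. ln (1 / \<sigma> j) = t * \<Lambda> j + 1 / 2 * ln (\<Lambda> j)"
    "(\<lambda>j. t * \<Lambda> j + 1 / 2 * ln (\<Lambda> j)) \<sim>[sequentially] (\<lambda>j. t * fractional_eigenbasis.weyl_const \<Omega> s * real j powr \<beta>)"
    "\<sigma> \<in> o(\<lambda>j. real j powr (- \<alpha>))"
    "p > 0 \<Longrightarrow> summable (\<lambda>j. \<sigma> (Suc j) powr p)"
proof -
  interpret E: fractional_eigenbasis \<Omega> s e "\<lambda>j. \<Lambda> (Suc j)" by (rule E)
  let ?W = "E.weyl_const"
  have \<beta>: "\<beta> > 0" using E.s by (simp add: \<beta>_def)
  show "1 \<le> \<Lambda> 1" using E.B.l_ge_1[of 0] by simp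
  show top: "filterlim \<Lambda> at_top sequentially"
    using E.l_at_top by (simp add: filterlim_sequentially_Suc)
  have pos: "\<Lambda> j > 0" if "j \<ge> 1" for j using E.B.l_ge_1[of "j - 1"] that by simp
  show "\<forall>j\<ge>1. ln (1 / \<sigma> j) = t * \<Lambda> j + 1 / 2 * ln (\<Lambda> j)"
  proof (intro allI impI)
    fix j :: nat assume "j \<ge> 1"
    then have "\<Lambda> j > 0" by (rule pos)
    then show "ln (1 / \<sigma> j) = t * \<Lambda> j + 1 / 2 * ln (\<Lambda> j)"
      by (simp add: \<sigma>_def ln_div ln_mult ln_powr)
  qed
  have "(\<lambda>j. \<Lambda> (Suc j) / real (Suc j) powr \<beta>) \<longlonglongrightarrow> ?W" using E.weyl_law[OF mono] by (simp add: \<beta>_def)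
  then have weyl: "(\<lambda>j. \<Lambda> j / real j powr \<beta>) \<longlonglongrightarrow> ?W" by (rule LIMSEQ_imp_Suc)
  show "(\<lambda>j. t * \<Lambda> j + 1 / 2 * ln (\<Lambda> j)) \<sim>[sequentially] (\<lambda>j. t * ?W * real j powr \<beta>)"
  proof (rule asymp_equivI')
    have "((\<lambda>x::real. ln x / x) \<longlongrightarrow> 0) at_top" by real_asymp
    then have "(\<lambda>j. ln (\<Lambda> j) / \<Lambda> j) \<longlonglongrightarrow> 0" by (rule filterlim_compose[OF _ top])
    \<comment> \<open>With the linear term factored out, the ratio is the Weyl ratio times a
      correction tending to 1, because the logarithm is negligible against its argument.\<close>
    then have "(\<lambda>j. (\<Lambda> j / real j powr \<beta>) / ?W * (1 + 1 / (2 * t) * (ln (\<Lambda> j) / \<Lambda> j))) \<longlonglongrightarrow> ?W / ?W * (1 + 1 / (2 * t) * 0)"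
      using E.weyl_const_pos by (intro tendsto_intros weyl) auto
    moreover have "eventually (\<lambda>j. (\<Lambda> j / real j powr \<beta>) / ?W * (1 + 1 / (2 * t) * (ln (\<Lambda> j) / \<Lambda> j)) =
        (t * \<Lambda> j + 1 / 2 * ln (\<Lambda> j)) / (t * ?W * real j powr \<beta>)) sequentially"
      using eventually_ge_at_top[of 1]
    proof eventually_elim
      fix j :: nat assume "1 \<le> j"
      then have "\<Lambda> j > 0" "real j powr \<beta> > 0" using pos by auto
      then show "(\<Lambda> j / real j powr \<beta>) / ?W * (1 + 1 / (2 * t) * (ln (\<Lambda> j) / \<Lambda> j)) =
        (t * \<Lambda> j + 1 / 2 * ln (\<Lambda> j)) / (t * ?W * real j powr \<beta>)"
        using t E.weyl_const_pos by (simp add: field_simps)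
    qed
    ultimately have "(\<lambda>j. (t * \<Lambda> j + 1 / 2 * ln (\<Lambda> j)) / (t * ?W * real j powr \<beta>)) \<longlonglongrightarrow> ?W / ?W * (1 + 1 / (2 * t) * 0)"
      by (rule Lim_transform_eventually)
    then show "(\<lambda>j. (t * \<Lambda> j + 1 / 2 * ln (\<Lambda> j)) / (t * ?W * real j powr \<beta>)) \<longlonglongrightarrow> 1"
      using E.weyl_const_pos by simp
  qed
  have \<sigma>_Suc: "\<sigma> (Suc j) = E.sing t j" for j by (simp add: \<sigma>_def E.sing_def)
  show small: "\<sigma> \<in> o(\<lambda>j. real j powr (- \<alpha>))" for \<alpha>
  proof (rule landau_o.big_small_trans)
    show "(\<lambda>j. exp (- (t * ?W / 2) * real j powr \<beta>)) \<in> o(\<lambda>j. real j powr (- \<alpha>))"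
      using t E.weyl_const_pos \<beta> by (intro exp_powr_smallo) auto
    \<comment> \<open>Half of the Weyl constant is an eventual lower bound for the ratio, so
      \<open>\<sigma>\<close> lies below a stretched exponential, which beats every power.\<close>
    have "eventually (\<lambda>j. ?W / 2 < \<Lambda> j / real j powr \<beta>) sequentially"
      using weyl E.weyl_const_pos by (intro order_tendstoD) auto
    then have "eventually (\<lambda>j. norm (\<sigma> j) \<le> 1 * norm (exp (- (t * ?W / 2) * real j powr \<beta>))) sequentially"
      using eventually_ge_at_top[of 1]
    proof eventually_elim
      fix j :: nat assume lt: "?W / 2 < \<Lambda> j / real j powr \<beta>" and j: "1 \<le> j"
      have "real j powr \<beta> > 0" using j by simp
      then have "?W / 2 * real j powr \<beta> \<le> \<Lambda> j" using lt by (simp add: pos_less_divide_eq)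
      then have "t * (?W / 2 * real j powr \<beta>) \<le> t * \<Lambda> j" using t by (intro mult_left_mono) auto
      then have le: "exp (- t * \<Lambda> j) \<le> exp (- (t * ?W / 2) * real j powr \<beta>)" by simp
      have \<sigma>j: "\<sigma> j \<le> exp (- t * \<Lambda> j)" "0 \<le> \<sigma> j"
        using \<sigma>_Suc[of "j - 1"] E.sing_le[of t "j - 1"] E.sing_pos[of t "j - 1"] j by auto
      show "norm (\<sigma> j) \<le> 1 * norm (exp (- (t * ?W / 2) * real j powr \<beta>))"
        using order_trans[OF \<sigma>j(1) le] \<sigma>j(2) by (simp only: real_norm_def abs_exp_cancel abs_of_nonneg mult_1)
    qed
    then show "\<sigma> \<in> O(\<lambda>j. exp (- (t * ?W / 2) * real j powr \<beta>))" by (rule landau_o.bigI[rotated]) simp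
  qed
  show "summable (\<lambda>j. \<sigma> (Suc j) powr p)" if p: "p > 0"
  proof -
    \<comment> \<open>The exponent \<open>2 / p\<close> is chosen so that the \<open>p\<close>-th
      powers are dominated by the summable \<open>real j powr (- 2)\<close>.\<close>
    have "eventually (\<lambda>j. norm (\<sigma> j) \<le> 1 * norm (real j powr (- (2 / p)))) sequentially"
      using landau_o.smallD[OF small[of "2 / p"], of 1] by simp
    then have ev: "eventually (\<lambda>j. norm (\<sigma> j powr p) \<le> real j powr (- 2)) sequentially"
      using eventually_ge_at_top[of 1]
    proof eventually_elim
      fix j :: nat assume le: "norm (\<sigma> j) \<le> 1 * norm (real j powr (- (2 / p)))" and j: "1 \<le> j"
      have "0 \<le> \<sigma> j" using \<sigma>_Suc[of "j - 1"] E.sing_pos[of t "j - 1"] j by simp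
      then have "\<sigma> j powr p \<le> (real j powr (- (2 / p))) powr p" using le p by (intro powr_mono2) auto
      also have "\<dots> = real j powr (- 2)" using p by (simp add: powr_powr)
      finally show "norm (\<sigma> j powr p) \<le> real j powr (- 2)" by simp
    qed
    have "summable (\<lambda>j. real j powr (- 2))" by (simp add: summable_real_powr_iff)
    then have "summable (\<lambda>j. \<sigma> j powr p)" by (rule summable_comparison_test_ev[OF ev])
    then show ?thesis using summable_Suc_iff[of "\<lambda>j. \<sigma> j powr p"] by simp
  qed
qed

theorem corollary4p9:
  fixes \<Omega> :: "'a::euclidean_space set" and s t :: real
  assumes "lipschitz_domain \<Omega>" and "bounded \<Omega>" and "0 < s" and "s < 1" and "0 < t"
  shows
    "(\<exists>\<Lambda>. eigenvalue_sequence (frac_operator s \<Omega>) \<Lambda>) \<and>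
     (\<forall>\<Lambda>. eigenvalue_sequence (frac_operator s \<Omega>) \<Lambda> \<longrightarrow>
        (let N = real DIM('a);
             \<omega> = measure lborel {\<xi>::'a. norm \<xi> < 1};
             \<kappa> = (2 * pi) powr (2 * s) * \<omega> powr (- 2 * s / N);
             \<sigma> = (\<lambda>j. \<Lambda> j powr (- 1 / 2) * exp (- t * \<Lambda> j))
         in 1 \<le> \<Lambda> 1 \<and> filterlim \<Lambda> at_top sequentially \<and>
            singular_values (L2_on \<Omega>) (forward_operator s t \<Omega>) \<sigma> \<and>
            (\<forall>j\<ge>1. ln (1 / \<sigma> j) = t * \<Lambda> j + 1 / 2 * ln (\<Lambda> j)) \<and>
            (\<lambda>j. t * \<Lambda> j + 1 / 2 * ln (\<Lambda> j)) \<sim>[sequentially]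
              (\<lambda>j. t * \<kappa> * measure lborel \<Omega> powr (- 2 * s / N) * real j powr (2 * s / N)) \<and>
            (\<forall>\<alpha>>0. \<sigma> \<in> o(\<lambda>j. real j powr (- \<alpha>))))) \<and>
     compact_operator (L2_on \<Omega>) (forward_operator s t \<Omega>) \<and>
     (\<forall>p>0. schatten_class (L2_on \<Omega>) p (forward_operator s t \<Omega>))"
proof -
  interpret fractional_domain \<Omega> s
    using assms by unfold_locales (auto simp: lipschitz_domain_def)
  have ball: "{\<xi>::'a. norm \<xi> < 1} = ball 0 1" by auto
  have basis: "\<exists>e. fractional_eigenbasis \<Omega> s e (\<lambda>j. \<Lambda> (Suc j))"
    and mono: "mono (\<lambda>j. \<Lambda> (Suc j))" if \<Lambda>: "eigenvalue_sequence (frac_operator s \<Omega>) \<Lambda>" for \<Lambda>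
  proof -
    obtain e where "compact_form_basis (L2_on \<Omega>) (H0 s \<Omega>) (frac_form s \<Omega>) e (\<lambda>j. \<Lambda> (Suc j))"
      using form.eigenvalue_sequence_basis[OF \<Lambda>[unfolded frac_operator_def]] .
    then show "\<exists>e. fractional_eigenbasis \<Omega> s e (\<lambda>j. \<Lambda> (Suc j))"
      by (intro exI fractional_eigenbasis.intro fractional_domain_axioms fractional_eigenbasis_axioms.intro)
    show "mono (\<lambda>j. \<Lambda> (Suc j))"
      using \<Lambda> by (auto simp: eigenvalue_sequence_def mono_on_def intro!: monoI)
  qed
  have ex: "\<exists>\<Lambda>. eigenvalue_sequence (frac_operator s \<Omega>) \<Lambda>"
    unfolding frac_operator_def by (rule form.eigenvalue_sequence_exists)
  have sv: "singular_values (L2_on \<Omega>) (forward_operator s t \<Omega>) (\<lambda>j. \<Lambda> j powr (- 1 / 2) * exp (- t * \<Lambda> j))"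
    if \<Lambda>: "eigenvalue_sequence (frac_operator s \<Omega>) \<Lambda>" for \<Lambda>
  proof -
    obtain e where "fractional_eigenbasis \<Omega> s e (\<lambda>j. \<Lambda> (Suc j))" using basis[OF \<Lambda>] by blast
    then interpret E: fractional_eigenbasis \<Omega> s e "\<lambda>j. \<Lambda> (Suc j)" .
    show ?thesis by (rule E.singular_values_forward[OF assms(5) mono[OF \<Lambda>]]) (simp add: E.sing_def)
  qed
  \<comment> \<open>Compactness and the Schatten property do not mention a sequence, so one is
    chosen to supply the eigenbasis.\<close>
  obtain \<Lambda> where \<Lambda>: "eigenvalue_sequence (frac_operator s \<Omega>) \<Lambda>" using ex by blast
  obtain e where e: "fractional_eigenbasis \<Omega> s e (\<lambda>j. \<Lambda> (Suc j))" using basis[OF \<Lambda>] by blast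
  have comp: "compact_operator (L2_on \<Omega>) (forward_operator s t \<Omega>)"
    by (rule fractional_eigenbasis.compact_forward[OF e assms(5)])
  have schatten: "schatten_class (L2_on \<Omega>) p (forward_operator s t \<Omega>)" if "p > 0" for p
    unfolding schatten_class_def
    using comp sv[OF \<Lambda>] eigenvalue_consequences(6)[OF e mono[OF \<Lambda>] assms(5) that] by blast
  show ?thesis
    unfolding Let_def
  proof (intro conjI allI impI ex comp schatten)
    fix \<Lambda> assume \<Lambda>: "eigenvalue_sequence (frac_operator s \<Omega>) \<Lambda>"
    obtain e where e: "fractional_eigenbasis \<Omega> s e (\<lambda>j. \<Lambda> (Suc j))" using basis[OF \<Lambda>] by blast
    note C = eigenvalue_consequences[OF e mono[OF \<Lambda>] assms(5)]
    show "1 \<le> \<Lambda> 1" by (rule C(1))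
    show "filterlim \<Lambda> at_top sequentially" by (rule C(2))
    show "singular_values (L2_on \<Omega>) (forward_operator s t \<Omega>) (\<lambda>j. \<Lambda> j powr (- 1 / 2) * exp (- t * \<Lambda> j))"
      by (rule sv[OF \<Lambda>])
    show "ln (1 / (\<Lambda> j powr (- 1 / 2) * exp (- t * \<Lambda> j))) = t * \<Lambda> j + 1 / 2 * ln (\<Lambda> j)" if "1 \<le> j" for j
      using C(3) that by blast
    show "(\<lambda>j. t * \<Lambda> j + 1 / 2 * ln (\<Lambda> j)) \<sim>[sequentially]
        (\<lambda>j. t * ((2 * pi) powr (2 * s) * measure lborel {\<xi>::'a. norm \<xi> < 1} powr (- 2 * s / real DIM('a))) *
          measure lborel \<Omega> powr (- 2 * s / real DIM('a)) * real j powr (2 * s / real DIM('a)))"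
      using C(4) unfolding fractional_eigenbasis.weyl_const_def[OF e] fractional_eigenbasis.\<omega>_def[OF e] ball
      by (simp only: mult.assoc)
    show "(\<lambda>j. \<Lambda> j powr (- 1 / 2) * exp (- t * \<Lambda> j)) \<in> o(\<lambda>j. real j powr (- \<alpha>))" for \<alpha>
      by (rule C(5))
  qed
qed

end
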